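(* Let $(X,J)$ be a spectrally negative MAP with matrix exponent $F$ and scale matrix $W$, and let $Z(\alpha,x)=e^{\alpha x}\big(I-\int_0^x e^{-\alpha y}W(y)\,\mathrm dy\,F(\alpha)\big)$ for $\alpha,x\ge 0$. Let $Y(t)=X(t)+R(t)$ with $R(t)=-\big(0\wedge \inf_{s\le t}X(s)\big)$ be $X$ reflected at its infimum at $0$, and $T_a=\inf\{t\ge 0: Y(t)>a\}$. Then for all $\alpha\ge 0$ and $a>0$ the matrix $Z(\alpha,a)$ is invertible, and for all $x\in[0,a]$, \[\mathbb E_x[e^{-\alpha R(T_a)};J(T_a)]=Z(\alpha,x)Z(\alpha,a)^{-1}.\]
   Context: Setting: $(X,J)$ is a Markov additive process (MAP): $X$ real-valued càdlàg, $J$ right-continuous with finite state space $E=\{1,\dots,N\}$, such that given $J(t)=i$, $(X(t+s)-X(t),J(t+s))_{s\ge0}$ is independent of $\mathcal F_t$ and distributed as $(X(s)-X(0),J(s))_{s\ge 0}$ given $J(0)=i$. Killing is allowed (absorbing state $\partial$, $X=\infty$ when $J=\partial$). Equivalently $J$ is an irreducible Markov chain with transition rate matrix $Q$ (row sums $\le 0$); while $J=i$, $X$ evolves as a Lévy process $X_i$; a transition $i\to j\ne i$ of $J$ causes an independent jump $U_{ij}\le 0$ of $X$. Each $X_i$ is spectrally negative (no positive jumps) and not with non-increasing paths; paths of $X$ are not a.s. monotone. With $\mathbb E e^{\alpha X_i(t)}=e^{\psi_i(\alpha)t}$ and $G(\alpha)_{ij}=\mathbb E e^{\alpha U_{ij}}$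 ($G_{ii}=1$), the matrix exponent is $F(\alpha)=\mathrm{diag}(\psi_i(\alpha))+Q\circ G(\alpha)$ ($\circ$ entrywise product), so $\mathbb E_i[e^{\alpha X(t)};J(t)=j]=(e^{F(\alpha)t})_{ij}$. The scale matrix $W:[0,\infty)\to\mathbb R^{N\times N}$ is the unique continuous function with $\int_0^\infty e^{-\alpha x}W(x)\,\mathrm dx=F(\alpha)^{-1}$ for all $\alpha>\eta=\max\{\Re z:\det F(z)=0\}$. Notation: $\mathbb P_{x,i}$ is the law given $X(0)=x,J(0)=i$; $\mathbb E_x[V;J(\tau)]$ denotes the $N\times N$ matrix with $(i,j)$ entry $\mathbb E_{x,i}[V\mathbf 1\{J(\tau)=j\}]$. $I$ is the identity matrix. *)

theory Defs
  imports "HOL-Probability.Probability"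
begin

section \<open>Matrices: power and exponential\<close>

text \<open>States of the modulating chain are the elements of a finite type 'n;
  the absorbing cemetery state is None, so J takes values in 'n option.
  N x N matrices are real^'n^'n.\<close>

definition mat_pow :: "real^'n^'n \<Rightarrow> nat \<Rightarrow> real^'n^'n" where
  "mat_pow A k = (((**) A) ^^ k) (mat 1)"

definition mat_exp :: "real^'n^'n \<Rightarrow> real^'n^'n" where
  "mat_exp A = (\<Sum>k. (1 / fact k) *\<^sub>R mat_pow A k)"

section \<open>Path functionals\<close>

text \<open>Regulator R(t) = -(0 min inf_{s<=t} X(s)), reflected process Y = X + R,
  first passage time T_a = inf{t >= 0 : Y(t) > a}.\<close>

definition refl_R :: "(real \<Rightarrow> 'w \<Rightarrow> real) \<Rightarrow> real \<Rightarrow> 'w \<Rightarrow> real" where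
  "refl_R X t \<omega> = - min 0 (INF s\<in>{0..t}. X s \<omega>)"

definition refl_Y :: "(real \<Rightarrow> 'w \<Rightarrow> real) \<Rightarrow> real \<Rightarrow> 'w \<Rightarrow> real" where
  "refl_Y X t \<omega> = X t \<omega> + refl_R X t \<omega>"

definition exceed_set :: "(real \<Rightarrow> 'w \<Rightarrow> real) \<Rightarrow> real \<Rightarrow> 'w \<Rightarrow> real set" where
  "exceed_set X a \<omega> = {t. 0 \<le> t \<and> a < refl_Y X t \<omega>}"

definition passage_time :: "(real \<Rightarrow> 'w \<Rightarrow> real) \<Rightarrow> real \<Rightarrow> 'w \<Rightarrow> real" where
  "passage_time X a \<omega> = Inf (exceed_set X a \<omega>)"

text \<open>Entry (i,j) of  E_x[e^{-alpha R(T_a)}; J(T_a)] (the event {J(T_a)=j} requires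
  T_a < infinity, i.e. the exceedance set is nonempty).\<close>

definition refl_exit_entry ::
  "(real \<Rightarrow> 'n \<Rightarrow> 'w measure) \<Rightarrow> (real \<Rightarrow> 'w \<Rightarrow> real) \<Rightarrow> (real \<Rightarrow> 'w \<Rightarrow> 'n option)
    \<Rightarrow> real \<Rightarrow> real \<Rightarrow> real \<Rightarrow> 'n \<Rightarrow> 'n \<Rightarrow> real" where
  "refl_exit_entry P X J \<alpha> a x i j =
     (\<integral>\<omega>. exp (- \<alpha> * refl_R X (passage_time X a \<omega>) \<omega>) *
          indicator {\<omega>. exceed_set X a \<omega> \<noteq> {} \<and> J (passage_time X a \<omega>) \<omega> = Some j} \<omega>
      \<partial>P x i)"

section \<open>Spectrally negative Markov additive process\<close>

text \<open>The shifted (post-t) path, masked after killing (there X = infinity in the paper;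
  the masked pair carries the same information since J = None marks killing).\<close>

definition shift_path ::
  "(real \<Rightarrow> 'w \<Rightarrow> real) \<Rightarrow> (real \<Rightarrow> 'w \<Rightarrow> 'n option) \<Rightarrow> real \<Rightarrow> (nat \<Rightarrow> real) \<Rightarrow> nat
     \<Rightarrow> 'w \<Rightarrow> (nat \<Rightarrow> real \<times> 'n option)" where
  "shift_path X J t s n \<omega> = (\<lambda>l\<in>{..<n}.
      (if J (t + s l) \<omega> = None then 0 else X (t + s l) \<omega> - X t \<omega>, J (t + s l) \<omega>))"

definition past_path ::
  "(real \<Rightarrow> 'w \<Rightarrow> real) \<Rightarrow> (real \<Rightarrow> 'w \<Rightarrow> 'n option) \<Rightarrow> (nat \<Rightarrow> real) \<Rightarrow> nat
     \<Rightarrow> 'w \<Rightarrow> (nat \<Rightarrow> real \<times> 'n option)" where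
  "past_path X J u m \<omega> = (\<lambda>l\<in>{..<m}. (X (u l) \<omega>, J (u l) \<omega>))"

abbreviation fd_space :: "nat \<Rightarrow> (nat \<Rightarrow> real \<times> 'n option) measure" where
  "fd_space n \<equiv> PiM {..<n} (\<lambda>_. borel \<Otimes>\<^sub>M count_space UNIV)"

text \<open>P x i is the law given X(0)=x, J(0)=i, all on the measurable space Omega.
  Paths are regular for every omega (a version with regular paths).\<close>

definition sn_MAP ::
  "'w measure \<Rightarrow> (real \<Rightarrow> 'n::finite \<Rightarrow> 'w measure) \<Rightarrow> (real \<Rightarrow> 'w \<Rightarrow> real)
     \<Rightarrow> (real \<Rightarrow> 'w \<Rightarrow> 'n option) \<Rightarrow> bool" where
  "sn_MAP \<Omega> P X J \<longleftrightarrow>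
    \<comment> \<open>laws\<close>
    (\<forall>x i. prob_space (P x i) \<and> sets (P x i) = sets \<Omega>) \<and>
    (\<forall>t. X t \<in> borel_measurable \<Omega> \<and> J t \<in> measurable \<Omega> (count_space UNIV)) \<and>
    (\<forall>x i. AE \<omega> in P x i. X 0 \<omega> = x \<and> J 0 \<omega> = Some i) \<and>
    \<comment> \<open>path regularity: J right-continuous, cemetery absorbing; X cadlag while alive\<close>
    (\<forall>\<omega>\<in>space \<Omega>. \<forall>t\<ge>0. \<exists>\<epsilon>>0. \<forall>s. t \<le> s \<and> s < t + \<epsilon> \<longrightarrow> J s \<omega> = J t \<omega>) \<and>
    (\<forall>\<omega>\<in>space \<Omega>. \<forall>s t. 0 \<le> s \<and> s \<le> t \<and> J s \<omega> = None \<longrightarrow> J t \<omega> = None) \<and>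
    (\<forall>\<omega>\<in>space \<Omega>. \<forall>t\<ge>0. J t \<omega> \<noteq> None \<longrightarrow>
        continuous (at_right t) (\<lambda>s. X s \<omega>)) \<and>
    \<comment> \<open>left limits and no positive jumps (spectral negativity)\<close>
    (\<forall>\<omega>\<in>space \<Omega>. \<forall>t>0. J t \<omega> \<noteq> None \<longrightarrow>
        (\<exists>L. ((\<lambda>s. X s \<omega>) \<longlongrightarrow> L) (at_left t) \<and> X t \<omega> \<le> L)) \<and>
    \<comment> \<open>Markov additive property (w.r.t. the natural filtration)\<close>
    (\<forall>x i t k m u A n s B. 0 \<le> t \<longrightarrow> (\<forall>l<m. 0 \<le> u l \<and> u l \<le> t) \<longrightarrow> (\<forall>l<n. 0 \<le> s l) \<longrightarrow>
       A \<in> sets (fd_space m) \<longrightarrow> B \<in> sets (fd_space n) \<longrightarrow>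
       measure (P x i) {\<omega>\<in>space \<Omega>. past_path X J u m \<omega> \<in> A \<and> J t \<omega> = Some k
                                     \<and> shift_path X J t s n \<omega> \<in> B}
       = measure (P x i) {\<omega>\<in>space \<Omega>. past_path X J u m \<omega> \<in> A \<and> J t \<omega> = Some k}
         * measure (P 0 k) {\<omega>\<in>space \<Omega>. shift_path X J 0 s n \<omega> \<in> B}) \<and>
    \<comment> \<open>J irreducible\<close>
    (\<forall>i j. \<exists>t>0. measure (P 0 i) {\<omega>\<in>space \<Omega>. J t \<omega> = Some j} > 0) \<and>
    \<comment> \<open>no X_i has non-increasing paths\<close>
    (\<forall>i. \<not> (AE \<omega> in P 0 i. \<forall>t\<ge>0. (\<forall>s\<in>{0..t}. J s \<omega> = Some i) \<longrightarrow> X t \<omega> \<le> 0)) \<and>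
    \<comment> \<open>paths of X are not a.s. monotone\<close>
    \<not> (\<forall>i. AE \<omega> in P 0 i.
          (\<forall>s t. 0 \<le> s \<and> s \<le> t \<and> J t \<omega> \<noteq> None \<longrightarrow> X s \<omega> \<le> X t \<omega>) \<or>
          (\<forall>s t. 0 \<le> s \<and> s \<le> t \<and> J t \<omega> \<noteq> None \<longrightarrow> X t \<omega> \<le> X s \<omega>))"

text \<open>Matrix exponent: E_i[e^{alpha X(t)}; J(t)=j] = (e^{F(alpha) t})_{ij}, alpha >= 0, t >= 0.\<close>

definition matrix_exponent ::
  "'w measure \<Rightarrow> (real \<Rightarrow> 'n::finite \<Rightarrow> 'w measure) \<Rightarrow> (real \<Rightarrow> 'w \<Rightarrow> real)
     \<Rightarrow> (real \<Rightarrow> 'w \<Rightarrow> 'n option) \<Rightarrow> (real \<Rightarrow> real^'n^'n) \<Rightarrow> bool" where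
  "matrix_exponent \<Omega> P X J F \<longleftrightarrow>
    (\<forall>\<alpha>\<ge>0. \<forall>t\<ge>0. \<forall>i j.
       integrable (P 0 i) (\<lambda>\<omega>. exp (\<alpha> * X t \<omega>) * indicator {\<omega>. J t \<omega> = Some j} \<omega>) \<and>
       (\<integral>\<omega>. exp (\<alpha> * X t \<omega>) * indicator {\<omega>. J t \<omega> = Some j} \<omega> \<partial>P 0 i)
         = mat_exp (t *\<^sub>R F \<alpha>) $ i $ j)"

text \<open>Scale matrix: continuous W on [0,inf) whose Laplace transform is F(alpha)^{-1}
  for all alpha beyond some threshold (determines W uniquely).\<close>

definition scale_matrix :: "(real \<Rightarrow> real^'n^'n) \<Rightarrow> (real \<Rightarrow> real^'n^'n) \<Rightarrow> bool" where
  "scale_matrix F W \<longleftrightarrow> continuous_on {0..} W \<and>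
    (\<exists>\<eta>\<ge>0. \<forall>\<alpha>>\<eta>. invertible (F \<alpha>) \<and>
        ((\<lambda>x. exp (- \<alpha> * x) *\<^sub>R W x) has_integral matrix_inv (F \<alpha>)) {0..})"

definition Zmat :: "(real \<Rightarrow> real^'n^'n) \<Rightarrow> (real \<Rightarrow> real^'n^'n) \<Rightarrow> real \<Rightarrow> real \<Rightarrow> real^'n^'n" where
  "Zmat F W \<alpha> x = exp (\<alpha> * x) *\<^sub>R
     (mat 1 - integral {0..x} (\<lambda>y. exp (- \<alpha> * y) *\<^sub>R W y) ** F \<alpha>)"

end

theory Submission
  imports Defs "HOL-Complex_Analysis.Conformal_Mappings"
begin

text \<open>Extend \<open>Z(\<alpha>, \<cdot>)\<close> to the negative half line by \<open>Z(\<alpha>, y) = e\<^sup>\<alpha>\<^sup>y I\<close>. Comparing Laplace transforms shows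
  that \<open>E[Z(\<alpha>, y + X(t)); J(t)] - Z(\<alpha>, y)\<close> is bounded by the expected time that \<open>y + X\<close> spends in
  \<open>(-\<infinity>, 0]\<close> before \<open>t\<close>. Reflect \<open>X\<close> along the grid of mesh \<open>h = 2\<^sup>-\<^sup>n\<close> only, with regulator \<open>r\<^sub>k\<close> and
  reflected value \<open>y\<^sub>k\<close>: since \<open>Z\<close> is exponential below \<open>0\<close>, pushing an undershoot back to \<open>0\<close> leaves
  \<open>e\<^sup>-\<^sup>\<alpha>\<^sup>r Z(\<alpha>, y)\<close> unchanged, so this quantity changes in mean by at most the time that \<open>X\<close> spends below
  its previous grid minimum. At a fixed time \<open>X\<close> is almost surely not at its past minimum, because after
  time reversal this would mean that \<open>X\<close> does not become positive immediately; so the total error tends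
  to \<open>0\<close> as the grid is refined. As \<open>X\<close> has no positive jumps, the stopped value of the grid process
  tends to \<open>e\<^sup>-\<^sup>\<alpha>\<^sup>R\<^sup>(\<^sup>T\<^sup>) Z(\<alpha>, a)\<close> with bounded second moments, and the contribution of the paths that
  have neither passed \<open>a\<close> nor been killed before time \<open>m\<close> decays geometrically in \<open>m\<close>. This gives
  \<open>Z(\<alpha>, x) = E\<^sub>x[e\<^sup>-\<^sup>\<alpha>\<^sup>R\<^sup>(\<^sup>T\<^sup>); J(T)] Z(\<alpha>, a)\<close>; as \<open>Z(\<alpha>, 0) = I\<close>, taking \<open>x = 0\<close> shows that \<open>Z(\<alpha>, a)\<close> is
  invertible.\<close>

section \<open>Uniqueness of the bilateral Laplace transform\<close>

text \<open>The Markov additive property is given at deterministic times and for finitely many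
  coordinates, so there is no strong Markov property at \<open>T\<close> and no stochastic calculus
  for \<open>R\<close>. This forces the grid: there every stopping event depends on finitely many
  coordinates, and optional stopping becomes a telescoping sum. \<open>W\<close> is likewise known
  only through a Laplace transform that may converge conditionally; hence the primitive of
  \<open>exp (- \<alpha> * y) * W y\<close> is used, which is all that \<open>Z\<close> contains and
  which has exponential growth. The one-step errors add up well because step \<open>k\<close>
  contributes the time during \<open>[k * h, (k + 1) * h)\<close> at which the path lies at or below
  its grid minimum: their sum is a single integral over \<open>[0, m)\<close>, to which dominated
  convergence applies. The second moments of the stopped values grow at most linearly in
  \<open>m\<close>, while the probability of still running decays geometrically; Young's inequality
  with a geometric weight balances the two.\<close>

lemma norm_exp_partial_sum_le:
  fixes z :: complex
  shows "norm (\<Sum>m<n. z ^ m /\<^sub>R fact m) \<le> exp (norm z)"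
proof -
  have "norm (\<Sum>m<n. z ^ m /\<^sub>R fact m) \<le> (\<Sum>m<n. norm z ^ m /\<^sub>R fact m)"
    by (rule order_trans[OF norm_sum]) (simp add: norm_power)
  also have "\<dots> \<le> exp (norm z)"
    unfolding exp_def by (rule sum_le_suminf) (auto intro: summable_exp)
  finally show ?thesis .
qed

text \<open>The exponential series of \<open>exp (- w * x)\<close> is integrated term by term by
  dominated convergence: each partial sum is at most \<open>exp (\<bar>x\<bar> * norm w)\<close>,
  and times \<open>exp (- Re z * x)\<close> this is a real exponential with one of two
  abscissae.\<close>

lemma bilateral_laplace_power_series:
  fixes u :: "real \<Rightarrow> real"
  assumes [measurable]: "u \<in> borel_measurable borel"
    and int: "\<And>b. b > b0 \<Longrightarrow> integrable lborel (\<lambda>x. exp (- b * x) * u x)"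
    and w: "norm w < Re z - b0"
  shows "(\<lambda>m. (\<integral>x. (- of_real x) ^ m /\<^sub>R fact m * exp (- z * of_real x) * of_real (u x) \<partial>lborel) * w ^ m)
     sums (\<integral>x. exp (- (z + w) * of_real x) * of_real (u x) \<partial>lborel)"
proof -
  \<comment> \<open>The abscissae that dominate for \<open>x \<ge> 0\<close> and for
    \<open>x < 0\<close>; the bound on \<open>norm w\<close> places both above
    \<open>b0\<close>.\<close>
  define b1 where "b1 = Re z - norm w"
  define b2 where "b2 = Re z + norm w"
  have b: "b1 > b0" "b2 > b0" using w norm_ge_zero[of w] unfolding b1_def b2_def by linarith+
  let ?S = "\<lambda>n x. (\<Sum>m<n. (- of_real x * w) ^ m /\<^sub>R fact m) * exp (- z * of_real x) * complex_of_real (u x)"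
  let ?B = "\<lambda>x. \<bar>exp (- b1 * x) * u x\<bar> + \<bar>exp (- b2 * x) * u x\<bar>"
  have B: "integrable lborel ?B"
    using int[OF b(1)] int[OF b(2)] by (intro Bochner_Integration.integrable_add integrable_abs)
  have bound: "norm (c * exp (- z * of_real x) * complex_of_real (u x)) \<le> ?B x"
    if "norm c \<le> exp (\<bar>x\<bar> * norm w)" for c x
  proof -
    have "exp (\<bar>x\<bar> * norm w) * exp (- Re z * x) \<le> exp (- b1 * x) + exp (- b2 * x)"
    proof (cases "x \<ge> 0")
      case True
      then have "exp (\<bar>x\<bar> * norm w) * exp (- Re z * x) = exp (- b1 * x)"
        by (simp add: b1_def algebra_simps flip: exp_add)
      then show ?thesis using exp_gt_zero[of "- b2 * x"] by linarith
    next
      case False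
      then have "exp (\<bar>x\<bar> * norm w) * exp (- Re z * x) = exp (- b2 * x)"
        by (simp add: b2_def algebra_simps flip: exp_add)
      then show ?thesis using exp_gt_zero[of "- b1 * x"] by linarith
    qed
    then have "norm c * exp (- Re z * x) \<le> exp (- b1 * x) + exp (- b2 * x)"
      using that by (meson exp_ge_zero mult_right_mono order_trans)
    then have "norm c * exp (- Re z * x) * \<bar>u x\<bar> \<le> (exp (- b1 * x) + exp (- b2 * x)) * \<bar>u x\<bar>"
      by (intro mult_right_mono) auto
    then show ?thesis by (simp add: norm_mult abs_mult algebra_simps)
  qed
  have termint: "integrable lborel (\<lambda>x. (- of_real x * w) ^ m /\<^sub>R fact m * exp (- z * of_real x) * complex_of_real (u x))" for m
  proof (rule Bochner_Integration.integrable_bound[OF B])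
    show "AE x in lborel. norm ((- of_real x * w) ^ m /\<^sub>R fact m * exp (- z * of_real x) * complex_of_real (u x)) \<le> norm (?B x)"
    proof (rule AE_I2)
      fix x
      have "norm ((- of_real x * w) ^ m /\<^sub>R fact m) = (\<bar>x\<bar> * norm w) ^ m /\<^sub>R fact m"
        by (simp add: norm_power norm_mult)
      also have "\<dots> = (\<Sum>k\<in>{m}. (\<bar>x\<bar> * norm w) ^ k /\<^sub>R fact k)" by simp
      also have "\<dots> \<le> exp (\<bar>x\<bar> * norm w)"
        unfolding exp_def by (rule sum_le_suminf) (auto intro: summable_exp)
      finally have "norm ((- of_real x * w) ^ m /\<^sub>R fact m * exp (- z * of_real x) * complex_of_real (u x)) \<le> ?B x"
        by (rule bound)
      then show "norm ((- of_real x * w) ^ m /\<^sub>R fact m * exp (- z * of_real x) * complex_of_real (u x)) \<le> norm (?B x)"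
        by simp
    qed
  qed measurable
  have "(\<lambda>n. \<integral>x. ?S n x \<partial>lborel) \<longlonglongrightarrow> (\<integral>x. exp (- (z + w) * of_real x) * complex_of_real (u x) \<partial>lborel)"
  proof (rule integral_dominated_convergence[where w = ?B])
    show "integrable lborel ?B" by fact
    show "AE x in lborel. (\<lambda>n. ?S n x) \<longlonglongrightarrow> exp (- (z + w) * of_real x) * complex_of_real (u x)"
    proof (rule AE_I2)
      fix x :: real
      have "(\<lambda>m. (- of_real x * w) ^ m /\<^sub>R fact m) sums exp (- of_real x * w)" by (rule exp_converges)
      then have "(\<lambda>n. \<Sum>m<n. (- of_real x * w) ^ m /\<^sub>R fact m) \<longlonglongrightarrow> exp (- of_real x * w)" by (simp add: sums_def)
      then have "(\<lambda>n. ?S n x) \<longlonglongrightarrow> exp (- of_real x * w) * exp (- z * of_real x) * complex_of_real (u x)"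
        by (intro tendsto_intros)
      moreover have "exp (- of_real x * w) * exp (- z * of_real x) = exp (- (z + w) * of_real x)"
        by (simp add: algebra_simps flip: exp_add)
      ultimately show "(\<lambda>n. ?S n x) \<longlonglongrightarrow> exp (- (z + w) * of_real x) * complex_of_real (u x)" by simp
    qed
    fix n
    show "AE x in lborel. norm (?S n x) \<le> ?B x"
    proof (rule AE_I2)
      fix x
      have "norm (\<Sum>m<n. (- of_real x * w) ^ m /\<^sub>R fact m) \<le> exp (norm (- of_real x * w))"
        by (rule norm_exp_partial_sum_le)
      then show "norm (?S n x) \<le> ?B x" by (intro bound) (simp add: norm_mult)
    qed
  qed measurable
  moreover have "(\<integral>x. ?S n x \<partial>lborel) = (\<Sum>m<n. (\<integral>x. (- of_real x) ^ m /\<^sub>R fact m * exp (- z * of_real x) * complex_of_real (u x) \<partial>lborel) * w ^ m)" for n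
  proof -
    have "(\<integral>x. ?S n x \<partial>lborel) = (\<integral>x. (\<Sum>m<n. (- of_real x * w) ^ m /\<^sub>R fact m * exp (- z * of_real x) * complex_of_real (u x)) \<partial>lborel)"
      by (simp add: sum_distrib_right)
    also have "\<dots> = (\<Sum>m<n. \<integral>x. (- of_real x * w) ^ m /\<^sub>R fact m * exp (- z * of_real x) * complex_of_real (u x) \<partial>lborel)"
      by (rule Bochner_Integration.integral_sum) (rule termint)
    also have "\<dots> = (\<Sum>m<n. (\<integral>x. (- of_real x) ^ m /\<^sub>R fact m * exp (- z * of_real x) * complex_of_real (u x) \<partial>lborel) * w ^ m)"
    proof (rule sum.cong[OF refl])
      fix m
      have e: "(- of_real x * w) ^ m = (- of_real x) ^ m * w ^ m" for x :: real
        by (rule power_mult_distrib)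
      have "(\<integral>x. (- of_real x * w) ^ m /\<^sub>R fact m * exp (- z * of_real x) * complex_of_real (u x) \<partial>lborel)
        = (\<integral>x. (- of_real x) ^ m /\<^sub>R fact m * exp (- z * of_real x) * complex_of_real (u x) * w ^ m \<partial>lborel)"
        unfolding e by (intro Bochner_Integration.integral_cong) (simp_all only: mult_scaleR_left mult_scaleR_right mult_ac)
      also have "\<dots> = (\<integral>x. (- of_real x) ^ m /\<^sub>R fact m * exp (- z * of_real x) * complex_of_real (u x) \<partial>lborel) * w ^ m"
        by (rule integral_mult_left_zero)
      finally show "(\<integral>x. (- of_real x * w) ^ m /\<^sub>R fact m * exp (- z * of_real x) * complex_of_real (u x) \<partial>lborel)
        = (\<integral>x. (- of_real x) ^ m /\<^sub>R fact m * exp (- z * of_real x) * complex_of_real (u x) \<partial>lborel) * w ^ m" .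
    qed
    finally show ?thesis .
  qed
  ultimately show ?thesis by (simp add: sums_def)
qed

text \<open>The power series makes the transform holomorphic on \<open>Re z > b0\<close>. It
  vanishes on the real ray in this half-plane, which has an accumulation point there, so analytic
  continuation applies.\<close>

lemma bilateral_laplace_eq_0_complex:
  fixes u :: "real \<Rightarrow> real"
  assumes [measurable]: "u \<in> borel_measurable borel"
    and int: "\<And>b. b > b0 \<Longrightarrow> integrable lborel (\<lambda>x. exp (- b * x) * u x)"
    and zero: "\<And>b. b > b0 \<Longrightarrow> (\<integral>x. exp (- b * x) * u x \<partial>lborel) = 0"
    and z: "Re z > b0"
  shows "(\<integral>x. exp (- z * of_real x) * of_real (u x) \<partial>lborel) = (0::complex)"
proof -
  define \<Phi> where "\<Phi> z = (\<integral>x. exp (- z * of_real x) * of_real (u x) \<partial>lborel)" for z :: complex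
  let ?S = "{z. Re z > b0}"
  have op: "open ?S" by (simp add: open_halfspace_Re_gt)
  have "\<exists>f'. (\<Phi> has_field_derivative f') (at z)" if z: "Re z > b0" for z
  proof -
    have "\<Phi> holomorphic_on ball z (Re z - b0)"
    proof (rule power_series_holomorphic)
      fix y assume "y \<in> ball z (Re z - b0)"
      then have "norm (y - z) < Re z - b0" by (simp add: dist_norm norm_minus_commute)
      from bilateral_laplace_power_series[OF assms(1) int this]
      show "(\<lambda>n. (\<integral>x. (- of_real x) ^ n /\<^sub>R fact n * exp (- z * of_real x) * of_real (u x) \<partial>lborel) * (y - z) ^ n) sums \<Phi> y"
        by (simp add: \<Phi>_def)
    qed
    then show ?thesis using z by (auto simp: holomorphic_on_open)
  qed
  then have hol: "\<Phi> holomorphic_on ?S" by (auto simp: holomorphic_on_open[OF op])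
  have "\<Phi> z = 0"
  proof (rule analytic_continuation[OF hol op])
    show "connected ?S" by (simp add: convex_halfspace_Re_gt convex_connected)
    show "of_real ` {b0<..} \<subseteq> ?S" by auto
    show "of_real (b0 + 1) \<in> ?S" by simp
    show "complex_of_real (b0 + 1) islimpt of_real ` {b0<..}"
      unfolding islimpt_approachable
    proof (intro allI impI)
      fix e :: real assume "e > 0"
      then show "\<exists>x'\<in>complex_of_real ` {b0<..}. x' \<noteq> complex_of_real (b0 + 1) \<and> dist x' (complex_of_real (b0 + 1)) < e"
        by (intro bexI[of _ "of_real (b0 + 1 + e / 2)"]) (auto simp: dist_norm intro!: imageI simp del: of_real_add simp flip: of_real_diff)
    qed
    show "\<Phi> y = 0" if y: "y \<in> of_real ` {b0<..}" for y
    proof -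
      from that obtain b where b: "b > b0" "y = of_real b" by auto
      have "\<Phi> y = (\<integral>x. complex_of_real (exp (- b * x) * u x) \<partial>lborel)"
        unfolding \<Phi>_def b(2) by (simp add: exp_of_real flip: of_real_mult of_real_minus)
      also have "\<dots> = 0" using zero[OF b(1)] by (simp only: integral_complex_of_real) simp
      finally show ?thesis .
    qed
    show "z \<in> ?S" using z by simp
  qed
  then show ?thesis by (simp add: \<Phi>_def)
qed

text \<open>At \<open>t = 0\<close> the hypothesis says that both functions have the same mass
  \<open>m\<close>. Division by \<open>m\<close> gives probability densities with equal
  characteristic functions, to which Levy's uniqueness theorem applies; for \<open>m = 0\<close>
  both functions vanish a.e.\<close>

lemma density_eq_of_fourier_eq:
  fixes f g :: "real \<Rightarrow> real"
  assumes [measurable]: "integrable lborel f" "integrable lborel g"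
    and nn: "\<And>x. f x \<ge> 0" "\<And>x. g x \<ge> 0"
    and eq: "\<And>t. (\<integral>x. iexp (t * x) * of_real (f x) \<partial>lborel) = (\<integral>x. iexp (t * x) * of_real (g x) \<partial>lborel)"
  shows "AE x in lborel. f x = g x"
proof -
  have [measurable]: "f \<in> borel_measurable borel" "g \<in> borel_measurable borel" using assms(1,2) by auto
  define m where "m = (\<integral>x. f x \<partial>lborel)"
  have "complex_of_real (\<integral>x. f x \<partial>lborel) = complex_of_real (\<integral>x. g x \<partial>lborel)"
    using eq[of 0] by (simp flip: integral_complex_of_real)
  then have mg: "m = (\<integral>x. g x \<partial>lborel)" unfolding m_def by simp
  have m0: "m \<ge> 0" unfolding m_def using nn by (intro integral_nonneg_AE) auto
  show ?thesis
  proof (cases "m = 0")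
    case True
    have "AE x in lborel. f x = 0" "AE x in lborel. g x = 0"
      using integral_nonneg_eq_0_iff_AE[OF assms(1)] integral_nonneg_eq_0_iff_AE[OF assms(2)] nn True m_def mg by auto
    then show ?thesis by eventually_elim simp
  next
    case False
    with m0 have m: "m > 0" by simp
    have rd: "real_distribution (density lborel (\<lambda>x. ennreal (h x / m)))"
      and ch: "char (density lborel (\<lambda>x. ennreal (h x / m))) t = (\<integral>x. iexp (t * x) * of_real (h x) \<partial>lborel) / m"
      if h: "integrable lborel h" "\<And>x. h x \<ge> 0" "(\<integral>x. h x \<partial>lborel) = m" for h :: "real \<Rightarrow> real" and t
    proof -
      have [measurable]: "h \<in> borel_measurable borel" using h(1) by auto
      have "emeasure (density lborel (\<lambda>x. ennreal (h x / m))) UNIV = (\<integral>\<^sup>+x. ennreal (h x / m) \<partial>lborel)"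
        by (subst emeasure_density) auto
      also have "\<dots> = ennreal (\<integral>x. h x / m \<partial>lborel)"
        using h m by (intro nn_integral_eq_integral) auto
      also have "\<dots> = 1" using h(3) m by simp
      finally have "prob_space (density lborel (\<lambda>x. ennreal (h x / m)))"
        by (intro prob_spaceI) simp
      then show "real_distribution (density lborel (\<lambda>x. ennreal (h x / m)))"
        by (intro real_distribution.intro real_distribution_axioms.intro) auto
      have "char (density lborel (\<lambda>x. ennreal (h x / m))) t = (\<integral>x. (h x / m) *\<^sub>R iexp (t * x) \<partial>lborel)"
        unfolding char_def using h m by (intro integral_density) auto
      also have "\<dots> = (\<integral>x. iexp (t * x) * of_real (h x) / of_real m \<partial>lborel)"
        by (intro Bochner_Integration.integral_cong) (auto simp: scaleR_conv_of_real)
      finally show "char (density lborel (\<lambda>x. ennreal (h x / m))) t = (\<integral>x. iexp (t * x) * of_real (h x) \<partial>lborel) / m"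
        by simp
    qed
    have "density lborel (\<lambda>x. ennreal (f x / m)) = density lborel (\<lambda>x. ennreal (g x / m))"
      by (rule Levy_uniqueness) (use assms mg m_def rd ch in auto)
    then have "AE x in lborel. ennreal (f x / m) = ennreal (g x / m)"
      by (intro sigma_finite_measure.density_unique) (auto intro: sigma_finite_lborel)
    then show ?thesis by eventually_elim (use m nn in simp)
  qed
qed

text \<open>On the vertical line \<open>Re z = b0 + 1\<close> the transform is the Fourier transform
  of \<open>v\<close>. Since it vanishes, the positive and negative parts of \<open>v\<close> have
  the same Fourier transform and agree a.e.; having disjoint supports, both are 0.\<close>

lemma bilateral_laplace_eq_0_imp_AE:
  fixes u :: "real \<Rightarrow> real"
  assumes [measurable]: "u \<in> borel_measurable borel"
    and int: "\<And>b. b > b0 \<Longrightarrow> integrable lborel (\<lambda>x. exp (- b * x) * u x)"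
    and zero: "\<And>b. b > b0 \<Longrightarrow> (\<integral>x. exp (- b * x) * u x \<partial>lborel) = 0"
  shows "AE x in lborel. u x = 0"
proof -
  define v where "v x = exp (- (b0 + 1) * x) * u x" for x
  have v: "integrable lborel v" unfolding v_def using int[of "b0 + 1"] by simp
  then have [measurable]: "v \<in> borel_measurable borel" by auto
  have vp: "integrable lborel (\<lambda>x. max 0 (v x))" "integrable lborel (\<lambda>x. max 0 (- v x))"
    using v by (auto intro!: integrable_max)
  have "AE x in lborel. max 0 (v x) = max 0 (- v x)"
  proof (rule density_eq_of_fourier_eq)
    fix t
    have I: "integrable lborel (\<lambda>x. iexp (t * x) * of_real (h x))" if "integrable lborel h" for h :: "real \<Rightarrow> real"
    proof (rule Bochner_Integration.integrable_bound[OF that])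
      show "(\<lambda>x. iexp (t * x) * of_real (h x)) \<in> borel_measurable lborel" using that by measurable
    qed (auto simp: norm_mult)
    have "(\<integral>x. iexp (t * x) * of_real (max 0 (v x)) \<partial>lborel) - (\<integral>x. iexp (t * x) * of_real (max 0 (- v x)) \<partial>lborel)
      = (\<integral>x. iexp (t * x) * of_real (max 0 (v x)) - iexp (t * x) * of_real (max 0 (- v x)) \<partial>lborel)"
      using vp by (intro Bochner_Integration.integral_diff[symmetric] I)
    also have "\<dots> = (\<integral>x. exp (- Complex (b0 + 1) (- t) * of_real x) * of_real (u x) \<partial>lborel)"
    proof (rule Bochner_Integration.integral_cong[OF refl])
      fix x
      have "iexp (t * x) * of_real (max 0 (v x)) - iexp (t * x) * of_real (max 0 (- v x))
        = iexp (t * x) * of_real (v x)" by (simp add: max_def flip: right_diff_distrib)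
      also have "\<dots> = iexp (t * x) * exp (of_real (- (b0 + 1) * x)) * of_real (u x)"
        by (simp add: v_def algebra_simps flip: exp_of_real)
      also have "iexp (t * x) * exp (of_real (- (b0 + 1) * x)) = exp (- Complex (b0 + 1) (- t) * of_real x)"
        unfolding exp_add[symmetric] by (rule arg_cong[where f = exp]) (simp add: complex_eq_iff algebra_simps)
      finally show "iexp (t * x) * of_real (max 0 (v x)) - iexp (t * x) * of_real (max 0 (- v x))
        = exp (- Complex (b0 + 1) (- t) * of_real x) * of_real (u x)" .
    qed
    also have "\<dots> = 0" by (rule bilateral_laplace_eq_0_complex[OF assms(1) int zero]) auto
    finally show "(\<integral>x. iexp (t * x) * of_real (max 0 (v x)) \<partial>lborel) = (\<integral>x. iexp (t * x) * of_real (max 0 (- v x)) \<partial>lborel)"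
      by simp
  qed (use vp in auto)
  then show ?thesis by eventually_elim (auto simp: v_def max_def split: if_splits)
qed

section \<open>Matrix exponentials and conditionally convergent Laplace integrals\<close>

definition entry_sum :: "real^'n^'n \<Rightarrow> real" where
  "entry_sum A = (\<Sum>i\<in>UNIV. \<Sum>j\<in>UNIV. \<bar>A $ i $ j\<bar>)"

lemma entry_sum_nonneg: "0 \<le> entry_sum A"
  by (auto simp: entry_sum_def intro!: sum_nonneg)

lemma row_sum_le_entry_sum: "(\<Sum>j\<in>UNIV. \<bar>A $ i $ j\<bar>) \<le> entry_sum A"
  unfolding entry_sum_def by (rule member_le_sum[of i UNIV "\<lambda>i. \<Sum>j\<in>UNIV. \<bar>A $ i $ j\<bar>"]) (auto intro: sum_nonneg)

lemma column_sum_le_entry_sum: "(\<Sum>i\<in>UNIV. \<bar>A $ i $ j\<bar>) \<le> entry_sum A"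
  unfolding entry_sum_def by (rule sum_mono) (rule member_le_sum, auto)

lemma mat_pow_0: "mat_pow A 0 = mat 1"
  and mat_pow_Suc: "mat_pow A (Suc k) = A ** mat_pow A k"
  by (simp_all add: mat_pow_def)

lemma mat_pow_Suc': "mat_pow A (Suc k) = mat_pow A k ** A"
proof (induction k)
  case 0 show ?case by (simp add: mat_pow_0 mat_pow_Suc)
next
  case (Suc k) then show ?case by (metis mat_pow_Suc matrix_mul_assoc)
qed

lemma mat_pow_scaleR: "mat_pow (t *\<^sub>R A) k = t ^ k *\<^sub>R mat_pow A k"
proof (induction k)
  case (Suc k)
  then show ?case
    by (simp add: mat_pow_Suc vec_eq_iff matrix_matrix_mult_def sum_distrib_left mult_ac)
qed (simp add: mat_pow_0)

lemma mat_pow_entry_le: "\<bar>mat_pow A k $ i $ j\<bar> \<le> entry_sum A ^ k"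
proof (induction k arbitrary: i j)
  case 0 show ?case by (simp add: mat_pow_0 mat_def)
next
  case (Suc k)
  have "\<bar>mat_pow A (Suc k) $ i $ j\<bar> = \<bar>\<Sum>l\<in>UNIV. A $ i $ l * mat_pow A k $ l $ j\<bar>"
    by (simp add: mat_pow_Suc matrix_matrix_mult_def)
  also have "\<dots> \<le> (\<Sum>l\<in>UNIV. \<bar>A $ i $ l\<bar> * entry_sum A ^ k)"
    by (rule order_trans[OF sum_abs]) (auto intro!: sum_mono mult_left_mono Suc simp: abs_mult)
  also have "\<dots> \<le> entry_sum A * entry_sum A ^ k"
    unfolding sum_distrib_right[symmetric]
    by (intro mult_right_mono row_sum_le_entry_sum zero_le_power entry_sum_nonneg)
  finally show ?case by simp
qed

lemma summable_mat_pow_entry: "summable (\<lambda>k. mat_pow A k $ i $ j / fact k * t ^ k)"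
proof (rule summable_comparison_test')
  show "summable (\<lambda>k. inverse (fact k) * (entry_sum A * \<bar>t\<bar>) ^ k)" by (rule summable_exp)
  show "norm (mat_pow A k $ i $ j / fact k * t ^ k) \<le> inverse (fact k) * (entry_sum A * \<bar>t\<bar>) ^ k" for k
    using mat_pow_entry_le[of A k i j]
    by (simp add: abs_mult power_abs power_mult_distrib field_simps mult_left_mono)
qed

text \<open>In entries the matrix series is a scalar power series in \<open>t\<close>, so the
  differentiation theorem for real power series becomes available.\<close>

lemma mat_exp_entry: "mat_exp (t *\<^sub>R A) $ i $ j = (\<Sum>k. mat_pow A k $ i $ j / fact k * t ^ k)"
proof -
  have "summable (\<lambda>k. (1 / fact k) *\<^sub>R mat_pow (t *\<^sub>R A) k)"
  proof (rule summable_comparison_test')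
    let ?c = "real CARD('a) * real CARD('a)"
    show "summable (\<lambda>k. ?c * (inverse (fact k) * (entry_sum A * \<bar>t\<bar>) ^ k))" by (intro summable_mult summable_exp)
    fix k :: nat
    have "norm (mat_pow A k) \<le> (\<Sum>i\<in>UNIV. norm (mat_pow A k $ i))"
      by (simp add: norm_vec_def L2_set_le_sum)
    also have "\<dots> \<le> (\<Sum>i\<in>(UNIV::'a set). \<Sum>j\<in>(UNIV::'a set). entry_sum A ^ k)"
      by (intro sum_mono order_trans[OF norm_le_l1_cart] mat_pow_entry_le)
    also have "\<dots> = ?c * entry_sum A ^ k" by simp
    finally have "norm (mat_pow A k) \<le> ?c * entry_sum A ^ k" .
    from mult_left_mono[OF this, of "\<bar>t\<bar> ^ k / fact k"]
    show "norm ((1 / fact k) *\<^sub>R mat_pow (t *\<^sub>R A) k) \<le> ?c * (inverse (fact k) * (entry_sum A * \<bar>t\<bar>) ^ k)"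
      by (simp add: mat_pow_scaleR power_abs power_mult_distrib field_simps)
  qed
  moreover have "bounded_linear (\<lambda>M. M $ i $ j :: real)"
    by (intro bounded_linear_compose[OF bounded_linear_vec_nth bounded_linear_vec_nth, unfolded o_def])
  ultimately have "mat_exp (t *\<^sub>R A) $ i $ j = (\<Sum>k. ((1 / fact k) *\<^sub>R mat_pow (t *\<^sub>R A) k) $ i $ j)"
    unfolding mat_exp_def by (intro bounded_linear.suminf)
  then show ?thesis by (simp add: mat_pow_scaleR mult_ac)
qed

lemma mat_exp_0 [simp]: "mat_exp 0 = mat 1"
proof -
  have "mat_exp (0 *\<^sub>R 0) $ i $ j = (mat 1 :: real^'a^'a) $ i $ j" for i j
    unfolding mat_exp_entry powser_zero by (simp add: mat_pow_0)
  then show ?thesis by (simp add: vec_eq_iff)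
qed

text \<open>The coefficients are shifted with \<open>mat_pow_Suc'\<close>, which leaves
  \<open>A\<close> on the right: later the integrated exponential is multiplied from the right by
  \<open>F b\<close> and then by its inverse.\<close>

lemma mat_exp_has_derivative:
  "((\<lambda>t. mat_exp (t *\<^sub>R A) $ i $ j) has_real_derivative (mat_exp (t *\<^sub>R A) ** A) $ i $ j) (at t)"
proof -
  have *: "diffs (\<lambda>k. mat_pow A k $ i $ j / fact k) k = (\<Sum>l\<in>UNIV. mat_pow A k $ i $ l / fact k * A $ l $ j)" for k
  proof -
    have "diffs (\<lambda>k. mat_pow A k $ i $ j / fact k) k = mat_pow A (Suc k) $ i $ j / fact k"
      by (simp add: diffs_def field_simps del: of_nat_Suc)
    then show ?thesis by (simp add: mat_pow_Suc' matrix_matrix_mult_def sum_divide_distrib)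
  qed
  have "(\<Sum>k. diffs (\<lambda>k. mat_pow A k $ i $ j / fact k) k * t ^ k)
    = (\<Sum>k. \<Sum>l\<in>UNIV. mat_pow A k $ i $ l / fact k * t ^ k * A $ l $ j)"
    unfolding * sum_distrib_right by (simp add: mult_ac)
  also have "\<dots> = (\<Sum>l\<in>UNIV. \<Sum>k. mat_pow A k $ i $ l / fact k * t ^ k * A $ l $ j)"
    by (intro suminf_sum summable_mult2 summable_mat_pow_entry)
  also have "\<dots> = (\<Sum>l\<in>UNIV. mat_exp (t *\<^sub>R A) $ i $ l * A $ l $ j)"
    unfolding mat_exp_entry by (intro sum.cong refl suminf_mult2[symmetric] summable_mat_pow_entry)
  also have "\<dots> = (mat_exp (t *\<^sub>R A) ** A) $ i $ j" by (simp add: matrix_matrix_mult_def)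
  finally show ?thesis
    using termdiffs_strong_converges_everywhere[of "\<lambda>k. mat_pow A k $ i $ j / fact k" t] summable_mat_pow_entry[of A i j]
    by (simp add: mat_exp_entry)
qed

lemma isCont_mat_exp: "isCont (\<lambda>t. mat_exp (t *\<^sub>R A) $ i $ j) t"
  using mat_exp_has_derivative by (rule DERIV_isCont)

lemma integral_mat_exp_mult:
  assumes "0 \<le> t"
  shows "(\<Sum>l\<in>UNIV. (\<integral>s. mat_exp (s *\<^sub>R A) $ i $ l * indicator {0..t} s \<partial>lborel) * A $ l $ j)
     = mat_exp (t *\<^sub>R A) $ i $ j - mat 1 $ i $ j"
proof -
  have int: "integrable lborel (\<lambda>s. mat_exp (s *\<^sub>R A) $ i $ l * indicator {0..t} s)" for l
    using isCont_mat_exp by (intro borel_integrable_atLeastAtMost)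
  have "mat_exp (t *\<^sub>R A) $ i $ j - mat_exp (0 *\<^sub>R A) $ i $ j
      = (\<integral>s. (mat_exp (s *\<^sub>R A) ** A) $ i $ j * indicator {0..t} s \<partial>lborel)"
    by (intro integral_FTC_Icc_real[symmetric] assms mat_exp_has_derivative)
      (auto simp: matrix_matrix_mult_def intro!: continuous_intros isCont_mat_exp)
  also have "\<dots> = (\<integral>s. (\<Sum>l\<in>UNIV. mat_exp (s *\<^sub>R A) $ i $ l * indicator {0..t} s * A $ l $ j) \<partial>lborel)"
    by (simp add: matrix_matrix_mult_def sum_distrib_left sum_distrib_right mult_ac)
  also have "\<dots> = (\<Sum>l\<in>UNIV. (\<integral>s. mat_exp (s *\<^sub>R A) $ i $ l * indicator {0..t} s * A $ l $ j \<partial>lborel))"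
    by (intro Bochner_Integration.integral_sum integrable_mult_left int)
  finally show ?thesis by simp
qed

text \<open>The derivative is bounded on [0, 1]. The linear order in \<open>t\<close> is what keeps
  the expected squared fluctuations of a fine grid summable to a bounded amount per unit of
  time.\<close>

lemma mat_exp_diff_le:
  obtains C where "\<And>t i j. 0 \<le> t \<Longrightarrow> t \<le> 1 \<Longrightarrow> \<bar>mat_exp (t *\<^sub>R A) $ i $ j - mat 1 $ i $ j\<bar> \<le> C * t" "C \<ge> 0"
proof
  let ?C = "exp (entry_sum A) * entry_sum A"
  show "?C \<ge> 0" by (simp add: entry_sum_nonneg)
  fix t :: real and i j assume t: "0 \<le> t" "t \<le> 1"
  have e: "\<bar>mat_exp (s *\<^sub>R A) $ i $ l\<bar> \<le> exp (entry_sum A)" if "0 \<le> s" "s \<le> 1" for s l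
  proof -
    have "norm (\<Sum>k. mat_pow A k $ i $ l / fact k * s ^ k) \<le> (\<Sum>k. inverse (fact k) * entry_sum A ^ k)"
    proof (rule norm_suminf_le)
      fix k
      have "\<bar>mat_pow A k $ i $ l\<bar> * s ^ k \<le> entry_sum A ^ k * 1"
        using that by (intro mult_mono mat_pow_entry_le power_le_one) (auto simp: entry_sum_nonneg)
      then show "norm (mat_pow A k $ i $ l / fact k * s ^ k) \<le> inverse (fact k) * entry_sum A ^ k"
        using that by (simp add: abs_mult field_simps)
    qed (rule summable_exp)
    then show ?thesis by (simp add: mat_exp_entry exp_def)
  qed
  have d: "norm ((mat_exp (s *\<^sub>R A) ** A) $ i $ j) \<le> ?C" if s: "s \<in> {0..1}" for s
  proof -
    have "\<bar>(mat_exp (s *\<^sub>R A) ** A) $ i $ j\<bar> \<le> (\<Sum>l\<in>UNIV. exp (entry_sum A) * \<bar>A $ l $ j\<bar>)"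
      using s unfolding matrix_matrix_mult_def
      by (auto intro!: order_trans[OF sum_abs] sum_mono mult_right_mono e simp: abs_mult)
    also have "\<dots> \<le> ?C"
      unfolding sum_distrib_left[symmetric] by (intro mult_left_mono column_sum_le_entry_sum) auto
    finally show ?thesis by simp
  qed
  have "norm (mat_exp (t *\<^sub>R A) $ i $ j - mat_exp (0 *\<^sub>R A) $ i $ j) \<le> ?C * norm (t - 0)"
    by (rule field_differentiable_bound[of "{0..1}" _ "\<lambda>s. (mat_exp (s *\<^sub>R A) ** A) $ i $ j"])
      (use t d in \<open>auto intro: has_field_derivative_at_within mat_exp_has_derivative\<close>)
  then show "\<bar>mat_exp (t *\<^sub>R A) $ i $ j - mat 1 $ i $ j\<bar> \<le> ?C * t" using t by simp
qed

section \<open>Growth and Laplace transform of the exponential primitive\<close>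

text \<open>The Laplace integral of \<open>w\<close> is only assumed to converge conditionally, so that \<open>w\<close> itself need not
  have exponential growth; its \<open>exp_primitive\<close> does, which is all that is used.\<close>

definition exp_primitive :: "real \<Rightarrow> (real \<Rightarrow> real) \<Rightarrow> real \<Rightarrow> real" where
  "exp_primitive a w x = (if 0 \<le> x then exp (a * x) * integral {0..x} (\<lambda>y. exp (- a * y) * w y) else 0)"

lemma exp_primitive_nonpos: "x \<le> 0 \<Longrightarrow> exp_primitive a w x = 0"
  by (auto simp: exp_primitive_def intro: order_antisym)

text \<open>A gauge integral over the half line is a limit over growing boxes, hence an improper
  integral. This limit is all the information that the transform of \<open>W\<close>
  provides.\<close>

lemma has_integral_atLeast_0_tendsto:
  fixes f :: "real \<Rightarrow> real"
  assumes "(f has_integral L) {0..}"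
  shows "((\<lambda>x. integral {0..x} f) \<longlongrightarrow> L) at_top"
proof (rule tendstoI)
  fix e :: real assume "e > 0"
  with assms obtain B where B: "B > 0" "\<And>a b. ball 0 B \<subseteq> cbox a b \<Longrightarrow>
      norm (integral (cbox a b) (\<lambda>x. if x \<in> {0..} then f x else 0) - L) < e"
    unfolding has_integral_alt' by blast
  have "dist (integral {0..x} f) L < e" if x: "x \<ge> B" for x
  proof -
    have "ball 0 B \<subseteq> cbox (-x) x" using x by (auto simp: dist_real_def)
    from B(2)[OF this] have "norm (integral {-x..x} (\<lambda>x. if x \<in> {0..} then f x else 0) - L) < e" by simp
    moreover have "integral {-x..x} (\<lambda>x. if x \<in> {0..} then f x else 0) = integral ({-x..x} \<inter> {0..}) f"
      by (simp only: integral_restrict_Int Int_commute)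
    moreover have "{-x..x} \<inter> {0..} = {0..x}" using x B(1) by auto
    ultimately show ?thesis by (simp only: dist_norm)
  qed
  then show "\<forall>\<^sub>F x in at_top. dist (integral {0..x} f) L < e"
    unfolding eventually_at_top_linorder by blast
qed

context
  fixes w :: "real \<Rightarrow> real" and a \<eta> :: real and L :: "real \<Rightarrow> real"
  assumes w: "continuous_on {0..} w"
    and lap: "\<And>b. b > \<eta> \<Longrightarrow> ((\<lambda>x. exp (- b * x) * w x) has_integral L b) {0..}"
begin

private lemma cont_exp_w: "continuous_on {0..x} (\<lambda>y. exp (- b * y) * w y)"
  by (intro continuous_intros continuous_on_subset[OF w]) auto

private lemma primitive_deriv:
  assumes "0 \<le> y" "y \<le> x"
  shows "((\<lambda>x. integral {0..x} (\<lambda>y. exp (- b * y) * w y)) has_real_derivative exp (- b * y) * w y) (at y within {0..x})"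
  unfolding has_real_derivative_iff_has_vector_derivative
  using assms by (intro integral_has_vector_derivative[OF cont_exp_w]) auto

private lemma primitive_cont: "continuous_on {0..x} (\<lambda>x. integral {0..x} (\<lambda>y. exp (- b * y) * w y))"
  by (intro indefinite_integral_continuous_1 integrable_continuous_real cont_exp_w)

lemma continuous_on_exp_primitive: "continuous_on UNIV (exp_primitive a w)"
proof -
  have 1: "continuous_on {0..x} (\<lambda>x. exp (a * x) * integral {0..x} (\<lambda>y. exp (- a * y) * w y))" for x
    by (intro continuous_intros primitive_cont)
  have 2: "continuous_on {0..} (\<lambda>x. exp (a * x) * integral {0..x} (\<lambda>y. exp (- a * y) * w y))"
    unfolding continuous_on_eq_continuous_within
  proof
    fix x :: real assume x: "x \<in> {0..}"
    then have "continuous (at x within {0..x+1}) (\<lambda>x. exp (a * x) * integral {0..x} (\<lambda>y. exp (- a * y) * w y))"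
      using 1[of "x + 1"] by (auto simp: continuous_on_eq_continuous_within)
    moreover have "at x within {0..x+1} = at x within {0..}"
      using x by (intro at_within_nhd[of x "{..<x+1}"]) auto
    ultimately show "continuous (at x within {0..}) (\<lambda>x. exp (a * x) * integral {0..x} (\<lambda>y. exp (- a * y) * w y))" by simp
  qed
  have "continuous_on ({0..} \<union> {..0}) (\<lambda>x. if 0 \<le> x then exp (a * x) * integral {0..x} (\<lambda>y. exp (- a * y) * w y) else 0)"
    by (rule continuous_on_If) (use 2 in \<open>auto intro: order_antisym\<close>)
  moreover have "{0..} \<union> {..0} = (UNIV :: real set)" by auto
  ultimately show ?thesis by (simp add: exp_primitive_def[abs_def])
qed

text \<open>Integration by parts with \<open>c = b - a\<close>: the truncated transform at
  \<open>a\<close> equals \<open>exp (c * x) * V b x\<close> minus the integral of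
  \<open>c * exp (c * y) * V b y\<close>, and \<open>V b\<close> is bounded because it is continuous
  and has a limit. Convergence of the transform at \<open>b\<close> suffices; absolute integrability
  does not enter.\<close>

lemma exp_primitive_bound:
  assumes b: "b > \<eta>" "b > a"
  obtains C where "C \<ge> 0" "\<And>x. 0 \<le> x \<Longrightarrow> \<bar>exp_primitive a w x\<bar> \<le> C * exp (b * x)"
proof -
  define V where "V c x = integral {0..x} (\<lambda>y. exp (- c * y) * w y)" for c x
  have "(V b \<longlongrightarrow> L b) at_top"
    unfolding V_def using has_integral_atLeast_0_tendsto[OF lap[OF b(1)]] .
  then have "eventually (\<lambda>x. dist (V b x) (L b) < 1) at_top" by (rule tendstoD) simp
  then obtain X where X: "\<And>x. x \<ge> X \<Longrightarrow> dist (V b x) (L b) < 1" by (auto simp: eventually_at_top_linorder)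
  have "continuous_on {0..X} (V b)"
    unfolding V_def by (rule primitive_cont)
  then have "bounded (V b ` {0..X})" by (intro compact_imp_bounded compact_continuous_image) auto
  then obtain B1 where "\<forall>x\<in>{0..X}. \<bar>V b x\<bar> \<le> B1" by (auto simp: bounded_iff)
  then have B1: "\<bar>V b x\<bar> \<le> B1" if "0 \<le> x" "x \<le> X" for x using that by auto
  define B where "B = max \<bar>B1\<bar> (\<bar>L b\<bar> + 1)"
  have B0: "B \<ge> 0" by (simp add: B_def)
  have B: "\<bar>V b x\<bar> \<le> B" if "0 \<le> x" for x
    using X[of x] B1[of x] that unfolding B_def dist_real_def by (cases "x \<le> X") linarith+
  define c where "c = b - a"
  have c: "c > 0" using b by (simp add: c_def)
  \<comment> \<open>What remains of \<open>V a\<close> after the boundary term. Its derivative no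
    longer contains \<open>w\<close> and is dominated by that of
    \<open>B * exp (c * y)\<close>.\<close>
  define q where "q x = V a x - exp (c * x) * V b x" for x
  have q: "(q has_real_derivative - c * exp (c * y) * V b y) (at y within {0..x})" if "0 \<le> y" "y \<le> x" for x y
  proof -
    have "(q has_real_derivative exp (- a * y) * w y - (c * exp (c * y) * V b y + exp (c * y) * (exp (- b * y) * w y))) (at y within {0..x})"
      unfolding q_def V_def using primitive_deriv[OF that]
      by (auto intro!: derivative_eq_intros)
    moreover have "exp (c * y) * exp (- b * y) = exp (- a * y)" by (simp add: c_def algebra_simps flip: exp_add)
    ultimately show ?thesis by (simp add: mult.assoc[symmetric])
  qed
  have qb: "\<bar>q x\<bar> \<le> B * exp (c * x)" if x: "0 \<le> x" for x
  proof -
    have "norm (q x - q 0) \<le> B * exp (c * x) - B * exp (c * 0)"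
    proof (cases "x = 0")
      case False
      show ?thesis
      proof (rule differentiable_bound_general[of 0 x q "\<lambda>y. B * exp (c * y)" "\<lambda>y. - c * exp (c * y) * V b y" "\<lambda>y. B * (c * exp (c * y))"])
        show "0 < x" using x False by simp
        show "continuous_on {0..x} q"
        proof (rule DERIV_continuous_on)
          show "(q has_real_derivative - c * exp (c * y) * V b y) (at y within {0..x})" if "y \<in> {0..x}" for y
            using that by (intro q) (simp_all only: atLeastAtMost_iff)
        qed
        show "continuous_on {0..x} (\<lambda>y. B * exp (c * y))" by (intro continuous_intros)
        fix y assume y: "0 < y" "y < x"
        have "at y within {0..x} = at y" using y by (intro at_within_interior) auto
        then show "(q has_vector_derivative - c * exp (c * y) * V b y) (at y)"
          using q[of y x] y by (simp add: has_real_derivative_iff_has_vector_derivative)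
        show "((\<lambda>y. B * exp (c * y)) has_vector_derivative B * (c * exp (c * y))) (at y)"
          unfolding has_real_derivative_iff_has_vector_derivative[symmetric] by (auto intro!: derivative_eq_intros)
        show "norm (- c * exp (c * y) * V b y) \<le> B * (c * exp (c * y))"
          using c B[of y] y by (simp add: abs_mult mult.commute mult_left_mono)
      qed
    qed simp
    moreover have "q 0 = 0" by (simp add: q_def V_def)
    ultimately show ?thesis using B0 by simp
  qed
  have "\<bar>exp_primitive a w x\<bar> \<le> (2 * B) * exp (b * x)" if x: "0 \<le> x" for x
  proof -
    have "V a x = q x + exp (c * x) * V b x" by (simp add: q_def)
    then have "\<bar>V a x\<bar> \<le> \<bar>q x\<bar> + exp (c * x) * \<bar>V b x\<bar>" using abs_triangle_ineq[of "q x" "exp (c * x) * V b x"] by (simp add: abs_mult)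
    also have "\<dots> \<le> B * exp (c * x) + exp (c * x) * B"
      using qb[OF x] B[OF x] by (intro add_mono mult_left_mono) auto
    finally have "\<bar>V a x\<bar> \<le> 2 * B * exp (c * x)" by simp
    then have "exp (a * x) * \<bar>V a x\<bar> \<le> exp (a * x) * (2 * B * exp (c * x))" by (rule mult_left_mono) simp
    also have "\<dots> = 2 * B * exp (b * x)" by (simp add: c_def algebra_simps flip: exp_add)
    finally show ?thesis using x by (simp add: exp_primitive_def V_def abs_mult)
  qed
  then show ?thesis using B0 that[of "2 * B"] by simp
qed

text \<open>The transform of \<open>w\<close> at \<open>b\<close> converges only conditionally, but
  that of its exponential primitive converges absolutely by the growth bound. Its value is then the
  limit of an explicit antiderivative.\<close>

lemma has_bochner_integral_exp_primitive:
  assumes b: "b > \<eta>" "b > a"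
  shows "has_bochner_integral lborel (\<lambda>x. exp (- b * x) * exp_primitive a w x) (L b / (b - a))"
proof -
  \<comment> \<open>An exponent strictly between the admissible threshold and \<open>b\<close>:
    growth of order \<open>exp (b1 * x)\<close> is integrable against
    \<open>exp (- b * x)\<close>.\<close>
  define b1 where "b1 = (b + max \<eta> a) / 2"
  have b1: "b1 > \<eta>" "b1 > a" "b1 < b" using b unfolding b1_def by (auto simp: max_def)
  obtain C where C: "C \<ge> 0" "\<And>x. 0 \<le> x \<Longrightarrow> \<bar>exp_primitive a w x\<bar> \<le> C * exp (b1 * x)"
    by (rule exp_primitive_bound[OF b1(1,2)]) blast
  have [measurable]: "exp_primitive a w \<in> borel_measurable borel"
    using continuous_on_exp_primitive by (rule borel_measurable_continuous_onI)
  have int: "integrable lborel (\<lambda>x. exp (- b * x) * exp_primitive a w x)"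
  proof (rule Bochner_Integration.integrable_bound)
    have "prob_space (density lborel (exponential_density (b - b1)))"
      using b1(3) by (intro prob_space_exponential_density) simp
    from prob_space.emeasure_space_1[OF this]
    have "(\<integral>\<^sup>+x. ennreal (exponential_density (b - b1) x) \<partial>lborel) = 1"
      by (simp add: emeasure_density)
    then have "integrable lborel (\<lambda>x. exponential_density (b - b1) x)"
      using b1(3) by (intro integrableI_nonneg) (auto intro!: AE_I2 exponential_density_nonneg)
    then show "integrable lborel (\<lambda>x. C / (b - b1) * exponential_density (b - b1) x)" by (rule integrable_mult_right)
    show "AE x in lborel. norm (exp (- b * x) * exp_primitive a w x) \<le> norm (C / (b - b1) * exponential_density (b - b1) x)"
    proof (rule AE_I2)
      fix x :: real
      show "norm (exp (- b * x) * exp_primitive a w x) \<le> norm (C / (b - b1) * exponential_density (b - b1) x)"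
      proof (cases "0 \<le> x")
        case True
        have "exp (- b * x) * \<bar>exp_primitive a w x\<bar> \<le> exp (- b * x) * (C * exp (b1 * x))"
          using C(2)[OF True] by (rule mult_left_mono) simp
        also have "\<dots> = C * exp (- x * (b - b1))" by (simp add: algebra_simps flip: exp_add)
        finally show ?thesis using True C b1(3) by (simp add: exponential_density_def abs_mult)
      qed (simp add: exp_primitive_nonpos)
    qed
  qed measurable
  \<comment> \<open>An antiderivative of the integrand: the primitive \<open>k\<close> satisfies
    \<open>k' = a * k + w\<close>, so the two terms in \<open>w\<close> cancel on differentiation
    and \<open>(b - a) * exp (- b * x) * k x\<close> is left.\<close>
  define G where "G x = (integral {0..x} (\<lambda>y. exp (- b * y) * w y) - exp (- b * x) * exp_primitive a w x) / (b - a)" for x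
  have "((\<lambda>x. integral {0..x} (\<lambda>y. exp (- b * y) * w y)) \<longlongrightarrow> L b) at_top"
    using has_integral_atLeast_0_tendsto[OF lap[OF b(1)]] .
  moreover have "((\<lambda>x. exp (- b * x) * exp_primitive a w x) \<longlongrightarrow> 0) at_top"
  proof (rule Lim_null_comparison)
    show "\<forall>\<^sub>F x in at_top. norm (exp (- b * x) * exp_primitive a w x) \<le> C * exp (- ((b - b1) * x))"
      unfolding eventually_at_top_linorder
    proof (intro exI[of _ 0] allI impI)
      fix x :: real assume x: "0 \<le> x"
      have "exp (- b * x) * \<bar>exp_primitive a w x\<bar> \<le> exp (- b * x) * (C * exp (b1 * x))"
        using C(2)[OF x] by (rule mult_left_mono) simp
      also have "\<dots> = C * exp (- ((b - b1) * x))" by (simp add: algebra_simps flip: exp_add)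
      finally show "norm (exp (- b * x) * exp_primitive a w x) \<le> C * exp (- ((b - b1) * x))" by (simp add: abs_mult)
    qed
    have "filterlim (\<lambda>x. (b - b1) * x) at_top at_top"
      using b1(3) by (intro filterlim_tendsto_pos_mult_at_top[OF tendsto_const]) (auto intro: filterlim_ident)
    then have "((\<lambda>x. exp (- ((b - b1) * x))) \<longlongrightarrow> 0) at_top"
      by (intro filterlim_compose[OF exp_at_bot] filterlim_compose[OF filterlim_uminus_at_bot_at_top])
    then show "((\<lambda>x. C * exp (- ((b - b1) * x))) \<longlongrightarrow> 0) at_top" by (rule tendsto_mult_right_zero)
  qed
  ultimately have G: "(G \<longlongrightarrow> (L b - 0) / (b - a)) at_top"
    unfolding G_def using b by (intro tendsto_intros) auto
  have "(\<integral>y. indicator {..x} y *\<^sub>R (exp (- b * y) * exp_primitive a w y) \<partial>lborel) = G x" if x: "0 \<le> x" for x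
  proof -
    have "(\<integral>y. indicator {..x} y *\<^sub>R (exp (- b * y) * exp_primitive a w y) \<partial>lborel)
        = (\<integral>y. indicator {0..x} y *\<^sub>R (exp (- b * y) * exp_primitive a w y) \<partial>lborel)"
      by (intro Bochner_Integration.integral_cong) (auto simp: indicator_def exp_primitive_nonpos)
    also have "\<dots> = G x - G 0"
    proof (rule integral_FTC_Icc[OF x])
      show "continuous_on {0..x} (\<lambda>y. exp (- b * y) * exp_primitive a w y)"
        by (intro continuous_intros continuous_on_subset[OF continuous_on_exp_primitive]) auto
      fix y assume y: "0 \<le> y" "y \<le> x"
      have "((\<lambda>x. (integral {0..x} (\<lambda>y. exp (- b * y) * w y) - exp (- b * x) * (exp (a * x) * integral {0..x} (\<lambda>y. exp (- a * y) * w y))) / (b - a))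
        has_real_derivative (exp (- b * y) * w y - ((- b) * exp (- b * y) * (exp (a * y) * integral {0..y} (\<lambda>y. exp (- a * y) * w y))
           + exp (- b * y) * (a * exp (a * y) * integral {0..y} (\<lambda>y. exp (- a * y) * w y) + exp (a * y) * (exp (- a * y) * w y)))) / (b - a)) (at y within {0..x})"
        apply (rule DERIV_cdivide)
        apply (rule derivative_eq_intros primitive_deriv[OF y] refl)+
        apply (simp add: algebra_simps)
        done
      moreover have "(exp (- b * y) * w y - ((- b) * exp (- b * y) * (exp (a * y) * integral {0..y} (\<lambda>y. exp (- a * y) * w y))
           + exp (- b * y) * (a * exp (a * y) * integral {0..y} (\<lambda>y. exp (- a * y) * w y) + exp (a * y) * (exp (- a * y) * w y)))) / (b - a)
          = exp (- b * y) * exp_primitive a w y"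
      proof -
        have "exp (a * y) * (exp (- a * y) * w y) = w y" by (simp add: mult.assoc[symmetric] flip: exp_add)
        then show ?thesis using y b by (simp add: exp_primitive_def field_simps)
      qed
      ultimately have "((\<lambda>x. (integral {0..x} (\<lambda>y. exp (- b * y) * w y) - exp (- b * x) * (exp (a * x) * integral {0..x} (\<lambda>y. exp (- a * y) * w y))) / (b - a))
        has_real_derivative exp (- b * y) * exp_primitive a w y) (at y within {0..x})" by simp
      then have "(G has_real_derivative exp (- b * y) * exp_primitive a w y) (at y within {0..x})"
        by (rule has_field_derivative_transform_within[of _ _ _ _ 1]) (use y in \<open>auto simp: G_def exp_primitive_def\<close>)
      then show "(G has_vector_derivative exp (- b * y) * exp_primitive a w y) (at y within {0..x})"
        by (simp add: has_real_derivative_iff_has_vector_derivative)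
    qed
    also have "G 0 = 0" by (simp add: G_def exp_primitive_def)
    finally show ?thesis by simp
  qed
  then have "((\<lambda>x. \<integral>y. indicator {..x} y *\<^sub>R (exp (- b * y) * exp_primitive a w y) \<partial>lborel) \<longlongrightarrow> L b / (b - a)) at_top"
    using G by (intro Lim_transform_eventually[OF G[simplified]]) (auto simp: eventually_at_top_linorder intro!: exI[of _ 0])
  from tendsto_unique[OF _ tendsto_integral_at_top[OF _ int] this]
  show ?thesis using int by (simp add: has_bochner_integral_iff)
qed

end

section \<open>The Markov additive property\<close>

lemma measurable_of_bool [measurable]:
  "Measurable.pred M Q \<Longrightarrow> (\<lambda>x. of_bool (Q x) :: 'a :: {zero_neq_one, topological_space}) \<in> borel_measurable M"
  unfolding of_bool_def by measurable

locale spectrally_negative_MAP =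
  fixes \<Omega> :: "'w measure" and P :: "real \<Rightarrow> 'n::finite \<Rightarrow> 'w measure"
    and X :: "real \<Rightarrow> 'w \<Rightarrow> real" and J :: "real \<Rightarrow> 'w \<Rightarrow> 'n option"
  assumes sn_MAP: "sn_MAP \<Omega> P X J"
begin

lemma prob_space_P: "prob_space (P x i)"
  and sets_P [measurable_cong, simp]: "sets (P x i) = sets \<Omega>"
  and measurable_X [measurable]: "X t \<in> borel_measurable \<Omega>"
  and measurable_J [measurable]: "J t \<in> measurable \<Omega> (count_space UNIV)"
  and AE_start: "AE \<omega> in P x i. X 0 \<omega> = x \<and> J 0 \<omega> = Some i"
  using sn_MAP[unfolded sn_MAP_def, THEN conjunct1] sn_MAP[unfolded sn_MAP_def, THEN conjunct2, THEN conjunct1]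
    sn_MAP[unfolded sn_MAP_def, THEN conjunct2, THEN conjunct2, THEN conjunct1]
  by blast+

lemma space_P [simp]: "space (P x i) = space \<Omega>"
  using sets_eq_imp_space_eq[OF sets_P] .

lemma AE_X0: "AE \<omega> in P x i. X 0 \<omega> = x"
  and AE_J0: "AE \<omega> in P x i. J 0 \<omega> = Some i"
  using AE_start[of x i] by auto

sublocale P: prob_space "P x i" for x i by (rule prob_space_P)

lemma J_right_const:
  assumes "\<omega> \<in> space \<Omega>" "0 \<le> t"
  obtains e where "e > 0" "\<And>s. t \<le> s \<Longrightarrow> s < t + e \<Longrightarrow> J s \<omega> = J t \<omega>"
  using sn_MAP[unfolded sn_MAP_def, THEN conjunct2, THEN conjunct2, THEN conjunct2, THEN conjunct1, rule_format, OF assms] by blast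

lemma J_absorbed: "\<omega> \<in> space \<Omega> \<Longrightarrow> 0 \<le> s \<Longrightarrow> s \<le> t \<Longrightarrow> J s \<omega> = None \<Longrightarrow> J t \<omega> = None"
  by (rule sn_MAP[unfolded sn_MAP_def, THEN conjunct2, THEN conjunct2, THEN conjunct2, THEN conjunct2, THEN conjunct1, rule_format]) auto

lemma J_alive: "\<omega> \<in> space \<Omega> \<Longrightarrow> J t \<omega> \<noteq> None \<Longrightarrow> 0 \<le> s \<Longrightarrow> s \<le> t \<Longrightarrow> J s \<omega> \<noteq> None"
  by (metis J_absorbed)

lemma X_right_cont:
  assumes "\<omega> \<in> space \<Omega>" "0 \<le> t" "J t \<omega> \<noteq> None"
  shows "((\<lambda>s. X s \<omega>) \<longlongrightarrow> X t \<omega>) (at_right t)"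
proof -
  have "continuous (at_right t) (\<lambda>s. X s \<omega>)" by (rule sn_MAP[unfolded sn_MAP_def, THEN conjunct2, THEN conjunct2, THEN conjunct2, THEN conjunct2, THEN conjunct2, THEN conjunct1, rule_format, OF assms])
  then show ?thesis by (simp add: continuous_within)
qed

lemma X_right_contE:
  assumes "\<omega> \<in> space \<Omega>" "0 \<le> t" "J t \<omega> \<noteq> None" "e > 0"
  obtains d where "d > 0" "\<And>s. t \<le> s \<Longrightarrow> s < t + d \<Longrightarrow> \<bar>X s \<omega> - X t \<omega>\<bar> < e"
proof -
  have "eventually (\<lambda>s. dist (X s \<omega>) (X t \<omega>) < e) (at_right t)"
    using X_right_cont[OF assms(1-3)] assms(4) by (rule tendstoD)
  then obtain b where b: "b > t" "\<And>s. t < s \<Longrightarrow> s < b \<Longrightarrow> dist (X s \<omega>) (X t \<omega>) < e"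
    unfolding eventually_at_right_field by blast
  show ?thesis
  proof (rule that[of "b - t"])
    show "\<bar>X s \<omega> - X t \<omega>\<bar> < e" if "t \<le> s" "s < t + (b - t)" for s
      using b(2)[of s] that assms(4) by (cases "s = t") (auto simp: dist_real_def)
  qed (use b in simp)
qed

lemma X_left_limit:
  assumes "\<omega> \<in> space \<Omega>" "0 < t" "J t \<omega> \<noteq> None"
  obtains L where "((\<lambda>s. X s \<omega>) \<longlongrightarrow> L) (at_left t)" "X t \<omega> \<le> L"
  using sn_MAP[unfolded sn_MAP_def, THEN conjunct2, THEN conjunct2, THEN conjunct2, THEN conjunct2, THEN conjunct2, THEN conjunct2, THEN conjunct1, rule_format, OF assms] by blast

lemma markov_set:
  assumes "0 \<le> t" "\<And>l. l < m \<Longrightarrow> 0 \<le> u l \<and> u l \<le> t" "\<And>l. l < n \<Longrightarrow> 0 \<le> s l"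
    and "A \<in> sets (fd_space m)" "B \<in> sets (fd_space n)"
  shows "measure (P x i) {\<omega>\<in>space \<Omega>. past_path X J u m \<omega> \<in> A \<and> J t \<omega> = Some k \<and> shift_path X J t s n \<omega> \<in> B}
       = measure (P x i) {\<omega>\<in>space \<Omega>. past_path X J u m \<omega> \<in> A \<and> J t \<omega> = Some k}
         * measure (P 0 k) {\<omega>\<in>space \<Omega>. shift_path X J 0 s n \<omega> \<in> B}"
  by (rule sn_MAP[unfolded sn_MAP_def, THEN conjunct2, THEN conjunct2, THEN conjunct2, THEN conjunct2, THEN conjunct2, THEN conjunct2, THEN conjunct2, THEN conjunct1, rule_format]) (use assms in auto)

lemma not_nonincreasing:
  "\<not> (AE \<omega> in P 0 i. \<forall>t\<ge>0. (\<forall>s\<in>{0..t}. J s \<omega> = Some i) \<longrightarrow> X t \<omega> \<le> 0)"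
  by (rule sn_MAP[unfolded sn_MAP_def, THEN conjunct2, THEN conjunct2, THEN conjunct2, THEN conjunct2, THEN conjunct2, THEN conjunct2, THEN conjunct2, THEN conjunct2, THEN conjunct2, THEN conjunct1, rule_format])

section \<open>Independence of past and future at a fixed time\<close>

definition past_algebra :: "(nat \<Rightarrow> real) \<Rightarrow> nat \<Rightarrow> 'w measure" where
  "past_algebra u m = vimage_algebra (space \<Omega>) (past_path X J u m) (fd_space m)"

lemma space_past_algebra [simp]: "space (past_algebra u m) = space \<Omega>"
  by (simp add: past_algebra_def)

lemma measurable_past_path [measurable]: "past_path X J u m \<in> measurable \<Omega> (fd_space m)"
  unfolding past_path_def by measurable

lemma measurable_shift_path [measurable]: "shift_path X J t s n \<in> measurable \<Omega> (fd_space n)"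
  unfolding shift_path_def by measurable

lemma past_path_in_space: "past_path X J u m \<in> space \<Omega> \<rightarrow> space (fd_space m)"
  using measurable_space[OF measurable_past_path] by blast

text \<open>The inclusion of the generated algebra in that of \<open>\<Omega>\<close>, phrased
  through the identity map so that \<open>distr\<close> and the measurability prover can use
  it.\<close>

lemma measurable_past_algebra_id: "(\<lambda>\<omega>. \<omega>) \<in> measurable \<Omega> (past_algebra u m)"
  unfolding past_algebra_def
  by (rule measurable_vimage_algebra2) (auto dest: measurable_space[OF measurable_past_path])

lemma sets_past_algebra_subset: "sets (past_algebra u m) \<subseteq> sets \<Omega>"
proof
  fix A assume A: "A \<in> sets (past_algebra u m)"
  from measurable_sets[OF measurable_past_algebra_id A] sets.sets_into_space[OF A] show "A \<in> sets \<Omega>"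
    by (simp add: Int_absorb2)
qed

lemma past_algebra_X:
  assumes "l < m" shows "X (u l) \<in> borel_measurable (past_algebra u m)"
proof -
  have 1: "past_path X J u m \<in> measurable (past_algebra u m) (fd_space m)"
    unfolding past_algebra_def by (rule measurable_vimage_algebra1) (rule past_path_in_space)
  have "(\<lambda>\<omega>. past_path X J u m \<omega> l) \<in> measurable (past_algebra u m) (borel \<Otimes>\<^sub>M count_space UNIV)"
    using assms by (intro measurable_compose[OF 1 measurable_component_singleton]) auto
  from measurable_compose[OF this measurable_fst]
  have "(\<lambda>\<omega>. fst (past_path X J u m \<omega> l)) \<in> borel_measurable (past_algebra u m)" .
  then show ?thesis using assms by (simp add: past_path_def)
qed

lemma past_algebra_J:
  assumes "l < m" shows "J (u l) \<in> measurable (past_algebra u m) (count_space UNIV)"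
proof -
  have 1: "past_path X J u m \<in> measurable (past_algebra u m) (fd_space m)"
    unfolding past_algebra_def by (rule measurable_vimage_algebra1) (rule past_path_in_space)
  have "(\<lambda>\<omega>. past_path X J u m \<omega> l) \<in> measurable (past_algebra u m) (borel \<Otimes>\<^sub>M count_space UNIV)"
    using assms by (intro measurable_compose[OF 1 measurable_component_singleton]) auto
  from measurable_compose[OF this measurable_snd]
  have "(\<lambda>\<omega>. snd (past_path X J u m \<omega> l)) \<in> measurable (past_algebra u m) (count_space UNIV)" .
  then show ?thesis using assms by (simp add: past_path_def)
qed

lemma finite_measure_restrict_J: "finite_measure (density (P x i) (\<lambda>\<omega>. of_bool (J t \<omega> = Some k)))"
proof (rule finite_measureI)
  have "(\<integral>\<^sup>+\<omega>. of_bool (J t \<omega> = Some k) * indicator (space \<Omega>) \<omega> \<partial>P x i) \<le> (\<integral>\<^sup>+\<omega>. 1 \<partial>P x i)"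
    by (intro nn_integral_mono) (auto split: split_indicator)
  also have "\<dots> = 1" using P.emeasure_space_1[of x i] by simp
  finally show "emeasure (density (P x i) (\<lambda>\<omega>. of_bool (J t \<omega> = Some k))) (space (density (P x i) (\<lambda>\<omega>. of_bool (J t \<omega> = Some k)))) \<noteq> \<infinity>"
    by (subst emeasure_density) (auto simp: top_unique)
qed

text \<open>The Markov additive property as a product measure: under \<open>P x i\<close> restricted
  to \<open>J t = Some k\<close>, the past and the shifted future are independent, and the future
  has its law under \<open>P 0 k\<close>. Both measures are finite and agree on rectangles by
  \<open>markov_set\<close>. The first component keeps the whole path, with only the information of
  the past made measurable.\<close>

lemma markov_pair_measure:
  fixes x i k t
  assumes tu: "0 \<le> t" "\<And>l. l < m \<Longrightarrow> 0 \<le> u l \<and> u l \<le> t" and s: "\<And>l. l < n \<Longrightarrow> 0 \<le> s l"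
  defines "R \<equiv> density (P x i) (\<lambda>\<omega>. of_bool (J t \<omega> = Some k))"
  shows "distr R (past_algebra u m) (\<lambda>\<omega>. \<omega>) \<Otimes>\<^sub>M distr (P 0 k) (fd_space n) (shift_path X J 0 s n)
     = distr R (past_algebra u m \<Otimes>\<^sub>M fd_space n) (\<lambda>\<omega>. (\<omega>, shift_path X J t s n \<omega>))"
proof -
  note [measurable] = measurable_past_algebra_id
  have sR [measurable_cong]: "sets R = sets \<Omega>" by (simp add: R_def)
  have spR [simp]: "space R = space \<Omega>" by (simp add: R_def)
  have emR: "emeasure R A = measure (P x i) {\<omega>\<in>space \<Omega>. \<omega> \<in> A \<and> J t \<omega> = Some k}" if [measurable]: "A \<in> sets \<Omega>" for A
  proof -
    have "emeasure R A = (\<integral>\<^sup>+\<omega>. of_bool (J t \<omega> = Some k) * indicator A \<omega> \<partial>P x i)"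
      unfolding R_def by (rule emeasure_density) auto
    also have "\<dots> = (\<integral>\<^sup>+\<omega>. indicator {\<omega>\<in>space \<Omega>. \<omega> \<in> A \<and> J t \<omega> = Some k} \<omega> \<partial>P x i)"
      by (intro nn_integral_cong) (auto split: split_indicator)
    also have "\<dots> = emeasure (P x i) {\<omega>\<in>space \<Omega>. \<omega> \<in> A \<and> J t \<omega> = Some k}"
      by (rule nn_integral_indicator) simp
    finally show ?thesis by (simp add: P.emeasure_eq_measure)
  qed
  have finR: "finite_measure R"
    unfolding R_def by (rule finite_measure_restrict_J)
  show ?thesis
  proof (rule pair_measure_eqI)
    show "sigma_finite_measure (distr R (past_algebra u m) (\<lambda>\<omega>. \<omega>))"
      by (intro finite_measure.sigma_finite_measure finite_measure.finite_measure_distr finR) measurable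
    show "sigma_finite_measure (distr (P 0 k) (fd_space n) (shift_path X J 0 s n))"
      by (intro finite_measure.sigma_finite_measure finite_measure.finite_measure_distr P.finite_measure_axioms) measurable
    show "sets (distr R (past_algebra u m) (\<lambda>\<omega>. \<omega>) \<Otimes>\<^sub>M distr (P 0 k) (fd_space n) (shift_path X J 0 s n)) =
      sets (distr R (past_algebra u m \<Otimes>\<^sub>M fd_space n) (\<lambda>\<omega>. (\<omega>, shift_path X J t s n \<omega>)))"
      by (simp cong: sets_pair_measure_cong)
    fix A B assume A: "A \<in> sets (distr R (past_algebra u m) (\<lambda>\<omega>. \<omega>))"
      and B: "B \<in> sets (distr (P 0 k) (fd_space n) (shift_path X J 0 s n))"
    from A have A': "A \<in> sets (past_algebra u m)" by simp
    from B have [measurable]: "B \<in> sets (fd_space n)" by simp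
    from A' obtain C where C: "C \<in> sets (fd_space m)" "A = past_path X J u m -` C \<inter> space \<Omega>"
      unfolding past_algebra_def sets_vimage_algebra2[OF past_path_in_space] by blast
    have A_sets [measurable]: "A \<in> sets \<Omega>" using A' sets_past_algebra_subset by auto
    have "emeasure (distr R (past_algebra u m) (\<lambda>\<omega>. \<omega>)) A = emeasure R A"
      using A' sets.sets_into_space[of A \<Omega>] by (subst emeasure_distr) (auto simp: Int_absorb2)
    also have "\<dots> = measure (P x i) {\<omega>\<in>space \<Omega>. past_path X J u m \<omega> \<in> C \<and> J t \<omega> = Some k}"
      unfolding emR[OF A_sets] by (auto simp: C(2) intro!: arg_cong[where f = "measure (P x i)"])
    finally have 1: "emeasure (distr R (past_algebra u m) (\<lambda>\<omega>. \<omega>)) A = \<dots>" .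
    have 2: "emeasure (distr (P 0 k) (fd_space n) (shift_path X J 0 s n)) B
        = measure (P 0 k) {\<omega>\<in>space \<Omega>. shift_path X J 0 s n \<omega> \<in> B}"
      by (subst emeasure_distr) (auto simp: P.emeasure_eq_measure intro!: arg_cong[where f = "measure (P 0 k)"])
    have AB: "A \<times> B \<in> sets (past_algebra u m \<Otimes>\<^sub>M fd_space n)" using A' by (intro pair_measureI) auto
    have "emeasure (distr R (past_algebra u m \<Otimes>\<^sub>M fd_space n) (\<lambda>\<omega>. (\<omega>, shift_path X J t s n \<omega>))) (A \<times> B)
        = emeasure R ((\<lambda>\<omega>. (\<omega>, shift_path X J t s n \<omega>)) -` (A \<times> B) \<inter> space R)"
      by (rule emeasure_distr[OF _ AB]) measurable
    moreover have "(\<lambda>\<omega>. (\<omega>, shift_path X J t s n \<omega>)) -` (A \<times> B) \<inter> space R = {\<omega>\<in>space \<Omega>. \<omega> \<in> A \<and> shift_path X J t s n \<omega> \<in> B}"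
      by auto
    ultimately have 3: "emeasure (distr R (past_algebra u m \<Otimes>\<^sub>M fd_space n) (\<lambda>\<omega>. (\<omega>, shift_path X J t s n \<omega>))) (A \<times> B)
        = emeasure R {\<omega>\<in>space \<Omega>. \<omega> \<in> A \<and> shift_path X J t s n \<omega> \<in> B}" by (simp only:)
    have S: "{\<omega>\<in>space \<Omega>. \<omega> \<in> A \<and> shift_path X J t s n \<omega> \<in> B} \<in> sets \<Omega>" by measurable
    have "emeasure R {\<omega>\<in>space \<Omega>. \<omega> \<in> A \<and> shift_path X J t s n \<omega> \<in> B}
        = measure (P x i) {\<omega>\<in>space \<Omega>. past_path X J u m \<omega> \<in> C \<and> J t \<omega> = Some k \<and> shift_path X J t s n \<omega> \<in> B}"
      unfolding emR[OF S] by (auto simp: C(2) intro!: arg_cong[where f = "measure (P x i)"])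
    also have "\<dots> = ennreal (measure (P x i) {\<omega>\<in>space \<Omega>. past_path X J u m \<omega> \<in> C \<and> J t \<omega> = Some k}
         * measure (P 0 k) {\<omega>\<in>space \<Omega>. shift_path X J 0 s n \<omega> \<in> B})"
      using assms C(1) by (subst markov_set) auto
    finally show "emeasure (distr R (past_algebra u m) (\<lambda>\<omega>. \<omega>)) A *
        emeasure (distr (P 0 k) (fd_space n) (shift_path X J 0 s n)) B =
        emeasure (distr R (past_algebra u m \<Otimes>\<^sub>M fd_space n) (\<lambda>\<omega>. (\<omega>, shift_path X J t s n \<omega>))) (A \<times> B)"
      unfolding 1 2 3 by (simp add: ennreal_mult)
  qed
qed

context
  fixes t :: real and u s :: "nat \<Rightarrow> real" and m n :: nat
  assumes tu: "0 \<le> t" "\<And>l. l < m \<Longrightarrow> 0 \<le> u l \<and> u l \<le> t" and s: "\<And>l. l < n \<Longrightarrow> 0 \<le> s l"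
begin

text \<open>Tonelli for the product measure. The integrand may mix past and future freely, as needed
  for a function of the current reflected value plus the next increment.\<close>

lemma markov_nn_integral:
  assumes [measurable]: "\<Psi> \<in> borel_measurable (past_algebra u m \<Otimes>\<^sub>M fd_space n)"
  shows "(\<integral>\<^sup>+\<omega>. \<Psi> (\<omega>, shift_path X J t s n \<omega>) * of_bool (J t \<omega> = Some k) \<partial>P x i)
    = (\<integral>\<^sup>+\<omega>. (\<integral>\<^sup>+\<omega>'. \<Psi> (\<omega>, shift_path X J 0 s n \<omega>') \<partial>P 0 k) * of_bool (J t \<omega> = Some k) \<partial>P x i)"
proof -
  note [measurable] = measurable_past_algebra_id
  define R where "R = density (P x i) (\<lambda>\<omega>. of_bool (J t \<omega> = Some k))"
  have sR [measurable_cong]: "sets R = sets \<Omega>" by (simp add: R_def)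
  interpret S: prob_space "distr (P 0 k) (fd_space n) (shift_path X J 0 s n)"
    by (rule P.prob_space_distr) measurable
  have meas: "(\<lambda>\<omega>. \<integral>\<^sup>+\<omega>'. \<Psi> (\<omega>, shift_path X J 0 s n \<omega>') \<partial>P 0 k) \<in> borel_measurable (past_algebra u m)"
    by (rule P.borel_measurable_nn_integral) measurable
  note [measurable] = measurable_compose[OF measurable_past_algebra_id meas]
  have "(\<integral>\<^sup>+\<omega>. \<Psi> (\<omega>, shift_path X J t s n \<omega>) * of_bool (J t \<omega> = Some k) \<partial>P x i)
      = (\<integral>\<^sup>+\<omega>. \<Psi> (\<omega>, shift_path X J t s n \<omega>) \<partial>R)"
    unfolding R_def by (subst nn_integral_density) (auto simp: mult.commute)
  also have "\<dots> = (\<integral>\<^sup>+z. \<Psi> z \<partial>distr R (past_algebra u m \<Otimes>\<^sub>M fd_space n) (\<lambda>\<omega>. (\<omega>, shift_path X J t s n \<omega>)))"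
    by (subst nn_integral_distr) auto
  also have "\<dots> = (\<integral>\<^sup>+z. \<Psi> z \<partial>(distr R (past_algebra u m) (\<lambda>\<omega>. \<omega>) \<Otimes>\<^sub>M distr (P 0 k) (fd_space n) (shift_path X J 0 s n)))"
    unfolding R_def by (subst markov_pair_measure[OF tu s]) auto
  also have "\<dots> = (\<integral>\<^sup>+\<omega>. \<integral>\<^sup>+p. \<Psi> (\<omega>, p) \<partial>distr (P 0 k) (fd_space n) (shift_path X J 0 s n) \<partial>distr R (past_algebra u m) (\<lambda>\<omega>. \<omega>))"
    by (rule S.nn_integral_fst[symmetric]) measurable
  also have "\<dots> = (\<integral>\<^sup>+\<omega>. \<integral>\<^sup>+\<omega>'. \<Psi> (\<omega>, shift_path X J 0 s n \<omega>') \<partial>P 0 k \<partial>distr R (past_algebra u m) (\<lambda>\<omega>. \<omega>))"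
    by (intro nn_integral_cong nn_integral_distr) auto
  also have "\<dots> = (\<integral>\<^sup>+\<omega>. \<integral>\<^sup>+\<omega>'. \<Psi> (\<omega>, shift_path X J 0 s n \<omega>') \<partial>P 0 k \<partial>R)"
    using meas by (subst nn_integral_distr) auto
  also have "\<dots> = (\<integral>\<^sup>+\<omega>. (\<integral>\<^sup>+\<omega>'. \<Psi> (\<omega>, shift_path X J 0 s n \<omega>') \<partial>P 0 k) * of_bool (J t \<omega> = Some k) \<partial>P x i)"
    unfolding R_def by (subst nn_integral_density) (auto simp: mult.commute)
  finally show ?thesis .
qed

text \<open>Integrability is asked of the original integrand; it passes to the product because both
  are integrals over the same image measure, and Fubini then applies.\<close>

lemma markov_integral:
  fixes \<Psi> :: "_ \<Rightarrow> real"
  assumes [measurable]: "\<Psi> \<in> borel_measurable (past_algebra u m \<Otimes>\<^sub>M fd_space n)"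
    and int: "integrable (P x i) (\<lambda>\<omega>. \<Psi> (\<omega>, shift_path X J t s n \<omega>) * of_bool (J t \<omega> = Some k))"
  shows "(\<integral>\<omega>. \<Psi> (\<omega>, shift_path X J t s n \<omega>) * of_bool (J t \<omega> = Some k) \<partial>P x i)
    = (\<integral>\<omega>. (\<integral>\<omega>'. \<Psi> (\<omega>, shift_path X J 0 s n \<omega>') \<partial>P 0 k) * of_bool (J t \<omega> = Some k) \<partial>P x i)"
proof -
  note [measurable] = measurable_past_algebra_id
  define R where "R = density (P x i) (\<lambda>\<omega>. ennreal (of_bool (J t \<omega> = Some k)))"
  have sR [measurable_cong]: "sets R = sets \<Omega>" by (simp add: R_def)
  have R_eq: "R = density (P x i) (\<lambda>\<omega>. of_bool (J t \<omega> = Some k))"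
    unfolding R_def by (intro density_cong) (auto simp: of_bool_def)
  interpret S: prob_space "distr (P 0 k) (fd_space n) (shift_path X J 0 s n)"
    by (rule P.prob_space_distr) measurable
  interpret R: finite_measure R
    unfolding R_eq by (rule finite_measure_restrict_J)
  interpret R': finite_measure "distr R (past_algebra u m) (\<lambda>\<omega>. \<omega>)"
    by (rule R.finite_measure_distr) measurable
  interpret pair_sigma_finite "distr R (past_algebra u m) (\<lambda>\<omega>. \<omega>)" "distr (P 0 k) (fd_space n) (shift_path X J 0 s n)" ..
  have eq: "distr R (past_algebra u m \<Otimes>\<^sub>M fd_space n) (\<lambda>\<omega>. (\<omega>, shift_path X J t s n \<omega>))
      = distr R (past_algebra u m) (\<lambda>\<omega>. \<omega>) \<Otimes>\<^sub>M distr (P 0 k) (fd_space n) (shift_path X J 0 s n)"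
    unfolding R_eq by (rule markov_pair_measure[OF tu s, symmetric])
  have meas: "(\<lambda>\<omega>. \<integral>\<omega>'. \<Psi> (\<omega>, shift_path X J 0 s n \<omega>') \<partial>P 0 k) \<in> borel_measurable (past_algebra u m)"
    by measurable
  note [measurable] = measurable_compose[OF measurable_past_algebra_id meas]
  have "integrable R (\<lambda>\<omega>. \<Psi> (\<omega>, shift_path X J t s n \<omega>))"
    unfolding R_def using int by (subst integrable_density) (auto simp: mult.commute)
  then have "integrable (distr R (past_algebra u m \<Otimes>\<^sub>M fd_space n) (\<lambda>\<omega>. (\<omega>, shift_path X J t s n \<omega>))) \<Psi>"
    by (subst integrable_distr_eq) auto
  then have I: "integrable (distr R (past_algebra u m) (\<lambda>\<omega>. \<omega>) \<Otimes>\<^sub>M distr (P 0 k) (fd_space n) (shift_path X J 0 s n)) \<Psi>"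
    unfolding eq .
  have "(\<integral>\<omega>. \<Psi> (\<omega>, shift_path X J t s n \<omega>) * of_bool (J t \<omega> = Some k) \<partial>P x i)
      = (\<integral>\<omega>. \<Psi> (\<omega>, shift_path X J t s n \<omega>) \<partial>R)"
    unfolding R_def by (subst integral_density) (auto simp: mult.commute)
  also have "\<dots> = (\<integral>z. \<Psi> z \<partial>distr R (past_algebra u m \<Otimes>\<^sub>M fd_space n) (\<lambda>\<omega>. (\<omega>, shift_path X J t s n \<omega>)))"
    by (subst integral_distr) auto
  also have "\<dots> = (\<integral>\<omega>. \<integral>p. \<Psi> (\<omega>, p) \<partial>distr (P 0 k) (fd_space n) (shift_path X J 0 s n) \<partial>distr R (past_algebra u m) (\<lambda>\<omega>. \<omega>))"
    unfolding eq by (rule integral_fst'[symmetric, OF I])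
  also have "\<dots> = (\<integral>\<omega>. \<integral>\<omega>'. \<Psi> (\<omega>, shift_path X J 0 s n \<omega>') \<partial>P 0 k \<partial>distr R (past_algebra u m) (\<lambda>\<omega>. \<omega>))"
    by (intro Bochner_Integration.integral_cong refl integral_distr) auto
  also have "\<dots> = (\<integral>\<omega>. \<integral>\<omega>'. \<Psi> (\<omega>, shift_path X J 0 s n \<omega>') \<partial>P 0 k \<partial>R)"
    using meas by (subst integral_distr) auto
  also have "\<dots> = (\<integral>\<omega>. (\<integral>\<omega>'. \<Psi> (\<omega>, shift_path X J 0 s n \<omega>') \<partial>P 0 k) * of_bool (J t \<omega> = Some k) \<partial>P x i)"
    unfolding R_def by (subst integral_density) (auto simp: mult.commute)
  finally show ?thesis .
qed

end

text \<open>The case of one future time, in terms of increments. The shifted path at time 0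
  subtracts \<open>X 0\<close>, which is a.s. 0 under \<open>P 0 k\<close> and therefore disappears
  on the right.\<close>

lemma
  assumes tu: "0 \<le> t" "\<And>l. l < m \<Longrightarrow> 0 \<le> u l \<and> u l \<le> t" and s: "0 \<le> s"
  shows markov_nn_integral_1:
    "\<And>\<psi> :: 'w \<Rightarrow> real \<Rightarrow> ennreal. case_prod \<psi> \<in> borel_measurable (past_algebra u m \<Otimes>\<^sub>M borel) \<Longrightarrow>
      (\<integral>\<^sup>+\<omega>. \<psi> \<omega> (X (t + s) \<omega> - X t \<omega>) * of_bool (J t \<omega> = Some k \<and> J (t + s) \<omega> = Some j) \<partial>P x i)
      = (\<integral>\<^sup>+\<omega>. (\<integral>\<^sup>+\<omega>'. \<psi> \<omega> (X s \<omega>') * of_bool (J s \<omega>' = Some j) \<partial>P 0 k) * of_bool (J t \<omega> = Some k) \<partial>P x i)"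
  and markov_integral_1:
    "\<And>\<psi> :: 'w \<Rightarrow> real \<Rightarrow> real. case_prod \<psi> \<in> borel_measurable (past_algebra u m \<Otimes>\<^sub>M borel) \<Longrightarrow>
      integrable (P x i) (\<lambda>\<omega>. \<psi> \<omega> (X (t + s) \<omega> - X t \<omega>) * of_bool (J t \<omega> = Some k \<and> J (t + s) \<omega> = Some j)) \<Longrightarrow>
      (\<integral>\<omega>. \<psi> \<omega> (X (t + s) \<omega> - X t \<omega>) * of_bool (J t \<omega> = Some k \<and> J (t + s) \<omega> = Some j) \<partial>P x i)
      = (\<integral>\<omega>. (\<integral>\<omega>'. \<psi> \<omega> (X s \<omega>') * of_bool (J s \<omega>' = Some j) \<partial>P 0 k) * of_bool (J t \<omega> = Some k) \<partial>P x i)"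
proof -
  fix \<psi> :: "'w \<Rightarrow> real \<Rightarrow> ennreal" assume [measurable]: "case_prod \<psi> \<in> borel_measurable (past_algebra u m \<Otimes>\<^sub>M borel)"
  have 1: "(\<lambda>z. \<psi> (fst z) (fst (snd z 0)) * of_bool (snd (snd z 0) = Some j)) \<in> borel_measurable (past_algebra u m \<Otimes>\<^sub>M fd_space 1)"
    by measurable
  have *: "\<psi> \<omega> (fst (shift_path X J t (\<lambda>_. s) 1 \<omega> 0)) * of_bool (snd (shift_path X J t (\<lambda>_. s) 1 \<omega> 0) = Some j) * of_bool (J t \<omega> = Some k)
    = \<psi> \<omega> (X (t + s) \<omega> - X t \<omega>) * of_bool (J t \<omega> = Some k \<and> J (t + s) \<omega> = Some j)" for \<omega>
    by (auto simp: shift_path_def)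
  have **: "\<psi> \<omega> (fst (shift_path X J 0 (\<lambda>_. s) 1 \<omega>' 0)) * of_bool (snd (shift_path X J 0 (\<lambda>_. s) 1 \<omega>' 0) = Some j)
    = \<psi> \<omega> (X s \<omega>' - X 0 \<omega>') * of_bool (J s \<omega>' = Some j)" for \<omega> \<omega>'
    by (auto simp: shift_path_def)
  have "(\<integral>\<^sup>+\<omega>. \<psi> \<omega> (X (t + s) \<omega> - X t \<omega>) * of_bool (J t \<omega> = Some k \<and> J (t + s) \<omega> = Some j) \<partial>P x i)
    = (\<integral>\<^sup>+\<omega>. (\<integral>\<^sup>+\<omega>'. \<psi> \<omega> (X s \<omega>' - X 0 \<omega>') * of_bool (J s \<omega>' = Some j) \<partial>P 0 k) * of_bool (J t \<omega> = Some k) \<partial>P x i)"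
    using markov_nn_integral[OF tu _ 1, where s = "\<lambda>_. s" and k = k and x = x and i = i] s by (simp only: fst_conv snd_conv * **)
  also have "\<dots> = (\<integral>\<^sup>+\<omega>. (\<integral>\<^sup>+\<omega>'. \<psi> \<omega> (X s \<omega>') * of_bool (J s \<omega>' = Some j) \<partial>P 0 k) * of_bool (J t \<omega> = Some k) \<partial>P x i)"
  proof (rule nn_integral_cong)
    fix \<omega>
    have "AE \<omega>' in P 0 k. \<psi> \<omega> (X s \<omega>' - X 0 \<omega>') * of_bool (J s \<omega>' = Some j) = \<psi> \<omega> (X s \<omega>') * of_bool (J s \<omega>' = Some j)"
      using AE_X0[of 0 k] by eventually_elim simp
    then show "(\<integral>\<^sup>+\<omega>'. \<psi> \<omega> (X s \<omega>' - X 0 \<omega>') * of_bool (J s \<omega>' = Some j) \<partial>P 0 k) * of_bool (J t \<omega> = Some k)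
      = (\<integral>\<^sup>+\<omega>'. \<psi> \<omega> (X s \<omega>') * of_bool (J s \<omega>' = Some j) \<partial>P 0 k) * of_bool (J t \<omega> = Some k)"
      by (simp only: nn_integral_cong_AE[of "\<lambda>\<omega>'. \<psi> \<omega> (X s \<omega>' - X 0 \<omega>') * of_bool (J s \<omega>' = Some j)"])
  qed
  finally show "(\<integral>\<^sup>+\<omega>. \<psi> \<omega> (X (t + s) \<omega> - X t \<omega>) * of_bool (J t \<omega> = Some k \<and> J (t + s) \<omega> = Some j) \<partial>P x i)
    = (\<integral>\<^sup>+\<omega>. (\<integral>\<^sup>+\<omega>'. \<psi> \<omega> (X s \<omega>') * of_bool (J s \<omega>' = Some j) \<partial>P 0 k) * of_bool (J t \<omega> = Some k) \<partial>P x i)" .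
next
  fix \<psi> :: "'w \<Rightarrow> real \<Rightarrow> real" assume [measurable]: "case_prod \<psi> \<in> borel_measurable (past_algebra u m \<Otimes>\<^sub>M borel)"
    and int: "integrable (P x i) (\<lambda>\<omega>. \<psi> \<omega> (X (t + s) \<omega> - X t \<omega>) * of_bool (J t \<omega> = Some k \<and> J (t + s) \<omega> = Some j))"
  note [measurable] = measurable_past_algebra_id
  have 1: "(\<lambda>z. \<psi> (fst z) (fst (snd z 0)) * of_bool (snd (snd z 0) = Some j)) \<in> borel_measurable (past_algebra u m \<Otimes>\<^sub>M fd_space 1)"
    by measurable
  have *: "\<psi> \<omega> (fst (shift_path X J t (\<lambda>_. s) 1 \<omega> 0)) * of_bool (snd (shift_path X J t (\<lambda>_. s) 1 \<omega> 0) = Some j) * of_bool (J t \<omega> = Some k)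
    = \<psi> \<omega> (X (t + s) \<omega> - X t \<omega>) * of_bool (J t \<omega> = Some k \<and> J (t + s) \<omega> = Some j)" for \<omega>
    by (auto simp: shift_path_def)
  have **: "\<psi> \<omega> (fst (shift_path X J 0 (\<lambda>_. s) 1 \<omega>' 0)) * of_bool (snd (shift_path X J 0 (\<lambda>_. s) 1 \<omega>' 0) = Some j)
    = \<psi> \<omega> (X s \<omega>' - X 0 \<omega>') * of_bool (J s \<omega>' = Some j)" for \<omega> \<omega>'
    by (auto simp: shift_path_def)
  have "(\<integral>\<omega>. \<psi> \<omega> (X (t + s) \<omega> - X t \<omega>) * of_bool (J t \<omega> = Some k \<and> J (t + s) \<omega> = Some j) \<partial>P x i)
    = (\<integral>\<omega>. (\<integral>\<omega>'. \<psi> \<omega> (X s \<omega>' - X 0 \<omega>') * of_bool (J s \<omega>' = Some j) \<partial>P 0 k) * of_bool (J t \<omega> = Some k) \<partial>P x i)"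
    using markov_integral[OF tu _ 1, where s = "\<lambda>_. s" and k = k and x = x and i = i] s int by (simp only: fst_conv snd_conv * **)
  also have "\<dots> = (\<integral>\<omega>. (\<integral>\<omega>'. \<psi> \<omega> (X s \<omega>') * of_bool (J s \<omega>' = Some j) \<partial>P 0 k) * of_bool (J t \<omega> = Some k) \<partial>P x i)"
  proof (rule Bochner_Integration.integral_cong[OF refl])
    fix \<omega> assume \<omega>: "\<omega> \<in> space (P x i)"
    have m: "(\<lambda>y. \<psi> \<omega> y) \<in> borel_measurable borel"
      using \<omega> by (intro measurable_Pair2[of "case_prod \<psi>" "past_algebra u m", simplified]) auto
    note [measurable] = measurable_compose[OF _ m]
    have "(\<integral>\<omega>'. \<psi> \<omega> (X s \<omega>' - X 0 \<omega>') * of_bool (J s \<omega>' = Some j) \<partial>P 0 k)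
      = (\<integral>\<omega>'. \<psi> \<omega> (X s \<omega>') * of_bool (J s \<omega>' = Some j) \<partial>P 0 k)"
    proof (rule integral_cong_AE)
      show "AE \<omega>' in P 0 k. \<psi> \<omega> (X s \<omega>' - X 0 \<omega>') * of_bool (J s \<omega>' = Some j) = \<psi> \<omega> (X s \<omega>') * of_bool (J s \<omega>' = Some j)"
        using AE_X0[of 0 k] by eventually_elim simp
    qed measurable
    then show "(\<integral>\<omega>'. \<psi> \<omega> (X s \<omega>' - X 0 \<omega>') * of_bool (J s \<omega>' = Some j) \<partial>P 0 k) * of_bool (J t \<omega> = Some k)
      = (\<integral>\<omega>'. \<psi> \<omega> (X s \<omega>') * of_bool (J s \<omega>' = Some j) \<partial>P 0 k) * of_bool (J t \<omega> = Some k)"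
      by (simp only:)
  qed
  finally show "(\<integral>\<omega>. \<psi> \<omega> (X (t + s) \<omega> - X t \<omega>) * of_bool (J t \<omega> = Some k \<and> J (t + s) \<omega> = Some j) \<partial>P x i)
      = (\<integral>\<omega>. (\<integral>\<omega>'. \<psi> \<omega> (X s \<omega>') * of_bool (J s \<omega>' = Some j) \<partial>P 0 k) * of_bool (J t \<omega> = Some k) \<partial>P x i)" .
qed

section \<open>Joint measurability in time and path\<close>

definition Jj :: "real \<Rightarrow> 'w \<Rightarrow> 'n option" where "Jj s = J (max 0 s)"

text \<open>Regularity of \<open>X\<close> is known only while the chain is alive, so values after
  killing are replaced by 0; negative times are sent to 0. The result is jointly measurable on the
  product of the time line and \<open>\<Omega>\<close>, as Tonelli over occupation times
  requires.\<close>

definition Xj :: "real \<Rightarrow> 'w \<Rightarrow> real" where "Xj s \<omega> = (if Jj s \<omega> = None then 0 else X (max 0 s) \<omega>)"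

text \<open>Rounding up strictly, also at dyadic points: the approximation then comes from the
  right, where the paths are continuous.\<close>

definition next_dyadic :: "nat \<Rightarrow> real \<Rightarrow> real" where "next_dyadic n s = (of_int \<lfloor>s * 2 ^ n\<rfloor> + 1) / 2 ^ n"

lemma next_dyadic_bounds: "s < next_dyadic n s" "next_dyadic n s \<le> s + 1 / 2 ^ n"
proof -
  have "s * 2 ^ n < of_int \<lfloor>s * 2 ^ n\<rfloor> + 1" by linarith
  then show "s < next_dyadic n s" by (simp add: next_dyadic_def field_simps)
  have "of_int \<lfloor>s * 2 ^ n\<rfloor> \<le> s * 2 ^ n" by linarith
  then show "next_dyadic n s \<le> s + 1 / 2 ^ n" by (simp add: next_dyadic_def field_simps)
qed

lemma next_dyadic_tendsto: "(\<lambda>n. next_dyadic n s) \<longlonglongrightarrow> s"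
proof (rule tendsto_sandwich)
  show "eventually (\<lambda>n. s \<le> next_dyadic n s) sequentially" 
    by (intro always_eventually allI less_imp_le next_dyadic_bounds)
  show "eventually (\<lambda>n. next_dyadic n s \<le> s + 1 / 2 ^ n) sequentially" 
    by (intro always_eventually allI next_dyadic_bounds)
  have "(\<lambda>n. s + (1 / 2) ^ n) \<longlonglongrightarrow> s + 0" by (intro tendsto_intros LIMSEQ_realpow_zero) auto
  then show "(\<lambda>n. s + 1 / 2 ^ n) \<longlonglongrightarrow> s" by (simp add: power_one_over)
qed simp

lemma eventually_J_next_dyadic:
  assumes "\<omega> \<in> space \<Omega>" "0 \<le> s"
  shows "eventually (\<lambda>n. J (next_dyadic n s) \<omega> = J s \<omega>) sequentially"
proof -
  obtain e where e: "e > 0" "\<And>r. s \<le> r \<Longrightarrow> r < s + e \<Longrightarrow> J r \<omega> = J s \<omega>"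
    using J_right_const[OF assms] by blast
  from order_tendstoD(2)[OF next_dyadic_tendsto, of s "s + e"] e(1)
  show ?thesis using next_dyadic_bounds(1)[of s] by (auto elim!: eventually_mono intro!: e(2) less_imp_le)
qed

lemma X_next_dyadic_tendsto:
  assumes "\<omega> \<in> space \<Omega>" "0 \<le> s" "J s \<omega> \<noteq> None"
  shows "(\<lambda>n. X (next_dyadic n s) \<omega>) \<longlonglongrightarrow> X s \<omega>"
proof (rule filterlim_compose[OF X_right_cont[OF assms]])
  have "next_dyadic n s \<in> {s<..} \<and> next_dyadic n s \<noteq> s" for n using next_dyadic_bounds(1)[of s n] by auto
  then show "filterlim (\<lambda>n. next_dyadic n s) (at_right s) sequentially"
    by (simp add: filterlim_at next_dyadic_tendsto)
qed

text \<open>For fixed \<open>n\<close> the rounded time takes countably many values, so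
  measurability at each fixed time is enough.\<close>

lemma measurable_next_dyadic_compose:
  assumes f: "\<And>t. f t \<in> measurable \<Omega> N"
  shows "(\<lambda>z. f (next_dyadic n (max 0 (fst z))) (snd z)) \<in> measurable (borel \<Otimes>\<^sub>M \<Omega>) N"
  unfolding next_dyadic_def
  by (rule measurable_compose_countable[of "\<lambda>i z. f ((of_int i + 1) / 2 ^ n) (snd z)" _ N "\<lambda>z. \<lfloor>max 0 (fst z) * 2 ^ n\<rfloor>"])
    (auto intro!: measurable_compose[OF measurable_snd f])

text \<open>The chain is constant on a short interval to the right of each time, so along
  \<open>next_dyadic\<close> the indicator of a state is eventually equal to its value at the
  limit.\<close>

lemma measurable_Jj_pair: "(\<lambda>z. Jj (fst z) (snd z)) \<in> measurable (borel \<Otimes>\<^sub>M \<Omega>) (count_space UNIV)"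
proof -
  have "(\<lambda>z. of_bool (Jj (fst z) (snd z) = v) :: real) \<in> borel_measurable (borel \<Otimes>\<^sub>M \<Omega>)" for v
  proof (rule borel_measurable_LIMSEQ_real)
    show "(\<lambda>z. of_bool (J (next_dyadic n (max 0 (fst z))) (snd z) = v) :: real) \<in> borel_measurable (borel \<Otimes>\<^sub>M \<Omega>)" for n
      by (rule measurable_next_dyadic_compose) measurable
    fix z :: "real \<times> 'w" assume "z \<in> space (borel \<Otimes>\<^sub>M \<Omega>)"
    then have "snd z \<in> space \<Omega>" by (auto simp: space_pair_measure)
    from eventually_J_next_dyadic[OF this, of "max 0 (fst z)"]
    show "(\<lambda>n. of_bool (J (next_dyadic n (max 0 (fst z))) (snd z) = v) :: real) \<longlonglongrightarrow> of_bool (Jj (fst z) (snd z) = v)"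
      by (intro tendsto_eventually) (auto simp: Jj_def elim: eventually_mono)
  qed
  then have "{z \<in> space (borel \<Otimes>\<^sub>M \<Omega>). (of_bool (Jj (fst z) (snd z) = v) :: real) = 1} \<in> sets (borel \<Otimes>\<^sub>M \<Omega>)" for v
    by measurable
  then have "(\<lambda>z. Jj (fst z) (snd z)) -` {v} \<inter> space (borel \<Otimes>\<^sub>M \<Omega>) \<in> sets (borel \<Otimes>\<^sub>M \<Omega>)" for v
    by (simp add: vimage_def Int_def conj_commute)
  then show ?thesis by (intro measurable_count_space_eq2_countable[THEN iffD2]) auto
qed

lemma measurable_Jj [measurable (raw)]:
  assumes "f \<in> borel_measurable N" "g \<in> measurable N \<Omega>"
  shows "(\<lambda>z. Jj (f z) (g z)) \<in> measurable N (count_space UNIV)"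
  using measurable_compose[OF measurable_Pair[OF assms] measurable_Jj_pair] by simp

lemma measurable_Xj_pair: "(\<lambda>z. Xj (fst z) (snd z)) \<in> borel_measurable (borel \<Otimes>\<^sub>M \<Omega>)"
proof (rule borel_measurable_LIMSEQ_real)
  show "(\<lambda>z. (if J (next_dyadic n (max 0 (fst z))) (snd z) = None then 0 else X (next_dyadic n (max 0 (fst z))) (snd z)))
      \<in> borel_measurable (borel \<Otimes>\<^sub>M \<Omega>)" for n
    by (rule measurable_next_dyadic_compose[of "\<lambda>t \<omega>. if J t \<omega> = None then 0 else X t \<omega>"]) measurable
  fix z :: "real \<times> 'w" assume "z \<in> space (borel \<Otimes>\<^sub>M \<Omega>)"
  then have z: "snd z \<in> space \<Omega>" by (auto simp: space_pair_measure)
  note ev = eventually_J_next_dyadic[OF z, of "max 0 (fst z)"]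
  show "(\<lambda>n. (if J (next_dyadic n (max 0 (fst z))) (snd z) = None then 0 else X (next_dyadic n (max 0 (fst z))) (snd z)))
     \<longlonglongrightarrow> Xj (fst z) (snd z)"
  proof (cases "Jj (fst z) (snd z) = None")
    case True
    then show ?thesis using ev by (intro tendsto_eventually) (auto simp: Jj_def Xj_def elim: eventually_mono)
  next
    case False
    have "(\<lambda>n. X (next_dyadic n (max 0 (fst z))) (snd z)) \<longlonglongrightarrow> Xj (fst z) (snd z)"
      using False X_next_dyadic_tendsto[OF z, of "max 0 (fst z)"] by (auto simp: Jj_def Xj_def)
    then show ?thesis
      by (rule Lim_transform_eventually) (use ev False in \<open>auto simp: Jj_def elim: eventually_mono\<close>)
  qed
qed

lemma measurable_Xj [measurable (raw)]:
  assumes "f \<in> borel_measurable N" "g \<in> measurable N \<Omega>"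
  shows "(\<lambda>z. Xj (f z) (g z)) \<in> borel_measurable N"
  using measurable_compose[OF measurable_Pair[OF assms] measurable_Xj_pair] by simp

end

section \<open>The scale identity\<close>

lemma has_bochner_integral_cmult:
  fixes f :: "'a \<Rightarrow> real"
  shows "has_bochner_integral M f x \<Longrightarrow> has_bochner_integral M (\<lambda>z. c * f z) (c * x)"
  by (rule has_bochner_integral_mult_right)

lemma has_bochner_integral_exp_pos:
  assumes "c > 0"
  shows "has_bochner_integral lborel (\<lambda>y::real. exp (- c * y) * of_bool (0 < y)) (1 / c)"
proof -
  have "prob_space (density lborel (exponential_density c))"
    using assms by (intro prob_space_exponential_density)
  from prob_space.emeasure_space_1[OF this]
  have 1: "(\<integral>\<^sup>+x. ennreal (exponential_density c x) \<partial>lborel) = ennreal 1"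
    by (simp add: emeasure_density)
  have "has_bochner_integral lborel (exponential_density c) 1"
    using assms 1 by (intro has_bochner_integral_nn_integral) (auto intro!: AE_I2 exponential_density_nonneg)
  then have "has_bochner_integral lborel (\<lambda>y. exponential_density c y / c) (1 / c)"
    by (rule has_bochner_integral_divide_zero)
  \<comment> \<open>The exponential density is nonzero at 0, where the truncated exponential is 0;
    hence equality almost everywhere only.\<close>
  moreover have "AE y in lborel. exponential_density c y / c = exp (- c * y) * of_bool (0 < y)"
    using AE_lborel_singleton[of 0] by eventually_elim (use assms in \<open>auto simp: exponential_density_def mult.commute\<close>)
  ultimately show ?thesis
    by (subst (asm) has_bochner_integral_cong_AE) auto
qed

section \<open>Laplace transforms under a random shift\<close>

context sigma_finite_measure
begin

context
  fixes q :: "real \<Rightarrow> real" and V w :: "'a \<Rightarrow> real" and b I :: real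
  assumes q [measurable]: "q \<in> borel_measurable borel"
    and V [measurable]: "V \<in> borel_measurable M" and w [measurable]: "w \<in> borel_measurable M" "\<And>z. w z \<ge> 0"
    and qI: "has_bochner_integral lborel (\<lambda>y. exp (- b * y) * q y) I"
    and Vw: "integrable M (\<lambda>z. exp (b * V z) * w z)"
begin

private lemma inner_integral:
  "has_bochner_integral lborel (\<lambda>x. exp (- b * x) * q (x + v)) (exp (b * v) * I)"
proof -
  have "has_bochner_integral lborel (\<lambda>x. exp (- b * (v + 1 * x)) * q (v + 1 * x)) (I /\<^sub>R \<bar>1\<bar>)"
    using qI by (subst (asm) lborel_has_bochner_integral_real_affine_iff[of 1 _ _ v]) auto
  then have "has_bochner_integral lborel (\<lambda>x. exp (b * v) * (exp (- b * (v + x)) * q (v + x))) (exp (b * v) * I)"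
    by (intro has_bochner_integral_mult_right) simp
  then show ?thesis
    by (rule has_bochner_integral_cong[THEN iffD1, rotated -1]) (auto simp: algebra_simps simp flip: exp_add)
qed

private lemma inner_abs_integral:
  "(\<integral>x. norm (exp (- b * x) * q (x + v)) \<partial>lborel) = exp (b * v) * (\<integral>y. \<bar>exp (- b * y) * q y\<bar> \<partial>lborel)"
proof -
  have "(\<integral>y. \<bar>exp (- b * y) * q y\<bar> \<partial>lborel) = (\<integral>x. \<bar>exp (- b * (v + x)) * q (v + x)\<bar> \<partial>lborel)"
    using lborel_integral_real_affine[of 1 "\<lambda>y. \<bar>exp (- b * y) * q y\<bar>" v] by simp
  then have "exp (b * v) * (\<integral>y. \<bar>exp (- b * y) * q y\<bar> \<partial>lborel)
      = (\<integral>x. exp (b * v) * \<bar>exp (- b * (v + x)) * q (v + x)\<bar> \<partial>lborel)"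
    by simp
  also have "\<dots> = (\<integral>x. norm (exp (- b * x) * q (x + v)) \<partial>lborel)"
    by (intro Bochner_Integration.integral_cong) (auto simp: abs_mult algebra_simps simp flip: exp_add)
  finally show ?thesis ..
qed

text \<open>Translating \<open>q\<close> by \<open>V z\<close> multiplies its transform by
  \<open>exp (b * V z)\<close>; Fubini then integrates over \<open>z\<close>. The same computation
  with absolute values provides the integrability on the product.\<close>

lemma has_bochner_integral_laplace_shift:
  "has_bochner_integral lborel (\<lambda>x. exp (- b * x) * (\<integral>z. q (x + V z) * w z \<partial>M)) ((\<integral>z. exp (b * V z) * w z \<partial>M) * I)"
proof -
  interpret L: pair_sigma_finite M lborel ..
  define f where "f = (\<lambda>(z, x). exp (- b * x) * q (x + V z) * w z)"
  have fm [measurable]: "f \<in> borel_measurable (M \<Otimes>\<^sub>M lborel)" unfolding f_def by measurable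
  have inner: "has_bochner_integral lborel (\<lambda>x. f (z, x)) (exp (b * V z) * I * w z)" for z
    unfolding f_def using inner_integral by (simp add: has_bochner_integral_mult_left)
  have int: "integrable (M \<Otimes>\<^sub>M lborel) f"
  proof (rule L.Fubini_integrable)
    have "(\<integral>x. norm (f (z, x)) \<partial>lborel) = exp (b * V z) * w z * (\<integral>y. \<bar>exp (- b * y) * q y\<bar> \<partial>lborel)" for z
    proof -
      have "(\<integral>x. norm (f (z, x)) \<partial>lborel) = (\<integral>x. norm (exp (- b * x) * q (x + V z)) * w z \<partial>lborel)"
        by (intro Bochner_Integration.integral_cong) (auto simp: f_def abs_mult w(2))
      also have "\<dots> = (\<integral>x. norm (exp (- b * x) * q (x + V z)) \<partial>lborel) * w z" by (rule integral_mult_left_zero)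
      finally show ?thesis unfolding inner_abs_integral by simp
    qed
    then show "integrable M (\<lambda>z. \<integral>x. norm (f (z, x)) \<partial>lborel)" using Vw by simp
    show "AE z in M. integrable lborel (\<lambda>x. f (z, x))" using inner by (auto simp: has_bochner_integral_iff)
  qed measurable
  have eq: "(\<integral>z. f (z, x) \<partial>M) = exp (- b * x) * (\<integral>z. q (x + V z) * w z \<partial>M)" for x
    unfolding f_def by (simp add: mult.assoc)
  have "integrable lborel (\<lambda>x. exp (- b * x) * (\<integral>z. q (x + V z) * w z \<partial>M))"
    using L.integrable_snd[of "\<lambda>z x. f (z, x)"] int eq by simp
  moreover have "(\<integral>x. exp (- b * x) * (\<integral>z. q (x + V z) * w z \<partial>M) \<partial>lborel) = (\<integral>z. \<integral>x. f (z, x) \<partial>lborel \<partial>M)"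
    using L.Fubini_integral[of "\<lambda>z x. f (z, x)"] int eq by simp
  moreover have "\<dots> = (\<integral>z. exp (b * V z) * I * w z \<partial>M)"
    using inner by (intro Bochner_Integration.integral_cong) (auto simp: has_bochner_integral_iff)
  moreover have "\<dots> = (\<integral>z. exp (b * V z) * w z * I \<partial>M)" by (simp add: mult_ac)
  ultimately show ?thesis by (simp add: has_bochner_integral_iff)
qed

end

text \<open>Limits are taken from the left because \<open>q\<close> will contain the indicator of
  the open half line, which is left-continuous at 0 but not right-continuous. Approach from below
  also gives the dominating function, as \<open>b \<ge> 0\<close>.\<close>

lemma shift_integral_tendsto_left:
  fixes q :: "real \<Rightarrow> real"
  assumes [measurable]: "q \<in> borel_measurable borel" "V \<in> borel_measurable M" "w \<in> borel_measurable M" and w: "\<And>z. w z \<ge> 0"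
    and Vw: "integrable M (\<lambda>z. exp (b * V z) * w z)" and b: "b \<ge> 0"
    and bound: "\<And>y. \<bar>q y\<bar> \<le> C * exp (b * y)"
    and left: "\<And>y. (q \<longlongrightarrow> q y) (at_left y)"
    and y: "y \<longlonglongrightarrow> x" "\<And>n. y n < x"
  shows "(\<lambda>n. \<integral>z. q (y n + V z) * w z \<partial>M) \<longlonglongrightarrow> (\<integral>z. q (x + V z) * w z \<partial>M)"
proof (rule integral_dominated_convergence[where w = "\<lambda>z. (\<bar>C\<bar> * exp (b * x)) * (exp (b * V z) * w z)"])
  show "integrable M (\<lambda>z. (\<bar>C\<bar> * exp (b * x)) * (exp (b * V z) * w z))" using Vw by (rule integrable_mult_right)
  show "AE z in M. (\<lambda>n. q (y n + V z) * w z) \<longlonglongrightarrow> q (x + V z) * w z"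
  proof (rule AE_I2)
    fix z
    have lim: "(\<lambda>n. y n + V z) \<longlonglongrightarrow> x + V z" by (intro tendsto_intros y)
    have "filterlim (\<lambda>n. y n + V z) (at_left (x + V z)) sequentially"
      unfolding filterlim_at using lim y(2) by (auto simp: less_imp_neq)
    from filterlim_compose[OF left this]
    show "(\<lambda>n. q (y n + V z) * w z) \<longlonglongrightarrow> q (x + V z) * w z" by (rule tendsto_mult_right)
  qed
  show "AE z in M. norm (q (y n + V z) * w z) \<le> (\<bar>C\<bar> * exp (b * x)) * (exp (b * V z) * w z)" for n
  proof (rule AE_I2)
    fix z
    have "\<bar>q (y n + V z)\<bar> \<le> C * exp (b * (y n + V z))" by (rule bound)
    also have "\<dots> \<le> \<bar>C\<bar> * exp (b * (x + V z))"
      using y(2)[of n] b by (intro mult_mono) (auto intro: mult_left_mono less_imp_le)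
    finally have "\<bar>q (y n + V z)\<bar> * w z \<le> \<bar>C\<bar> * exp (b * (x + V z)) * w z" by (intro mult_right_mono w)
    then show "norm (q (y n + V z) * w z) \<le> (\<bar>C\<bar> * exp (b * x)) * (exp (b * V z) * w z)"
      by (simp add: abs_mult w distrib_left exp_add mult_ac)
  qed
qed measurable

end

text \<open>Every interval to the left of \<open>x\<close> has positive length and so contains a
  good point. This turns identities a.e. into identities everywhere for left-continuous
  functions.\<close>

lemma AE_lborel_left_sequence:
  fixes x :: real
  assumes "AE y in lborel. Q y"
  obtains y where "y \<longlonglongrightarrow> x" "\<And>n. y n < x" "\<And>n. Q (y n)"
proof -
  have "\<exists>y. x - 1 / real (Suc n) < y \<and> y < x \<and> Q y" for n
  proof (rule ccontr)
    let ?I = "{x - 1 / real (Suc n) <..< x}"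
    assume "\<nexists>y. x - 1 / real (Suc n) < y \<and> y < x \<and> Q y"
    then have "AE y in lborel. y \<notin> ?I" using assms by (auto elim!: eventually_mono)
    then have "emeasure lborel ?I = 0" by (subst (asm) AE_iff_measurable[of ?I]) auto
    then show False by (simp add: field_simps)
  qed
  then obtain y where y: "\<And>n. x - 1 / real (Suc n) < y n \<and> y n < x \<and> Q (y n)" by metis
  have "y \<longlonglongrightarrow> x"
  proof (rule tendsto_sandwich)
    show "(\<lambda>n. x - 1 / real (Suc n)) \<longlonglongrightarrow> x"
      using tendsto_diff[OF tendsto_const LIMSEQ_inverse_real_of_nat, of x] by (simp add: inverse_eq_divide)
    show "eventually (\<lambda>n. x - 1 / real (Suc n) \<le> y n) sequentially" "eventually (\<lambda>n. y n \<le> x) sequentially"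
      using y by (auto intro!: always_eventually less_imp_le)
  qed simp
  with y that show ?thesis by blast
qed

lemma matrix_inv_right:
  fixes A :: "real^'n^'n"
  assumes "invertible A" shows "A ** matrix_inv A = mat 1"
  using someI_ex[OF assms[unfolded invertible_def]] unfolding matrix_inv_def by blast

locale spectrally_negative_MAP_scale = spectrally_negative_MAP \<Omega> P X J
  for \<Omega> :: "'w measure" and P :: "real \<Rightarrow> 'n::finite \<Rightarrow> 'w measure"
    and X :: "real \<Rightarrow> 'w \<Rightarrow> real" and J :: "real \<Rightarrow> 'w \<Rightarrow> 'n option" +
  fixes F W :: "real \<Rightarrow> real^'n^'n" and \<alpha> :: real
  assumes matrix_exponent: "matrix_exponent \<Omega> P X J F"
    and scale_matrix: "scale_matrix F W"
    and alpha_nonneg: "0 \<le> \<alpha>"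
begin

section \<open>The kernel \<open>kappa\<close> and expected occupation integrals\<close>

lemma exp_moment:
  assumes "0 \<le> b" "0 \<le> t"
  shows "has_bochner_integral (P 0 i) (\<lambda>\<omega>. exp (b * X t \<omega>) * of_bool (J t \<omega> = Some j)) (mat_exp (t *\<^sub>R F b) $ i $ j)"
proof -
  have "indicator {\<omega>. J t \<omega> = Some j} \<omega> = (of_bool (J t \<omega> = Some j) :: real)" for \<omega> by (auto simp: indicator_def)
  moreover have "integrable (P 0 i) (\<lambda>\<omega>. exp (b * X t \<omega>) * indicator {\<omega>. J t \<omega> = Some j} \<omega>) \<and>
      (\<integral>\<omega>. exp (b * X t \<omega>) * indicator {\<omega>. J t \<omega> = Some j} \<omega> \<partial>P 0 i) = mat_exp (t *\<^sub>R F b) $ i $ j"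
    using matrix_exponent assms unfolding matrix_exponent_def by blast
  ultimately show ?thesis by (simp add: has_bochner_integral_iff)
qed

text \<open>The entries of the factor in front of \<open>F \<alpha>\<close> in \<open>Z\<close>,
  already multiplied by \<open>exp (\<alpha> * x)\<close> and continued by 0 to the left.\<close>

definition kappa :: "'n \<Rightarrow> 'n \<Rightarrow> real \<Rightarrow> real" where
  "kappa i j = exp_primitive \<alpha> (\<lambda>y. W y $ i $ j)"

lemma kappa_nonpos: "y \<le> 0 \<Longrightarrow> kappa i j y = 0"
  by (simp add: kappa_def exp_primitive_nonpos)

definition eta :: real where
  "eta = (SOME \<eta>. \<eta> \<ge> 0 \<and> (\<forall>b>\<eta>. invertible (F b) \<and>
        ((\<lambda>x. exp (- b * x) *\<^sub>R W x) has_integral matrix_inv (F b)) {0..}))"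

lemma eta: "eta \<ge> 0" "\<And>b. b > eta \<Longrightarrow> invertible (F b)"
    "\<And>b. b > eta \<Longrightarrow> ((\<lambda>x. exp (- b * x) *\<^sub>R W x) has_integral matrix_inv (F b)) {0..}"
proof -
  have "\<exists>\<eta>. \<eta> \<ge> 0 \<and> (\<forall>b>\<eta>. invertible (F b) \<and> ((\<lambda>x. exp (- b * x) *\<^sub>R W x) has_integral matrix_inv (F b)) {0..})"
    using scale_matrix unfolding scale_matrix_def by blast
  from someI_ex[OF this]
  show "eta \<ge> 0" "\<And>b. b > eta \<Longrightarrow> invertible (F b)"
    "\<And>b. b > eta \<Longrightarrow> ((\<lambda>x. exp (- b * x) *\<^sub>R W x) has_integral matrix_inv (F b)) {0..}"
    unfolding eta_def[symmetric] by blast+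
qed

lemma W_entry:
  shows "continuous_on {0..} (\<lambda>y. W y $ i $ j)"
    and "b > eta \<Longrightarrow> ((\<lambda>x. exp (- b * x) * W x $ i $ j) has_integral matrix_inv (F b) $ i $ j) {0..}"
proof -
  have W: "continuous_on {0..} W" using scale_matrix unfolding scale_matrix_def by blast
  show "continuous_on {0..} (\<lambda>y. W y $ i $ j)" by (intro continuous_intros W)
  have bl: "bounded_linear (\<lambda>M. M $ i $ j :: real)"
    by (intro bounded_linear_compose[OF bounded_linear_vec_nth bounded_linear_vec_nth, unfolded o_def])
  assume "b > eta"
  from has_integral_linear[OF eta(3)[OF this] bl]
  show "((\<lambda>x. exp (- b * x) * W x $ i $ j) has_integral matrix_inv (F b) $ i $ j) {0..}" by (simp add: o_def)
qed

lemma continuous_on_kappa: "continuous_on UNIV (kappa i j)"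
  unfolding kappa_def using W_entry(1) W_entry(2) by (rule continuous_on_exp_primitive)

lemma measurable_kappa [measurable]: "kappa i j \<in> borel_measurable borel"
  using continuous_on_kappa by (rule borel_measurable_continuous_onI)

lemma has_bochner_integral_kappa:
  "b > eta \<Longrightarrow> b > \<alpha> \<Longrightarrow> has_bochner_integral lborel (\<lambda>x. exp (- b * x) * kappa i j x) (matrix_inv (F b) $ i $ j / (b - \<alpha>))"
  unfolding kappa_def by (rule has_bochner_integral_exp_primitive[OF W_entry(1) W_entry(2)])

text \<open>One exponent for all growth estimates: above \<open>eta\<close> and
  \<open>\<alpha>\<close>, so that it bounds both \<open>kappa\<close> and
  \<open>exp (\<alpha> * y)\<close> on the right half line, and positive, so that
  \<open>exp (beta * y)\<close> is monotone.\<close>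

definition beta :: real where "beta = max eta \<alpha> + 1"

lemma beta: "beta > eta" "beta > \<alpha>" "beta > 0"
  using eta(1) alpha_nonneg by (auto simp: beta_def)

lemma kappa_bound: "\<exists>C\<ge>0. \<forall>i j y. \<bar>kappa i j y\<bar> \<le> C * exp (beta * y)"
proof -
  have "\<exists>C\<ge>0. \<forall>y. \<bar>kappa i j y\<bar> \<le> C * exp (beta * y)" for i j
  proof -
    obtain C where "C \<ge> 0" "\<And>x. 0 \<le> x \<Longrightarrow> \<bar>kappa i j x\<bar> \<le> C * exp (beta * x)"
      unfolding kappa_def by (rule exp_primitive_bound[OF W_entry(1) W_entry(2)[where i = i and j = j] beta(1,2)]) blast+
    then have "C \<ge> 0 \<and> (\<forall>y. \<bar>kappa i j y\<bar> \<le> C * exp (beta * y))"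
      using kappa_nonpos[of _ i j] by (metis abs_zero exp_ge_zero linorder_le_cases mult_nonneg_nonneg)
    then show ?thesis by blast
  qed
  then obtain C where C: "\<And>i j. C i j \<ge> 0" "\<And>i j y. \<bar>kappa i j y\<bar> \<le> C i j * exp (beta * y)" by metis
  have "C i j \<le> (\<Sum>i\<in>UNIV. \<Sum>j\<in>UNIV. C i j)" for i j
    by (rule order_trans[OF member_le_sum[of j UNIV "C i"] member_le_sum[of i UNIV "\<lambda>i. \<Sum>j\<in>UNIV. C i j"]])
      (auto intro: sum_nonneg C)
  then have "\<bar>kappa i j y\<bar> \<le> (\<Sum>i\<in>UNIV. \<Sum>j\<in>UNIV. C i j) * exp (beta * y)" for i j y
    by (rule order_trans[OF C(2) mult_right_mono]) simp
  then show ?thesis by (intro exI[of _ "\<Sum>i\<in>UNIV. \<Sum>j\<in>UNIV. C i j"]) (auto intro!: sum_nonneg C)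
qed

text \<open>Integrated over \<open>occ_measure i\<close> this yields expected occupation: the first
  component of \<open>z\<close> is the running time, cut to [0, t], the second the path. Written as
  a weight, it fits the random-shift lemma for transforms.\<close>

definition occ_weight :: "real \<Rightarrow> 'n \<Rightarrow> real \<times> 'w \<Rightarrow> real" where
  "occ_weight t j z = of_bool (0 \<le> fst z \<and> fst z \<le> t \<and> Jj (fst z) (snd z) = Some j)"

abbreviation occ_measure :: "'n \<Rightarrow> (real \<times> 'w) measure" where
  "occ_measure i \<equiv> lborel \<Otimes>\<^sub>M P 0 i"

lemma occ_weight_nonneg: "occ_weight t j z \<ge> 0" by (simp add: occ_weight_def)

lemma measurable_occ_weight [measurable]: "occ_weight t j \<in> borel_measurable (lborel \<Otimes>\<^sub>M P x i)"
  unfolding occ_weight_def[abs_def] by measurable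

lemma sigma_finite_occ: "sigma_finite_measure (occ_measure i)"
proof -
  interpret pair_sigma_finite lborel "P 0 i" ..
  show ?thesis by unfold_locales
qed

lemma occ_exp_moment:
  assumes b: "0 \<le> b"
  shows "has_bochner_integral (occ_measure i) (\<lambda>z. exp (b * Xj (fst z) (snd z)) * occ_weight t j z)
    (\<integral>s. mat_exp (s *\<^sub>R F b) $ i $ j * indicator {0..t} s \<partial>lborel)"
proof -
  interpret L: pair_sigma_finite lborel "P 0 i" ..
  define f where "f = (\<lambda>(s, \<omega>). exp (b * Xj s \<omega>) * occ_weight t j (s, \<omega>))"
  have fm [measurable]: "f \<in> borel_measurable (occ_measure i)" unfolding f_def by measurable
  have f0: "f z \<ge> 0" for z by (auto simp: f_def occ_weight_nonneg split: prod.split)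
  have inner: "has_bochner_integral (P 0 i) (\<lambda>\<omega>. f (s, \<omega>)) (mat_exp (s *\<^sub>R F b) $ i $ j * indicator {0..t} s)" for s
  proof (cases "s \<in> {0..t}")
    case True
    have eq: "f (s, \<omega>) = exp (b * X s \<omega>) * of_bool (J s \<omega> = Some j)" for \<omega>
      using True by (auto simp: f_def occ_weight_def Jj_def Xj_def max_def)
    show ?thesis unfolding eq using exp_moment[OF b, of s i j] True by simp
  next
    case False
    then have "f (s, \<omega>) = 0" for \<omega> by (auto simp: f_def occ_weight_def)
    then show ?thesis using False by (simp add: has_bochner_integral_zero)
  qed
  have int0: "integrable lborel (\<lambda>s. mat_exp (s *\<^sub>R F b) $ i $ j * indicator {0..t} s)"
    using isCont_mat_exp by (intro borel_integrable_atLeastAtMost)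
  have int: "integrable (occ_measure i) f"
  proof (rule L.Fubini_integrable)
    show "integrable lborel (\<lambda>s. \<integral>\<omega>. norm (f (s, \<omega>)) \<partial>P 0 i)"
      using int0 inner f0 by (simp add: has_bochner_integral_iff)
    show "AE s in lborel. integrable (P 0 i) (\<lambda>\<omega>. f (s, \<omega>))" using inner by (auto simp: has_bochner_integral_iff)
  qed measurable
  have "(\<integral>z. f z \<partial>occ_measure i) = (\<integral>s. \<integral>\<omega>. f (s, \<omega>) \<partial>P 0 i \<partial>lborel)"
    by (rule L.integral_fst'[symmetric, OF int])
  also have "\<dots> = (\<integral>s. mat_exp (s *\<^sub>R F b) $ i $ j * indicator {0..t} s \<partial>lborel)"
    using inner by (simp add: has_bochner_integral_iff)
  finally have "has_bochner_integral (occ_measure i) f (\<integral>s. mat_exp (s *\<^sub>R F b) $ i $ j * indicator {0..t} s \<partial>lborel)"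
    using int by (simp add: has_bochner_integral_iff)
  moreover have "f = (\<lambda>z. exp (b * Xj (fst z) (snd z)) * occ_weight t j z)" by (auto simp: f_def)
  ultimately show ?thesis by simp
qed

text \<open>Read as a Dynkin formula: the generator sends \<open>kappa\<close> to
  \<open>exp (\<alpha> * y)\<close> on the positive half line. Both sides are compared through
  Laplace transforms in \<open>x\<close>, where the claim becomes
  \<open>S ** F b = mat_exp (t *\<^sub>R F b) - mat 1\<close> multiplied by the inverse of
  \<open>F b\<close> and divided by \<open>b - \<alpha>\<close>. Uniqueness of the transform gives
  the identity a.e., and left-continuity of all terms extends it to every \<open>x\<close>.\<close>

lemma scale_identity:
  assumes t: "0 \<le> t"
  shows "(\<Sum>l\<in>UNIV. \<integral>\<omega>. kappa l j (x + X t \<omega>) * of_bool (J t \<omega> = Some l) \<partial>P 0 i) = kappa i j x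
    + (\<integral>z. exp (\<alpha> * (x + Xj (fst z) (snd z))) * of_bool (0 < x + Xj (fst z) (snd z)) * occ_weight t j z \<partial>occ_measure i)"
proof -
  interpret L: sigma_finite_measure "occ_measure i" by (rule sigma_finite_occ)
  define A where "A l x = (\<integral>\<omega>. kappa l j (x + X t \<omega>) * of_bool (J t \<omega> = Some l) \<partial>P 0 i)" for l x
  define q where "q y = exp (\<alpha> * y) * of_bool (0 < y)" for y :: real
  have qm [measurable]: "q \<in> borel_measurable borel" unfolding q_def by measurable
  define B where "B x = (\<integral>z. q (x + Xj (fst z) (snd z)) * occ_weight t j z \<partial>occ_measure i)" for x
  define u where "u x = (\<Sum>l\<in>UNIV. A l x) - kappa i j x - B x" for x
  have Am [measurable]: "A l \<in> borel_measurable borel" for l unfolding A_def by measurable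
  have Bm [measurable]: "B \<in> borel_measurable borel" unfolding B_def by measurable
  have lap: "has_bochner_integral lborel (\<lambda>x. exp (- b * x) * u x) 0" if b: "b > beta" for b
  proof -
    have b': "b > eta" "b > \<alpha>" "b \<ge> 0" using b beta by auto
    have 1: "has_bochner_integral lborel (\<lambda>x. exp (- b * x) * A l x)
       (mat_exp (t *\<^sub>R F b) $ i $ l * (matrix_inv (F b) $ l $ j / (b - \<alpha>)))" for l
      using P.has_bochner_integral_laplace_shift[of "kappa l j" "X t" 0 i "\<lambda>\<omega>. of_bool (J t \<omega> = Some l)" b,
          OF _ _ _ _ has_bochner_integral_kappa[OF b'(1,2)]] exp_moment[OF b'(3) t, of i l]
      by (simp add: A_def has_bochner_integral_iff)
    have "has_bochner_integral lborel (\<lambda>y. exp (- b * y) * q y) (1 / (b - \<alpha>))"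
      using has_bochner_integral_exp_pos[of "b - \<alpha>"] b'(2)
      by (simp add: q_def left_diff_distrib exp_diff exp_minus field_simps)
    from L.has_bochner_integral_laplace_shift[OF qm _ _ occ_weight_nonneg this, of "\<lambda>z. Xj (fst z) (snd z)"] occ_exp_moment[OF b'(3), of i t j]
    have 2: "has_bochner_integral lborel (\<lambda>x. exp (- b * x) * B x)
       ((\<integral>s. mat_exp (s *\<^sub>R F b) $ i $ j * indicator {0..t} s \<partial>lborel) * (1 / (b - \<alpha>)))"
      by (simp add: B_def has_bochner_integral_iff)
    \<comment> \<open>The integrated semigroup. It is solved for by multiplying with the inverse of
      \<open>F b\<close> from the right, which exists for \<open>b > eta\<close>.\<close>
    define S :: "real^'n^'n" where "S = (\<chi> i j. \<integral>s. mat_exp (s *\<^sub>R F b) $ i $ j * indicator {0..t} s \<partial>lborel)"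
    have "S ** F b = mat_exp (t *\<^sub>R F b) - mat 1"
      using integral_mat_exp_mult[OF t, of "F b"] by (simp add: vec_eq_iff matrix_matrix_mult_def S_def)
    then have "S ** (F b ** matrix_inv (F b)) = (mat_exp (t *\<^sub>R F b) - mat 1) ** matrix_inv (F b)"
      by (simp add: matrix_mul_assoc)
    then have "S = (mat_exp (t *\<^sub>R F b) - mat 1) ** matrix_inv (F b)"
      using matrix_inv_right[OF eta(2)[OF b'(1)]] by simp
    moreover have "(mat_exp (t *\<^sub>R F b) - mat 1) ** matrix_inv (F b) = mat_exp (t *\<^sub>R F b) ** matrix_inv (F b) - mat 1 ** matrix_inv (F b)"
      by (simp add: vec_eq_iff matrix_matrix_mult_def left_diff_distrib sum_subtractf)
    ultimately have "S = mat_exp (t *\<^sub>R F b) ** matrix_inv (F b) - matrix_inv (F b)" by simp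
    then have 3: "(\<integral>s. mat_exp (s *\<^sub>R F b) $ i $ j * indicator {0..t} s \<partial>lborel)
        = (\<Sum>l\<in>UNIV. mat_exp (t *\<^sub>R F b) $ i $ l * matrix_inv (F b) $ l $ j) - matrix_inv (F b) $ i $ j"
      by (simp add: S_def vec_eq_iff matrix_matrix_mult_def)
    have "has_bochner_integral lborel (\<lambda>x. (\<Sum>l\<in>UNIV. exp (- b * x) * A l x) - exp (- b * x) * kappa i j x - exp (- b * x) * B x)
      ((\<Sum>l\<in>UNIV. mat_exp (t *\<^sub>R F b) $ i $ l * (matrix_inv (F b) $ l $ j / (b - \<alpha>))) - matrix_inv (F b) $ i $ j / (b - \<alpha>)
        - (\<integral>s. mat_exp (s *\<^sub>R F b) $ i $ j * indicator {0..t} s \<partial>lborel) * (1 / (b - \<alpha>)))"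
      by (intro has_bochner_integral_diff has_bochner_integral_sum 1 2 has_bochner_integral_kappa b'(1,2))
    moreover have "(\<Sum>l\<in>UNIV. mat_exp (t *\<^sub>R F b) $ i $ l * (matrix_inv (F b) $ l $ j / (b - \<alpha>))) - matrix_inv (F b) $ i $ j / (b - \<alpha>)
        - (\<integral>s. mat_exp (s *\<^sub>R F b) $ i $ j * indicator {0..t} s \<partial>lborel) * (1 / (b - \<alpha>)) = 0"
      unfolding 3 by (simp add: sum_divide_distrib diff_divide_distrib)
    moreover have "(\<Sum>l\<in>UNIV. exp (- b * x) * A l x) - exp (- b * x) * kappa i j x - exp (- b * x) * B x = exp (- b * x) * u x" for x
      by (simp add: u_def right_diff_distrib sum_distrib_left)
    ultimately show ?thesis by simp
  qed
  have um [measurable]: "u \<in> borel_measurable borel" unfolding u_def by measurable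
  have "AE x in lborel. u x = 0"
    by (rule bilateral_laplace_eq_0_imp_AE[of u beta]) (use lap um in \<open>auto simp: has_bochner_integral_iff\<close>)
  then obtain y where y: "y \<longlonglongrightarrow> x" "\<And>n. y n < x" "\<And>n. u (y n) = 0" by (rule AE_lborel_left_sequence[of _ x]) metis
  obtain C where C: "\<And>i j y. \<bar>kappa i j y\<bar> \<le> C * exp (beta * y)" using kappa_bound by blast
  have ck: "isCont (kappa i j) v" for i j v
    using continuous_on_kappa by (simp add: continuous_on_eq_continuous_at)
  have limA: "(\<lambda>n. A l (y n)) \<longlonglongrightarrow> A l x" for l
    unfolding A_def
  proof (rule P.shift_integral_tendsto_left[where b = beta and C = C])
    show "integrable (P 0 i) (\<lambda>\<omega>. exp (beta * X t \<omega>) * of_bool (J t \<omega> = Some l))"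
      using exp_moment[of beta t, where i = i and j = l] t beta by (auto simp: has_bochner_integral_iff)
    show "(kappa l j \<longlongrightarrow> kappa l j v) (at_left v)" for v
      by (rule tendsto_mono[OF _ ck[unfolded continuous_at]]) (simp add: at_le)
  qed (use C y beta in auto)
  have limB: "(\<lambda>n. B (y n)) \<longlonglongrightarrow> B x"
    unfolding B_def
  proof (rule L.shift_integral_tendsto_left[where b = \<alpha> and C = 1])
    show "integrable (occ_measure i) (\<lambda>z. exp (\<alpha> * Xj (fst z) (snd z)) * occ_weight t j z)"
      using occ_exp_moment[OF alpha_nonneg, of i t j] by (simp add: has_bochner_integral_iff)
    \<comment> \<open>The jump of \<open>q\<close> sits at 0, and \<open>q 0 = 0\<close> is its left
      limit there.\<close>
    show "(q \<longlongrightarrow> q v) (at_left v)" for v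
    proof (cases "0 < v")
      case True
      have e: "((\<lambda>y. exp (\<alpha> * y)) \<longlongrightarrow> exp (\<alpha> * v)) (at_left v)" by (intro tendsto_intros)
      have "eventually (\<lambda>y. exp (\<alpha> * y) = q y) (at_left v)"
        using eventually_at_left_real[OF True] by eventually_elim (simp add: q_def)
      from Lim_transform_eventually[OF e this] have "(q \<longlongrightarrow> exp (\<alpha> * v)) (at_left v)" .
      moreover have "q v = exp (\<alpha> * v)" using True by (simp add: q_def)
      ultimately show ?thesis by (simp only:)
    next
      case False
      have "eventually (\<lambda>y. q y = q v) (at_left v)"
        unfolding eventually_at_left_field by (rule exI[of _ "v - 1"]) (use False in \<open>auto simp: q_def\<close>)
      then show ?thesis by (rule tendsto_eventually)
    qed
    show "\<bar>q v\<bar> \<le> 1 * exp (\<alpha> * v)" for v by (simp add: q_def)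
  qed (use y occ_weight_nonneg alpha_nonneg in auto)
  have "(\<lambda>n. u (y n)) \<longlonglongrightarrow> u x"
    unfolding u_def by (intro tendsto_intros limA limB isCont_tendsto_compose[OF ck] y)
  then have "u x = 0" using y(3) by (simp add: LIMSEQ_const_iff)
  then show ?thesis by (simp add: u_def A_def B_def q_def)
qed

section \<open>The extended \<open>Z\<close> and its martingale defect\<close>

definition Zext :: "'n \<Rightarrow> 'n \<Rightarrow> real \<Rightarrow> real" where
  "Zext i j y = exp (\<alpha> * y) * of_bool (i = j) - (\<Sum>m\<in>UNIV. kappa i m y * F \<alpha> $ m $ j)"

lemma Zext_nonpos: "y \<le> 0 \<Longrightarrow> Zext i j y = exp (\<alpha> * y) * of_bool (i = j)"
  by (simp add: Zext_def kappa_nonpos)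

lemma Zext_eq_Zmat:
  assumes "0 \<le> y" shows "Zext i j y = Zmat F W \<alpha> y $ i $ j"
proof -
  have "continuous_on {0..y} (\<lambda>y. exp (- \<alpha> * y) *\<^sub>R W y)"
    using scale_matrix unfolding scale_matrix_def
    by (intro continuous_intros) (auto elim: continuous_on_subset)
  then have int: "(\<lambda>y. exp (- \<alpha> * y) *\<^sub>R W y) integrable_on {0..y}" by (rule integrable_continuous_real)
  have "integral {0..y} (\<lambda>y. exp (- \<alpha> * y) *\<^sub>R W y) $ i $ m = integral {0..y} (\<lambda>y. exp (- \<alpha> * y) * W y $ i $ m)" for m
  proof -
    have "bounded_linear (\<lambda>M. M $ i $ m :: real)"
      by (intro bounded_linear_compose[OF bounded_linear_vec_nth bounded_linear_vec_nth, unfolded o_def])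
    from integral_linear[OF int this] show ?thesis by (simp add: o_def)
  qed
  then show ?thesis
    using assms by (simp add: Zext_def Zmat_def kappa_def exp_primitive_def matrix_matrix_mult_def mat_def right_diff_distrib
      sum_distrib_left mult_ac)
qed

lemma isCont_kappa: "isCont (kappa i j) v"
  using continuous_on_kappa by (simp add: continuous_on_eq_continuous_at)

lemma isCont_Zext: "isCont (Zext i j) v"
  unfolding Zext_def[abs_def] by (intro continuous_intros isCont_kappa)

lemma measurable_Zext [measurable]: "Zext i j \<in> borel_measurable borel"
  unfolding Zext_def[abs_def] by measurable

text \<open>The summand 1 takes care of the left half line, where \<open>exp (\<alpha> * y)\<close>
  is bounded but may exceed every multiple of \<open>exp (beta * y)\<close>.\<close>

lemma Zext_bound: "\<exists>C\<ge>0. \<forall>i j y. \<bar>Zext i j y\<bar> \<le> C * (1 + exp (beta * y))"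
proof -
  obtain C where C: "C \<ge> 0" "\<And>i j y. \<bar>kappa i j y\<bar> \<le> C * exp (beta * y)" using kappa_bound by blast
  have "\<bar>Zext i j y\<bar> \<le> (1 + C * entry_sum (F \<alpha>)) * (1 + exp (beta * y))" for i j y
  proof -
    have e: "exp (\<alpha> * y) \<le> 1 + exp (beta * y)"
    proof (cases "y \<ge> 0")
      case True
      then have "exp (\<alpha> * y) \<le> exp (beta * y)" using beta(2) by (simp add: mult_right_mono)
      then show ?thesis by linarith
    next
      case False
      then have "exp (\<alpha> * y) \<le> 1" using alpha_nonneg by (simp add: mult_nonneg_nonpos)
      then show ?thesis using exp_gt_zero[of "beta * y"] by linarith
    qed
    have "\<bar>\<Sum>m\<in>UNIV. kappa i m y * F \<alpha> $ m $ j\<bar> \<le> (\<Sum>m\<in>UNIV. (C * exp (beta * y)) * \<bar>F \<alpha> $ m $ j\<bar>)"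
      by (rule order_trans[OF sum_abs]) (auto intro!: sum_mono mult_right_mono C simp: abs_mult)
    also have "\<dots> \<le> (C * exp (beta * y)) * entry_sum (F \<alpha>)"
      unfolding sum_distrib_left[symmetric] by (intro mult_left_mono column_sum_le_entry_sum) (simp add: C)
    also have "\<dots> \<le> (C * entry_sum (F \<alpha>)) * (1 + exp (beta * y))"
      using C(1) entry_sum_nonneg[of "F \<alpha>"] by (simp add: algebra_simps)
    finally have s: "\<bar>\<Sum>m\<in>UNIV. kappa i m y * F \<alpha> $ m $ j\<bar> \<le> (C * entry_sum (F \<alpha>)) * (1 + exp (beta * y))" .
    have "\<bar>Zext i j y\<bar> \<le> exp (\<alpha> * y) + \<bar>\<Sum>m\<in>UNIV. kappa i m y * F \<alpha> $ m $ j\<bar>"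
      unfolding Zext_def by (rule order_trans[OF abs_triangle_ineq4]) simp
    also have "\<dots> \<le> (1 + exp (beta * y)) + (C * entry_sum (F \<alpha>)) * (1 + exp (beta * y))"
      using e s by linarith
    also have "\<dots> = (1 + C * entry_sum (F \<alpha>)) * (1 + exp (beta * y))" by (simp add: algebra_simps)
    finally show ?thesis .
  qed
  then show ?thesis using C(1) entry_sum_nonneg[of "F \<alpha>"] by (intro exI[of _ "1 + C * entry_sum (F \<alpha>)"]) auto
qed

lemma integrable_kappa_shift:
  assumes t: "0 \<le> t"
  shows "integrable (P 0 i) (\<lambda>\<omega>. kappa l m (x + X t \<omega>) * of_bool (J t \<omega> = Some l))"
proof -
  obtain C where C: "C \<ge> 0" "\<And>i j y. \<bar>kappa i j y\<bar> \<le> C * exp (beta * y)" using kappa_bound by blast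
  show ?thesis
  proof (rule Bochner_Integration.integrable_bound)
    show "integrable (P 0 i) (\<lambda>\<omega>. (C * exp (beta * x)) * (exp (beta * X t \<omega>) * of_bool (J t \<omega> = Some l)))"
      using exp_moment[of beta t, where i = i and j = l] t beta(3) by (intro integrable_mult_right) (auto simp: has_bochner_integral_iff)
    show "AE \<omega> in P 0 i. norm (kappa l m (x + X t \<omega>) * of_bool (J t \<omega> = Some l))
       \<le> norm ((C * exp (beta * x)) * (exp (beta * X t \<omega>) * of_bool (J t \<omega> = Some l)))"
    proof (rule AE_I2)
      fix \<omega>
      show "norm (kappa l m (x + X t \<omega>) * of_bool (J t \<omega> = Some l))
       \<le> norm ((C * exp (beta * x)) * (exp (beta * X t \<omega>) * of_bool (J t \<omega> = Some l)))"
        using C(1) C(2)[of l m "x + X t \<omega>"] by (simp add: abs_mult distrib_left exp_add mult_ac)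
    qed
  qed measurable
qed

lemma has_bochner_integral_occ:
  "has_bochner_integral (occ_measure i) (\<lambda>z. exp (\<alpha> * (x + Xj (fst z) (snd z))) * occ_weight t l z)
    (exp (\<alpha> * x) * (\<integral>s. mat_exp (s *\<^sub>R F \<alpha>) $ i $ l * indicator {0..t} s \<partial>lborel))"
  using has_bochner_integral_cmult[OF occ_exp_moment[OF alpha_nonneg, of i t l], of "exp (\<alpha> * x)"]
  by (simp add: distrib_left exp_add mult_ac)

lemma integrable_occ:
  assumes [measurable]: "Measurable.pred borel Q"
  shows "integrable (occ_measure i) (\<lambda>z. exp (\<alpha> * (x + Xj (fst z) (snd z))) * of_bool (Q (x + Xj (fst z) (snd z))) * occ_weight t l z)"
proof (rule Bochner_Integration.integrable_bound)
  show "integrable (occ_measure i) (\<lambda>z. exp (\<alpha> * (x + Xj (fst z) (snd z))) * occ_weight t l z)"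
    using has_bochner_integral_occ by (simp add: has_bochner_integral_iff)
qed (auto simp: abs_mult occ_weight_nonneg)

text \<open>The exponential part of \<open>Zext\<close> changes in mean by
  \<open>exp (\<alpha> * x)\<close> times the integrated semigroup times \<open>F \<alpha>\<close>,
  that is, by the weighted occupation of the whole line. The part in \<open>kappa\<close> subtracts
  the occupation of the positive half line, also multiplied by \<open>F \<alpha>\<close>. Only that
  of the nonpositive half line survives.\<close>

lemma Zext_identity:
  assumes t: "0 \<le> t"
  shows "(\<Sum>l\<in>UNIV. \<integral>\<omega>. Zext l j (x + X t \<omega>) * of_bool (J t \<omega> = Some l) \<partial>P 0 i) = Zext i j x
    + (\<Sum>l\<in>UNIV. (\<integral>z. exp (\<alpha> * (x + Xj (fst z) (snd z))) * of_bool (x + Xj (fst z) (snd z) \<le> 0) * occ_weight t l z \<partial>occ_measure i) * F \<alpha> $ l $ j)"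
proof -
  define D where "D l = (\<integral>z. exp (\<alpha> * (x + Xj (fst z) (snd z))) * of_bool (x + Xj (fst z) (snd z) \<le> 0) * occ_weight t l z \<partial>occ_measure i)" for l
  define B where "B l = (\<integral>z. exp (\<alpha> * (x + Xj (fst z) (snd z))) * of_bool (0 < x + Xj (fst z) (snd z)) * occ_weight t l z \<partial>occ_measure i)" for l
  define S where "S l = (\<integral>s. mat_exp (s *\<^sub>R F \<alpha>) $ i $ l * indicator {0..t} s \<partial>lborel)" for l
  note occ = has_bochner_integral_occ[of i x t, folded S_def]
  \<comment> \<open>The total weighted occupation split at level 0.\<close>
  have DB: "D l + B l = exp (\<alpha> * x) * S l" for l
  proof -
    have "D l + B l = (\<integral>z. exp (\<alpha> * (x + Xj (fst z) (snd z))) * of_bool (x + Xj (fst z) (snd z) \<le> 0) * occ_weight t l z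
        + exp (\<alpha> * (x + Xj (fst z) (snd z))) * of_bool (0 < x + Xj (fst z) (snd z)) * occ_weight t l z \<partial>occ_measure i)"
      unfolding D_def B_def
      by (rule Bochner_Integration.integral_add[symmetric]) (rule integrable_occ, measurable)+
    also have "\<dots> = (\<integral>z. exp (\<alpha> * (x + Xj (fst z) (snd z))) * occ_weight t l z \<partial>occ_measure i)"
      by (intro Bochner_Integration.integral_cong) auto
    finally show ?thesis using occ by (simp add: has_bochner_integral_iff)
  qed
  have em: "has_bochner_integral (P 0 i) (\<lambda>\<omega>. exp (\<alpha> * (x + X t \<omega>)) * of_bool (l = j) * of_bool (J t \<omega> = Some l))
      (exp (\<alpha> * x) * of_bool (l = j) * mat_exp (t *\<^sub>R F \<alpha>) $ i $ l)" for l
    using has_bochner_integral_cmult[OF exp_moment[OF alpha_nonneg t, of i l], of "exp (\<alpha> * x) * of_bool (l = j)"]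
    by (simp add: distrib_left exp_add mult_ac)
  have "(\<integral>\<omega>. Zext l j (x + X t \<omega>) * of_bool (J t \<omega> = Some l) \<partial>P 0 i)
    = exp (\<alpha> * x) * of_bool (l = j) * mat_exp (t *\<^sub>R F \<alpha>) $ i $ l
      - (\<Sum>m\<in>UNIV. (\<integral>\<omega>. kappa l m (x + X t \<omega>) * of_bool (J t \<omega> = Some l) \<partial>P 0 i) * F \<alpha> $ m $ j)" for l
  proof -
    have "(\<integral>\<omega>. Zext l j (x + X t \<omega>) * of_bool (J t \<omega> = Some l) \<partial>P 0 i)
      = (\<integral>\<omega>. exp (\<alpha> * (x + X t \<omega>)) * of_bool (l = j) * of_bool (J t \<omega> = Some l)
         - (\<Sum>m\<in>UNIV. kappa l m (x + X t \<omega>) * of_bool (J t \<omega> = Some l) * F \<alpha> $ m $ j) \<partial>P 0 i)"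
      by (intro Bochner_Integration.integral_cong) (auto simp: Zext_def left_diff_distrib sum_distrib_right mult_ac)
    also have "\<dots> = (\<integral>\<omega>. exp (\<alpha> * (x + X t \<omega>)) * of_bool (l = j) * of_bool (J t \<omega> = Some l) \<partial>P 0 i)
       - (\<integral>\<omega>. (\<Sum>m\<in>UNIV. kappa l m (x + X t \<omega>) * of_bool (J t \<omega> = Some l) * F \<alpha> $ m $ j) \<partial>P 0 i)"
      using em[of l] by (intro Bochner_Integration.integral_diff Bochner_Integration.integrable_sum integrable_mult_left integrable_kappa_shift t)
        (simp add: has_bochner_integral_iff)
    also have "(\<integral>\<omega>. (\<Sum>m\<in>UNIV. kappa l m (x + X t \<omega>) * of_bool (J t \<omega> = Some l) * F \<alpha> $ m $ j) \<partial>P 0 i)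
       = (\<Sum>m\<in>UNIV. (\<integral>\<omega>. kappa l m (x + X t \<omega>) * of_bool (J t \<omega> = Some l) \<partial>P 0 i) * F \<alpha> $ m $ j)"
      by (subst Bochner_Integration.integral_sum) (auto intro!: integrable_mult_left integrable_kappa_shift t)
    finally show ?thesis using em[of l] by (simp add: has_bochner_integral_iff)
  qed
  moreover have "(\<Sum>l\<in>UNIV. exp (\<alpha> * x) * of_bool (l = j) * mat_exp (t *\<^sub>R F \<alpha>) $ i $ l) = exp (\<alpha> * x) * mat_exp (t *\<^sub>R F \<alpha>) $ i $ j"
  proof -
    have "exp (\<alpha> * x) * of_bool (l = j) * mat_exp (t *\<^sub>R F \<alpha>) $ i $ l = (if l = j then exp (\<alpha> * x) * mat_exp (t *\<^sub>R F \<alpha>) $ i $ l else 0)" for l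
      by simp
    then show ?thesis by (simp only: sum.delta finite_UNIV) simp
  qed
  ultimately have "(\<Sum>l\<in>UNIV. \<integral>\<omega>. Zext l j (x + X t \<omega>) * of_bool (J t \<omega> = Some l) \<partial>P 0 i)
    = exp (\<alpha> * x) * mat_exp (t *\<^sub>R F \<alpha>) $ i $ j
      - (\<Sum>l\<in>UNIV. \<Sum>m\<in>UNIV. (\<integral>\<omega>. kappa l m (x + X t \<omega>) * of_bool (J t \<omega> = Some l) \<partial>P 0 i) * F \<alpha> $ m $ j)"
    by (simp only: sum_subtractf)
  also have "(\<Sum>l\<in>UNIV. \<Sum>m\<in>UNIV. (\<integral>\<omega>. kappa l m (x + X t \<omega>) * of_bool (J t \<omega> = Some l) \<partial>P 0 i) * F \<alpha> $ m $ j)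
    = (\<Sum>m\<in>UNIV. (\<Sum>l\<in>UNIV. \<integral>\<omega>. kappa l m (x + X t \<omega>) * of_bool (J t \<omega> = Some l) \<partial>P 0 i) * F \<alpha> $ m $ j)"
    by (subst sum.swap) (simp add: sum_distrib_right)
  also have "\<dots> = (\<Sum>m\<in>UNIV. (kappa i m x + B m) * F \<alpha> $ m $ j)"
    by (simp add: scale_identity[OF t] B_def)
  also have "mat_exp (t *\<^sub>R F \<alpha>) $ i $ j = of_bool (i = j) + (\<Sum>l\<in>UNIV. S l * F \<alpha> $ l $ j)"
    using integral_mat_exp_mult[OF t, of "F \<alpha>" i j] by (simp add: S_def mat_def)
  also have "exp (\<alpha> * x) * (of_bool (i = j) + (\<Sum>l\<in>UNIV. S l * F \<alpha> $ l $ j)) - (\<Sum>m\<in>UNIV. (kappa i m x + B m) * F \<alpha> $ m $ j)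
    = Zext i j x + (\<Sum>l\<in>UNIV. (exp (\<alpha> * x) * S l - B l) * F \<alpha> $ l $ j)"
    by (simp add: Zext_def algebra_simps sum_distrib_left sum.distrib sum_subtractf)
  also have "\<dots> = Zext i j x + (\<Sum>l\<in>UNIV. D l * F \<alpha> $ l $ j)"
    by (simp add: DB[symmetric])
  finally show ?thesis by (simp add: D_def)
qed

definition defect :: "real \<Rightarrow> 'n \<Rightarrow> 'n \<Rightarrow> real \<Rightarrow> real" where
  "defect t i j y = (\<Sum>l\<in>UNIV. \<integral>\<omega>. Zext l j (y + X t \<omega>) * of_bool (J t \<omega> = Some l) \<partial>P 0 i) - Zext i j y"

text \<open>Taken in \<open>ennreal\<close> so that errors can be added and integrated by Tonelli
  without any integrability side conditions.\<close>

definition low_time :: "real \<Rightarrow> 'n \<Rightarrow> real \<Rightarrow> ennreal" where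
  "low_time t i y = (\<integral>\<^sup>+s. (\<integral>\<^sup>+\<omega>. of_bool (y + Xj s \<omega> \<le> 0 \<and> Jj s \<omega> \<noteq> None) \<partial>P 0 i) * indicator {0..t} s \<partial>lborel)"

text \<open>On the nonpositive half line the weight \<open>exp (\<alpha> * y)\<close> is at most 1,
  so each occupation integral is bounded by time alone; the entries of \<open>F \<alpha>\<close>
  contribute the constant.\<close>

lemma defect_le_low_time:
  assumes t: "0 \<le> t"
  shows "ennreal \<bar>defect t i j y\<bar> \<le> ennreal (entry_sum (F \<alpha>)) * low_time t i y"
proof -
  interpret L: pair_sigma_finite lborel "P 0 i" ..
  define D where "D l = (\<integral>z. exp (\<alpha> * (y + Xj (fst z) (snd z))) * of_bool (y + Xj (fst z) (snd z) \<le> 0) * occ_weight t l z \<partial>occ_measure i)" for l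
  have "ennreal \<bar>D l\<bar> \<le> low_time t i y" for l
  proof -
    have "ennreal \<bar>D l\<bar> \<le> (\<integral>\<^sup>+z. ennreal (norm (exp (\<alpha> * (y + Xj (fst z) (snd z))) * of_bool (y + Xj (fst z) (snd z) \<le> 0) * occ_weight t l z)) \<partial>occ_measure i)"
      unfolding D_def real_norm_def[symmetric] by (intro integral_norm_bound_ennreal integrable_occ) measurable
    also have "\<dots> \<le> (\<integral>\<^sup>+z. of_bool (y + Xj (fst z) (snd z) \<le> 0 \<and> Jj (fst z) (snd z) \<noteq> None) * indicator {0..t} (fst z) \<partial>occ_measure i)"
      by (intro nn_integral_mono) (auto simp: occ_weight_def mult_nonneg_nonpos alpha_nonneg split: split_indicator)
    also have "\<dots> = (\<integral>\<^sup>+s. (\<integral>\<^sup>+\<omega>. of_bool (y + Xj s \<omega> \<le> 0 \<and> Jj s \<omega> \<noteq> None) * indicator {0..t} s \<partial>P 0 i) \<partial>lborel)"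
      by (subst P.nn_integral_fst[symmetric]) auto
    also have "\<dots> = low_time t i y" unfolding low_time_def by (simp add: nn_integral_multc)
    finally show ?thesis .
  qed
  then have D: "ennreal (\<bar>D l\<bar> * c) \<le> ennreal c * low_time t i y" if "c \<ge> 0" for l c
    using that by (simp add: ennreal_mult' mult.commute mult_left_mono)
  have "\<bar>defect t i j y\<bar> \<le> (\<Sum>l\<in>UNIV. \<bar>D l\<bar> * \<bar>F \<alpha> $ l $ j\<bar>)"
    unfolding defect_def Zext_identity[OF t] D_def[symmetric]
    using sum_abs[of "\<lambda>l. D l * F \<alpha> $ l $ j" UNIV] by (simp add: abs_mult)
  then have "ennreal \<bar>defect t i j y\<bar> \<le> ennreal (\<Sum>l\<in>UNIV. \<bar>D l\<bar> * \<bar>F \<alpha> $ l $ j\<bar>)" by (rule ennreal_leI)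
  also have "\<dots> = (\<Sum>l\<in>UNIV. ennreal (\<bar>D l\<bar> * \<bar>F \<alpha> $ l $ j\<bar>))" by (rule sum_ennreal[symmetric]) simp
  also have "\<dots> \<le> (\<Sum>l\<in>UNIV. ennreal \<bar>F \<alpha> $ l $ j\<bar> * low_time t i y)" by (intro sum_mono D) simp
  also have "\<dots> = ennreal (\<Sum>l\<in>UNIV. \<bar>F \<alpha> $ l $ j\<bar>) * low_time t i y"
    by (simp add: sum_distrib_right[symmetric])
  also have "\<dots> \<le> ennreal (entry_sum (F \<alpha>)) * low_time t i y"
    by (intro mult_right_mono ennreal_leI column_sum_le_entry_sum) simp
  finally show ?thesis .
qed

text \<open>Expanding the square gives exponential moments at \<open>2 * beta\<close>,
  \<open>beta\<close> and 0 with coefficients 1, -2 and 1. These coefficients sum to 0, so the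
  identity matrices cancel and only deviations of order \<open>h\<close> remain.\<close>

lemma exp_increment_variance:
  "\<exists>C\<ge>0. \<forall>h i j. 0 \<le> h \<longrightarrow> h \<le> 1 \<longrightarrow>
     has_bochner_integral (P 0 i) (\<lambda>\<omega>. (exp (beta * X h \<omega>) - 1)\<^sup>2 * of_bool (J h \<omega> = Some j))
       (mat_exp (h *\<^sub>R F (2 * beta)) $ i $ j - 2 * mat_exp (h *\<^sub>R F beta) $ i $ j + mat_exp (h *\<^sub>R F 0) $ i $ j)
     \<and> mat_exp (h *\<^sub>R F (2 * beta)) $ i $ j - 2 * mat_exp (h *\<^sub>R F beta) $ i $ j + mat_exp (h *\<^sub>R F 0) $ i $ j \<le> C * h"
proof -
  obtain C2 where C2: "\<And>t i j. 0 \<le> t \<Longrightarrow> t \<le> 1 \<Longrightarrow> \<bar>mat_exp (t *\<^sub>R F (2 * beta)) $ i $ j - mat 1 $ i $ j\<bar> \<le> C2 * t" "C2 \<ge> 0"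
    using mat_exp_diff_le by metis
  obtain C1 where C1: "\<And>t i j. 0 \<le> t \<Longrightarrow> t \<le> 1 \<Longrightarrow> \<bar>mat_exp (t *\<^sub>R F beta) $ i $ j - mat 1 $ i $ j\<bar> \<le> C1 * t" "C1 \<ge> 0"
    using mat_exp_diff_le by metis
  obtain C0 where C0: "\<And>t i j. 0 \<le> t \<Longrightarrow> t \<le> 1 \<Longrightarrow> \<bar>mat_exp (t *\<^sub>R F 0) $ i $ j - mat 1 $ i $ j\<bar> \<le> C0 * t" "C0 \<ge> 0"
    using mat_exp_diff_le by metis
  show ?thesis
  proof (intro exI[of _ "C2 + 2 * C1 + C0"] conjI allI impI)
    show "C2 + 2 * C1 + C0 \<ge> 0" using C2 C1 C0 by simp
    fix h :: real and i j assume h: "0 \<le> h" "h \<le> 1"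
    have "has_bochner_integral (P 0 i) (\<lambda>\<omega>. exp ((2 * beta) * X h \<omega>) * of_bool (J h \<omega> = Some j)
        - 2 * (exp (beta * X h \<omega>) * of_bool (J h \<omega> = Some j)) + exp (0 * X h \<omega>) * of_bool (J h \<omega> = Some j))
       (mat_exp (h *\<^sub>R F (2 * beta)) $ i $ j - 2 * mat_exp (h *\<^sub>R F beta) $ i $ j + mat_exp (h *\<^sub>R F 0) $ i $ j)"
      using beta(3) h by (intro has_bochner_integral_add has_bochner_integral_diff has_bochner_integral_mult_right exp_moment) auto
    then show "has_bochner_integral (P 0 i) (\<lambda>\<omega>. (exp (beta * X h \<omega>) - 1)\<^sup>2 * of_bool (J h \<omega> = Some j))
       (mat_exp (h *\<^sub>R F (2 * beta)) $ i $ j - 2 * mat_exp (h *\<^sub>R F beta) $ i $ j + mat_exp (h *\<^sub>R F 0) $ i $ j)"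
      by (rule has_bochner_integral_cong[THEN iffD1, rotated -1])
        (auto simp: power2_eq_square algebra_simps exp_add[symmetric])
    have "mat_exp (h *\<^sub>R F (2 * beta)) $ i $ j - 2 * mat_exp (h *\<^sub>R F beta) $ i $ j + mat_exp (h *\<^sub>R F 0) $ i $ j
       \<le> C2 * h + 2 * (C1 * h) + C0 * h"
      using C2(1)[OF h, of i j] C1(1)[OF h, of i j] C0(1)[OF h, of i j] by linarith
    then show "mat_exp (h *\<^sub>R F (2 * beta)) $ i $ j - 2 * mat_exp (h *\<^sub>R F beta) $ i $ j + mat_exp (h *\<^sub>R F 0) $ i $ j
       \<le> (C2 + 2 * C1 + C0) * h" by (simp add: algebra_simps)
  qed
qed

end

section \<open>First passage along dyadic grids\<close>

context spectrally_negative_MAP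
begin

section \<open>Upward oscillation of paths and the regulator\<close>

text \<open>To the right of \<open>s\<close> the path is close to \<open>X s\<close>, to the left
  close to a limit \<open>L\<close> with \<open>X s \<le> L\<close>. Hence a pair of times that
  straddles \<open>s\<close> can only show a substantial drop, never a substantial rise.\<close>

lemma local_upward_oscillation:
  assumes \<omega>: "\<omega> \<in> space \<Omega>" and alive: "J t \<omega> \<noteq> None" and s: "0 \<le> s" "s \<le> t" and \<eta>: "\<eta> > 0"
  shows "\<exists>e>0. \<forall>u v. 0 \<le> u \<longrightarrow> u \<le> v \<longrightarrow> \<bar>u - s\<bar> < e \<longrightarrow> \<bar>v - s\<bar> < e \<longrightarrow> X v \<omega> - X u \<omega> \<le> \<eta>"
proof -
  have as: "J s \<omega> \<noteq> None" using J_alive[OF \<omega> alive s] .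
  obtain d1 where d1: "d1 > 0" "\<And>r. s \<le> r \<Longrightarrow> r < s + d1 \<Longrightarrow> \<bar>X r \<omega> - X s \<omega>\<bar> < \<eta> / 2"
    using X_right_contE[OF \<omega> s(1) as, of "\<eta> / 2"] \<eta> by auto
  show ?thesis
  proof (cases "s = 0")
    case True
    show ?thesis
    proof (intro exI[of _ d1] conjI allI impI)
      fix u v assume "0 \<le> u" "u \<le> v" "\<bar>u - s\<bar> < d1" "\<bar>v - s\<bar> < d1"
      then show "X v \<omega> - X u \<omega> \<le> \<eta>" using d1(2)[of u] d1(2)[of v] True unfolding abs_less_iff by linarith
    qed (rule d1)
  next
    case False
    then obtain L where L: "((\<lambda>r. X r \<omega>) \<longlongrightarrow> L) (at_left s)" "X s \<omega> \<le> L"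
      using X_left_limit[OF \<omega> _ as] s by auto
    have "eventually (\<lambda>r. dist (X r \<omega>) L < \<eta> / 2) (at_left s)"
      using L(1) \<eta> by (intro tendstoD) auto
    then obtain b where b: "b < s" "\<And>r. b < r \<Longrightarrow> r < s \<Longrightarrow> dist (X r \<omega>) L < \<eta> / 2"
      unfolding eventually_at_left_field by blast
    show ?thesis
    proof (intro exI[of _ "min d1 (s - b)"] conjI allI impI)
      show "0 < min d1 (s - b)" using b d1 by simp
      fix u v assume uv: "0 \<le> u" "u \<le> v" "\<bar>u - s\<bar> < min d1 (s - b)" "\<bar>v - s\<bar> < min d1 (s - b)"
      have r: "\<bar>X r \<omega> - X s \<omega>\<bar> < \<eta> / 2" if "s \<le> r" "\<bar>r - s\<bar> < min d1 (s - b)" for r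
        using d1(2)[of r] that by auto
      have l: "\<bar>X r \<omega> - L\<bar> < \<eta> / 2" if "r < s" "\<bar>r - s\<bar> < min d1 (s - b)" for r
        using b(2)[of r] that by (auto simp: dist_real_def)
      consider "s \<le> u" | "u < s" "s \<le> v" | "v < s" by linarith
      then show "X v \<omega> - X u \<omega> \<le> \<eta>"
      proof cases
        case 1 then show ?thesis using r[of u] r[of v] uv by linarith
      next
        case 2 then show ?thesis using l[of u] r[of v] uv L(2) by linarith
      next
        case 3 then show ?thesis using l[of u] l[of v] uv by linarith
      qed
    qed
  qed
qed

text \<open>A one-sided modulus of continuity, from the local version and a Lebesgue number of the
  compact interval. This is the form in which the absence of positive jumps is used: for boundedness
  from below, for climbing in small steps and for passage without overshoot.\<close>

lemma upward_oscillation: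
  assumes \<omega>: "\<omega> \<in> space \<Omega>" and alive: "J t \<omega> \<noteq> None" and \<eta>: "\<eta> > 0"
  obtains d where "d > 0" "\<And>u v. 0 \<le> u \<Longrightarrow> u \<le> v \<Longrightarrow> v \<le> t \<Longrightarrow> v - u < d \<Longrightarrow> X v \<omega> - X u \<omega> \<le> \<eta>"
proof -
  let ?G = "{G. open G \<and> (\<forall>u v. u \<in> G \<longrightarrow> v \<in> G \<longrightarrow> 0 \<le> u \<longrightarrow> u \<le> v \<longrightarrow> X v \<omega> - X u \<omega> \<le> \<eta>)}"
  have "{0..t} \<subseteq> \<Union>?G"
  proof
    fix s assume "s \<in> {0..t}"
    then obtain e where e: "e > 0" "\<forall>u v. 0 \<le> u \<longrightarrow> u \<le> v \<longrightarrow> \<bar>u - s\<bar> < e \<longrightarrow> \<bar>v - s\<bar> < e \<longrightarrow> X v \<omega> - X u \<omega> \<le> \<eta>"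
      using local_upward_oscillation[OF \<omega> alive _ _ \<eta>, of s] by auto
    have "ball s e \<in> ?G" using e(2) by (auto simp: dist_real_def abs_minus_commute)
    then show "s \<in> \<Union>?G" using e(1) by (intro UnionI[of "ball s e"]) auto
  qed
  then obtain d where d: "0 < d" "\<And>x. x \<in> {0..t} \<Longrightarrow> \<exists>G \<in> ?G. ball x d \<subseteq> G"
  proof (rule Heine_Borel_lemma[OF compact_Icc])
    fix e assume "0 < e" "\<And>x. x \<in> {0..t} \<Longrightarrow> \<exists>G \<in> ?G. ball x e \<subseteq> G"
    then show thesis by (rule that)
  qed simp
  show ?thesis
  proof (rule that[OF d(1)])
    fix u v assume uv: "0 \<le> u" "u \<le> v" "v \<le> t" "v - u < d"
    then obtain G where G: "G \<in> ?G" "ball u d \<subseteq> G" using d(2)[of u] by auto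
    have "u \<in> G" "v \<in> G" using G(2) uv d(1) by (auto simp: dist_real_def subset_iff)
    then show "X v \<omega> - X u \<omega> \<le> \<eta>" using G(1) uv by blast
  qed
qed

text \<open>It makes the infimum in \<open>refl_R\<close> a genuine one, since \<open>Inf\<close> of
  an unbounded set of reals carries no information.\<close>

lemma X_bounded_below:
  assumes \<omega>: "\<omega> \<in> space \<Omega>" and alive: "J t \<omega> \<noteq> None"
  shows "bdd_below ((\<lambda>s. X s \<omega>) ` {0..t})"
proof -
  obtain d where d: "d > 0" "\<And>u v. 0 \<le> u \<Longrightarrow> u \<le> v \<Longrightarrow> v \<le> t \<Longrightarrow> v - u < d \<Longrightarrow> X v \<omega> - X u \<omega> \<le> 1"
    using upward_oscillation[OF \<omega> alive, of 1] by auto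
  \<comment> \<open>Going back in time by \<open>d / 2\<close> lowers the path by at most 1, so the
    bound is obtained by counting steps back from \<open>t\<close>.\<close>
  have *: "X t \<omega> - real n \<le> X s \<omega>" if "0 \<le> s" "s \<le> t" "t - s \<le> real n * (d / 2)" for n s
    using that
  proof (induction n arbitrary: s)
    case 0 then show ?case by simp
  next
    case (Suc n)
    let ?s = "min t (s + d / 2)"
    have "X t \<omega> - real n \<le> X ?s \<omega>"
      using Suc.prems d(1) by (intro Suc.IH) (auto simp: min_def algebra_simps)
    moreover have "X ?s \<omega> - X s \<omega> \<le> 1" using Suc.prems d(1) by (intro d(2)) auto
    ultimately show ?case by simp
  qed
  obtain n where n: "t < real n * (d / 2)" using d(1) reals_Archimedean3[of "d / 2"] by auto
  have "X t \<omega> - real n \<le> X s \<omega>" if "s \<in> {0..t}" for s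
    using that n by (intro *) auto
  then show ?thesis by (intro bdd_belowI2) auto
qed

lemma refl_R_nonneg: "0 \<le> refl_R X t \<omega>"
  by (simp add: refl_R_def)

lemma refl_R_ge:
  assumes "\<omega> \<in> space \<Omega>" "J t \<omega> \<noteq> None" "0 \<le> s" "s \<le> t"
  shows "- X s \<omega> \<le> refl_R X t \<omega>"
proof -
  have "(INF s\<in>{0..t}. X s \<omega>) \<le> X s \<omega>"
    using assms by (intro cINF_lower X_bounded_below) auto
  then show ?thesis by (simp add: refl_R_def min_def)
qed

lemma refl_R_approx:
  assumes "0 \<le> t" "e > 0" "refl_R X t \<omega> \<noteq> 0"
  obtains s where "0 \<le> s" "s \<le> t" "refl_R X t \<omega> < - X s \<omega> + e"
proof -
  have neg: "refl_R X t \<omega> = - (INF s\<in>{0..t}. X s \<omega>)"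
    using assms(3) by (auto simp: refl_R_def min_def)
  have lt: "Inf ((\<lambda>s. X s \<omega>) ` {0..t}) < (INF s\<in>{0..t}. X s \<omega>) + e" using assms(2) by simp
  have ne: "(\<lambda>s. X s \<omega>) ` {0..t} \<noteq> {}" using assms(1) by simp
  from cInf_lessD[OF ne lt] obtain y where "y \<in> (\<lambda>s. X s \<omega>) ` {0..t}" "y < (INF s\<in>{0..t}. X s \<omega>) + e" ..
  then show ?thesis using that neg by auto
qed

end

text \<open>Skorokhod reflection of the skeleton of the path on the grid of mesh \<open>1 / 2 ^ n\<close>.\<close>

primrec grid_R :: "(real \<Rightarrow> 'w \<Rightarrow> real) \<Rightarrow> nat \<Rightarrow> nat \<Rightarrow> 'w \<Rightarrow> real" where
  "grid_R X n 0 \<omega> = max 0 (- X 0 \<omega>)"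
| "grid_R X n (Suc k) \<omega> = max (grid_R X n k \<omega>) (- X (real (Suc k) / 2 ^ n) \<omega>)"

definition grid_Y :: "(real \<Rightarrow> 'w \<Rightarrow> real) \<Rightarrow> nat \<Rightarrow> nat \<Rightarrow> 'w \<Rightarrow> real" where
  "grid_Y X n k \<omega> = X (real k / 2 ^ n) \<omega> + grid_R X n k \<omega>"

text \<open>The first index at which \<open>grid_Y\<close> exceeds \<open>a\<close>, capped at the
  current one. The recursive form lets the stopped value change from one index to the next only
  while the level has not been exceeded.\<close>

primrec grid_stop :: "(real \<Rightarrow> 'w \<Rightarrow> real) \<Rightarrow> real \<Rightarrow> nat \<Rightarrow> nat \<Rightarrow> 'w \<Rightarrow> nat" where
  "grid_stop X a n 0 \<omega> = 0"
| "grid_stop X a n (Suc k) \<omega> = (if \<forall>j\<le>k. grid_Y X n j \<omega> \<le> a then Suc k else grid_stop X a n k \<omega>)"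

lemma grid_R_nonneg: "0 \<le> grid_R X n k \<omega>"
  by (induction k) auto

lemma grid_R_ge: "j \<le> k \<Longrightarrow> - X (real j / 2 ^ n) \<omega> \<le> grid_R X n k \<omega>"
  by (induction k) (auto simp: le_Suc_eq max.coboundedI1)

lemma grid_R_le:
  assumes "0 \<le> c" "\<And>j. j \<le> k \<Longrightarrow> - X (real j / 2 ^ n) \<omega> \<le> c"
  shows "grid_R X n k \<omega> \<le> c"
  using assms(2)
proof (induction k)
  case 0 then show ?case using assms(1) 0[of 0] by simp
next
  case (Suc k)
  then have "grid_R X n k \<omega> \<le> c" by simp
  then show ?case using Suc.prems[of "Suc k"] by simp
qed

text \<open>Lindley's recursion for the reflected walk.\<close>

lemma grid_Y_Suc:
  "grid_Y X n (Suc k) \<omega> = max 0 (grid_Y X n k \<omega> + (X (real (Suc k) / 2 ^ n) \<omega> - X (real k / 2 ^ n) \<omega>))"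
  by (simp add: grid_Y_def max_def del: of_nat_Suc)

lemma grid_Y_0: "0 \<le> X 0 \<omega> \<Longrightarrow> grid_Y X n 0 \<omega> = X 0 \<omega>"
  by (simp add: grid_Y_def)

text \<open>Index \<open>k\<close> at mesh \<open>1 / 2 ^ n\<close> is index
  \<open>k * 2 ^ j\<close> at the finer mesh, where the regulator is a maximum over more points. An
  exceedance detected on one grid is thus never lost on a finer one.\<close>

lemma grid_Y_refine:
  "grid_Y X n k \<omega> \<le> grid_Y X (n + j) (k * 2 ^ j) \<omega>"
proof -
  have "grid_R X n k \<omega> \<le> grid_R X (n + j) (k * 2 ^ j) \<omega>"
  proof (rule grid_R_le[OF grid_R_nonneg])
    fix i assume "i \<le> k"
    then have "- X (real (i * 2 ^ j) / 2 ^ (n + j)) \<omega> \<le> grid_R X (n + j) (k * 2 ^ j) \<omega>"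
      by (intro grid_R_ge) simp
    then show "- X (real i / 2 ^ n) \<omega> \<le> grid_R X (n + j) (k * 2 ^ j) \<omega>"
      by (simp add: power_add)
  qed
  then show ?thesis by (simp add: grid_Y_def power_add)
qed

lemma grid_stop_no: "(\<And>j. j < k \<Longrightarrow> grid_Y X n j \<omega> \<le> a) \<Longrightarrow> grid_stop X a n k \<omega> = k"
  by (cases k) (auto simp: less_Suc_eq_le)

lemma grid_stop_first:
  assumes "grid_Y X n k \<omega> > a" "\<And>j. j < k \<Longrightarrow> grid_Y X n j \<omega> \<le> a" "k \<le> N"
  shows "grid_stop X a n N \<omega> = k"
  using assms(3)
proof (induction N rule: dec_induct)
  case base show ?case using assms(2) by (rule grid_stop_no)
next
  case (step N)
  then have "\<not> (\<forall>j\<le>N. grid_Y X n j \<omega> \<le> a)" using assms(1) by (auto simp: not_le)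
  then show ?case using step by simp
qed

lemma grid_stop_cases:
  obtains "grid_stop X a n N \<omega> = N" "\<And>j. j < N \<Longrightarrow> grid_Y X n j \<omega> \<le> a"
  | "grid_stop X a n N \<omega> < N" "grid_Y X n (grid_stop X a n N \<omega>) \<omega> > a" "\<And>j. j < grid_stop X a n N \<omega> \<Longrightarrow> grid_Y X n j \<omega> \<le> a"
proof (cases "\<forall>j<N. grid_Y X n j \<omega> \<le> a")
  case True
  then show ?thesis using that(1) grid_stop_no[of N X n \<omega> a] by auto
next
  case False
  define k where "k = (LEAST j. grid_Y X n j \<omega> > a)"
  from False obtain i where i: "i < N" "grid_Y X n i \<omega> > a" by (auto simp: not_le)
  have k: "grid_Y X n k \<omega> > a" unfolding k_def by (rule LeastI[of _ i]) (rule i)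
  have kl: "grid_Y X n j \<omega> \<le> a" if "j < k" for j
    using not_less_Least[of j "\<lambda>j. grid_Y X n j \<omega> > a"] that by (auto simp: k_def not_less)
  have kN: "k < N" using Least_le[of "\<lambda>j. grid_Y X n j \<omega> > a" i] i by (simp add: k_def)
  have "grid_stop X a n N \<omega> = k" using k kl kN by (intro grid_stop_first) auto
  then show ?thesis using that(2) k kl kN by simp
qed

context spectrally_negative_MAP
begin

section \<open>Convergence of the grid data at the first passage\<close>

lemma grid_R_le_refl_R:
  assumes "\<omega> \<in> space \<Omega>" "J (real k / 2 ^ n) \<omega> \<noteq> None"
  shows "grid_R X n k \<omega> \<le> refl_R X (real k / 2 ^ n) \<omega>"
  using assms by (intro grid_R_le refl_R_nonneg refl_R_ge) (auto intro: divide_right_mono)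

lemma grid_Y_le_refl_Y:
  assumes "\<omega> \<in> space \<Omega>" "J (real k / 2 ^ n) \<omega> \<noteq> None"
  shows "grid_Y X n k \<omega> \<le> refl_Y X (real k / 2 ^ n) \<omega>"
  using grid_R_le_refl_R[OF assms] by (simp add: grid_Y_def refl_Y_def)

lemma next_dyadic_grid:
  assumes "0 \<le> s" obtains k where "next_dyadic n s = real k / 2 ^ n"
proof (rule that[of "nat (\<lfloor>s * 2 ^ n\<rfloor> + 1)"])
  have "0 \<le> \<lfloor>s * 2 ^ n\<rfloor>" using assms by simp
  then show "next_dyadic n s = real (nat (\<lfloor>s * 2 ^ n\<rfloor> + 1)) / 2 ^ n" by (simp add: next_dyadic_def)
qed

lemma next_dyadic_mono: "s \<le> t \<Longrightarrow> next_dyadic n s \<le> next_dyadic n t"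
  unfolding next_dyadic_def by (intro divide_right_mono add_right_mono) (auto intro: floor_mono mult_right_mono)

lemma eventually_X_next_dyadic:
  assumes "\<omega> \<in> space \<Omega>" "0 \<le> s" "J s \<omega> \<noteq> None" "e > 0"
  shows "eventually (\<lambda>n. \<bar>X (next_dyadic n s) \<omega> - X s \<omega>\<bar> < e) sequentially"
  using tendstoD[OF X_next_dyadic_tendsto[OF assms(1-3)] assms(4)] by (simp add: dist_real_def)

text \<open>Dyadic points just to the right of \<open>u\<close> and of a near-minimiser
  \<open>s\<close> reproduce the path value and the regulator by right-continuity. Monotonicity of
  the rounding keeps the image of \<open>s\<close> in the past of that of \<open>u\<close>.\<close>

lemma eventually_grid_exceeds:
  assumes \<omega>: "\<omega> \<in> space \<Omega>" and u: "0 \<le> u" "u < v" and alive: "J u \<omega> \<noteq> None" and Y: "refl_Y X u \<omega> > a"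
  shows "eventually (\<lambda>n. \<exists>k. real k / 2 ^ n < v \<and> J (real k / 2 ^ n) \<omega> \<noteq> None \<and> grid_Y X n k \<omega> > a) sequentially"
proof -
  \<comment> \<open>The excess over \<open>a\<close> is split into four: \<open>e\<close> for the
    path at \<open>u\<close>, \<open>2 * e\<close> for the regulator (near-minimiser and its
    rounding), and \<open>e\<close> to spare.\<close>
  define e where "e = (refl_Y X u \<omega> - a) / 4"
  have e: "e > 0" using Y by (simp add: e_def)
  obtain s where s: "0 \<le> s" "s \<le> u" "refl_R X u \<omega> = 0 \<or> refl_R X u \<omega> < - X s \<omega> + e"
    using refl_R_approx[OF u(1) e, of \<omega>] u(1) by (metis order_refl)
  have as: "J s \<omega> \<noteq> None" by (rule J_alive[OF \<omega> alive s(1,2)])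
  have "eventually (\<lambda>n. next_dyadic n u < v) sequentially"
    using order_tendstoD(2)[OF next_dyadic_tendsto u(2)] .
  moreover note eventually_J_next_dyadic[OF \<omega> u(1)] eventually_X_next_dyadic[OF \<omega> u(1) alive e]
    eventually_X_next_dyadic[OF \<omega> s(1) as e]
  ultimately show ?thesis
  proof eventually_elim
    case (elim n)
    obtain k where k: "next_dyadic n u = real k / 2 ^ n" using next_dyadic_grid[OF u(1)] .
    obtain j where j: "next_dyadic n s = real j / 2 ^ n" using next_dyadic_grid[OF s(1)] .
    have "j \<le> k" using next_dyadic_mono[OF s(2), of n] unfolding j k by (simp add: divide_le_cancel)
    from grid_R_ge[OF this, of X n \<omega>] have R: "- X (next_dyadic n s) \<omega> \<le> grid_R X n k \<omega>" by (simp add: j)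
    have "grid_Y X n k \<omega> = X (next_dyadic n u) \<omega> + grid_R X n k \<omega>" by (simp add: grid_Y_def k)
    moreover have "refl_R X u \<omega> < grid_R X n k \<omega> + 2 * e"
      using s(3) R elim(4) grid_R_nonneg[of X n k \<omega>] e by linarith
    ultimately have "grid_Y X n k \<omega> > X u \<omega> + refl_R X u \<omega> - 3 * e" using elim(3) by linarith
    moreover have "X u \<omega> + refl_R X u \<omega> - 3 * e > a" using e by (simp add: e_def refl_Y_def field_simps)
    ultimately have "grid_Y X n k \<omega> > a" by linarith
    moreover have "J (real k / 2 ^ n) \<omega> \<noteq> None" using elim(2) alive by (simp add: k)
    ultimately show ?case using elim(1) by (auto simp: k)
  qed
qed

text \<open>Passage before time \<open>m\<close> while alive, detected on some grid. Its quantifiers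
  are countable, which makes it measurable; the exceedance set itself ranges over all real
  times.\<close>

definition grid_exceeds :: "real \<Rightarrow> nat \<Rightarrow> 'w \<Rightarrow> bool" where
  "grid_exceeds a m \<omega> \<longleftrightarrow> (\<exists>n k. k < m * 2 ^ n \<and> J (real k / 2 ^ n) \<omega> \<noteq> None \<and> grid_Y X n k \<omega> > a)"

lemma exceed_set_bdd_below: "bdd_below (exceed_set X a \<omega>)"
  by (rule bdd_belowI[of _ 0]) (auto simp: exceed_set_def)

context
  fixes \<omega> a m
  assumes \<omega>: "\<omega> \<in> space \<Omega>" and ex: "grid_exceeds a m \<omega>"
begin

text \<open>Since \<open>grid_Y\<close> never exceeds the true reflected process, grid passage
  cannot precede \<open>T\<close>; since every exceedance is eventually detected, grid passage times
  tend to \<open>T\<close>. They do so from the right, where \<open>J\<close> is locally constant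
  and \<open>X\<close> continuous. The path may jump down at \<open>T\<close>, so the regulator and
  the level are treated separately.\<close>

lemma passage_limit:
  defines "T \<equiv> passage_time X a \<omega>" and "K \<equiv> \<lambda>n. grid_stop X a n (m * 2 ^ n) \<omega>"
  shows "exceed_set X a \<omega> \<noteq> {}" "0 \<le> T" "T < real m" "J T \<omega> \<noteq> None"
    "eventually (\<lambda>n. J (real (K n) / 2 ^ n) \<omega> = J T \<omega>) sequentially"
    "(\<lambda>n. grid_R X n (K n) \<omega>) \<longlonglongrightarrow> refl_R X T \<omega>"
    "0 \<le> X 0 \<omega> \<Longrightarrow> X 0 \<omega> \<le> a \<Longrightarrow> (\<lambda>n. grid_Y X n (K n) \<omega>) \<longlonglongrightarrow> a"
    "eventually (\<lambda>n. K n < m * 2 ^ n) sequentially"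
    "eventually (\<lambda>n. a < grid_Y X n (K n) \<omega>) sequentially"
proof -
  from ex obtain n0 k0 where n0: "k0 < m * 2 ^ n0" "J (real k0 / 2 ^ n0) \<omega> \<noteq> None" "grid_Y X n0 k0 \<omega> > a"
    unfolding grid_exceeds_def by blast
  \<comment> \<open>An exceedance time at which the chain is alive. For fine grids stopping happens
    no later, so the path is regular on the range that matters.\<close>
  define u0 where "u0 = real k0 / 2 ^ n0"
  have u0: "0 \<le> u0" "J u0 \<omega> \<noteq> None" using n0 by (auto simp: u0_def)
  have u0m: "u0 < real m"
  proof -
    have "real k0 < real (m * 2 ^ n0)" using n0(1) by (simp only: of_nat_less_iff)
    then show ?thesis by (simp add: u0_def field_simps)
  qed
  have u0E: "u0 \<in> exceed_set X a \<omega>"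
    using grid_Y_le_refl_Y[OF \<omega>, of k0 n0] n0(2,3) u0 by (auto simp: exceed_set_def u0_def)
  then show ne: "exceed_set X a \<omega> \<noteq> {}" by auto
  have Tu0: "T \<le> u0" unfolding T_def passage_time_def by (rule cInf_lower[OF u0E exceed_set_bdd_below])
  show T0: "0 \<le> T" unfolding T_def passage_time_def
    using ne by (intro cInf_greatest) (auto simp: exceed_set_def)
  show "T < real m" using Tu0 u0m by simp
  show aT: "J T \<omega> \<noteq> None" by (rule J_alive[OF \<omega> u0(2) T0 Tu0])
  define s where "s n = real (K n) / 2 ^ n" for n
  \<comment> \<open>A grid point known to exceed forces the grid to stop there or earlier.\<close>
  have trig: "K n < m * 2 ^ n \<and> grid_Y X n (K n) \<omega> > a \<and> s n \<le> real k / 2 ^ n"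
    if k: "k < m * 2 ^ n" "grid_Y X n k \<omega> > a" for n k
  proof (cases rule: grid_stop_cases[of X a n "m * 2 ^ n" \<omega>])
    case 1 then show ?thesis using k by force
  next
    case 2
    have "K n \<le> k" using 2(3)[of k] k(2) by (auto simp: K_def not_less[symmetric])
    then show ?thesis using 2 by (simp add: K_def s_def divide_right_mono)
  qed
  have trig0: "K n < m * 2 ^ n \<and> grid_Y X n (K n) \<omega> > a \<and> s n \<le> u0" if "n \<ge> n0" for n
  proof -
    obtain j where j: "n = n0 + j" using \<open>n \<ge> n0\<close> le_Suc_ex by blast
    have "k0 * 2 ^ j < m * 2 ^ n" using n0(1) by (simp add: j power_add)
    moreover have "grid_Y X n (k0 * 2 ^ j) \<omega> > a" using grid_Y_refine[of X n0 k0 \<omega> j] n0(3) by (simp add: j)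
    moreover have "real (k0 * 2 ^ j) / 2 ^ n = u0" by (simp add: u0_def j power_add)
    ultimately show ?thesis using trig[of "k0 * 2 ^ j" n] by simp
  qed
  show KN: "eventually (\<lambda>n. K n < m * 2 ^ n) sequentially"
    and Ya: "eventually (\<lambda>n. a < grid_Y X n (K n) \<omega>) sequentially"
    using trig0 by (auto simp: eventually_sequentially)
  have s0: "0 \<le> s n" for n by (simp add: s_def)
  have as: "J (s n) \<omega> \<noteq> None" if "n \<ge> n0" for n
    using trig0[OF that] by (intro J_alive[OF \<omega> u0(2) s0]) auto
  have Ts: "T \<le> s n" if "n \<ge> n0" for n
  proof -
    have "refl_Y X (s n) \<omega> > a"
      using grid_Y_le_refl_Y[OF \<omega>, of "K n" n] as[OF that] trig0[OF that] by (auto simp: s_def)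
    then have "s n \<in> exceed_set X a \<omega>" using s0 by (auto simp: exceed_set_def)
    then show ?thesis unfolding T_def passage_time_def by (rule cInf_lower[OF _ exceed_set_bdd_below])
  qed
  \<comment> \<open>If \<open>T < u0\<close>, there is an exceedance time below
    \<open>min (T + e) u0\<close>, which fine grids detect. If \<open>T = u0\<close>, the bound
    \<open>s n \<le> u0\<close> already suffices.\<close>
  have slim: "eventually (\<lambda>n. s n < T + e) sequentially" if e: "e > 0" for e
  proof (cases "T = u0")
    case True
    then have "s n < T + e" if "n \<ge> n0" for n using trig0[OF that] e by simp
    then show ?thesis by (auto simp: eventually_sequentially)
  next
    case False
    then have "Inf (exceed_set X a \<omega>) < min (T + e) u0" using Tu0 e by (auto simp: T_def passage_time_def)
    then obtain u where u: "u \<in> exceed_set X a \<omega>" "u < T + e" "u < u0"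
      using cInf_lessD[OF ne] by (metis min_less_iff_conj)
    have u': "0 \<le> u" "refl_Y X u \<omega> > a" using u(1) by (auto simp: exceed_set_def)
    have au: "J u \<omega> \<noteq> None" using J_alive[OF \<omega> u0(2) u'(1)] u(3) by simp
    have "u < min (T + e) (real m)" using u u0m by simp
    from eventually_grid_exceeds[OF \<omega> u'(1) this au u'(2)]
    show ?thesis
    proof eventually_elim
      case (elim n)
      then obtain k where k: "real k / 2 ^ n < min (T + e) (real m)" "grid_Y X n k \<omega> > a" by blast
      have "real k < real (m * 2 ^ n)" using k(1) by (simp add: field_simps)
      then have "k < m * 2 ^ n" by (simp only: of_nat_less_iff)
      from trig[OF this k(2)] k(1) show ?case by auto
    qed
  qed
  have nn0: "eventually (\<lambda>n. n \<ge> n0) sequentially" by (rule eventually_ge_at_top)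
  show "eventually (\<lambda>n. J (real (K n) / 2 ^ n) \<omega> = J T \<omega>) sequentially"
  proof -
    obtain e where e: "e > 0" "\<And>r. T \<le> r \<Longrightarrow> r < T + e \<Longrightarrow> J r \<omega> = J T \<omega>"
      using J_right_const[OF \<omega> T0] by blast
    from slim[OF e(1)] nn0 show ?thesis by eventually_elim (auto intro!: e(2) Ts simp: s_def[symmetric])
  qed
  \<comment> \<open>No overshoot in the limit: one index earlier the reflected value is at most
    \<open>a\<close>, and a single increment of a fine grid is at most \<open>e / 2\<close>. The
    starting condition guarantees that there is an earlier index.\<close>
  show "(\<lambda>n. grid_Y X n (K n) \<omega>) \<longlonglongrightarrow> a" if start: "0 \<le> X 0 \<omega>" "X 0 \<omega> \<le> a"
  proof (rule tendstoI)
    fix e :: real assume e: "e > 0"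
    obtain d where d: "d > 0" "\<And>u v. 0 \<le> u \<Longrightarrow> u \<le> v \<Longrightarrow> v \<le> u0 \<Longrightarrow> v - u < d \<Longrightarrow> X v \<omega> - X u \<omega> \<le> e / 2"
      using upward_oscillation[OF \<omega> u0(2), of "e / 2"] e by auto
    have "(\<lambda>n. (1 / 2) ^ n :: real) \<longlonglongrightarrow> 0" by (rule LIMSEQ_realpow_zero) auto
    from order_tendstoD(2)[OF this d(1)] nn0
    show "eventually (\<lambda>n. dist (grid_Y X n (K n) \<omega>) a < e) sequentially"
    proof eventually_elim
      case (elim n)
      have K: "grid_Y X n (K n) \<omega> > a" "s n \<le> u0" using trig0[OF elim(2)] by auto
      have "K n \<noteq> 0"
      proof
        assume "K n = 0"
        with K(1) start grid_Y_0[of X \<omega> n] show False by simp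
      qed
      then obtain k where k: "K n = Suc k" using not0_implies_Suc by blast
      have kl: "grid_Y X n k \<omega> \<le> a"
        using trig0[OF elim(2)] k by (cases rule: grid_stop_cases[of X a n "m * 2 ^ n" \<omega>]) (auto simp: K_def)
      have "real (Suc k) / 2 ^ n - real k / 2 ^ n = (1 / 2) ^ n"
        by (simp add: diff_divide_distrib[symmetric] power_one_over)
      then have "X (real (Suc k) / 2 ^ n) \<omega> - X (real k / 2 ^ n) \<omega> \<le> e / 2"
        using K(2) elim(1) unfolding s_def k by (intro d(2) divide_right_mono) auto
      then have "grid_Y X n (K n) \<omega> \<le> a + e / 2"
        using kl K(1) start unfolding k grid_Y_Suc by auto
      then show ?case using K(1) e by (simp add: dist_real_def)
    qed
  qed
  show "(\<lambda>n. grid_R X n (K n) \<omega>) \<longlonglongrightarrow> refl_R X T \<omega>"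
  proof (rule tendstoI)
    fix e :: real assume e: "e > 0"
    then have e4: "e / 4 > 0" by simp
    obtain d where d: "d > 0" "\<And>r. T \<le> r \<Longrightarrow> r < T + d \<Longrightarrow> \<bar>X r \<omega> - X T \<omega>\<bar> < e / 4"
      using X_right_contE[OF \<omega> T0 aT e4] by blast
    obtain r where r: "0 \<le> r" "r \<le> T" "refl_R X T \<omega> = 0 \<or> refl_R X T \<omega> < - X r \<omega> + e / 4"
      using refl_R_approx[OF T0 e4, of \<omega>] T0 by (metis order_refl)
    have ar: "J r \<omega> \<noteq> None" by (rule J_alive[OF \<omega> aT r(1,2)])
    \<comment> \<open>For \<open>r < T\<close> the near-minimiser is approximated by a dyadic point
      still before \<open>T\<close>. For \<open>r = T\<close> rounding up could pass beyond the
      stopping point, so the stopping point itself takes its role.\<close>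
    have "eventually (\<lambda>n. - X r \<omega> - e / 4 \<le> grid_R X n (K n) \<omega>) sequentially"
    proof (cases "r = T")
      case True
      from slim[OF d(1)] nn0 show ?thesis
      proof eventually_elim
        case (elim n)
        have "\<bar>X (s n) \<omega> - X T \<omega>\<bar> < e / 4" using d(2)[OF Ts[OF elim(2)] elim(1)] .
        moreover have "- X (s n) \<omega> \<le> grid_R X n (K n) \<omega>" unfolding s_def by (rule grid_R_ge) simp
        ultimately show ?case unfolding True by linarith
      qed
    next
      case False
      then have "r < T" using r(2) by simp
      from order_tendstoD(2)[OF next_dyadic_tendsto this] eventually_X_next_dyadic[OF \<omega> r(1) ar e4] nn0
      show ?thesis
      proof eventually_elim
        case (elim n)
        obtain j where j: "next_dyadic n r = real j / 2 ^ n" using next_dyadic_grid[OF r(1)] .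
        have "real j / 2 ^ n \<le> s n" using elim(1) Ts[OF elim(3)] j by simp
        then have "j \<le> K n" by (simp add: s_def divide_le_cancel)
        from grid_R_ge[OF this, of X n \<omega>] elim(2) show ?case unfolding j by linarith
      qed
    qed
    with slim[OF d(1)] nn0
    show "eventually (\<lambda>n. dist (grid_R X n (K n) \<omega>) (refl_R X T \<omega>) < e) sequentially"
    proof eventually_elim
      case (elim n)
      have "grid_R X n (K n) \<omega> \<le> refl_R X T \<omega> + e / 4"
      proof (rule grid_R_le)
        show "0 \<le> refl_R X T \<omega> + e / 4" using refl_R_nonneg[of T \<omega>] e by simp
        fix j assume "j \<le> K n"
        then have j: "real j / 2 ^ n \<le> s n" unfolding s_def by (intro divide_right_mono) auto
        show "- X (real j / 2 ^ n) \<omega> \<le> refl_R X T \<omega> + e / 4"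
        proof (cases "real j / 2 ^ n \<le> T")
          case True
          then show ?thesis using refl_R_ge[OF \<omega> aT, of "real j / 2 ^ n"] e by simp
        next
          case False
          then have "\<bar>X (real j / 2 ^ n) \<omega> - X T \<omega>\<bar> < e / 4" using j elim(1) by (intro d(2)) auto
          then show ?thesis using refl_R_ge[OF \<omega> aT T0 order_refl] by linarith
        qed
      qed
      moreover have "refl_R X T \<omega> - e / 2 \<le> grid_R X n (K n) \<omega>"
        using r(3) elim(3) grid_R_nonneg[of X n "K n" \<omega>] e by linarith
      ultimately show ?case using e by (simp add: dist_real_def abs_less_iff)
    qed
  qed
qed

end

text \<open>\<open>T\<close> is an infimum and need not be an exceedance time. Right-constancy of
  \<open>J\<close> supplies an exceedance shortly after \<open>T\<close> at which the chain is still
  alive.\<close>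

lemma grid_exceeds_of_passage:
  assumes \<omega>: "\<omega> \<in> space \<Omega>" and ne: "exceed_set X a \<omega> \<noteq> {}" and alive: "J (passage_time X a \<omega>) \<omega> \<noteq> None"
    and m: "passage_time X a \<omega> < real m"
  shows "grid_exceeds a m \<omega>"
proof -
  let ?T = "passage_time X a \<omega>"
  have T0: "0 \<le> ?T" unfolding passage_time_def using ne by (intro cInf_greatest) (auto simp: exceed_set_def)
  obtain e where e: "e > 0" "\<And>r. ?T \<le> r \<Longrightarrow> r < ?T + e \<Longrightarrow> J r \<omega> = J ?T \<omega>"
    using J_right_const[OF \<omega> T0] by blast
  have "Inf (exceed_set X a \<omega>) < min (?T + e) (real m)" using e m by (auto simp: passage_time_def)
  then obtain u where u: "u \<in> exceed_set X a \<omega>" "u < ?T + e" "u < real m"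
    using cInf_lessD[OF ne] by (metis min_less_iff_conj)
  have "?T \<le> u" unfolding passage_time_def by (rule cInf_lower[OF u(1) exceed_set_bdd_below])
  then have au: "J u \<omega> \<noteq> None" using e(2)[of u] u(2) alive by simp
  have u': "0 \<le> u" "refl_Y X u \<omega> > a" using u(1) by (auto simp: exceed_set_def)
  from eventually_grid_exceeds[OF \<omega> u'(1) u(3) au u'(2)]
  obtain n k where k: "real k / 2 ^ n < real m" "J (real k / 2 ^ n) \<omega> \<noteq> None" "grid_Y X n k \<omega> > a"
    by (auto simp: eventually_sequentially)
  have "real k < real (m * 2 ^ n)" using k(1) by (simp add: field_simps)
  then have "k < m * 2 ^ n" by (simp only: of_nat_less_iff)
  then show ?thesis using k unfolding grid_exceeds_def by blast
qed

end

section \<open>Ascents and time reversal\<close>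

lemma (in prob_space) prob_decreasing_INT_le:
  assumes A: "\<And>n. A n \<in> events" "decseq A" and le: "\<And>n. c \<le> prob (A n)"
  shows "c \<le> prob (\<Inter>n. A n)"
proof -
  have "(\<lambda>n. prob (A n)) \<longlonglongrightarrow> prob (\<Inter>n. A n)"
    using A by (intro finite_Lim_measure_decseq) auto
  then show ?thesis by (rule LIMSEQ_le_const) (use le in auto)
qed

lemma ball_atMost_Suc_shift:
  fixes K :: nat
  shows "(\<forall>j\<in>{..Suc K}. A j \<and> (0 < j \<longrightarrow> Q j)) \<longleftrightarrow> A 0 \<and> Q 1 \<and> (\<forall>j\<in>{..K}. A (Suc j) \<and> (0 < j \<longrightarrow> Q (Suc j)))"
proof -
  have "(\<forall>j\<in>{..K}. A (Suc j) \<and> Q (Suc j)) \<longleftrightarrow> Q 1 \<and> (\<forall>j\<in>{..K}. A (Suc j) \<and> (0 < j \<longrightarrow> Q (Suc j)))"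
  proof
    assume h: "\<forall>j\<in>{..K}. A (Suc j) \<and> Q (Suc j)"
    then show "Q 1 \<and> (\<forall>j\<in>{..K}. A (Suc j) \<and> (0 < j \<longrightarrow> Q (Suc j)))" using h[THEN bspec, of 0] by simp
  next
    assume h: "Q 1 \<and> (\<forall>j\<in>{..K}. A (Suc j) \<and> (0 < j \<longrightarrow> Q (Suc j)))"
    show "\<forall>j\<in>{..K}. A (Suc j) \<and> Q (Suc j)"
    proof
      fix j assume "j \<in> {..K}" then show "A (Suc j) \<and> Q (Suc j)" using h by (cases j) auto
    qed
  qed
  then show ?thesis by (simp add: atMost_Suc_eq_insert_0)
qed

lemma ball_atMost_Suc_last:
  fixes K :: nat
  shows "(\<forall>j\<in>{..Suc K}. A j \<and> (j < Suc K \<longrightarrow> Q j)) \<longleftrightarrow> A (Suc K) \<and> Q K \<and> (\<forall>j\<in>{..K}. A j \<and> (j < K \<longrightarrow> Q j))"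
  by (auto simp: atMost_Suc less_Suc_eq)

context spectrally_negative_MAP
begin

section \<open>The Markov property for events on a grid\<close>

lemma markov_prob:
  assumes "0 \<le> t" "\<And>l. l < m \<Longrightarrow> 0 \<le> u l \<and> u l \<le> t" "\<And>l. l < n \<Longrightarrow> 0 \<le> s l"
    and A: "A \<in> sets (past_algebra u m)" and B: "B \<in> sets (fd_space n)"
  shows "measure (P x i) {\<omega>\<in>space \<Omega>. \<omega> \<in> A \<and> J t \<omega> = Some k \<and> shift_path X J t s n \<omega> \<in> B}
       = measure (P x i) {\<omega>\<in>space \<Omega>. \<omega> \<in> A \<and> J t \<omega> = Some k}
         * measure (P 0 k) {\<omega>\<in>space \<Omega>. shift_path X J 0 s n \<omega> \<in> B}"
proof -
  from A obtain C where C: "C \<in> sets (fd_space m)" "A = past_path X J u m -` C \<inter> space \<Omega>"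
    unfolding past_algebra_def sets_vimage_algebra2[OF past_path_in_space] by blast
  have "\<omega> \<in> A \<longleftrightarrow> past_path X J u m \<omega> \<in> C" if "\<omega> \<in> space \<Omega>" for \<omega> using C(2) that by auto
  then show ?thesis using markov_set[OF assms(1-3) C(1) B, where x = x and i = i and k = k] by (simp cong: conj_cong)
qed

lemma markov_prob_now:
  assumes "0 \<le> t" "\<And>l. l < n \<Longrightarrow> 0 \<le> s l" and B: "B \<in> sets (fd_space n)"
  shows "measure (P x i) {\<omega>\<in>space \<Omega>. J t \<omega> = Some k \<and> shift_path X J t s n \<omega> \<in> B}
       = measure (P x i) {\<omega>\<in>space \<Omega>. J t \<omega> = Some k}
         * measure (P 0 k) {\<omega>\<in>space \<Omega>. shift_path X J 0 s n \<omega> \<in> B}"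
  using markov_prob[where t = t and m = 0 and u = "\<lambda>_. 0" and n = n and s = s and A = "space \<Omega>" and B = B and x = x and i = i and k = k] assms sets.top[of "past_algebra (\<lambda>_. 0) 0"]
  by (simp cong: conj_cong)

lemma markov_prob_now_le:
  assumes "0 \<le> t" "\<And>l. l < n \<Longrightarrow> 0 \<le> s l" and B: "B \<in> sets (fd_space n)"
  shows "measure (P x i) {\<omega>\<in>space \<Omega>. J t \<omega> = Some k \<and> shift_path X J t s n \<omega> \<in> B}
       \<le> measure (P 0 k) {\<omega>\<in>space \<Omega>. shift_path X J 0 s n \<omega> \<in> B}"
  using markov_prob_now[OF assms, where x = x and i = i and k = k] by (simp add: mult_left_le_one_le)

definition grid_algebra :: "nat \<Rightarrow> nat \<Rightarrow> 'w measure" where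
  "grid_algebra n k = past_algebra (\<lambda>l. real l / 2 ^ n) (Suc k)"

lemma space_grid_algebra [simp]: "space (grid_algebra n k) = space \<Omega>"
  by (simp add: grid_algebra_def)

lemma grid_algebra_X [measurable (raw)]: "j \<le> k \<Longrightarrow> X (real j / 2 ^ n) \<in> borel_measurable (grid_algebra n k)"
  unfolding grid_algebra_def using past_algebra_X[of j "Suc k" "\<lambda>l. real l / 2 ^ n"] by simp

lemma grid_algebra_J [measurable (raw)]: "j \<le> k \<Longrightarrow> J (real j / 2 ^ n) \<in> measurable (grid_algebra n k) (count_space UNIV)"
  unfolding grid_algebra_def using past_algebra_J[of j "Suc k" "\<lambda>l. real l / 2 ^ n"] by simp

lemma sets_grid_algebra_subset: "A \<in> sets (grid_algebra n k) \<Longrightarrow> A \<in> sets \<Omega>"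
  unfolding grid_algebra_def using sets_past_algebra_subset by blast

text \<open>\<open>Suc K\<close> coordinates: the offsets \<open>0 / 2 ^ n\<close> to
  \<open>K / 2 ^ n\<close>, both ends included.\<close>

abbreviation gshift :: "nat \<Rightarrow> nat \<Rightarrow> real \<Rightarrow> 'w \<Rightarrow> nat \<Rightarrow> real \<times> 'n option" where
  "gshift n K t \<equiv> shift_path X J t (\<lambda>l. real l / 2 ^ n) (Suc K)"

lemma gshift_apply:
  "j \<le> K \<Longrightarrow> gshift n K t \<omega> j = (if J (t + real j / 2 ^ n) \<omega> = None then 0 else X (t + real j / 2 ^ n) \<omega> - X t \<omega>, J (t + real j / 2 ^ n) \<omega>)"
  by (simp add: shift_path_def)

lemma markov_grid:
  assumes A: "A \<in> sets (grid_algebra n k)" and B: "B \<in> sets (fd_space (Suc K))"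
  shows "measure (P x i) {\<omega>\<in>space \<Omega>. \<omega> \<in> A \<and> J (real k / 2 ^ n) \<omega> = Some l \<and> gshift n' K (real k / 2 ^ n) \<omega> \<in> B}
       = measure (P x i) {\<omega>\<in>space \<Omega>. \<omega> \<in> A \<and> J (real k / 2 ^ n) \<omega> = Some l}
         * measure (P 0 l) {\<omega>\<in>space \<Omega>. gshift n' K 0 \<omega> \<in> B}"
  using A B unfolding grid_algebra_def by (intro markov_prob) (auto intro: divide_right_mono)

section \<open>Ascents while the chain stays in one state\<close>

definition stays :: "nat \<Rightarrow> 'n \<Rightarrow> 'w \<Rightarrow> bool" where
  "stays r i \<omega> \<longleftrightarrow> (\<forall>n. \<forall>j\<in>{..2 ^ n}. J (real j / 2 ^ (r + n)) \<omega> = Some i)"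

lemma pred_stays [measurable]: "Measurable.pred \<Omega> (stays r i)"
  unfolding stays_def by measurable

text \<open>The chain is constant on some random interval to the right of 0, and the events decrease
  with the window.\<close>

lemma prob_not_stays_tendsto_0:
  "(\<lambda>r. measure (P 0 i) {\<omega>\<in>space \<Omega>. \<not> stays r i \<omega>}) \<longlonglongrightarrow> 0"
proof -
  define H where "H r = {\<omega>\<in>space \<Omega>. \<not> stays r i \<omega>}" for r
  have [measurable]: "H r \<in> sets \<Omega>" for r unfolding H_def by measurable
  have "stays (Suc r) i \<omega>" if "stays r i \<omega>" for r \<omega>
    unfolding stays_def
  proof (intro allI ballI)
    fix n j :: nat assume j: "j \<in> {..2 ^ n}"
    then have "j \<in> {..2 ^ Suc n}" by (auto intro: order_trans)
    then have "J (real j / 2 ^ (r + Suc n)) \<omega> = Some i" using that unfolding stays_def by blast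
    then show "J (real j / 2 ^ (Suc r + n)) \<omega> = Some i" by simp
  qed
  then have "decseq H" by (intro decseq_SucI) (auto simp: H_def)
  then have "(\<lambda>r. measure (P 0 i) (H r)) \<longlonglongrightarrow> measure (P 0 i) (\<Inter>r. H r)"
    by (intro P.finite_Lim_measure_decseq) auto
  moreover have "measure (P 0 i) (\<Inter>r. H r) = 0"
  proof -
    have "AE \<omega> in P 0 i. \<omega> \<notin> (\<Inter>r. H r)"
      using AE_J0[where x = 0 and i = i] AE_space
    proof eventually_elim
      case (elim \<omega>)
      then have \<omega>: "\<omega> \<in> space \<Omega>" by simp
      obtain e where e: "e > 0" "\<And>s. 0 \<le> s \<Longrightarrow> s < 0 + e \<Longrightarrow> J s \<omega> = J 0 \<omega>"
        using J_right_const[OF \<omega>, of 0] by auto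
      have "(\<lambda>n. (1 / 2) ^ n :: real) \<longlonglongrightarrow> 0" by (rule LIMSEQ_realpow_zero) auto
      from order_tendstoD(2)[OF this e(1)] obtain r where r: "(1 / 2) ^ r < e" by (auto simp: eventually_sequentially)
      have "stays r i \<omega>"
        unfolding stays_def
      proof (intro allI ballI)
        fix n j :: nat assume "j \<in> {..2 ^ n}"
        then have "real j \<le> 2 ^ n" by (metis atMost_iff of_nat_le_iff of_nat_numeral of_nat_power)
        then have "real j / 2 ^ (r + n) \<le> (1 / 2) ^ r" by (simp add: power_add field_simps)
        then show "J (real j / 2 ^ (r + n)) \<omega> = Some i" using e(2) r elim(1) by simp
      qed
      then show ?case by (auto simp: H_def)
    qed
    then have "(\<Inter>r. H r) \<in> null_sets (P 0 i)" by (subst (asm) AE_iff_null_sets[symmetric]) auto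
    then show ?thesis by (simp add: measure_eq_0_null_sets)
  qed
  ultimately show ?thesis by (simp add: H_def)
qed

text \<open>Otherwise countably many null events would cover all upward excursions within state
  \<open>i\<close>: if \<open>X t > 0\<close> at a real time \<open>t\<close>, right-continuity
  shows an ascent with a margin at a dyadic time just after \<open>t\<close>, where the chain is
  still in \<open>i\<close>. That would make the paths in state \<open>i\<close>
  nonincreasing.\<close>

lemma ascent_in_state:
  "\<exists>p q m. measure (P 0 i) {\<omega>\<in>space \<Omega>. X (real p / 2 ^ q) \<omega> - X 0 \<omega> > 1 / real (Suc m) \<and>
     (\<forall>n k. real k / 2 ^ n \<le> real p / 2 ^ q \<longrightarrow> J (real k / 2 ^ n) \<omega> = Some i)} > 0"
proof (rule ccontr)
  define Q where "Q p q \<omega> \<longleftrightarrow> (\<forall>n k. real k / 2 ^ n \<le> real p / 2 ^ q \<longrightarrow> J (real k / 2 ^ n) \<omega> = Some i)" for p q :: nat and \<omega>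
  have [measurable]: "Measurable.pred \<Omega> (Q p q)" for p q unfolding Q_def by measurable
  define E where "E p q m = {\<omega>\<in>space \<Omega>. X (real p / 2 ^ q) \<omega> - X 0 \<omega> > 1 / real (Suc m) \<and> Q p q \<omega>}" for p q m :: nat
  have [measurable]: "E p q m \<in> sets \<Omega>" for p q m unfolding E_def by measurable
  assume "\<not> ?thesis"
  then have "measure (P 0 i) (E p q m) = 0" for p q m
    unfolding E_def Q_def using zero_less_measure_iff by blast
  then have "E p q m \<in> null_sets (P 0 i)" for p q m by (simp add: null_sets_def P.emeasure_eq_measure)
  then have "AE \<omega> in P 0 i. \<omega> \<notin> E p q m" for p q m by (rule AE_not_in)
  then have "AE \<omega> in P 0 i. \<forall>p q m. \<omega> \<notin> E p q m" by (simp add: AE_all_countable)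
  then have "AE \<omega> in P 0 i. \<forall>t\<ge>0. (\<forall>s\<in>{0..t}. J s \<omega> = Some i) \<longrightarrow> X t \<omega> \<le> 0"
    using AE_X0[of 0 i] AE_space
  proof eventually_elim
    case (elim \<omega>)
    then have \<omega>: "\<omega> \<in> space \<Omega>" by simp
    show ?case
    proof (intro allI impI, rule ccontr)
      fix t :: real assume t: "0 \<le> t" and Jt: "\<forall>s\<in>{0..t}. J s \<omega> = Some i" and pos: "\<not> X t \<omega> \<le> 0"
      have at: "J t \<omega> = Some i" using Jt t by auto
      obtain e where e: "e > 0" "\<And>s. t \<le> s \<Longrightarrow> s < t + e \<Longrightarrow> J s \<omega> = J t \<omega>"
        using J_right_const[OF \<omega> t] by blast
      have "X t \<omega> / 2 > 0" using pos by simp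
      then have "eventually (\<lambda>n. \<bar>X (next_dyadic n t) \<omega> - X t \<omega>\<bar> < X t \<omega> / 2) sequentially"
        using at by (intro eventually_X_next_dyadic[OF \<omega> t]) auto
      moreover have "eventually (\<lambda>n. next_dyadic n t < t + e) sequentially"
        using order_tendstoD(2)[OF next_dyadic_tendsto, of t "t + e"] e(1) by simp
      ultimately have "eventually (\<lambda>n. \<bar>X (next_dyadic n t) \<omega> - X t \<omega>\<bar> < X t \<omega> / 2 \<and> next_dyadic n t < t + e) sequentially"
        by (rule eventually_conj)
      then obtain q where q: "\<bar>X (next_dyadic q t) \<omega> - X t \<omega>\<bar> < X t \<omega> / 2" "next_dyadic q t < t + e"
        by (auto simp: eventually_sequentially)
      obtain p where p: "next_dyadic q t = real p / 2 ^ q" using next_dyadic_grid[OF t] .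
      have Xp: "X (real p / 2 ^ q) \<omega> > X t \<omega> / 2" using q(1) unfolding p abs_less_iff by linarith
      obtain m where m: "1 / real (Suc m) < X t \<omega> / 2"
        using reals_Archimedean[OF \<open>X t \<omega> / 2 > 0\<close>] by (auto simp: inverse_eq_divide)
      have "Q p q \<omega>"
        unfolding Q_def
      proof (intro allI impI)
        fix n k :: nat assume k: "real k / 2 ^ n \<le> real p / 2 ^ q"
        show "J (real k / 2 ^ n) \<omega> = Some i"
        proof (cases "real k / 2 ^ n \<le> t")
          case True then show ?thesis using Jt by auto
        next
          case False
          then show ?thesis using e(2)[of "real k / 2 ^ n"] k q(2) at by (auto simp: p)
        qed
      qed
      then have "\<omega> \<in> E p q m" using \<omega> Xp m elim(2) by (auto simp: E_def)
      then show False using elim(1) by blast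
    qed
  qed
  then show False using not_nonincreasing by blast
qed

text \<open>Pigeonhole: an ascent over \<open>M\<close> intervals of length \<open>1 / 2 ^ r\<close>
  requires a proportional ascent over one of them, and by the Markov property each interval is as
  likely to show it as the first one is at most. The point is a common \<open>r\<close>, usable for
  all states at once.\<close>

lemma eventually_ascent_short:
  "eventually (\<lambda>r. \<exists>e>0. measure (P 0 i) {\<omega>\<in>space \<Omega>. X (1 / 2 ^ r) \<omega> - X 0 \<omega> > e \<and> stays r i \<omega>} > 0) sequentially"
proof -
  obtain p q m where c: "measure (P 0 i) {\<omega>\<in>space \<Omega>. X (real p / 2 ^ q) \<omega> - X 0 \<omega> > 1 / real (Suc m) \<and>
     (\<forall>n k. real k / 2 ^ n \<le> real p / 2 ^ q \<longrightarrow> J (real k / 2 ^ n) \<omega> = Some i)} > 0" (is "measure _ ?S > 0")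
    using ascent_in_state by blast
  have "\<exists>e>0. measure (P 0 i) {\<omega>\<in>space \<Omega>. X (1 / 2 ^ r) \<omega> - X 0 \<omega> > e \<and> stays r i \<omega>} > 0" if r: "r \<ge> q" for r
  proof -
    define M where "M = p * 2 ^ (r - q)"
    obtain d where "r = q + d" using r le_Suc_ex by blast
    then have t: "real p / 2 ^ q = real M / 2 ^ r"
      by (simp add: M_def power_add)
    have M0: "M > 0"
    proof (rule ccontr)
      assume "\<not> M > 0"
      then have S: "?S = {}" using t by auto
      show False using c unfolding S by simp
    qed
    \<comment> \<open>If no increment exceeded \<open>e\<close>, the \<open>M\<close> of them
      together could not exceed \<open>1 / real (Suc m)\<close>.\<close>
    define e where "e = 1 / real (Suc m) / real M"
    have e0: "e > 0" using M0 by (simp add: e_def)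
    define B where "B n = {w\<in>space (fd_space (Suc (2 ^ n))). fst (w (2 ^ n)) > e \<and> (\<forall>j\<in>{..2 ^ n}. snd (w j) = Some i)}" for n :: nat
    have [measurable]: "B n \<in> sets (fd_space (Suc (2 ^ n)))" for n unfolding B_def by measurable
    define E where "E n = {\<omega>\<in>space \<Omega>. gshift (r + n) (2 ^ n) 0 \<omega> \<in> B n}" for n
    have [measurable]: "E n \<in> sets \<Omega>" for n unfolding E_def by measurable
    have gB: "gshift (r + n) (2 ^ n) t \<omega> \<in> B n \<longleftrightarrow> X (t + 1 / 2 ^ r) \<omega> - X t \<omega> > e \<and> (\<forall>j\<in>{..2 ^ n}. J (t + real j / 2 ^ (r + n)) \<omega> = Some i)"
      if "\<omega> \<in> space \<Omega>" for t \<omega> n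
    proof -
      have "gshift (r + n) (2 ^ n) t \<omega> \<in> space (fd_space (Suc (2 ^ n)))"
        using measurable_space[OF measurable_shift_path that] .
      moreover have "real (2 ^ n) / 2 ^ (r + n) = 1 / (2 ^ r :: real)" by (simp add: power_add)
      moreover have "J (t + 1 / 2 ^ r) \<omega> = Some i" if "\<forall>j\<in>{..2 ^ n}. J (t + real j / 2 ^ (r + n)) \<omega> = Some i"
        using that[THEN bspec, of "2 ^ n"] by (simp add: power_add)
      ultimately show ?thesis by (auto simp: B_def gshift_apply)
    qed
    \<comment> \<open>The Markov property sees finitely many coordinates, so staying in
      \<open>i\<close> is first imposed on the grid of level \<open>r + n\<close>. The bound does
      not depend on \<open>n\<close> and therefore survives the intersection over
      \<open>n\<close>.\<close>
    have "measure (P 0 i) ?S / real M \<le> measure (P 0 i) (E n)" for n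
    proof -
      define G where "G k = {\<omega>\<in>space \<Omega>. J (real k / 2 ^ r) \<omega> = Some i \<and> gshift (r + n) (2 ^ n) (real k / 2 ^ r) \<omega> \<in> B n}" for k
      have [measurable]: "G k \<in> sets \<Omega>" for k unfolding G_def by measurable
      have "?S \<subseteq> (\<Union>k\<in>{..<M}. G k)"
      proof
        fix \<omega> assume \<omega>: "\<omega> \<in> ?S"
        have "\<exists>k<M. X (real (Suc k) / 2 ^ r) \<omega> - X (real k / 2 ^ r) \<omega> > e"
        proof (rule ccontr)
          assume "\<not> ?thesis"
          then have "(\<Sum>k<M. X (real (Suc k) / 2 ^ r) \<omega> - X (real k / 2 ^ r) \<omega>) \<le> (\<Sum>k<M. e)"
            by (intro sum_mono) (meson lessThan_iff not_le)
          also have "(\<Sum>k<M. X (real (Suc k) / 2 ^ r) \<omega> - X (real k / 2 ^ r) \<omega>) = X (real M / 2 ^ r) \<omega> - X 0 \<omega>"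
            using sum_lessThan_telescope[of "\<lambda>k. X (real k / 2 ^ r) \<omega>" M] by simp
          finally show False using \<omega> M0 by (simp add: t e_def)
        qed
        then obtain k where k: "k < M" "X (real (Suc k) / 2 ^ r) \<omega> - X (real k / 2 ^ r) \<omega> > e" by blast
        have J: "J (real k / 2 ^ r + real j / 2 ^ (r + n)) \<omega> = Some i" if "j \<le> 2 ^ n" for j
        proof -
          have "real j \<le> 2 ^ n" using that by (metis of_nat_le_iff of_nat_numeral of_nat_power)
          moreover have "real k + 1 \<le> real M" using k(1) by linarith
          ultimately have "real j / 2 ^ (r + n) \<le> 2 ^ n / 2 ^ (r + n)" "(real k + 1) / 2 ^ r \<le> real M / 2 ^ r"
            by (intro divide_right_mono; simp)+
          then have "real k / 2 ^ r + real j / 2 ^ (r + n) \<le> real M / 2 ^ r"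
            by (simp add: power_add add_divide_distrib)
          moreover have "real k / 2 ^ r + real j / 2 ^ (r + n) = real (k * 2 ^ n + j) / 2 ^ (r + n)"
            by (simp add: power_add field_simps)
          ultimately show ?thesis using \<omega> unfolding t by (metis (mono_tags, lifting) mem_Collect_eq)
        qed
        have "real (Suc k) / 2 ^ r = real k / 2 ^ r + 1 / 2 ^ r" by (simp add: add_divide_distrib)
        with k(2) have "X (real k / 2 ^ r + 1 / 2 ^ r) \<omega> - X (real k / 2 ^ r) \<omega> > e" by (simp only:)
        then have "\<omega> \<in> G k" unfolding G_def using \<omega> J J[of 0] by (simp add: gB)
        then show "\<omega> \<in> (\<Union>k\<in>{..<M}. G k)" using k(1) by blast
      qed
      then have "measure (P 0 i) ?S \<le> measure (P 0 i) (\<Union>k\<in>{..<M}. G k)"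
        by (intro P.finite_measure_mono) auto
      also have "\<dots> \<le> (\<Sum>k<M. measure (P 0 i) (G k))"
        by (intro P.finite_measure_subadditive_finite) auto
      also have "\<dots> \<le> (\<Sum>k<M. measure (P 0 i) (E n))"
        unfolding G_def E_def by (intro sum_mono markov_prob_now_le) auto
      finally show ?thesis using M0 by (simp add: field_simps)
    qed
    moreover have E_iff: "\<omega> \<in> E n \<longleftrightarrow> \<omega> \<in> space \<Omega> \<and> X (1 / 2 ^ r) \<omega> - X 0 \<omega> > e \<and> (\<forall>j\<in>{..2 ^ n}. J (real j / 2 ^ (r + n)) \<omega> = Some i)" for \<omega> n
      by (cases "\<omega> \<in> space \<Omega>") (simp_all add: E_def gB)
    moreover have "decseq E"
    proof (rule decseq_SucI, rule subsetI)
      fix n \<omega> assume w: "\<omega> \<in> E (Suc n)"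
      have "J (real j / 2 ^ (r + n)) \<omega> = Some i" if "j \<le> 2 ^ n" for j
      proof -
        have "2 * j \<in> {..2 ^ Suc n}" using that by simp
        then have "J (real (2 * j) / 2 ^ (r + Suc n)) \<omega> = Some i" using w unfolding E_iff by blast
        then show ?thesis by simp
      qed
      then show "\<omega> \<in> E n" using w unfolding E_iff by simp
    qed
    ultimately have "measure (P 0 i) ?S / real M \<le> measure (P 0 i) (\<Inter>n. E n)"
      by (intro P.prob_decreasing_INT_le) auto
    also have "(\<Inter>n. E n) = {\<omega>\<in>space \<Omega>. X (1 / 2 ^ r) \<omega> - X 0 \<omega> > e \<and> stays r i \<omega>}"
      by (auto simp: E_iff stays_def)
    finally have "measure (P 0 i) {\<omega>\<in>space \<Omega>. X (1 / 2 ^ r) \<omega> - X 0 \<omega> > e \<and> stays r i \<omega>} > 0"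
      using c M0 by (meson divide_pos_pos less_le_trans of_nat_0_less_iff)
    then show ?thesis using e0 by blast
  qed
  then show ?thesis by (auto simp: eventually_sequentially)
qed

text \<open>The cap \<open>\<eta>\<close> on single increments is what bounds the level at the first
  strict ascent, so that a climb of height \<open>m * \<eta>\<close> splits into \<open>m\<close>
  successive first ascents.\<close>

definition climb_set :: "'n \<Rightarrow> real \<Rightarrow> nat \<Rightarrow> nat \<Rightarrow> (nat \<Rightarrow> real \<times> 'n option) set" where
  "climb_set i \<eta> m K = {w\<in>space (fd_space (Suc K)). \<exists>k\<in>{..K}. fst (w k) > real m * \<eta> \<and>
     (\<forall>j\<in>{..K}. j \<le> k \<longrightarrow> snd (w j) = Some i) \<and> (\<forall>j\<in>{..<K}. j < k \<longrightarrow> fst (w (Suc j)) - fst (w j) \<le> \<eta>)}"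

definition up_prob :: "'n \<Rightarrow> nat \<Rightarrow> nat \<Rightarrow> real" where
  "up_prob i n K = measure (P 0 i) {\<omega>\<in>space \<Omega>. \<exists>k\<in>{..K}. X (real k / 2 ^ n) \<omega> - X 0 \<omega> > 0 \<and>
     (\<forall>j\<in>{..k}. J (real j / 2 ^ n) \<omega> = Some i)}"

lemma sets_climb_set [measurable]: "climb_set i \<eta> m K \<in> sets (fd_space (Suc K))"
  unfolding climb_set_def by measurable

lemma mem_climb_set:
  assumes "\<omega> \<in> space \<Omega>"
  shows "gshift n K t \<omega> \<in> climb_set i \<eta> m K \<longleftrightarrow> (\<exists>k\<le>K. X (t + real k / 2 ^ n) \<omega> - X t \<omega> > real m * \<eta> \<and>
    (\<forall>j\<le>k. J (t + real j / 2 ^ n) \<omega> = Some i) \<and>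
    (\<forall>j<k. X (t + real (Suc j) / 2 ^ n) \<omega> - X (t + real j / 2 ^ n) \<omega> \<le> \<eta>))" (is "?L \<longleftrightarrow> (\<exists>k\<le>K. ?R k)")
proof -
  have sp: "gshift n K t \<omega> \<in> space (fd_space (Suc K))" using measurable_space[OF measurable_shift_path assms] .
  define Q where "Q k \<longleftrightarrow> fst (gshift n K t \<omega> k) > real m * \<eta> \<and>
     (\<forall>j\<in>{..K}. j \<le> k \<longrightarrow> snd (gshift n K t \<omega> j) = Some i) \<and> (\<forall>j\<in>{..<K}. j < k \<longrightarrow> fst (gshift n K t \<omega> (Suc j)) - fst (gshift n K t \<omega> j) \<le> \<eta>)" for k
  have L: "?L \<longleftrightarrow> (\<exists>k\<in>{..K}. Q k)" unfolding climb_set_def Q_def using sp by simp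
  have eq: "Q k \<longleftrightarrow> ?R k" if k: "k \<le> K" for k
  proof (cases "\<forall>j\<le>k. J (t + real j / 2 ^ n) \<omega> = Some i")
    case True
    have f: "fst (gshift n K t \<omega> j) = X (t + real j / 2 ^ n) \<omega> - X t \<omega>" if "j \<le> k" for j
      using that k True by (simp add: gshift_apply)
    have sn: "\<forall>j\<in>{..K}. j \<le> k \<longrightarrow> snd (gshift n K t \<omega> j) = Some i"
      using True by (simp add: gshift_apply)
    have inc: "(\<forall>j\<in>{..<K}. j < k \<longrightarrow> fst (gshift n K t \<omega> (Suc j)) - fst (gshift n K t \<omega> j) \<le> \<eta>)
      \<longleftrightarrow> (\<forall>j<k. X (t + real (Suc j) / 2 ^ n) \<omega> - X (t + real j / 2 ^ n) \<omega> \<le> \<eta>)"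
      using k f by (auto simp del: of_nat_Suc)
    show ?thesis unfolding Q_def inc using True sn f[of k] by simp
  next
    case False
    then obtain j where "j \<le> k" "J (t + real j / 2 ^ n) \<omega> \<noteq> Some i" by blast
    moreover from this have "snd (gshift n K t \<omega> j) \<noteq> Some i" using k by (simp add: gshift_apply)
    ultimately show ?thesis unfolding Q_def using False k by (meson atMost_iff order_trans)
  qed
  show ?thesis unfolding L Bex_def atMost_iff using eq by meson
qed

text \<open>At the first grid index above the start the path has risen by at most
  \<open>\<eta>\<close>, being nonpositive one index earlier; so a climb by
  \<open>m * \<eta>\<close> is still to come, independent of the past. The events of different first
  indices are disjoint, and their union is contained in the event of \<open>up_prob\<close>.\<close>

lemma climb_step:
  assumes \<eta>: "\<eta> \<ge> 0"
  shows "measure (P 0 i) {\<omega>\<in>space \<Omega>. gshift n K 0 \<omega> \<in> climb_set i \<eta> (Suc m) K}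
    \<le> up_prob i n K * measure (P 0 i) {\<omega>\<in>space \<Omega>. gshift n K 0 \<omega> \<in> climb_set i \<eta> m K}"
proof -
  define D where "D k \<omega> = X (real k / 2 ^ n) \<omega> - X 0 \<omega>" for k \<omega>
  have D0 [simp]: "D 0 \<omega> = 0" for \<omega> by (simp add: D_def)
  define A where "A k = {\<omega>\<in>space (grid_algebra n k). X (real k / 2 ^ n) \<omega> - X (real 0 / 2 ^ n) \<omega> > 0 \<and>
     (\<forall>j\<in>{..<k}. X (real j / 2 ^ n) \<omega> - X (real 0 / 2 ^ n) \<omega> \<le> 0) \<and> (\<forall>j\<in>{..k}. J (real j / 2 ^ n) \<omega> = Some i)}" for k
  have A: "A k \<in> sets (grid_algebra n k)" for k unfolding A_def by measurable
  have [measurable]: "A k \<in> sets \<Omega>" for k using A by (rule sets_grid_algebra_subset)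
  have A_iff: "\<omega> \<in> A k \<longleftrightarrow> \<omega> \<in> space \<Omega> \<and> D k \<omega> > 0 \<and> (\<forall>j<k. D j \<omega> \<le> 0) \<and> (\<forall>j\<le>k. J (real j / 2 ^ n) \<omega> = Some i)" for k \<omega>
    by (auto simp: A_def D_def)
  define E where "E k = {\<omega>\<in>space \<Omega>. \<omega> \<in> A k \<and> J (real k / 2 ^ n) \<omega> = Some i \<and> gshift n K (real k / 2 ^ n) \<omega> \<in> climb_set i \<eta> m K}" for k
  have [measurable]: "E k \<in> sets \<Omega>" for k unfolding E_def by measurable
  have "{\<omega>\<in>space \<Omega>. gshift n K 0 \<omega> \<in> climb_set i \<eta> (Suc m) K} \<subseteq> (\<Union>k\<in>{..K}. E k)"
  proof
    fix \<omega> assume "\<omega> \<in> {\<omega>\<in>space \<Omega>. gshift n K 0 \<omega> \<in> climb_set i \<eta> (Suc m) K}"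
    then have \<omega>: "\<omega> \<in> space \<Omega>" and "gshift n K 0 \<omega> \<in> climb_set i \<eta> (Suc m) K" by auto
    then obtain k where k: "k \<le> K" "D k \<omega> > real (Suc m) * \<eta>" "\<And>j. j \<le> k \<Longrightarrow> J (real j / 2 ^ n) \<omega> = Some i"
      "\<And>j. j < k \<Longrightarrow> D (Suc j) \<omega> - D j \<omega> \<le> \<eta>"
      unfolding mem_climb_set[OF \<omega>] D_def by auto
    define k0 where "k0 = (LEAST j. D j \<omega> > 0)"
    have Dk: "D k \<omega> > 0" using k(2) \<eta> by (meson mult_nonneg_nonneg of_nat_0_le_iff order_le_less_trans)
    have k0: "D k0 \<omega> > 0" unfolding k0_def using Dk by (rule LeastI)
    have k0k: "k0 \<le> k" unfolding k0_def using Dk by (rule Least_le)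
    have min: "D j \<omega> \<le> 0" if "j < k0" for j using not_less_Least[of j "\<lambda>j. D j \<omega> > 0"] that by (auto simp: k0_def not_less)
    have "k0 \<noteq> 0" using k0 by (cases k0) auto
    then obtain j0 where j0: "k0 = Suc j0" using not0_implies_Suc by blast
    have "D k0 \<omega> \<le> \<eta>" using k(4)[of j0] min[of j0] k0k j0 by auto
    then have "D k \<omega> - D k0 \<omega> > real m * \<eta>" using k(2) by (simp add: algebra_simps)
    moreover have e: "real k0 / 2 ^ n + real l / 2 ^ n = real (k0 + l) / 2 ^ n" for l by (simp add: add_divide_distrib)
    ultimately have "gshift n K (real k0 / 2 ^ n) \<omega> \<in> climb_set i \<eta> m K"
      unfolding mem_climb_set[OF \<omega>] e using k0k k
      by (intro exI[of _ "k - k0"]) (auto simp: D_def simp del: of_nat_Suc of_nat_add)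
    moreover have "\<omega> \<in> A k0" unfolding A_iff using \<omega> k0 min k(3) k0k by auto
    ultimately have "\<omega> \<in> E k0" using \<omega> k(3)[OF k0k] by (simp add: E_def)
    then show "\<omega> \<in> (\<Union>k\<in>{..K}. E k)" using k0k k(1) by auto
  qed
  then have "measure (P 0 i) {\<omega>\<in>space \<Omega>. gshift n K 0 \<omega> \<in> climb_set i \<eta> (Suc m) K} \<le> measure (P 0 i) (\<Union>k\<in>{..K}. E k)"
    by (intro P.finite_measure_mono) auto
  also have "\<dots> \<le> (\<Sum>k\<le>K. measure (P 0 i) (E k))"
    by (intro P.finite_measure_subadditive_finite) auto
  also have "\<dots> = (\<Sum>k\<le>K. measure (P 0 i) (A k) * measure (P 0 i) {\<omega>\<in>space \<Omega>. gshift n K 0 \<omega> \<in> climb_set i \<eta> m K})"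
  proof (rule sum.cong[OF refl])
    fix k
    have "{\<omega>\<in>space \<Omega>. \<omega> \<in> A k \<and> J (real k / 2 ^ n) \<omega> = Some i} = A k" by (auto simp: A_iff)
    then show "measure (P 0 i) (E k) = measure (P 0 i) (A k) * measure (P 0 i) {\<omega>\<in>space \<Omega>. gshift n K 0 \<omega> \<in> climb_set i \<eta> m K}"
      unfolding E_def using markov_grid[OF A[of k] sets_climb_set] by simp
  qed
  also have "\<dots> = (\<Sum>k\<le>K. measure (P 0 i) (A k)) * measure (P 0 i) {\<omega>\<in>space \<Omega>. gshift n K 0 \<omega> \<in> climb_set i \<eta> m K}"
    by (simp add: sum_distrib_right)
  also have "(\<Sum>k\<le>K. measure (P 0 i) (A k)) = measure (P 0 i) (\<Union>k\<in>{..K}. A k)"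
  proof (rule P.finite_measure_finite_Union[symmetric])
    have "A k \<inter> A k' = {}" if "k < k'" for k k' using that by (force simp: A_iff)
    then show "disjoint_family_on A {..K}"
      unfolding disjoint_family_on_def by (metis Int_commute linorder_neqE_nat)
  qed auto
  also have "measure (P 0 i) (\<Union>k\<in>{..K}. A k) \<le> up_prob i n K"
    unfolding up_prob_def by (intro P.finite_measure_mono) (auto simp: A_iff D_def)
  finally show ?thesis by (simp add: mult_right_mono)
qed

lemma climb_power:
  assumes "\<eta> \<ge> 0"
  shows "measure (P 0 i) {\<omega>\<in>space \<Omega>. gshift n K 0 \<omega> \<in> climb_set i \<eta> m K} \<le> up_prob i n K ^ m"
proof (induction m)
  case (Suc m)
  have "up_prob i n K \<ge> 0" by (simp add: up_prob_def)
  then show ?case using climb_step[OF assms, of i n K m] Suc by (simp add: order_trans[OF _ mult_left_mono])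
qed simp

text \<open>Immediate ascent: by \<open>climb_power\<close>, an \<open>up_prob\<close> bounded away
  from 1 would make a climb in \<open>m\<close> small steps exponentially unlikely in
  \<open>m\<close>. Yet an ascent by \<open>e\<close> has fixed positive probability, and on a fine
  grid it is a climb in steps at most \<open>e / m\<close>, whatever \<open>m\<close>.\<close>

lemma up_prob_tendsto_1:
  assumes e: "e > 0" and c: "measure (P 0 i) {\<omega>\<in>space \<Omega>. X (1 / 2 ^ r) \<omega> - X 0 \<omega> > e \<and> stays r i \<omega>} > 0" (is "measure _ ?C > 0")
    and d: "d > 0"
  shows "eventually (\<lambda>n. up_prob i (r + n) (2 ^ n) > 1 - d) sequentially"
proof -
  let ?c = "measure (P 0 i) ?C"
  \<comment> \<open>The maximum with 0 keeps the base of the power nonnegative when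
    \<open>d > 1\<close>.\<close>
  define b where "b = max 0 (1 - d)"
  have b: "0 \<le> b" "b < 1" using d by (auto simp: b_def)
  obtain m0 where m0: "b ^ m0 < ?c / 2" using real_arch_pow_inv[of "?c / 2" b] c b by auto
  define m where "m = Suc m0"
  have "b ^ m \<le> b ^ m0" using b unfolding m_def by (simp add: mult_left_le_one_le)
  then have m: "b ^ m < ?c / 2" using m0 by linarith
  define \<eta> where "\<eta> = e / real m"
  have \<eta>: "\<eta> > 0" using e by (simp add: \<eta>_def m_def)
  define E where "E n = {\<omega>\<in>space \<Omega>. gshift (r + n) (2 ^ n) 0 \<omega> \<in> climb_set i \<eta> m (2 ^ n)}" for n
  have [measurable]: "E n \<in> sets \<Omega>" for n unfolding E_def by measurable
  \<comment> \<open>How fine a grid must be for all increments to stay below \<open>\<eta>\<close>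
    depends on the path; \<open>G k\<close> collects the paths for which every grid from level
    \<open>k\<close> on is a climb.\<close>
  define G where "G k = ?C \<inter> (\<Inter>n\<in>{k..}. E n)" for k
  have [measurable]: "G k \<in> sets \<Omega>" for k unfolding G_def by measurable
  have "incseq G" by (rule incseq_SucI) (auto simp: G_def)
  moreover have "(\<Union>k. G k) = ?C"
  proof
    show "?C \<subseteq> (\<Union>k. G k)"
    proof
      fix \<omega> assume C: "\<omega> \<in> ?C"
      then have \<omega>: "\<omega> \<in> space \<Omega>" by simp
      have J: "J (real j / 2 ^ (r + n)) \<omega> = Some i" if "j \<le> 2 ^ n" for n j
        using C that unfolding stays_def by auto
      have "J (1 / 2 ^ r) \<omega> \<noteq> None" using J[of 1 0] by simp
      then obtain d where d: "d > 0" "\<And>u v. 0 \<le> u \<Longrightarrow> u \<le> v \<Longrightarrow> v \<le> 1 / 2 ^ r \<Longrightarrow> v - u < d \<Longrightarrow> X v \<omega> - X u \<omega> \<le> \<eta>"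
        using upward_oscillation[OF \<omega> _ \<eta>, of "1 / 2 ^ r"] by blast
      have "(\<lambda>n. (1 / 2) ^ n :: real) \<longlonglongrightarrow> 0" by (rule LIMSEQ_realpow_zero) auto
      from order_tendstoD(2)[OF this d(1)] obtain k where k: "\<And>n. n \<ge> k \<Longrightarrow> (1 / 2 :: real) ^ n < d"
        by (auto simp: eventually_sequentially)
      have "\<omega> \<in> E n" if n: "n \<ge> k" for n
        unfolding E_def mem_Collect_eq mem_climb_set[OF \<omega>]
      proof (intro conjI \<omega> exI[of _ "2 ^ n"] allI impI)
        have "real (2 ^ n) / 2 ^ (r + n) = 1 / (2 ^ r :: real)" by (simp add: power_add)
        then show "real m * \<eta> < X (0 + real (2 ^ n) / 2 ^ (r + n)) \<omega> - X 0 \<omega>"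
          using C by (simp add: \<eta>_def m_def)
        show "J (0 + real j / 2 ^ (r + n)) \<omega> = Some i" if "j \<le> 2 ^ n" for j using J[OF that] by simp
        fix j :: nat assume j: "j < 2 ^ n"
        then have "real (Suc j) \<le> real (2 ^ n)" by (simp only: of_nat_le_iff Suc_le_eq)
        then have "real (Suc j) / 2 ^ (r + n) \<le> real (2 ^ n) / 2 ^ (r + n)" by (rule divide_right_mono) simp
        then have 1: "real (Suc j) / 2 ^ (r + n) \<le> 1 / 2 ^ r" by (simp add: power_add)
        have "real (Suc j) / 2 ^ (r + n) - real j / 2 ^ (r + n) = (1 / 2) ^ r * (1 / 2) ^ n"
          by (simp add: diff_divide_distrib[symmetric] power_one_over power_add)
        also have "\<dots> \<le> (1 / 2) ^ n" by (intro mult_left_le_one_le) (auto simp: power_le_one)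
        also have "\<dots> < d" by (rule k[OF n])
        finally show "X (0 + real (Suc j) / 2 ^ (r + n)) \<omega> - X (0 + real j / 2 ^ (r + n)) \<omega> \<le> \<eta>"
          using 1 by (simp only: add_0, intro d(2) divide_right_mono) auto
      qed auto
      then show "\<omega> \<in> (\<Union>k. G k)" using C by (auto simp: G_def)
    qed
  qed (auto simp: G_def)
  moreover have "(\<lambda>k. measure (P 0 i) (G k)) \<longlonglongrightarrow> measure (P 0 i) (\<Union>k. G k)"
    by (rule P.finite_Lim_measure_incseq) (use \<open>incseq G\<close> in auto)
  ultimately have "(\<lambda>k. measure (P 0 i) (G k)) \<longlonglongrightarrow> ?c" by (simp only:)
  from order_tendstoD(1)[OF this, of "?c / 2"] c obtain k where k: "measure (P 0 i) (G k) > ?c / 2"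
    by (auto simp: eventually_sequentially)
  have "up_prob i (r + n) (2 ^ n) > 1 - d" if "n \<ge> k" for n
  proof (rule ccontr)
    assume "\<not> up_prob i (r + n) (2 ^ n) > 1 - d"
    then have "up_prob i (r + n) (2 ^ n) \<le> b" by (simp add: b_def)
    then have "up_prob i (r + n) (2 ^ n) ^ m \<le> b ^ m" by (intro power_mono) (auto simp: up_prob_def)
    moreover have "measure (P 0 i) (G k) \<le> measure (P 0 i) (E n)"
      using that by (intro P.finite_measure_mono) (auto simp: G_def)
    moreover have "measure (P 0 i) (E n) \<le> up_prob i (r + n) (2 ^ n) ^ m"
      unfolding E_def using \<eta> by (intro climb_power) simp
    ultimately show False using k m by linarith
  qed
  then show ?thesis by (auto simp: eventually_sequentially)
qed

section \<open>Time reversal of grid increments\<close>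

text \<open>While the chain stays in one state the grid increments are exchangeable, so that reversing
  time turns the event of ending at the minimum into the event of staying below the starting point.\<close>

definition below_prob :: "'n \<Rightarrow> nat \<Rightarrow> nat \<Rightarrow> real \<Rightarrow> ennreal" where
  "below_prob i n K y = (\<integral>\<^sup>+\<omega>. of_bool (\<forall>j\<in>{..K}. J (real j / 2 ^ n) \<omega> = Some i \<and> (0 < j \<longrightarrow> y + (X (real j / 2 ^ n) \<omega> - X 0 \<omega>) \<le> 0)) \<partial>P 0 i)"

definition end_min_prob :: "'n \<Rightarrow> nat \<Rightarrow> nat \<Rightarrow> real \<Rightarrow> ennreal" where
  "end_min_prob i n K y = (\<integral>\<^sup>+\<omega>. of_bool (\<forall>j\<in>{..K}. J (real j / 2 ^ n) \<omega> = Some i \<and> (j < K \<longrightarrow> y + (X (real K / 2 ^ n) \<omega> - X (real j / 2 ^ n) \<omega>) \<le> 0)) \<partial>P 0 i)"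

text \<open>The first increment is split off and absorbed into the level \<open>y\<close>, which is
  the reason for carrying \<open>y\<close> as a parameter.\<close>

lemma below_prob_Suc:
  "below_prob i n (Suc K) y = (\<integral>\<^sup>+\<omega>. below_prob i n K (y + X (1 / 2 ^ n) \<omega>) * of_bool (y + X (1 / 2 ^ n) \<omega> \<le> 0 \<and> J (1 / 2 ^ n) \<omega> = Some i) \<partial>P 0 i)"
proof -
  define \<Psi> where "\<Psi> z = (of_bool (J (real 0 / 2 ^ n) (fst z) = Some i \<and> y + (X (real 1 / 2 ^ n) (fst z) - X (real 0 / 2 ^ n) (fst z)) \<le> 0 \<and>
     (\<forall>j\<in>{..K}. snd (snd z j) = Some i \<and> (0 < j \<longrightarrow> y + (X (real 1 / 2 ^ n) (fst z) - X (real 0 / 2 ^ n) (fst z)) + fst (snd z j) \<le> 0))) :: ennreal)" for z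
  have \<Psi>m [measurable]: "\<Psi> \<in> borel_measurable (grid_algebra n 1 \<Otimes>\<^sub>M fd_space (Suc K))"
  proof -
    \<comment> \<open>The integrand must be measurable for the algebra of the past, so the rules for
      the ambient algebra are switched off.\<close>
    note measurable_X [measurable del] measurable_J [measurable del]
    have [measurable]: "(\<lambda>z. X (real j / 2 ^ n) (fst z)) \<in> borel_measurable (grid_algebra n 1 \<Otimes>\<^sub>M fd_space (Suc K))" if "j \<le> 1" for j
      using that by (intro measurable_compose[OF measurable_fst grid_algebra_X])
    have [measurable]: "(\<lambda>z. J (real j / 2 ^ n) (fst z)) \<in> measurable (grid_algebra n 1 \<Otimes>\<^sub>M fd_space (Suc K)) (count_space UNIV)" if "j \<le> 1" for j
      using that by (intro measurable_compose[OF measurable_fst grid_algebra_J])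
    show ?thesis unfolding \<Psi>_def by measurable
  qed
  have eq: "(of_bool (\<forall>j\<in>{..Suc K}. J (real j / 2 ^ n) \<omega> = Some i \<and> (0 < j \<longrightarrow> y + (X (real j / 2 ^ n) \<omega> - X 0 \<omega>) \<le> 0)) :: ennreal)
     = \<Psi> (\<omega>, gshift n K (1 / 2 ^ n) \<omega>) * of_bool (J (1 / 2 ^ n) \<omega> = Some i)" for \<omega>
  proof -
    have e: "1 / 2 ^ n + real j / 2 ^ n = real (Suc j) / 2 ^ n" for j by (simp add: add_divide_distrib)
    let ?A = "\<lambda>j. J (real j / 2 ^ n) \<omega> = Some i" and ?Q = "\<lambda>j. y + (X (real j / 2 ^ n) \<omega> - X 0 \<omega>) \<le> 0"
    have "\<Psi> (\<omega>, gshift n K (1 / 2 ^ n) \<omega>) = of_bool (?A 0 \<and> ?Q 1 \<and> (\<forall>j\<in>{..K}. ?A (Suc j) \<and> (0 < j \<longrightarrow> ?Q (Suc j))))"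
    proof -
      have g: "snd (gshift n K (1 / 2 ^ n) \<omega> j) = J (real (Suc j) / 2 ^ n) \<omega>"
        "J (real (Suc j) / 2 ^ n) \<omega> = Some i \<Longrightarrow> fst (gshift n K (1 / 2 ^ n) \<omega> j) = X (real (Suc j) / 2 ^ n) \<omega> - X (1 / 2 ^ n) \<omega>"
        if "j \<in> {..K}" for j
        using that by (simp_all add: gshift_apply e del: of_nat_Suc)
      have "(\<forall>j\<in>{..K}. snd (gshift n K (1 / 2 ^ n) \<omega> j) = Some i \<and> (0 < j \<longrightarrow> y + (X (1 / 2 ^ n) \<omega> - X 0 \<omega>) + fst (gshift n K (1 / 2 ^ n) \<omega> j) \<le> 0))
        \<longleftrightarrow> (\<forall>j\<in>{..K}. ?A (Suc j) \<and> (0 < j \<longrightarrow> ?Q (Suc j)))"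
        by (rule ball_cong[OF refl]) (auto simp: g simp del: of_nat_Suc)
      then show ?thesis unfolding \<Psi>_def by simp
    qed
    moreover have "(\<forall>j\<in>{..Suc K}. ?A j \<and> (0 < j \<longrightarrow> ?Q j)) \<longleftrightarrow> ?A 0 \<and> ?Q 1 \<and> (\<forall>j\<in>{..K}. ?A (Suc j) \<and> (0 < j \<longrightarrow> ?Q (Suc j)))"
      by (rule ball_atMost_Suc_shift)
    moreover have "(\<forall>j\<in>{..K}. ?A (Suc j) \<and> (0 < j \<longrightarrow> ?Q (Suc j))) \<Longrightarrow> ?A 1" by (metis One_nat_def atMost_iff le0)
    ultimately show ?thesis by auto
  qed
  have "below_prob i n (Suc K) y = (\<integral>\<^sup>+\<omega>. \<Psi> (\<omega>, gshift n K (1 / 2 ^ n) \<omega>) * of_bool (J (1 / 2 ^ n) \<omega> = Some i) \<partial>P 0 i)"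
    unfolding below_prob_def eq ..
  also have "\<dots> = (\<integral>\<^sup>+\<omega>. (\<integral>\<^sup>+\<omega>'. \<Psi> (\<omega>, gshift n K 0 \<omega>') \<partial>P 0 i) * of_bool (J (1 / 2 ^ n) \<omega> = Some i) \<partial>P 0 i)"
    by (rule markov_nn_integral[where u = "\<lambda>l. real l / 2 ^ n" and m = "Suc 1" and \<Psi> = \<Psi> and t = "1 / 2 ^ n" and s = "\<lambda>l. real l / 2 ^ n" and n = "Suc K"])
      (use \<Psi>m in \<open>auto simp: grid_algebra_def[symmetric] intro!: divide_right_mono\<close>)
  also have "\<dots> = (\<integral>\<^sup>+\<omega>. below_prob i n K (y + X (1 / 2 ^ n) \<omega>) * of_bool (y + X (1 / 2 ^ n) \<omega> \<le> 0 \<and> J (1 / 2 ^ n) \<omega> = Some i) \<partial>P 0 i)"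
  proof (rule nn_integral_cong_AE)
    show "AE \<omega> in P 0 i. (\<integral>\<^sup>+\<omega>'. \<Psi> (\<omega>, gshift n K 0 \<omega>') \<partial>P 0 i) * of_bool (J (1 / 2 ^ n) \<omega> = Some i)
      = below_prob i n K (y + X (1 / 2 ^ n) \<omega>) * of_bool (y + X (1 / 2 ^ n) \<omega> \<le> 0 \<and> J (1 / 2 ^ n) \<omega> = Some i)"
      using AE_start[of 0 i]
    proof eventually_elim
      case (elim \<omega>)
      have "\<Psi> (\<omega>, gshift n K 0 \<omega>') = of_bool (\<forall>j\<in>{..K}. J (real j / 2 ^ n) \<omega>' = Some i \<and> (0 < j \<longrightarrow> (y + X (1 / 2 ^ n) \<omega>) + (X (real j / 2 ^ n) \<omega>' - X 0 \<omega>') \<le> 0))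
         * of_bool (y + X (1 / 2 ^ n) \<omega> \<le> 0)" for \<omega>'
        using elim by (auto simp: \<Psi>_def gshift_apply)
      then show ?case by (simp add: below_prob_def nn_integral_multc of_bool_conj mult.assoc)
    qed
  qed
  finally show ?thesis .
qed

text \<open>Here the last increment is split off; by independence and Fubini it can be moved
  outside, where it acts exactly like the first increment in \<open>below_prob_Suc\<close>. Hence
  both quantities obey one recursion.\<close>

lemma end_min_prob_Suc:
  "end_min_prob i n (Suc K) y = (\<integral>\<^sup>+\<omega>. end_min_prob i n K (y + X (1 / 2 ^ n) \<omega>) * of_bool (y + X (1 / 2 ^ n) \<omega> \<le> 0 \<and> J (1 / 2 ^ n) \<omega> = Some i) \<partial>P 0 i)"
proof -
  interpret pair_sigma_finite "P 0 i" "P 0 i" ..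
  define \<psi> where "\<psi> \<omega> x = (of_bool (y + x \<le> 0 \<and> (\<forall>j\<in>{..K}. J (real j / 2 ^ n) \<omega> = Some i \<and>
      (j < K \<longrightarrow> (y + x) + (X (real K / 2 ^ n) \<omega> - X (real j / 2 ^ n) \<omega>) \<le> 0))) :: ennreal)" for \<omega> x
  have m1 [measurable]: "case_prod \<psi> \<in> borel_measurable (grid_algebra n K \<Otimes>\<^sub>M borel)"
  proof -
    note measurable_X [measurable del] measurable_J [measurable del]
    have [measurable]: "(\<lambda>z. X (real j / 2 ^ n) (fst z)) \<in> borel_measurable (grid_algebra n K \<Otimes>\<^sub>M borel)" if "j \<le> K" for j
      using that by (intro measurable_compose[OF measurable_fst grid_algebra_X])
    have [measurable]: "(\<lambda>z. J (real j / 2 ^ n) (fst z)) \<in> measurable (grid_algebra n K \<Otimes>\<^sub>M borel) (count_space UNIV)" if "j \<le> K" for j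
      using that by (intro measurable_compose[OF measurable_fst grid_algebra_J])
    show ?thesis unfolding \<psi>_def case_prod_beta' by measurable
  qed
  have eq: "(of_bool (\<forall>j\<in>{..Suc K}. J (real j / 2 ^ n) \<omega> = Some i \<and> (j < Suc K \<longrightarrow> y + (X (real (Suc K) / 2 ^ n) \<omega> - X (real j / 2 ^ n) \<omega>) \<le> 0)) :: ennreal)
     = \<psi> \<omega> (X (real K / 2 ^ n + 1 / 2 ^ n) \<omega> - X (real K / 2 ^ n) \<omega>) * of_bool (J (real K / 2 ^ n) \<omega> = Some i \<and> J (real K / 2 ^ n + 1 / 2 ^ n) \<omega> = Some i)" for \<omega>
  proof -
    have e: "real K / 2 ^ n + 1 / 2 ^ n = real (Suc K) / 2 ^ n" by (simp add: add_divide_distrib)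
    let ?A = "\<lambda>j. J (real j / 2 ^ n) \<omega> = Some i" and ?Q = "\<lambda>j. y + (X (real (Suc K) / 2 ^ n) \<omega> - X (real j / 2 ^ n) \<omega>) \<le> 0"
    have "(\<forall>j\<in>{..Suc K}. ?A j \<and> (j < Suc K \<longrightarrow> ?Q j)) \<longleftrightarrow> ?A (Suc K) \<and> ?Q K \<and> (\<forall>j\<in>{..K}. ?A j \<and> (j < K \<longrightarrow> ?Q j))"
      by (rule ball_atMost_Suc_last)
    moreover have "(\<forall>j\<in>{..K}. ?A j \<and> (j < K \<longrightarrow> ?Q j)) \<Longrightarrow> ?A K" by (metis atMost_iff order_refl)
    moreover have "\<psi> \<omega> (X (real K / 2 ^ n + 1 / 2 ^ n) \<omega> - X (real K / 2 ^ n) \<omega>) = of_bool (?Q K \<and> (\<forall>j\<in>{..K}. ?A j \<and> (j < K \<longrightarrow> ?Q j)))"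
      unfolding \<psi>_def e by (simp add: algebra_simps del: of_nat_Suc)
    ultimately show ?thesis unfolding e by auto
  qed
  have "end_min_prob i n (Suc K) y = (\<integral>\<^sup>+\<omega>. \<psi> \<omega> (X (real K / 2 ^ n + 1 / 2 ^ n) \<omega> - X (real K / 2 ^ n) \<omega>) * of_bool (J (real K / 2 ^ n) \<omega> = Some i \<and> J (real K / 2 ^ n + 1 / 2 ^ n) \<omega> = Some i) \<partial>P 0 i)"
    unfolding end_min_prob_def eq ..
  also have "\<dots> = (\<integral>\<^sup>+\<omega>. (\<integral>\<^sup>+\<omega>'. \<psi> \<omega> (X (1 / 2 ^ n) \<omega>') * of_bool (J (1 / 2 ^ n) \<omega>' = Some i) \<partial>P 0 i) * of_bool (J (real K / 2 ^ n) \<omega> = Some i) \<partial>P 0 i)"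
    by (rule markov_nn_integral_1[where u = "\<lambda>l. real l / 2 ^ n" and m = "Suc K" and \<psi> = \<psi> and t = "real K / 2 ^ n" and s = "1 / 2 ^ n"])
      (auto simp: grid_algebra_def[symmetric] m1 intro!: divide_right_mono)
  also have "\<dots> = (\<integral>\<^sup>+\<omega>. (\<integral>\<^sup>+\<omega>'. of_bool (\<forall>j\<in>{..K}. J (real j / 2 ^ n) \<omega> = Some i \<and>
      (j < K \<longrightarrow> (y + X (1 / 2 ^ n) \<omega>') + (X (real K / 2 ^ n) \<omega> - X (real j / 2 ^ n) \<omega>) \<le> 0)) * of_bool (y + X (1 / 2 ^ n) \<omega>' \<le> 0 \<and> J (1 / 2 ^ n) \<omega>' = Some i) \<partial>P 0 i) \<partial>P 0 i)"
  proof (rule nn_integral_cong)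
    fix \<omega>
    show "(\<integral>\<^sup>+\<omega>'. \<psi> \<omega> (X (1 / 2 ^ n) \<omega>') * of_bool (J (1 / 2 ^ n) \<omega>' = Some i) \<partial>P 0 i) * of_bool (J (real K / 2 ^ n) \<omega> = Some i)
      = (\<integral>\<^sup>+\<omega>'. of_bool (\<forall>j\<in>{..K}. J (real j / 2 ^ n) \<omega> = Some i \<and>
      (j < K \<longrightarrow> (y + X (1 / 2 ^ n) \<omega>') + (X (real K / 2 ^ n) \<omega> - X (real j / 2 ^ n) \<omega>) \<le> 0)) * of_bool (y + X (1 / 2 ^ n) \<omega>' \<le> 0 \<and> J (1 / 2 ^ n) \<omega>' = Some i) \<partial>P 0 i)"
    proof (cases "J (real K / 2 ^ n) \<omega> = Some i")
      case True
      then show ?thesis by (auto simp: \<psi>_def intro!: nn_integral_cong)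
    next
      case False
      then have z: "(of_bool (\<forall>j\<in>{..K}. J (real j / 2 ^ n) \<omega> = Some i \<and>
        (j < K \<longrightarrow> (y + X (1 / 2 ^ n) \<omega>') + (X (real K / 2 ^ n) \<omega> - X (real j / 2 ^ n) \<omega>) \<le> 0)) :: ennreal) = 0" for \<omega>' by auto
      show ?thesis unfolding z using False by simp
    qed
  qed
  also have "\<dots> = (\<integral>\<^sup>+\<omega>'. (\<integral>\<^sup>+\<omega>. of_bool (\<forall>j\<in>{..K}. J (real j / 2 ^ n) \<omega> = Some i \<and>
      (j < K \<longrightarrow> (y + X (1 / 2 ^ n) \<omega>') + (X (real K / 2 ^ n) \<omega> - X (real j / 2 ^ n) \<omega>) \<le> 0)) * of_bool (y + X (1 / 2 ^ n) \<omega>' \<le> 0 \<and> J (1 / 2 ^ n) \<omega>' = Some i) \<partial>P 0 i) \<partial>P 0 i)"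
    by (rule Fubini'[symmetric]) measurable
  also have "\<dots> = (\<integral>\<^sup>+\<omega>'. end_min_prob i n K (y + X (1 / 2 ^ n) \<omega>') * of_bool (y + X (1 / 2 ^ n) \<omega>' \<le> 0 \<and> J (1 / 2 ^ n) \<omega>' = Some i) \<partial>P 0 i)"
    by (intro nn_integral_cong) (simp add: end_min_prob_def nn_integral_multc)
  finally show ?thesis .
qed

lemma below_prob_eq_end_min_prob: "below_prob i n K y = end_min_prob i n K y"
proof (induction K arbitrary: y)
  case 0 show ?case by (simp add: below_prob_def end_min_prob_def)
next
  case (Suc K) then show ?case by (simp add: below_prob_Suc end_min_prob_Suc)
qed

text \<open>After reversal the event says that the path stays at or below its start at all later
  grid points. It is disjoint from the event of \<open>up_prob\<close>, whose probability tends to 1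
  as the window of length \<open>1 / 2 ^ r\<close> is subdivided.\<close>

lemma eventually_end_min_prob_small:
  assumes d: "d > 0"
  shows "eventually (\<lambda>r. eventually (\<lambda>n. end_min_prob i (r + n) (2 ^ n) 0 \<le> ennreal d) sequentially) sequentially"
  using eventually_ascent_short[of i]
proof eventually_elim
  case (elim r)
  then obtain e where "e > 0" "measure (P 0 i) {\<omega>\<in>space \<Omega>. X (1 / 2 ^ r) \<omega> - X 0 \<omega> > e \<and> stays r i \<omega>} > 0" by blast
  from up_prob_tendsto_1[OF this d] show ?case
  proof eventually_elim
    case (elim n)
    let ?B = "{\<omega>\<in>space \<Omega>. \<forall>j\<in>{..2 ^ n}. J (real j / 2 ^ (r + n)) \<omega> = Some i \<and> (0 < j \<longrightarrow> 0 + (X (real j / 2 ^ (r + n)) \<omega> - X 0 \<omega>) \<le> 0)}"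
    let ?U = "{\<omega>\<in>space \<Omega>. \<exists>k\<in>{..2 ^ n}. X (real k / 2 ^ (r + n)) \<omega> - X 0 \<omega> > 0 \<and> (\<forall>j\<in>{..k}. J (real j / 2 ^ (r + n)) \<omega> = Some i)}"
    have "end_min_prob i (r + n) (2 ^ n) 0 = (\<integral>\<^sup>+\<omega>. indicator ?B \<omega> \<partial>P 0 i)"
      unfolding below_prob_eq_end_min_prob[symmetric] below_prob_def by (intro nn_integral_cong) (auto simp: indicator_def)
    also have "\<dots> = ennreal (measure (P 0 i) ?B)" by (subst nn_integral_indicator) (auto simp: P.emeasure_eq_measure)
    finally have E: "end_min_prob i (r + n) (2 ^ n) 0 = ennreal (measure (P 0 i) ?B)" .
    have "measure (P 0 i) ?B \<le> measure (P 0 i) (space \<Omega> - ?U)"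
    proof (rule P.finite_measure_mono)
      show "?B \<subseteq> space \<Omega> - ?U"
      proof (rule subsetI, rule DiffI)
        fix \<omega> assume B: "\<omega> \<in> ?B"
        then show "\<omega> \<in> space \<Omega>" by blast
        show "\<omega> \<notin> ?U"
        proof
          assume "\<omega> \<in> ?U"
          then obtain k where k: "k \<in> {..2 ^ n}" "X (real k / 2 ^ (r + n)) \<omega> - X 0 \<omega> > 0" by blast
          have "k \<noteq> 0" using k(2) by (intro notI) simp
          moreover have "0 < k \<longrightarrow> 0 + (X (real k / 2 ^ (r + n)) \<omega> - X 0 \<omega>) \<le> 0" using B k(1) by blast
          ultimately show False using k(2) by simp
        qed
      qed
    qed measurable
    also have "\<dots> = 1 - up_prob i (r + n) (2 ^ n)"
    proof -
      have "?U \<in> sets (P 0 i)" by measurable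
      from P.prob_compl[OF this] show ?thesis by (simp add: up_prob_def)
    qed
    also have "\<dots> \<le> d" using elim by simp
    finally show ?case unfolding E by (rule ennreal_leI)
  qed
qed

lemma sets_end_min:
  "{w\<in>space (fd_space (Suc K)). (\<forall>j\<in>{..K}. snd (w j) = Some k) \<and> (\<forall>j\<in>{..K}. j < K \<longrightarrow> fst (w K) \<le> fst (w j))}
    \<in> sets (fd_space (Suc K) :: (nat \<Rightarrow> real \<times> 'n option) measure)"
proof -
  have w: "(\<lambda>w. w j) \<in> measurable (fd_space (Suc K)) (borel \<Otimes>\<^sub>M count_space (UNIV :: 'n option set))" if "j \<in> {..K}" for j
    using that by (intro measurable_component_singleton) auto
  have f: "(\<lambda>w. fst (w j)) \<in> borel_measurable (fd_space (Suc K) :: (nat \<Rightarrow> real \<times> 'n option) measure)" if "j \<in> {..K}" for j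
    using measurable_compose[OF w[OF that] measurable_fst] .
  have 1: "Measurable.pred (fd_space (Suc K)) (\<lambda>w. snd (w j) = Some k)" if "j \<in> {..K}" for j
    by (rule measurable_compose[OF measurable_compose[OF w[OF that] measurable_snd]]) simp
  have "Measurable.pred (fd_space (Suc K) :: (nat \<Rightarrow> real \<times> 'n option) measure) (\<lambda>w. fst (w K) \<le> fst (w j))" if "j \<in> {..K}" for j
    using that unfolding pred_def by (intro borel_measurable_le f) auto
  then have 2: "Measurable.pred (fd_space (Suc K) :: (nat \<Rightarrow> real \<times> 'n option) measure) (\<lambda>w. j < K \<longrightarrow> fst (w K) \<le> fst (w j))" if "j \<in> {..K}" for j
    using that by (cases "j < K") auto
  show ?thesis
    by (intro predE pred_intros_logic pred_intros_finite 1 2) auto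
qed

text \<open>A minimum over the whole past is a minimum over the last window before \<open>s\<close>.
  In a short window the chain rarely changes state, and if it does not, the reversal estimate
  applies from the start of the window by the Markov property. The window is chosen before the mesh
  that subdivides it.\<close>

lemma prob_at_minimum_tendsto_0:
  assumes s: "s > 0"
  shows "(\<lambda>n. measure (P x i) {\<omega>\<in>space \<Omega>. J s \<omega> \<noteq> None \<and> (\<forall>k. real k / 2 ^ n \<le> s \<longrightarrow> X s \<omega> \<le> X (real k / 2 ^ n) \<omega>)}) \<longlonglongrightarrow> 0"
proof -
  define G where "G n = {\<omega>\<in>space \<Omega>. J s \<omega> \<noteq> None \<and> (\<forall>k. real k / 2 ^ n \<le> s \<longrightarrow> X s \<omega> \<le> X (real k / 2 ^ n) \<omega>)}" for n :: nat
  have [measurable]: "G n \<in> sets \<Omega>" for n unfolding G_def by measurable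
  have dec: "decseq G"
  proof (rule decseq_SucI, rule subsetI)
    fix n \<omega> assume w: "\<omega> \<in> G (Suc n)"
    have "X s \<omega> \<le> X (real k / 2 ^ n) \<omega>" if "real k / 2 ^ n \<le> s" for k
    proof -
      have e: "real (2 * k) / 2 ^ Suc n = real k / 2 ^ n" by simp
      show ?thesis using w that unfolding G_def e[symmetric] by blast
    qed
    then show "\<omega> \<in> G n" using w by (simp add: G_def)
  qed
  have "measure (P x i) (\<Inter>n. G n) \<le> 0 + e" if e: "e > 0" for e
  proof -
    \<comment> \<open>Two exceptional events, \<open>B1\<close> and \<open>B2\<close>, for each
      state occupied at the start of the window.\<close>
    define e' where "e' = e / (2 * real CARD('n))"
    have e': "e' > 0" using e by (simp add: e'_def)
    have "(\<lambda>r. (1 / 2) ^ r :: real) \<longlonglongrightarrow> 0" by (rule LIMSEQ_realpow_zero) auto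
    from order_tendstoD(2)[OF this s] have ev1: "eventually (\<lambda>r. (1 / 2) ^ r < s) sequentially" .
    have ev2: "eventually (\<lambda>r. \<forall>k\<in>UNIV. measure (P 0 k) {\<omega>\<in>space \<Omega>. \<not> stays r k \<omega>} < e') sequentially"
      using order_tendstoD(2)[OF prob_not_stays_tendsto_0 e'] by (intro eventually_ball_finite) auto
    have ev3: "eventually (\<lambda>r. \<forall>k\<in>UNIV. eventually (\<lambda>n. end_min_prob k (r + n) (2 ^ n) 0 \<le> ennreal e') sequentially) sequentially"
      using eventually_end_min_prob_small[OF e'] by (intro eventually_ball_finite) auto
    from eventually_conj[OF ev1 eventually_conj[OF ev2 ev3]]
    obtain r where r: "(1 / 2) ^ r < s" "\<And>k. measure (P 0 k) {\<omega>\<in>space \<Omega>. \<not> stays r k \<omega>} < e'"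
      "\<forall>k\<in>UNIV. eventually (\<lambda>n. end_min_prob k (r + n) (2 ^ n) 0 \<le> ennreal e') sequentially"
      by (auto simp: eventually_sequentially)
    have "eventually (\<lambda>n. \<forall>k\<in>UNIV. end_min_prob k (r + n) (2 ^ n) 0 \<le> ennreal e') sequentially"
      using r(3) by (intro eventually_ball_finite) auto
    then obtain n where n: "\<And>k. end_min_prob k (r + n) (2 ^ n) 0 \<le> ennreal e'"
      by (auto simp: eventually_sequentially)
    define v where "v = s - 1 / 2 ^ r"
    have v: "0 \<le> v" using r(1) by (simp add: v_def power_one_over)
    define B1 where "B1 k = {w\<in>space (fd_space (Suc (2 ^ n))). \<exists>j\<in>{..2 ^ n}. snd (w j) \<noteq> Some k}" for k :: 'n
    define B2 where "B2 k = {w\<in>space (fd_space (Suc (2 ^ n))). (\<forall>j\<in>{..2 ^ n}. snd (w j) = Some k) \<and> (\<forall>j\<in>{..2 ^ n}. j < 2 ^ n \<longrightarrow> fst (w (2 ^ n)) \<le> fst (w j))}" for k :: 'n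
    have [measurable]: "B1 k \<in> sets (fd_space (Suc (2 ^ n)))" for k unfolding B1_def by measurable
    have [measurable]: "B2 k \<in> sets (fd_space (Suc (2 ^ n)))" for k unfolding B2_def by (rule sets_end_min)
    define E where "E B k = {\<omega>\<in>space \<Omega>. J v \<omega> = Some k \<and> gshift (r + n) (2 ^ n) v \<omega> \<in> B k}"
      for B :: "'n \<Rightarrow> (nat \<Rightarrow> real \<times> 'n option) set" and k
    have E: "E B k \<in> sets \<Omega>" "measure (P x i) (E B k) \<le> measure (P 0 k) {\<omega>\<in>space \<Omega>. gshift (r + n) (2 ^ n) 0 \<omega> \<in> B k}"
      if [measurable]: "B k \<in> sets (fd_space (Suc (2 ^ n)))" for B k
      unfolding E_def using v by (measurable, intro markov_prob_now_le) auto
    have p1: "measure (P x i) (E B1 k) \<le> e'" for k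
    proof -
      have "{\<omega>\<in>space \<Omega>. gshift (r + n) (2 ^ n) 0 \<omega> \<in> B1 k} \<subseteq> {\<omega>\<in>space \<Omega>. \<not> stays r k \<omega>}"
        by (auto simp: B1_def gshift_apply stays_def)
      then have "measure (P 0 k) {\<omega>\<in>space \<Omega>. gshift (r + n) (2 ^ n) 0 \<omega> \<in> B1 k} \<le> measure (P 0 k) {\<omega>\<in>space \<Omega>. \<not> stays r k \<omega>}"
        by (intro P.finite_measure_mono) auto
      then show ?thesis using E(2)[of B1 k] r(2)[of k] by simp
    qed
    have p2: "measure (P x i) (E B2 k) \<le> e'" for k
    proof -
      have "ennreal (measure (P 0 k) {\<omega>\<in>space \<Omega>. gshift (r + n) (2 ^ n) 0 \<omega> \<in> B2 k})
        = (\<integral>\<^sup>+\<omega>. indicator {\<omega>\<in>space \<Omega>. gshift (r + n) (2 ^ n) 0 \<omega> \<in> B2 k} \<omega> \<partial>P 0 k)"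
        by (subst nn_integral_indicator) (auto simp: P.emeasure_eq_measure)
      also have "\<dots> \<le> end_min_prob k (r + n) (2 ^ n) 0"
        unfolding end_min_prob_def
      proof (rule nn_integral_mono)
        fix \<omega> assume "\<omega> \<in> space (P 0 k)"
        have "\<forall>j\<in>{..2 ^ n}. J (real j / 2 ^ (r + n)) \<omega> = Some k \<and> (j < 2 ^ n \<longrightarrow> 0 + (X (real (2 ^ n) / 2 ^ (r + n)) \<omega> - X (real j / 2 ^ (r + n)) \<omega>) \<le> 0)"
          if g: "gshift (r + n) (2 ^ n) 0 \<omega> \<in> B2 k"
        proof -
          have b1: "snd (gshift (r + n) (2 ^ n) 0 \<omega> j) = Some k" if "j \<le> 2 ^ n" for j
            using g that by (simp add: B2_def)
          have b2: "fst (gshift (r + n) (2 ^ n) 0 \<omega> (2 ^ n)) \<le> fst (gshift (r + n) (2 ^ n) 0 \<omega> j)" if "j < 2 ^ n" for j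
            using g that by (simp add: B2_def)
          have J: "J (real j / 2 ^ (r + n)) \<omega> = Some k" if "j \<le> 2 ^ n" for j
            using b1[OF that] that by (simp add: gshift_apply)
          have f: "fst (gshift (r + n) (2 ^ n) 0 \<omega> j) = X (real j / 2 ^ (r + n)) \<omega> - X 0 \<omega>" if "j \<le> 2 ^ n" for j
            using J[OF that] that by (simp add: gshift_apply)
          show ?thesis
          proof (intro ballI conjI impI)
            fix j :: nat assume "j \<in> {..2 ^ n}" then show "J (real j / 2 ^ (r + n)) \<omega> = Some k" by (intro J) simp
          next
            fix j :: nat assume j: "j < 2 ^ n"
            show "0 + (X (real (2 ^ n) / 2 ^ (r + n)) \<omega> - X (real j / 2 ^ (r + n)) \<omega>) \<le> 0"
              using b2[OF j] j unfolding f[OF less_imp_le[OF j]] f[OF order_refl] by linarith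
          qed
        qed
        then show "indicator {\<omega>\<in>space \<Omega>. gshift (r + n) (2 ^ n) 0 \<omega> \<in> B2 k} \<omega> \<le> (of_bool (\<forall>j\<in>{..2 ^ n}. J (real j / 2 ^ (r + n)) \<omega> = Some k \<and> (j < 2 ^ n \<longrightarrow> 0 + (X (real (2 ^ n) / 2 ^ (r + n)) \<omega> - X (real j / 2 ^ (r + n)) \<omega>) \<le> 0)) :: ennreal)"
          by (auto simp: indicator_def)
      qed
      also have "\<dots> \<le> ennreal e'" by (rule n)
      finally have "measure (P 0 k) {\<omega>\<in>space \<Omega>. gshift (r + n) (2 ^ n) 0 \<omega> \<in> B2 k} \<le> e'"
        using e' by (simp add: ennreal_le_iff)
      then show ?thesis using E(2)[of B2 k] by simp
    qed
    have "(\<Inter>n. G n) \<subseteq> (\<Union>k\<in>UNIV. E B1 k \<union> E B2 k)"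
    proof
      fix \<omega> assume w: "\<omega> \<in> (\<Inter>n. G n)"
      then have \<omega>: "\<omega> \<in> space \<Omega>" and alive: "J s \<omega> \<noteq> None" and min: "\<And>n k. real k / 2 ^ n \<le> s \<Longrightarrow> X s \<omega> \<le> X (real k / 2 ^ n) \<omega>"
        by (auto simp: G_def)
      \<comment> \<open>The window starts at \<open>s - 1 / 2 ^ r\<close>, so its subdivision points
        need not be dyadic; right-continuity extends the minimum property to all earlier
        times.\<close>
      have min': "X s \<omega> \<le> X u \<omega>" if u: "0 \<le> u" "u < s" for u
      proof (rule LIMSEQ_le_const[OF X_next_dyadic_tendsto[OF \<omega> u(1)]])
        show "J u \<omega> \<noteq> None" using J_alive[OF \<omega> alive u(1)] u(2) by simp
        from order_tendstoD(2)[OF next_dyadic_tendsto u(2)] obtain N where N: "\<And>n. n \<ge> N \<Longrightarrow> next_dyadic n u < s"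
          by (auto simp: eventually_sequentially)
        show "\<exists>N. \<forall>n\<ge>N. X s \<omega> \<le> X (next_dyadic n u) \<omega>"
        proof (intro exI[of _ N] allI impI)
          fix n assume "n \<ge> N"
          from N[OF this] next_dyadic_grid[OF u(1), of n] min show "X s \<omega> \<le> X (next_dyadic n u) \<omega>"
            by (metis less_imp_le)
        qed
      qed
      have "J v \<omega> \<noteq> None" using J_alive[OF \<omega> alive v] by (simp add: v_def)
      then obtain k where k: "J v \<omega> = Some k" by blast
      have sp: "gshift (r + n) (2 ^ n) v \<omega> \<in> space (fd_space (Suc (2 ^ n)))"
        using measurable_space[OF measurable_shift_path \<omega>] .
      have fin: "v + real (2 ^ n) / 2 ^ (r + n) = s" by (simp add: v_def power_add)
      have "gshift (r + n) (2 ^ n) v \<omega> \<in> B2 k" if "gshift (r + n) (2 ^ n) v \<omega> \<notin> B1 k"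
      proof -
        have J: "J (v + real j / 2 ^ (r + n)) \<omega> = Some k" if "j \<le> 2 ^ n" for j
          using \<open>gshift (r + n) (2 ^ n) v \<omega> \<notin> B1 k\<close> sp that by (auto simp: B1_def gshift_apply)
        have "X (v + real (2 ^ n) / 2 ^ (r + n)) \<omega> \<le> X (v + real j / 2 ^ (r + n)) \<omega>" if j: "j < 2 ^ n" for j
          unfolding fin
        proof (rule min')
          show "0 \<le> v + real j / 2 ^ (r + n)" using v by simp
          have "real j < real (2 ^ n)" using j by (simp only: of_nat_less_iff)
          then have "real j / 2 ^ (r + n) < real (2 ^ n) / 2 ^ (r + n)" by (rule divide_strict_right_mono) simp
          then show "v + real j / 2 ^ (r + n) < s" using fin by linarith
        qed
        then show ?thesis using sp J J[of "2 ^ n"] by (auto simp: B2_def gshift_apply)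
      qed
      then show "\<omega> \<in> (\<Union>k\<in>UNIV. E B1 k \<union> E B2 k)" using \<omega> k by (auto simp: E_def)
    qed
    then have "measure (P x i) (\<Inter>n. G n) \<le> measure (P x i) (\<Union>k\<in>UNIV. E B1 k \<union> E B2 k)"
      using E(1) by (intro P.finite_measure_mono) auto
    also have "\<dots> \<le> (\<Sum>k\<in>UNIV. measure (P x i) (E B1 k \<union> E B2 k))"
      using E(1) by (intro P.finite_measure_subadditive_finite) auto
    also have "\<dots> \<le> (\<Sum>k\<in>(UNIV::'n set). e' + e')"
      using E(1) p1 p2 by (intro sum_mono order_trans[OF measure_Un_le] add_mono) auto
    also have "\<dots> = e" by (simp add: e'_def)
    finally show ?thesis by simp
  qed
  then have "measure (P x i) (\<Inter>n. G n) \<le> 0" by (rule field_le_epsilon)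
  then have "measure (P x i) (\<Inter>n. G n) = 0" using measure_nonneg by (rule antisym)
  moreover have "(\<lambda>n. measure (P x i) (G n)) \<longlonglongrightarrow> measure (P x i) (\<Inter>n. G n)"
    using dec by (intro P.finite_Lim_measure_decseq) auto
  ultimately show ?thesis by (simp add: G_def)
qed

section \<open>Geometric decay of the probability of no passage\<close>

text \<open>Short ascents that end in the same state are chained: each raises \<open>X\<close> by at
  least \<open>e0\<close> with probability at least \<open>b l\<close>. Finiteness of the state
  space makes height and probability uniform.\<close>

lemma uniform_ascent:
  obtains T c where "c > 0" "c \<le> 1"
    "\<And>l. c \<le> measure (P 0 l) {\<omega>\<in>space \<Omega>. X (real T) \<omega> - X 0 \<omega> > a \<and> J (real T) \<omega> = Some l}"
proof -
  have "eventually (\<lambda>r. \<forall>l\<in>UNIV. \<exists>e>0. measure (P 0 l) {\<omega>\<in>space \<Omega>. X (1 / 2 ^ r) \<omega> - X 0 \<omega> > e \<and> stays r l \<omega>} > 0) sequentially"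
    using eventually_ascent_short by (intro eventually_ball_finite) auto
  then obtain r where "\<forall>l. \<exists>e>0. measure (P 0 l) {\<omega>\<in>space \<Omega>. X (1 / 2 ^ r) \<omega> - X 0 \<omega> > e \<and> stays r l \<omega>} > 0"
    by (auto simp: eventually_sequentially)
  then have ex: "\<exists>e>0. measure (P 0 l) {\<omega>\<in>space \<Omega>. X (1 / 2 ^ r) \<omega> - X 0 \<omega> > e \<and> stays r l \<omega>} > 0" for l by blast
  define e where "e l = (SOME e. 0 < e \<and> 0 < measure (P 0 l) {\<omega>\<in>space \<Omega>. X (1 / 2 ^ r) \<omega> - X 0 \<omega> > e \<and> stays r l \<omega>})" for l
  have e: "e l > 0" "measure (P 0 l) {\<omega>\<in>space \<Omega>. X (1 / 2 ^ r) \<omega> - X 0 \<omega> > e l \<and> stays r l \<omega>} > 0" for l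
    using someI_ex[OF ex[of l]] unfolding e_def by blast+
  define e0 where "e0 = Min (range e)"
  have e0: "e0 > 0" "\<And>l. e0 \<le> e l" using e(1) by (auto simp: e0_def)
  define B where "B l = {w\<in>space (fd_space 2). e0 \<le> fst (w 1) \<and> snd (w 1) = Some l}" for l :: 'n
  have [measurable]: "B l \<in> sets (fd_space 2)" for l unfolding B_def by measurable
  have gB: "shift_path X J t (\<lambda>l. real l / 2 ^ r) 2 \<omega> \<in> B l \<longleftrightarrow> e0 \<le> X (t + 1 / 2 ^ r) \<omega> - X t \<omega> \<and> J (t + 1 / 2 ^ r) \<omega> = Some l"
    if "\<omega> \<in> space \<Omega>" for t \<omega> l
    using measurable_space[OF measurable_shift_path that] by (auto simp: B_def shift_path_def)
  define b where "b l = measure (P 0 l) {\<omega>\<in>space \<Omega>. shift_path X J 0 (\<lambda>l. real l / 2 ^ r) 2 \<omega> \<in> B l}" for l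
  have b: "b l > 0" for l
  proof -
    have "{\<omega>\<in>space \<Omega>. X (1 / 2 ^ r) \<omega> - X 0 \<omega> > e l \<and> stays r l \<omega>} \<subseteq> {\<omega>\<in>space \<Omega>. shift_path X J 0 (\<lambda>l. real l / 2 ^ r) 2 \<omega> \<in> B l}"
    proof safe
      fix \<omega> assume \<omega>: "\<omega> \<in> space \<Omega>" and "e l < X (1 / 2 ^ r) \<omega> - X 0 \<omega>" "stays r l \<omega>"
      moreover have "J (real 1 / 2 ^ (r + 0)) \<omega> = Some l" using \<open>stays r l \<omega>\<close> unfolding stays_def by (metis atMost_iff order_refl power_0)
      ultimately show "shift_path X J 0 (\<lambda>l. real l / 2 ^ r) 2 \<omega> \<in> B l"
        using e0(2)[of l] by (subst gB) auto
    qed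
    then have "measure (P 0 l) {\<omega>\<in>space \<Omega>. X (1 / 2 ^ r) \<omega> - X 0 \<omega> > e l \<and> stays r l \<omega>} \<le> b l"
      unfolding b_def by (intro P.finite_measure_mono) auto
    then show ?thesis using e(2)[of l] by simp
  qed
  have pow: "b l ^ M \<le> measure (P 0 l) {\<omega>\<in>space \<Omega>. X (real M / 2 ^ r) \<omega> - X 0 \<omega> \<ge> real M * e0 \<and> J (real M / 2 ^ r) \<omega> = Some l}" for l M
  proof (induction M)
    case 0
    have "measure (P 0 l) {\<omega>\<in>space \<Omega>. J 0 \<omega> = Some l} = 1"
      using AE_J0[where x = 0 and i = l] by (subst P.prob_eq_1) auto
    then show ?case by simp
  next
    case (Suc M)
    let ?A = "{\<omega>\<in>space (grid_algebra r M). X (real M / 2 ^ r) \<omega> - X (real 0 / 2 ^ r) \<omega> \<ge> real M * e0}"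
    have A: "?A \<in> sets (past_algebra (\<lambda>l. real l / 2 ^ r) (Suc M))" unfolding grid_algebra_def[symmetric] by measurable
    have "b l ^ Suc M \<le> measure (P 0 l) {\<omega>\<in>space \<Omega>. X (real M / 2 ^ r) \<omega> - X 0 \<omega> \<ge> real M * e0 \<and> J (real M / 2 ^ r) \<omega> = Some l} * b l"
      using mult_right_mono[OF Suc.IH, of "b l"] b[of l] by (simp add: mult.commute)
    also have "\<dots> = measure (P 0 l) {\<omega>\<in>space \<Omega>. \<omega> \<in> ?A \<and> J (real M / 2 ^ r) \<omega> = Some l} * b l" by simp
    also have "\<dots> = measure (P 0 l) {\<omega>\<in>space \<Omega>. \<omega> \<in> ?A \<and> J (real M / 2 ^ r) \<omega> = Some l \<and> shift_path X J (real M / 2 ^ r) (\<lambda>l. real l / 2 ^ r) 2 \<omega> \<in> B l}"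
      unfolding b_def using A by (intro markov_prob[symmetric]) (auto intro: divide_right_mono)
    also have "\<dots> \<le> measure (P 0 l) {\<omega>\<in>space \<Omega>. X (real (Suc M) / 2 ^ r) \<omega> - X 0 \<omega> \<ge> real (Suc M) * e0 \<and> J (real (Suc M) / 2 ^ r) \<omega> = Some l}"
    proof (rule P.finite_measure_mono)
      have e: "real M / 2 ^ r + 1 / 2 ^ r = real (Suc M) / 2 ^ r" by (simp add: add_divide_distrib)
      show "{\<omega>\<in>space \<Omega>. \<omega> \<in> ?A \<and> J (real M / 2 ^ r) \<omega> = Some l \<and> shift_path X J (real M / 2 ^ r) (\<lambda>l. real l / 2 ^ r) 2 \<omega> \<in> B l}
        \<subseteq> {\<omega>\<in>space \<Omega>. X (real (Suc M) / 2 ^ r) \<omega> - X 0 \<omega> \<ge> real (Suc M) * e0 \<and> J (real (Suc M) / 2 ^ r) \<omega> = Some l}"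
      proof
        fix \<omega> assume w: "\<omega> \<in> {\<omega>\<in>space \<Omega>. \<omega> \<in> ?A \<and> J (real M / 2 ^ r) \<omega> = Some l \<and> shift_path X J (real M / 2 ^ r) (\<lambda>l. real l / 2 ^ r) 2 \<omega> \<in> B l}"
        then have \<omega>: "\<omega> \<in> space \<Omega>" by simp
        have "e0 \<le> X (real (Suc M) / 2 ^ r) \<omega> - X (real M / 2 ^ r) \<omega> \<and> J (real (Suc M) / 2 ^ r) \<omega> = Some l"
          using w gB[OF \<omega>, of "real M / 2 ^ r" l] unfolding e by blast
        moreover have "real M * e0 \<le> X (real M / 2 ^ r) \<omega> - X 0 \<omega>" using w by simp
        ultimately show "\<omega> \<in> {\<omega>\<in>space \<Omega>. X (real (Suc M) / 2 ^ r) \<omega> - X 0 \<omega> \<ge> real (Suc M) * e0 \<and> J (real (Suc M) / 2 ^ r) \<omega> = Some l}"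
          using \<omega> by (auto simp: algebra_simps)
      qed
    qed measurable
    finally show ?case .
  qed
  \<comment> \<open>\<open>T\<close> is a natural number, so it is a point of every grid; it
    contains \<open>T * 2 ^ r\<close> short intervals, more than enough to climb above
    \<open>a\<close>.\<close>
  obtain T where T: "a < real T * e0" using e0(1) reals_Archimedean3[of e0] by blast
  have Te: "real (T * 2 ^ r) / 2 ^ r = real T" by simp
  have "real T * e0 * 1 \<le> real T * e0 * 2 ^ r" using e0(1) by (intro mult_left_mono) auto
  then have "real T * e0 \<le> real (T * 2 ^ r) * e0" by (simp add: mult_ac)
  with T have Ta: "a < real (T * 2 ^ r) * e0" by linarith
  define c where "c = Min (range (\<lambda>l. b l ^ (T * 2 ^ r)))"
  have c: "c > 0" "\<And>l. c \<le> b l ^ (T * 2 ^ r)" using b by (auto simp: c_def)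
  have main: "c \<le> measure (P 0 l) {\<omega>\<in>space \<Omega>. X (real T) \<omega> - X 0 \<omega> > a \<and> J (real T) \<omega> = Some l}" for l
  proof -
    have "c \<le> measure (P 0 l) {\<omega>\<in>space \<Omega>. X (real T) \<omega> - X 0 \<omega> \<ge> real (T * 2 ^ r) * e0 \<and> J (real T) \<omega> = Some l}"
      using order_trans[OF c(2)[of l] pow[of l "T * 2 ^ r"]] unfolding Te .
    also have "\<dots> \<le> measure (P 0 l) {\<omega>\<in>space \<Omega>. X (real T) \<omega> - X 0 \<omega> > a \<and> J (real T) \<omega> = Some l}"
      using Ta by (intro P.finite_measure_mono) auto
    finally show ?thesis .
  qed
  have "c \<le> 1" using main P.prob_le_1 by (meson order_trans)
  then show ?thesis using that c(1) main by blast
qed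

text \<open>The reflected process at the end of a block is at least the increment of
  \<open>X\<close> over the block, so an increment above \<open>a\<close> in any of the
  \<open>j\<close> blocks of length \<open>T\<close> causes passage. The additional unit of time
  makes the end of the last block lie strictly before the horizon, as \<open>grid_exceeds\<close>
  demands.\<close>

lemma no_passage_prob:
  assumes a: "0 \<le> a"
  obtains T c where "T > 0" "c > 0" "c \<le> 1"
    "\<And>x i j. measure (P x i) {\<omega>\<in>space \<Omega>. J (real (j * T + 1)) \<omega> \<noteq> None \<and> \<not> grid_exceeds a (j * T + 1) \<omega>} \<le> (1 - c) ^ j"
proof -
  obtain T c where c: "c > 0" "c \<le> 1" and asc: "\<And>l. c \<le> measure (P 0 l) {\<omega>\<in>space \<Omega>. X (real T) \<omega> - X 0 \<omega> > a \<and> J (real T) \<omega> = Some l}"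
  proof (rule uniform_ascent[where a = a])
    fix T c assume "c > 0" "c \<le> 1" "\<And>l. c \<le> measure (P 0 l) {\<omega>\<in>space \<Omega>. X (real T) \<omega> - X 0 \<omega> > a \<and> J (real T) \<omega> = Some l}"
    then show thesis by (rule that)
  qed
  have T: "T > 0"
  proof (rule ccontr)
    assume "\<not> T > 0"
    then have e: "{\<omega>\<in>space \<Omega>. X (real T) \<omega> - X 0 \<omega> > a \<and> J (real T) \<omega> = Some undefined} = {}" using a by auto
    show False using asc[of undefined] c(1) unfolding e by simp
  qed
  \<comment> \<open>The grid of mesh 1, written with exponent 0: all block ends are natural
    numbers.\<close>
  define A where "A j = {\<omega>\<in>space (grid_algebra 0 (j * T)). \<forall>i\<in>{..<j}. X (real (Suc i * T) / 2 ^ 0) \<omega> - X (real (i * T) / 2 ^ 0) \<omega> \<le> a}" for j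
  have le: "Suc i * T \<le> j * T" "i * T \<le> j * T" if "i < j" for i j using that by (auto intro: mult_le_mono1 simp del: mult_Suc)
  have A: "A j \<in> sets (grid_algebra 0 (j * T))" for j
    unfolding A_def
  proof (rule sets.sets_Collect_finite_All)
    fix i assume i: "i \<in> {..<j}"
    have "X (real (Suc i * T) / 2 ^ 0) \<in> borel_measurable (grid_algebra 0 (j * T))" "X (real (i * T) / 2 ^ 0) \<in> borel_measurable (grid_algebra 0 (j * T))"
      using i le by (intro grid_algebra_X; blast)+
    then show "{\<omega>\<in>space (grid_algebra 0 (j * T)). X (real (Suc i * T) / 2 ^ 0) \<omega> - X (real (i * T) / 2 ^ 0) \<omega> \<le> a} \<in> sets (grid_algebra 0 (j * T))"
      by (intro borel_measurable_le borel_measurable_diff borel_measurable_const)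
  qed simp
  have [measurable]: "A j \<in> sets \<Omega>" for j using A by (rule sets_grid_algebra_subset)
  have A_iff: "\<omega> \<in> A j \<longleftrightarrow> \<omega> \<in> space \<Omega> \<and> (\<forall>i<j. X (real (Suc i * T)) \<omega> - X (real (i * T)) \<omega> \<le> a)" for j \<omega>
    by (auto simp: A_def)
  define H where "H j = {\<omega>\<in>space \<Omega>. \<omega> \<in> A j \<and> J (real (j * T)) \<omega> \<noteq> None}" for j
  have [measurable]: "H j \<in> sets \<Omega>" for j unfolding H_def by measurable
  define B where "B l = {w\<in>space (fd_space (Suc T)). \<not> (fst (w T) > a \<and> snd (w T) = Some l)}" for l :: 'n
  have [measurable]: "B l \<in> sets (fd_space (Suc T))" for l unfolding B_def by measurable
  have gB: "gshift 0 T t \<omega> \<in> B l \<longleftrightarrow> \<not> (X (t + real T) \<omega> - X t \<omega> > a \<and> J (t + real T) \<omega> = Some l)" if "\<omega> \<in> space \<Omega>" for t \<omega> l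
  proof -
    have "fst (gshift 0 T t \<omega> T) = (if J (t + real T) \<omega> = None then 0 else X (t + real T) \<omega> - X t \<omega>)"
      "snd (gshift 0 T t \<omega> T) = J (t + real T) \<omega>" by (simp_all add: shift_path_def)
    moreover have "gshift 0 T t \<omega> \<in> space (fd_space (Suc T))" using measurable_space[OF measurable_shift_path that] .
    ultimately show ?thesis by (simp only: B_def mem_Collect_eq) auto
  qed
  have pB: "measure (P 0 l) {\<omega>\<in>space \<Omega>. gshift 0 T 0 \<omega> \<in> B l} \<le> 1 - c" for l
  proof -
    let ?S = "{\<omega>\<in>space \<Omega>. X (real T) \<omega> - X 0 \<omega> > a \<and> J (real T) \<omega> = Some l}"
    have "{\<omega>\<in>space \<Omega>. gshift 0 T 0 \<omega> \<in> B l} = space (P 0 l) - ?S" using gB[of _ 0 l] by auto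
    then have "measure (P 0 l) {\<omega>\<in>space \<Omega>. gshift 0 T 0 \<omega> \<in> B l} = 1 - measure (P 0 l) ?S"
      by (subst P.prob_compl[symmetric]) auto
    then show ?thesis using asc[of l] by simp
  qed
  have H: "measure (P x i) (H j) \<le> (1 - c) ^ j" for x i j
  proof (induction j)
    case 0 show ?case by simp
  next
    case (Suc j)
    define E where "E l = {\<omega>\<in>space \<Omega>. \<omega> \<in> A j \<and> J (real (j * T) / 2 ^ 0) \<omega> = Some l \<and> gshift 0 T (real (j * T) / 2 ^ 0) \<omega> \<in> B l}" for l
    define E' where "E' l = {\<omega>\<in>space \<Omega>. \<omega> \<in> A j \<and> J (real (j * T) / 2 ^ 0) \<omega> = Some l}" for l
    have [measurable]: "E l \<in> sets \<Omega>" "E' l \<in> sets \<Omega>" for l unfolding E_def E'_def by measurable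
    have "H (Suc j) \<subseteq> (\<Union>l\<in>UNIV. E l)"
    proof
      fix \<omega> assume w: "\<omega> \<in> H (Suc j)"
      then have \<omega>: "\<omega> \<in> space \<Omega>" and alive: "J (real (Suc j * T)) \<omega> \<noteq> None" by (auto simp: H_def)
      have "J (real (j * T)) \<omega> \<noteq> None" by (rule J_alive[OF \<omega> alive]) (auto simp: distrib_right)
      then obtain l where l: "J (real (j * T)) \<omega> = Some l" by blast
      have "X (real (Suc j * T)) \<omega> - X (real (j * T)) \<omega> \<le> a" and Aj: "\<omega> \<in> A j" using w by (auto simp: H_def A_iff simp del: mult_Suc)
      moreover have "real (j * T) + real T = real (Suc j * T)" by simp
      ultimately have "gshift 0 T (real (j * T)) \<omega> \<in> B l" by (subst gB[OF \<omega>]) (simp only:, simp)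
      then show "\<omega> \<in> (\<Union>l\<in>UNIV. E l)" using \<omega> l Aj by (auto simp: E_def)
    qed
    then have "measure (P x i) (H (Suc j)) \<le> measure (P x i) (\<Union>l\<in>UNIV. E l)" by (intro P.finite_measure_mono) auto
    also have "\<dots> \<le> (\<Sum>l\<in>UNIV. measure (P x i) (E l))" by (intro P.finite_measure_subadditive_finite) auto
    also have "\<dots> \<le> (\<Sum>l\<in>UNIV. measure (P x i) (E' l) * (1 - c))"
    proof (rule sum_mono)
      fix l
      have "measure (P x i) (E l) = measure (P x i) (E' l) * measure (P 0 l) {\<omega>\<in>space \<Omega>. gshift 0 T 0 \<omega> \<in> B l}"
        unfolding E_def E'_def by (rule markov_grid[OF A]) measurable
      then show "measure (P x i) (E l) \<le> measure (P x i) (E' l) * (1 - c)"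
        using mult_left_mono[OF pB[of l] measure_nonneg] by (simp only:)
    qed
    also have "\<dots> = (\<Sum>l\<in>UNIV. measure (P x i) (E' l)) * (1 - c)" by (simp add: sum_distrib_right)
    also have "(\<Sum>l\<in>UNIV. measure (P x i) (E' l)) = measure (P x i) (\<Union>l\<in>UNIV. E' l)"
      by (rule P.finite_measure_finite_Union[symmetric]) (auto simp: disjoint_family_on_def E'_def)
    also have "\<dots> \<le> measure (P x i) (H j)" by (intro P.finite_measure_mono) (auto simp: E'_def H_def)
    also have "\<dots> \<le> (1 - c) ^ j" by (rule Suc.IH)
    finally show ?case using c by (simp add: mult_right_mono mult.commute)
  qed
  have "measure (P x i) {\<omega>\<in>space \<Omega>. J (real (j * T + 1)) \<omega> \<noteq> None \<and> \<not> grid_exceeds a (j * T + 1) \<omega>} \<le> measure (P x i) (H j)" for x i j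
  proof (rule P.finite_measure_mono)
    show "{\<omega>\<in>space \<Omega>. J (real (j * T + 1)) \<omega> \<noteq> None \<and> \<not> grid_exceeds a (j * T + 1) \<omega>} \<subseteq> H j"
    proof
      fix \<omega> assume w: "\<omega> \<in> {\<omega>\<in>space \<Omega>. J (real (j * T + 1)) \<omega> \<noteq> None \<and> \<not> grid_exceeds a (j * T + 1) \<omega>}"
      then have \<omega>: "\<omega> \<in> space \<Omega>" and alive: "J (real (j * T + 1)) \<omega> \<noteq> None" by auto
      have al: "J (real k) \<omega> \<noteq> None" if "k \<le> j * T + 1" for k
        using that by (intro J_alive[OF \<omega> alive]) (simp_all only: of_nat_0_le_iff of_nat_le_iff)
      have "X (real (Suc i * T)) \<omega> - X (real (i * T)) \<omega> \<le> a" if i: "i < j" for i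
      proof (rule ccontr)
        assume "\<not> ?thesis"
        \<comment> \<open>The regulator at the end of the block dominates the negative of
          \<open>X\<close> at its beginning.\<close>
        moreover have "- X (real (i * T) / 2 ^ 0) \<omega> \<le> grid_R X 0 (Suc i * T) \<omega>" by (rule grid_R_ge) simp
        ultimately have "grid_Y X 0 (Suc i * T) \<omega> > a" by (simp add: grid_Y_def del: mult_Suc)
        moreover have "Suc i * T < (j * T + 1) * 2 ^ 0" using le(1)[OF i] by simp
        moreover have "J (real (Suc i * T) / 2 ^ 0) \<omega> \<noteq> None" using al[of "Suc i * T"] le(1)[OF i] by simp
        ultimately have "grid_exceeds a (j * T + 1) \<omega>" unfolding grid_exceeds_def by blast
        then show False using w by simp
      qed
      then show "\<omega> \<in> H j" using \<omega> al[of "j * T"] by (simp add: H_def A_iff del: mult_Suc)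
    qed
  qed measurable
  then have "measure (P x i) {\<omega>\<in>space \<Omega>. J (real (j * T + 1)) \<omega> \<noteq> None \<and> \<not> grid_exceeds a (j * T + 1) \<omega>} \<le> (1 - c) ^ j" for x i j
    using H order_trans by blast
  then show ?thesis using that T c by blast
qed

end

section \<open>The reflected process on a grid\<close>

lemma nn_integral_of_bool:
  assumes [measurable]: "Measurable.pred M Q"
  shows "(\<integral>\<^sup>+\<omega>. of_bool (Q \<omega>) \<partial>M) = emeasure M {\<omega>\<in>space M. Q \<omega>}"
proof -
  have "(\<integral>\<^sup>+\<omega>. of_bool (Q \<omega>) \<partial>M) = (\<integral>\<^sup>+\<omega>. indicator {\<omega>\<in>space M. Q \<omega>} \<omega> \<partial>M)"
    by (intro nn_integral_cong) (auto simp: indicator_def)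
  also have "\<dots> = emeasure M {\<omega>\<in>space M. Q \<omega>}" by (rule nn_integral_indicator) measurable
  finally show ?thesis .
qed

lemma integral_of_bool:
  assumes [measurable]: "Measurable.pred M Q"
  shows "(\<integral>\<omega>. of_bool (Q \<omega>) \<partial>M) = measure M {\<omega>\<in>space M. Q \<omega>}"
proof -
  have "(\<integral>\<omega>. of_bool (Q \<omega>) \<partial>M) = (\<integral>\<omega>. indicator {\<omega>\<in>space M. Q \<omega>} \<omega> \<partial>M)"
    by (intro Bochner_Integration.integral_cong) (auto simp: indicator_def)
  also have "\<dots> = measure M ({\<omega>\<in>space M. Q \<omega>} \<inter> space M)" by (rule Bochner_Integration.integral_indicator)
  also have "{\<omega>\<in>space M. Q \<omega>} \<inter> space M = {\<omega>\<in>space M. Q \<omega>}" by auto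
  finally show ?thesis .
qed

lemma (in prob_space) integrable_of_bool_bounded:
  fixes f :: "'a \<Rightarrow> real"
  assumes [measurable]: "f \<in> borel_measurable M" and "\<And>\<omega>. \<omega> \<in> space M \<Longrightarrow> \<bar>f \<omega>\<bar> \<le> C"
  shows "integrable M f"
  by (rule integrable_const_bound[where B = C]) (use assms in auto)

lemma sum_of_bool_Some:
  fixes f :: "'n::finite \<Rightarrow> 'b::semiring_1"
  shows "(\<Sum>l\<in>UNIV. f l * of_bool (v = Some l)) = (case v of None \<Rightarrow> 0 | Some l \<Rightarrow> f l)"
proof (cases v)
  case (Some a)
  have "(\<Sum>l\<in>UNIV. f l * of_bool (v = Some l)) = (\<Sum>l\<in>UNIV. if a = l then f l else 0)"
    using Some by (intro sum.cong) auto
  also have "\<dots> = f a" by (subst sum.delta') auto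
  finally show ?thesis using Some by simp
qed simp

lemma sum_of_bool_Some2:
  fixes f :: "'n::finite \<Rightarrow> 'n \<Rightarrow> 'b::semiring_1"
  shows "(\<Sum>l\<in>UNIV. \<Sum>m\<in>UNIV. f l m * of_bool (v = Some l \<and> w = Some m))
    = (case v of None \<Rightarrow> 0 | Some l \<Rightarrow> (case w of None \<Rightarrow> 0 | Some m \<Rightarrow> f l m))"
proof -
  have "(\<Sum>m\<in>UNIV. f l m * of_bool (v = Some l \<and> w = Some m)) = (\<Sum>m\<in>UNIV. f l m * of_bool (w = Some m)) * of_bool (v = Some l)" for l
    unfolding sum_distrib_right by (intro sum.cong) auto
  then show ?thesis by (simp only: sum_of_bool_Some)
qed

context spectrally_negative_MAP
begin

section \<open>Increments, grid events and the time spent at the minimum\<close>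

text \<open>An empty past (\<open>m = 0\<close>) suffices: moments of an increment depend on the
  past only through the state at time \<open>t\<close>.\<close>

lemma increment_moment:
  assumes t: "0 \<le> t" and s: "0 \<le> s" and f [measurable]: "f \<in> borel_measurable borel"
    and v: "has_bochner_integral (P 0 l) (\<lambda>\<omega>. f (X s \<omega>) * of_bool (J s \<omega> = Some m)) v"
  shows "has_bochner_integral (P x i) (\<lambda>\<omega>. f (X (t + s) \<omega> - X t \<omega>) * of_bool (J t \<omega> = Some l \<and> J (t + s) \<omega> = Some m))
    (measure (P x i) {\<omega>\<in>space \<Omega>. J t \<omega> = Some l} * v)"
proof -
  define \<psi>1 :: "'w \<Rightarrow> real \<Rightarrow> ennreal" where "\<psi>1 = (\<lambda>_ y. ennreal \<bar>f y\<bar>)"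
  define \<psi>2 :: "'w \<Rightarrow> real \<Rightarrow> real" where "\<psi>2 = (\<lambda>_ y. f y)"
  have m1: "case_prod \<psi>1 \<in> borel_measurable (past_algebra (\<lambda>_. 0) 0 \<Otimes>\<^sub>M borel)"
    unfolding \<psi>1_def case_prod_beta' by measurable
  have m2: "case_prod \<psi>2 \<in> borel_measurable (past_algebra (\<lambda>_. 0) 0 \<Otimes>\<^sub>M borel)"
    unfolding \<psi>2_def case_prod_beta' by measurable
  have fin: "(\<integral>\<^sup>+\<omega>. ennreal \<bar>f (X s \<omega>)\<bar> * of_bool (J s \<omega> = Some m) \<partial>P 0 l) < \<infinity>"
  proof -
    have "(\<integral>\<^sup>+\<omega>. ennreal \<bar>f (X s \<omega>)\<bar> * of_bool (J s \<omega> = Some m) \<partial>P 0 l) = (\<integral>\<^sup>+\<omega>. ennreal (norm (f (X s \<omega>) * of_bool (J s \<omega> = Some m))) \<partial>P 0 l)"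
      by (intro nn_integral_cong) auto
    also have "\<dots> < \<infinity>" using v by (auto simp: has_bochner_integral_iff integrable_iff_bounded)
    finally show ?thesis .
  qed
  have "(\<integral>\<^sup>+\<omega>. ennreal (norm (f (X (t + s) \<omega> - X t \<omega>) * of_bool (J t \<omega> = Some l \<and> J (t + s) \<omega> = Some m))) \<partial>P x i)
    = (\<integral>\<^sup>+\<omega>. \<psi>1 \<omega> (X (t + s) \<omega> - X t \<omega>) * of_bool (J t \<omega> = Some l \<and> J (t + s) \<omega> = Some m) \<partial>P x i)"
    by (intro nn_integral_cong) (auto simp: \<psi>1_def)
  also have "\<dots> = (\<integral>\<^sup>+\<omega>. (\<integral>\<^sup>+\<omega>'. \<psi>1 \<omega> (X s \<omega>') * of_bool (J s \<omega>' = Some m) \<partial>P 0 l) * of_bool (J t \<omega> = Some l) \<partial>P x i)"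
    by (rule markov_nn_integral_1[where u = "\<lambda>_. 0" and m = 0, OF t _ s m1]) simp
  also have "\<dots> \<le> (\<integral>\<^sup>+\<omega>. (\<integral>\<^sup>+\<omega>'. ennreal \<bar>f (X s \<omega>')\<bar> * of_bool (J s \<omega>' = Some m) \<partial>P 0 l) \<partial>P x i)"
    by (intro nn_integral_mono) (auto simp: \<psi>1_def)
  also have "\<dots> < \<infinity>" using fin P.emeasure_space_1[of x i] by simp
  finally have int: "integrable (P x i) (\<lambda>\<omega>. f (X (t + s) \<omega> - X t \<omega>) * of_bool (J t \<omega> = Some l \<and> J (t + s) \<omega> = Some m))"
    by (intro integrableI_bounded) auto
  have "(\<integral>\<omega>. \<psi>2 \<omega> (X (t + s) \<omega> - X t \<omega>) * of_bool (J t \<omega> = Some l \<and> J (t + s) \<omega> = Some m) \<partial>P x i)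
    = (\<integral>\<omega>. (\<integral>\<omega>'. \<psi>2 \<omega> (X s \<omega>') * of_bool (J s \<omega>' = Some m) \<partial>P 0 l) * of_bool (J t \<omega> = Some l) \<partial>P x i)"
    by (rule markov_integral_1[where u = "\<lambda>_. 0" and m = 0, OF t _ s m2]) (use int in \<open>simp_all add: \<psi>2_def\<close>)
  then have "(\<integral>\<omega>. f (X (t + s) \<omega> - X t \<omega>) * of_bool (J t \<omega> = Some l \<and> J (t + s) \<omega> = Some m) \<partial>P x i)
    = v * (\<integral>\<omega>. of_bool (J t \<omega> = Some l) \<partial>P x i)"
    using v by (simp only: \<psi>2_def has_bochner_integral_iff integral_mult_right_zero)
  then show ?thesis using int by (simp add: has_bochner_integral_iff integral_of_bool)
qed

lemma measurable_grid_R [measurable]: "grid_R X n k \<in> borel_measurable \<Omega>"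
proof (induction k)
  case 0 have "grid_R X n 0 = (\<lambda>\<omega>. max 0 (- X 0 \<omega>))" by auto
  then show ?case by simp
next
  case (Suc k)
  have "grid_R X n (Suc k) = (\<lambda>\<omega>. max (grid_R X n k \<omega>) (- X (real (Suc k) / 2 ^ n) \<omega>))" by auto
  then show ?case using Suc by simp
qed

lemma measurable_grid_Y [measurable]: "grid_Y X n k \<in> borel_measurable \<Omega>"
  unfolding grid_Y_def[abs_def] by measurable

lemma pred_grid_exceeds [measurable]: "Measurable.pred \<Omega> (grid_exceeds a m)"
  unfolding grid_exceeds_def[abs_def] by measurable

lemma grid_algebra_grid_R: "k \<le> k' \<Longrightarrow> grid_R X n k \<in> borel_measurable (grid_algebra n k')"
proof (induction k)
  case 0
  have "grid_R X n 0 = (\<lambda>\<omega>. max 0 (- X (real 0 / 2 ^ n) \<omega>))" by auto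
  moreover have "X (real 0 / 2 ^ n) \<in> borel_measurable (grid_algebra n k')" by (rule grid_algebra_X) simp
  ultimately show ?case by (simp only: borel_measurable_max borel_measurable_const borel_measurable_uminus)
next
  case (Suc k)
  have "grid_R X n (Suc k) = (\<lambda>\<omega>. max (grid_R X n k \<omega>) (- X (real (Suc k) / 2 ^ n) \<omega>))" by auto
  moreover have "X (real (Suc k) / 2 ^ n) \<in> borel_measurable (grid_algebra n k')" by (rule grid_algebra_X) (rule Suc.prems)
  moreover have "grid_R X n k \<in> borel_measurable (grid_algebra n k')" using Suc by simp
  ultimately show ?case by (simp only: borel_measurable_max borel_measurable_uminus)
qed

lemma grid_algebra_grid_Y: "k \<le> k' \<Longrightarrow> grid_Y X n k \<in> borel_measurable (grid_algebra n k')"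
  unfolding grid_Y_def[abs_def] by (intro borel_measurable_add grid_algebra_X grid_algebra_grid_R)

definition grid_below :: "real \<Rightarrow> nat \<Rightarrow> nat \<Rightarrow> 'w \<Rightarrow> bool" where
  "grid_below a n k \<omega> \<longleftrightarrow> (\<forall>j\<in>{..k}. grid_Y X n j \<omega> \<le> a)"

lemma pred_grid_below [measurable]: "Measurable.pred \<Omega> (grid_below a n k)"
  unfolding grid_below_def[abs_def] by measurable

lemma grid_algebra_grid_below: "Measurable.pred (grid_algebra n k) (grid_below a n k)"
  unfolding grid_below_def[abs_def] pred_def
proof (rule sets.sets_Collect_finite_All)
  fix j assume "j \<in> {..k}"
  then show "{\<omega>\<in>space (grid_algebra n k). grid_Y X n j \<omega> \<le> a} \<in> sets (grid_algebra n k)"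
    by (intro borel_measurable_le grid_algebra_grid_Y borel_measurable_const) simp
qed simp

text \<open>Stated with \<open>Jj\<close> and \<open>Xj\<close> because it is integrated over real
  times \<open>s\<close> and must be jointly measurable.\<close>

definition at_min :: "nat \<Rightarrow> real \<Rightarrow> 'w \<Rightarrow> bool" where
  "at_min n s \<omega> \<longleftrightarrow> Jj s \<omega> \<noteq> None \<and> (\<forall>k. real k / 2 ^ n \<le> s \<longrightarrow> Xj s \<omega> \<le> X (real k / 2 ^ n) \<omega>)"

lemma measurable_at_min [measurable (raw)]:
  assumes [measurable]: "f \<in> borel_measurable N" "g \<in> measurable N \<Omega>"
  shows "Measurable.pred N (\<lambda>z. at_min n (f z) (g z))"
  unfolding at_min_def by measurable

definition min_prob :: "real \<Rightarrow> 'n \<Rightarrow> nat \<Rightarrow> real \<Rightarrow> ennreal" where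
  "min_prob x i n s = (\<integral>\<^sup>+\<omega>. of_bool (at_min n s \<omega>) \<partial>P x i)"

lemma measurable_min_prob [measurable]: "min_prob x i n \<in> borel_measurable borel"
  unfolding min_prob_def[abs_def] by measurable

lemma min_prob_le_1: "min_prob x i n s \<le> 1"
proof -
  have "min_prob x i n s \<le> (\<integral>\<^sup>+\<omega>. 1 \<partial>P x i)" unfolding min_prob_def by (intro nn_integral_mono) auto
  then show ?thesis using P.emeasure_space_1[of x i] by simp
qed

text \<open>Dominated convergence over a bounded time interval. Time 0, where the path trivially is
  at its minimum, is a null set.\<close>

lemma min_prob_integral_tendsto_0:
  "(\<lambda>n. \<integral>\<^sup>+s. min_prob x i n s * indicator {0..<real m} s \<partial>lborel) \<longlonglongrightarrow> 0"
proof -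
  have "(\<lambda>n. \<integral>\<^sup>+s. min_prob x i n s * indicator {0..<real m} s \<partial>lborel) \<longlonglongrightarrow> (\<integral>\<^sup>+(s::real). 0 \<partial>lborel)"
  proof (rule nn_integral_dominated_convergence[where w = "indicator {0..<real m}"])
    show "AE s in lborel. min_prob x i n s * indicator {0..<real m} s \<le> indicator {0..<real m} s" for n
      using min_prob_le_1 by (auto split: split_indicator)
    show "(\<integral>\<^sup>+s. indicator {0..<real m} s \<partial>lborel) < \<infinity>" by (subst nn_integral_indicator) auto
    show "AE s in lborel. (\<lambda>n. min_prob x i n s * indicator {0..<real m} s) \<longlonglongrightarrow> 0"
      using AE_lborel_singleton[of 0]
    proof eventually_elim
      case (elim s)
      show ?case
      proof (cases "s > 0")
        case True
        have eq: "min_prob x i n s = ennreal (measure (P x i) {\<omega>\<in>space \<Omega>. J s \<omega> \<noteq> None \<and> (\<forall>k. real k / 2 ^ n \<le> s \<longrightarrow> X s \<omega> \<le> X (real k / 2 ^ n) \<omega>)})" for n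
        proof -
          have "min_prob x i n s = emeasure (P x i) {\<omega>\<in>space (P x i). at_min n s \<omega>}"
            unfolding min_prob_def by (rule nn_integral_of_bool) measurable
          also have "{\<omega>\<in>space (P x i). at_min n s \<omega>} = {\<omega>\<in>space \<Omega>. J s \<omega> \<noteq> None \<and> (\<forall>k. real k / 2 ^ n \<le> s \<longrightarrow> X s \<omega> \<le> X (real k / 2 ^ n) \<omega>)}"
            using True by (auto simp: at_min_def Jj_def Xj_def max_def)
          finally show ?thesis by (simp add: P.emeasure_eq_measure)
        qed
        have "(\<lambda>n. min_prob x i n s) \<longlonglongrightarrow> ennreal 0"
          unfolding eq by (intro tendsto_ennrealI prob_at_minimum_tendsto_0 True)
        then show ?thesis using True by (auto split: split_indicator)
      next
        case False then show ?thesis using elim by auto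
      qed
    qed
  qed auto
  then show ?thesis by simp
qed

end

context spectrally_negative_MAP_scale
begin

definition low_prob :: "'n \<Rightarrow> real \<Rightarrow> real \<Rightarrow> ennreal" where
  "low_prob l y s = (\<integral>\<^sup>+\<omega>. of_bool (y + Xj s \<omega> \<le> 0 \<and> Jj s \<omega> \<noteq> None) \<partial>P 0 l)"

lemma measurable_low_prob [measurable]: "(\<lambda>z. low_prob l (fst z) (snd z)) \<in> borel_measurable (borel \<Otimes>\<^sub>M borel)"
  unfolding low_prob_def by measurable

text \<open>Half-open, so that consecutive grid intervals tile the time axis.\<close>

lemma low_time_eq: "low_time t l y = (\<integral>\<^sup>+s. low_prob l y s * indicator {0..<t} s \<partial>lborel)"
  unfolding low_time_def low_prob_def[symmetric]
proof (rule nn_integral_cong_AE)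
  show "AE s in lborel. low_prob l y s * indicator {0..t} s = low_prob l y s * indicator {0..<t} s"
    using AE_lborel_singleton[of t] by eventually_elim (auto split: split_indicator)
qed

text \<open>With the current reflected value as starting level, being at or below 0 after time
  \<open>s\<close> means that \<open>X\<close> is at most \<open>- grid_R\<close>, hence at most its
  values at all grid points so far. As \<open>s < 1 / 2 ^ n\<close>, no further grid point has been
  reached.\<close>

lemma low_prob_step:
  assumes s: "0 \<le> s" "s < 1 / 2 ^ n"
  shows "(\<Sum>l\<in>UNIV. \<integral>\<^sup>+\<omega>. low_prob l (grid_Y X n k \<omega>) s * of_bool (J (real k / 2 ^ n) \<omega> = Some l) \<partial>P x i)
    \<le> min_prob x i n (real k / 2 ^ n + s)"
proof -
  let ?t = "real k / 2 ^ n"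
  define \<psi> :: "'w \<Rightarrow> real \<Rightarrow> ennreal" where "\<psi> \<omega> y = of_bool (grid_Y X n k \<omega> + y \<le> 0)" for \<omega> y
  have gY: "(\<lambda>z. grid_Y X n k (fst z)) \<in> borel_measurable (grid_algebra n k \<Otimes>\<^sub>M borel)"
    by (rule measurable_compose[OF measurable_fst grid_algebra_grid_Y]) simp
  have "Measurable.pred (grid_algebra n k \<Otimes>\<^sub>M borel) (\<lambda>z. grid_Y X n k (fst z) + snd z \<le> 0)"
    unfolding pred_def by (intro borel_measurable_le borel_measurable_add gY borel_measurable_const measurable_snd)
  then have \<psi>m: "case_prod \<psi> \<in> borel_measurable (grid_algebra n k \<Otimes>\<^sub>M borel)"
    unfolding \<psi>_def case_prod_beta' by (rule measurable_of_bool)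
  have inner: "low_prob l y s = (\<Sum>m\<in>UNIV. \<integral>\<^sup>+\<omega>'. of_bool (y + X s \<omega>' \<le> 0) * of_bool (J s \<omega>' = Some m) \<partial>P 0 l)" for l y
  proof -
    have "of_bool (y + Xj s \<omega>' \<le> 0 \<and> Jj s \<omega>' \<noteq> None) = (\<Sum>m\<in>UNIV. of_bool (y + X s \<omega>' \<le> 0) * of_bool (J s \<omega>' = Some m) :: ennreal)" for \<omega>'
      using s by (cases "J s \<omega>'") (auto simp: Xj_def Jj_def max_def sum_distrib_left[symmetric] of_bool_def)
    then show ?thesis unfolding low_prob_def by (simp only:) (rule nn_integral_sum, measurable)
  qed
  have "(\<integral>\<^sup>+\<omega>. low_prob l (grid_Y X n k \<omega>) s * of_bool (J ?t \<omega> = Some l) \<partial>P x i)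
     = (\<Sum>m\<in>UNIV. \<integral>\<^sup>+\<omega>. \<psi> \<omega> (X (?t + s) \<omega> - X ?t \<omega>) * of_bool (J ?t \<omega> = Some l \<and> J (?t + s) \<omega> = Some m) \<partial>P x i)" for l
  proof -
    have *: "(\<integral>\<^sup>+\<omega>. \<psi> \<omega> (X (?t + s) \<omega> - X ?t \<omega>) * of_bool (J ?t \<omega> = Some l \<and> J (?t + s) \<omega> = Some m) \<partial>P x i)
      = (\<integral>\<^sup>+\<omega>. (\<integral>\<^sup>+\<omega>'. \<psi> \<omega> (X s \<omega>') * of_bool (J s \<omega>' = Some m) \<partial>P 0 l) * of_bool (J ?t \<omega> = Some l) \<partial>P x i)" for m
      by (rule markov_nn_integral_1[where u = "\<lambda>l. real l / 2 ^ n" and m = "Suc k"])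
        (use s \<psi>m in \<open>auto simp: grid_algebra_def intro!: divide_right_mono\<close>)
    show ?thesis unfolding * unfolding inner \<psi>_def sum_distrib_right
      by (rule nn_integral_sum) measurable
  qed
  then have "(\<Sum>l\<in>UNIV. \<integral>\<^sup>+\<omega>. low_prob l (grid_Y X n k \<omega>) s * of_bool (J ?t \<omega> = Some l) \<partial>P x i)
     = (\<Sum>l\<in>UNIV. \<Sum>m\<in>UNIV. \<integral>\<^sup>+\<omega>. \<psi> \<omega> (X (?t + s) \<omega> - X ?t \<omega>) * of_bool (J ?t \<omega> = Some l \<and> J (?t + s) \<omega> = Some m) \<partial>P x i)"
    by simp
  also have "\<dots> = (\<integral>\<^sup>+\<omega>. (\<Sum>l\<in>UNIV. \<Sum>m\<in>UNIV. \<psi> \<omega> (X (?t + s) \<omega> - X ?t \<omega>) * of_bool (J ?t \<omega> = Some l \<and> J (?t + s) \<omega> = Some m)) \<partial>P x i)"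
  proof -
    have [measurable]: "(\<lambda>\<omega>. \<psi> \<omega> (X (?t + s) \<omega> - X ?t \<omega>)) \<in> borel_measurable \<Omega>" unfolding \<psi>_def by measurable
    let ?f = "\<lambda>l m \<omega>. \<psi> \<omega> (X (?t + s) \<omega> - X ?t \<omega>) * of_bool (J ?t \<omega> = Some l \<and> J (?t + s) \<omega> = Some m)"
    have "(\<integral>\<^sup>+\<omega>. (\<Sum>m\<in>UNIV. ?f l m \<omega>) \<partial>P x i) = (\<Sum>m\<in>UNIV. \<integral>\<^sup>+\<omega>. ?f l m \<omega> \<partial>P x i)" for l
      by (rule nn_integral_sum) measurable
    moreover have "(\<integral>\<^sup>+\<omega>. (\<Sum>l\<in>UNIV. \<Sum>m\<in>UNIV. ?f l m \<omega>) \<partial>P x i) = (\<Sum>l\<in>UNIV. \<integral>\<^sup>+\<omega>. (\<Sum>m\<in>UNIV. ?f l m \<omega>) \<partial>P x i)"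
      by (rule nn_integral_sum) measurable
    ultimately show ?thesis by (simp only:)
  qed
  also have "\<dots> \<le> (\<integral>\<^sup>+\<omega>. of_bool (at_min n (?t + s) \<omega>) \<partial>P x i)"
  proof (rule nn_integral_mono)
    fix \<omega> assume "\<omega> \<in> space (P x i)"
    have t0: "0 \<le> ?t + s" using s by simp
    show "(\<Sum>l\<in>UNIV. \<Sum>m\<in>UNIV. \<psi> \<omega> (X (?t + s) \<omega> - X ?t \<omega>) * of_bool (J ?t \<omega> = Some l \<and> J (?t + s) \<omega> = Some m)) \<le> of_bool (at_min n (?t + s) \<omega>)"
    proof (cases "J ?t \<omega> = None \<or> J (?t + s) \<omega> = None \<or> \<not> grid_Y X n k \<omega> + (X (?t + s) \<omega> - X ?t \<omega>) \<le> 0")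
      case True then show ?thesis by (auto simp: \<psi>_def)
    next
      case False
      then obtain l0 m0 where lm: "J ?t \<omega> = Some l0" "J (?t + s) \<omega> = Some m0" and low: "X (?t + s) \<omega> + grid_R X n k \<omega> \<le> 0"
        by (auto simp: grid_Y_def)
      have "X (?t + s) \<omega> \<le> X (real j / 2 ^ n) \<omega>" if j: "real j / 2 ^ n \<le> ?t + s" for j
      proof -
        have "real j / 2 ^ n < real (Suc k) / 2 ^ n" using j s(2) by (simp add: add_divide_distrib)
        then have "j \<le> k" by (simp add: divide_less_cancel)
        from grid_R_ge[OF this, of X n \<omega>] low show ?thesis by linarith
      qed
      then have "at_min n (?t + s) \<omega>" using lm t0 by (simp add: at_min_def Jj_def Xj_def max_def)
      moreover have "(\<Sum>l\<in>UNIV. \<Sum>m\<in>UNIV. \<psi> \<omega> (X (?t + s) \<omega> - X ?t \<omega>) * of_bool (J ?t \<omega> = Some l \<and> J (?t + s) \<omega> = Some m)) \<le> (1 :: ennreal)"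
        unfolding sum_of_bool_Some2 lm \<psi>_def by simp
      ultimately show ?thesis by simp
    qed
  qed
  finally show ?thesis unfolding min_prob_def .
qed

text \<open>The previous bound integrated over one mesh interval; a translation of time places it at
  \<open>real k / 2 ^ n\<close>, so that different steps occupy disjoint intervals.\<close>

lemma low_time_step:
  "(\<Sum>l\<in>UNIV. \<integral>\<^sup>+\<omega>. low_time (1 / 2 ^ n) l (grid_Y X n k \<omega>) * of_bool (J (real k / 2 ^ n) \<omega> = Some l) \<partial>P x i)
    \<le> (\<integral>\<^sup>+s. min_prob x i n s * indicator {real k / 2 ^ n..<real (Suc k) / 2 ^ n} s \<partial>lborel)"
proof -
  interpret L: pair_sigma_finite lborel "P x i" ..
  let ?t = "real k / 2 ^ n"
  have [measurable]: "(\<lambda>z. low_prob l (grid_Y X n k (snd z)) (fst z)) \<in> borel_measurable (lborel \<Otimes>\<^sub>M P x i)" for l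
    unfolding low_prob_def by measurable
  have [measurable]: "(\<lambda>z. low_prob l (grid_Y X n k (fst z)) (snd z)) \<in> borel_measurable (P x i \<Otimes>\<^sub>M lborel)" for l
    unfolding low_prob_def by measurable
  have "(\<integral>\<^sup>+\<omega>. low_time (1 / 2 ^ n) l (grid_Y X n k \<omega>) * of_bool (J ?t \<omega> = Some l) \<partial>P x i)
    = (\<integral>\<^sup>+s. (\<integral>\<^sup>+\<omega>. low_prob l (grid_Y X n k \<omega>) s * of_bool (J ?t \<omega> = Some l) \<partial>P x i) * indicator {0..<1 / 2 ^ n} s \<partial>lborel)" for l
  proof -
    have [measurable]: "low_prob l y \<in> borel_measurable borel" for y unfolding low_prob_def by measurable
    have [measurable]: "(\<lambda>\<omega>. low_prob l (grid_Y X n k \<omega>) s) \<in> borel_measurable \<Omega>" for s unfolding low_prob_def by measurable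
    have "(\<integral>\<^sup>+\<omega>. low_time (1 / 2 ^ n) l (grid_Y X n k \<omega>) * of_bool (J ?t \<omega> = Some l) \<partial>P x i)
      = (\<integral>\<^sup>+\<omega>. \<integral>\<^sup>+s. low_prob l (grid_Y X n k \<omega>) s * indicator {0..<1 / 2 ^ n} s * of_bool (J ?t \<omega> = Some l) \<partial>lborel \<partial>P x i)"
      by (simp add: low_time_eq nn_integral_multc)
    also have "\<dots> = (\<integral>\<^sup>+s. \<integral>\<^sup>+\<omega>. low_prob l (grid_Y X n k \<omega>) s * indicator {0..<1 / 2 ^ n} s * of_bool (J ?t \<omega> = Some l) \<partial>P x i \<partial>lborel)"
      by (rule L.Fubini') measurable
    also have "\<dots> = (\<integral>\<^sup>+s. (\<integral>\<^sup>+\<omega>. low_prob l (grid_Y X n k \<omega>) s * of_bool (J ?t \<omega> = Some l) \<partial>P x i) * indicator {0..<1 / 2 ^ n} s \<partial>lborel)"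
      by (intro nn_integral_cong, subst nn_integral_multc[symmetric]) (auto simp: mult_ac)
    finally show ?thesis .
  qed
  then have "(\<Sum>l\<in>UNIV. \<integral>\<^sup>+\<omega>. low_time (1 / 2 ^ n) l (grid_Y X n k \<omega>) * of_bool (J ?t \<omega> = Some l) \<partial>P x i)
    = (\<Sum>l\<in>UNIV. \<integral>\<^sup>+s. (\<integral>\<^sup>+\<omega>. low_prob l (grid_Y X n k \<omega>) s * of_bool (J ?t \<omega> = Some l) \<partial>P x i) * indicator {0..<1 / 2 ^ n} s \<partial>lborel)"
    by simp
  also have "\<dots> = (\<integral>\<^sup>+s. (\<Sum>l\<in>UNIV. (\<integral>\<^sup>+\<omega>. low_prob l (grid_Y X n k \<omega>) s * of_bool (J ?t \<omega> = Some l) \<partial>P x i) * indicator {0..<1 / 2 ^ n} s) \<partial>lborel)"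
    by (rule nn_integral_sum[symmetric]) measurable
  also have "\<dots> = (\<integral>\<^sup>+s. (\<Sum>l\<in>UNIV. (\<integral>\<^sup>+\<omega>. low_prob l (grid_Y X n k \<omega>) s * of_bool (J ?t \<omega> = Some l) \<partial>P x i)) * indicator {0..<1 / 2 ^ n} s \<partial>lborel)"
    by (simp add: sum_distrib_right)
  also have "\<dots> \<le> (\<integral>\<^sup>+s. min_prob x i n (?t + 1 * s) * indicator {?t..<real (Suc k) / 2 ^ n} (?t + 1 * s) \<partial>lborel)"
  proof (rule nn_integral_mono)
    fix s :: real
    show "(\<Sum>l\<in>UNIV. (\<integral>\<^sup>+\<omega>. low_prob l (grid_Y X n k \<omega>) s * of_bool (J ?t \<omega> = Some l) \<partial>P x i)) * indicator {0..<1 / 2 ^ n} s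
      \<le> min_prob x i n (?t + 1 * s) * indicator {?t..<real (Suc k) / 2 ^ n} (?t + 1 * s)"
    proof (cases "s \<in> {0..<1 / 2 ^ n}")
      case True
      then have "?t + s \<in> {?t..<real (Suc k) / 2 ^ n}" by (simp add: add_divide_distrib)
      then show ?thesis using True low_prob_step[where s = s and n = n and k = k and x = x and i = i] by simp
    qed simp
  qed
  also have "\<dots> = (\<integral>\<^sup>+s. min_prob x i n s * indicator {?t..<real (Suc k) / 2 ^ n} s \<partial>lborel)"
    using nn_integral_real_affine[of "\<lambda>s. min_prob x i n s * indicator {?t..<real (Suc k) / 2 ^ n} s" 1 ?t] by simp
  finally show ?thesis .
qed

section \<open>Stopped grid values and their one-step error\<close>

text \<open>The function \<open>\<phi>\<close> is left open: with \<open>Zcase j\<close> this is the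
  approximate martingale, with a function of the state alone it approximates the exit functional and
  proves its measurability.\<close>

definition grid_value :: "('n option \<Rightarrow> real \<Rightarrow> real) \<Rightarrow> nat \<Rightarrow> nat \<Rightarrow> 'w \<Rightarrow> real" where
  "grid_value \<phi> n k \<omega> = exp (- \<alpha> * grid_R X n k \<omega>) * \<phi> (J (real k / 2 ^ n) \<omega>) (grid_Y X n k \<omega>)"

definition stopped_value :: "('n option \<Rightarrow> real \<Rightarrow> real) \<Rightarrow> real \<Rightarrow> nat \<Rightarrow> nat \<Rightarrow> 'w \<Rightarrow> real" where
  "stopped_value \<phi> a n k \<omega> = grid_value \<phi> n (grid_stop X a n k \<omega>) \<omega>"

lemma stopped_value_0: "stopped_value \<phi> a n 0 \<omega> = grid_value \<phi> n 0 \<omega>"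
  by (simp add: stopped_value_def)

lemma stopped_value_Suc:
  "stopped_value \<phi> a n (Suc k) \<omega> = (if grid_below a n k \<omega> then grid_value \<phi> n (Suc k) \<omega> else stopped_value \<phi> a n k \<omega>)"
  by (auto simp: stopped_value_def grid_below_def)

lemma stopped_value_below: "grid_below a n k \<omega> \<Longrightarrow> stopped_value \<phi> a n k \<omega> = grid_value \<phi> n k \<omega>"
  unfolding stopped_value_def grid_below_def by (subst grid_stop_no) auto

lemma measurable_grid_value [measurable]:
  assumes [measurable]: "\<And>v. \<phi> v \<in> borel_measurable borel"
  shows "grid_value \<phi> n k \<in> borel_measurable \<Omega>"
proof -
  have "(\<lambda>\<omega>. \<phi> (J (real k / 2 ^ n) \<omega>) (grid_Y X n k \<omega>)) \<in> borel_measurable \<Omega>"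
    by (rule measurable_compose_countable[of "\<lambda>v \<omega>. \<phi> v (grid_Y X n k \<omega>)" _ _ "J (real k / 2 ^ n)"]) measurable
  then show ?thesis unfolding grid_value_def[abs_def] by measurable
qed

lemma measurable_stopped_value:
  assumes "\<And>v. \<phi> v \<in> borel_measurable borel"
  shows "stopped_value \<phi> a n k \<in> borel_measurable \<Omega>"
proof (induction k)
  case 0 then show ?case using measurable_grid_value[OF assms] by (simp add: stopped_value_0[abs_def] cong: measurable_cong)
next
  case (Suc k)
  note [measurable] = Suc measurable_grid_value[OF assms]
  have "stopped_value \<phi> a n (Suc k) = (\<lambda>\<omega>. if grid_below a n k \<omega> then grid_value \<phi> n (Suc k) \<omega> else stopped_value \<phi> a n k \<omega>)"
    by (auto simp: stopped_value_Suc)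
  then show ?case by simp
qed

definition Zcase :: "'n \<Rightarrow> 'n option \<Rightarrow> real \<Rightarrow> real" where
  "Zcase j v y = (case v of None \<Rightarrow> 0 | Some l \<Rightarrow> Zext l j y)"

lemma measurable_Zcase [measurable]: "Zcase j v \<in> borel_measurable borel"
  by (cases v) (simp_all add: Zcase_def[abs_def])

lemma measurable_stopped_Zcase [measurable]: "stopped_value (Zcase j) a n k \<in> borel_measurable \<Omega>"
  by (rule measurable_stopped_value) measurable

lemma Zcase_eq_sum: "Zcase j v y = (\<Sum>l\<in>UNIV. Zext l j y * of_bool (v = Some l))"
  by (simp add: sum_of_bool_Some Zcase_def)

definition grid_inc :: "nat \<Rightarrow> nat \<Rightarrow> 'w \<Rightarrow> real" where
  "grid_inc n k \<omega> = X (real k / 2 ^ n + 1 / 2 ^ n) \<omega> - X (real k / 2 ^ n) \<omega>"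

lemma measurable_grid_inc [measurable]: "grid_inc n k \<in> borel_measurable \<Omega>"
  unfolding grid_inc_def[abs_def] by measurable

lemma grid_next: "real (Suc k) / 2 ^ n = real k / 2 ^ n + 1 / 2 ^ n"
  by (simp add: add_divide_distrib)

text \<open>The reflection disappears from the step: the new value is expressed by the old
  regulator, the old reflected value and the free increment, which is the form required by the
  Markov property. In the case of an undershoot both sides reduce to
  \<open>exp (\<alpha> * x')\<close> times the identity.\<close>

lemma grid_value_Suc_eq: "grid_value (Zcase j) n (Suc k) \<omega>
    = exp (- \<alpha> * grid_R X n k \<omega>) * Zcase j (J (real k / 2 ^ n + 1 / 2 ^ n) \<omega>) (grid_Y X n k \<omega> + grid_inc n k \<omega>)"
proof -
  define x' where "x' = X (real k / 2 ^ n + 1 / 2 ^ n) \<omega>"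
  define r where "r = grid_R X n k \<omega>"
  have Y: "grid_Y X n k \<omega> + grid_inc n k \<omega> = x' + r"
    by (simp add: grid_Y_def grid_inc_def x'_def r_def)
  have R': "grid_R X n (Suc k) \<omega> = max r (- x')" by (simp only: grid_R.simps grid_next x'_def r_def)
  have Y': "grid_Y X n (Suc k) \<omega> = x' + max r (- x')" by (simp only: grid_Y_def R' grid_next x'_def)
  show ?thesis
  proof (cases "J (real k / 2 ^ n + 1 / 2 ^ n) \<omega>")
    case None then show ?thesis by (simp only: grid_value_def grid_next Zcase_def) simp
  next
    case (Some m)
    have "exp (- \<alpha> * max r (- x')) * Zext m j (x' + max r (- x')) = exp (- \<alpha> * r) * Zext m j (x' + r)"
    proof (cases "0 \<le> x' + r")
      case True
      have "max r (- x') = r" by (rule max_absorb1) (use True in linarith)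
      then show ?thesis by simp
    next
      case False
      then have "max r (- x') = - x'" by (simp add: max_def)
      moreover have "Zext m j (x' + r) = exp (\<alpha> * (x' + r)) * of_bool (m = j)" using False by (intro Zext_nonpos) simp
      moreover have "Zext m j 0 = of_bool (m = j)" using Zext_nonpos[of 0 m j] by simp
      moreover have "exp (- \<alpha> * r) * exp (\<alpha> * (x' + r)) = exp (\<alpha> * x')"
        by (simp add: exp_add[symmetric] algebra_simps)
      ultimately show ?thesis by (simp add: mult.assoc[symmetric])
    qed
    then show ?thesis
      unfolding grid_value_def grid_next Y R' Y' Some Zcase_def r_def[symmetric] by simp
  qed
qed

text \<open>The Markov lemmas fix the states at both ends of a step, hence the double sum. Nothing
  is lost, because a chain dead at the beginning is dead at the end.\<close>

lemma grid_value_Suc_sum: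
  assumes "\<omega> \<in> space \<Omega>"
  shows "grid_value (Zcase j) n (Suc k) \<omega>
    = (\<Sum>l\<in>UNIV. \<Sum>m\<in>UNIV. exp (- \<alpha> * grid_R X n k \<omega>) * Zext m j (grid_Y X n k \<omega> + grid_inc n k \<omega>)
        * of_bool (J (real k / 2 ^ n) \<omega> = Some l \<and> J (real k / 2 ^ n + 1 / 2 ^ n) \<omega> = Some m))"
proof -
  have "J (real k / 2 ^ n) \<omega> = None \<Longrightarrow> J (real k / 2 ^ n + 1 / 2 ^ n) \<omega> = None"
    by (rule J_absorbed[OF assms]) auto
  then show ?thesis
    unfolding grid_value_Suc_eq sum_of_bool_Some2 Zcase_def by (auto split: option.split)
qed

lemma stopped_value_Suc_diff:
  "stopped_value \<phi> a n (Suc k) \<omega> - stopped_value \<phi> a n k \<omega>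
    = of_bool (grid_below a n k \<omega>) * grid_value \<phi> n (Suc k) \<omega> - of_bool (grid_below a n k \<omega>) * grid_value \<phi> n k \<omega>"
  by (simp add: stopped_value_Suc stopped_value_below)

definition next_mean :: "nat \<Rightarrow> 'n \<Rightarrow> 'n \<Rightarrow> 'n \<Rightarrow> real \<Rightarrow> real" where
  "next_mean n l m j y = (\<integral>\<omega>'. Zext m j (y + X (1 / 2 ^ n) \<omega>') * of_bool (J (1 / 2 ^ n) \<omega>' = Some m) \<partial>P 0 l)"

lemma measurable_next_mean [measurable]: "next_mean n l m j \<in> borel_measurable borel"
  unfolding next_mean_def[abs_def] by measurable

lemma sum_next_mean: "(\<Sum>m\<in>UNIV. next_mean n l m j y) = defect (1 / 2 ^ n) l j y + Zext l j y"
  by (simp add: defect_def next_mean_def)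

lemma grid_Y_below: "grid_below a n k \<omega> \<Longrightarrow> grid_Y X n k \<omega> \<le> a"
  by (simp add: grid_below_def)

text \<open>Before stopping the level is at most \<open>a\<close>, so the growth of
  \<open>Zext\<close> after a step is governed by the exponential of the increment alone, whose
  moments are known.\<close>

lemma Zext_below_bound:
  assumes "\<And>i j y. \<bar>Zext i j y\<bar> \<le> C * (1 + exp (beta * y))" "C \<ge> 0" "y \<le> a"
  shows "\<bar>Zext i j (y + u)\<bar> \<le> C * (1 + exp (beta * a) * exp (beta * u))"
proof -
  have "exp (beta * (y + u)) \<le> exp (beta * a) * exp (beta * u)"
    using assms(3) beta(3) by (simp add: exp_add[symmetric] ring_distribs[symmetric])
  then have "C * (1 + exp (beta * (y + u))) \<le> C * (1 + exp (beta * a) * exp (beta * u))"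
    using assms(2) by (intro mult_left_mono) auto
  then show ?thesis using assms(1)[of i j "y + u"] by linarith
qed

lemma next_mean_bound: "\<exists>D. \<forall>l m j y. y \<le> a \<longrightarrow> \<bar>next_mean n l m j y\<bar> \<le> D"
proof -
  obtain C where C: "C \<ge> 0" "\<And>i j y. \<bar>Zext i j y\<bar> \<le> C * (1 + exp (beta * y))" using Zext_bound by blast
  define h :: real where "h = 1 / 2 ^ n"
  have h: "0 \<le> h" by (simp add: h_def)
  define e where "e = exp (beta * a)"
  have e: "e > 0" by (simp add: e_def)
  define D where "D l m = C * (mat_exp (h *\<^sub>R F 0) $ l $ m + e * (mat_exp (h *\<^sub>R F beta) $ l $ m))" for l m
  have D: "\<bar>next_mean n l m j y\<bar> \<le> D l m" if y: "y \<le> a" for l m j y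
  proof -
    have i0: "has_bochner_integral (P 0 l) (\<lambda>\<omega>. of_bool (J h \<omega> = Some m)) (mat_exp (h *\<^sub>R F 0) $ l $ m)"
      using exp_moment[of 0 h l m] h by simp
    have i1: "has_bochner_integral (P 0 l) (\<lambda>\<omega>. exp (beta * X h \<omega>) * of_bool (J h \<omega> = Some m)) (mat_exp (h *\<^sub>R F beta) $ l $ m)"
      using exp_moment[of beta h l m] h beta(3) by simp
    have i: "has_bochner_integral (P 0 l) (\<lambda>\<omega>. C * (of_bool (J h \<omega> = Some m) + e * (exp (beta * X h \<omega>) * of_bool (J h \<omega> = Some m)))) (D l m)"
      unfolding D_def by (intro has_bochner_integral_cmult has_bochner_integral_add i0 i1)
    have "\<bar>next_mean n l m j y\<bar> \<le> (\<integral>\<omega>. norm (Zext m j (y + X h \<omega>) * of_bool (J h \<omega> = Some m)) \<partial>P 0 l)"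
      unfolding next_mean_def h_def[symmetric] real_norm_def[symmetric] by (rule integral_norm_bound)
    also have "\<dots> \<le> (\<integral>\<omega>. C * (of_bool (J h \<omega> = Some m) + e * (exp (beta * X h \<omega>) * of_bool (J h \<omega> = Some m))) \<partial>P 0 l)"
    proof (rule integral_mono')
      show "integrable (P 0 l) (\<lambda>\<omega>. C * (of_bool (J h \<omega> = Some m) + e * (exp (beta * X h \<omega>) * of_bool (J h \<omega> = Some m))))"
        using i by (simp add: has_bochner_integral_iff)
      fix \<omega>
      show "norm (Zext m j (y + X h \<omega>) * of_bool (J h \<omega> = Some m)) \<le> C * (of_bool (J h \<omega> = Some m) + e * (exp (beta * X h \<omega>) * of_bool (J h \<omega> = Some m)))"
        using Zext_below_bound[OF C(2) C(1) y, of m j "X h \<omega>"] by (simp add: e_def)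
      show "0 \<le> C * (of_bool (J h \<omega> = Some m) + e * (exp (beta * X h \<omega>) * of_bool (J h \<omega> = Some m)))"
        using C(1) e by simp
    qed
    also have "\<dots> = D l m" using i by (simp add: has_bochner_integral_iff)
    finally show ?thesis .
  qed
  have "D l m \<le> (\<Sum>l\<in>UNIV. \<Sum>m\<in>UNIV. \<bar>D l m\<bar>)" for l m
  proof -
    have "\<bar>D l m\<bar> \<le> (\<Sum>m\<in>UNIV. \<bar>D l m\<bar>)" by (rule member_le_sum) auto
    also have "\<dots> \<le> (\<Sum>l\<in>UNIV. \<Sum>m\<in>UNIV. \<bar>D l m\<bar>)" by (rule member_le_sum[of l]) (auto intro: sum_nonneg)
    finally show ?thesis by simp
  qed
  then show ?thesis using D order_trans by blast
qed

lemma integrable_step: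
  "integrable (P x i) (\<lambda>\<omega>. of_bool (grid_below a n k \<omega>) * exp (- \<alpha> * grid_R X n k \<omega>) * Zext m j (grid_Y X n k \<omega> + grid_inc n k \<omega>)
     * of_bool (J (real k / 2 ^ n) \<omega> = Some l \<and> J (real k / 2 ^ n + 1 / 2 ^ n) \<omega> = Some m))"
  (is "integrable _ ?f")
proof -
  obtain C where C: "C \<ge> 0" "\<And>i j y. \<bar>Zext i j y\<bar> \<le> C * (1 + exp (beta * y))" using Zext_bound by blast
  define h :: real where "h = 1 / 2 ^ n"
  have h: "0 \<le> h" by (simp add: h_def)
  let ?t = "real k / 2 ^ n"
  let ?b = "\<lambda>\<omega>. of_bool (J ?t \<omega> = Some l \<and> J (?t + h) \<omega> = Some m) :: real"
  have i0: "integrable (P x i) ?b"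
    by (rule P.integrable_of_bool_bounded[where C = 1]) auto
  have i1: "integrable (P x i) (\<lambda>\<omega>. exp (beta * (X (?t + h) \<omega> - X ?t \<omega>)) * ?b \<omega>)"
    using increment_moment[where f = "\<lambda>y. exp (beta * y)" and t = ?t and s = h and l = l and m = m and x = x and i = i, OF _ h _ exp_moment] h beta(3)
    by (simp add: has_bochner_integral_iff)
  have "integrable (P x i) (\<lambda>\<omega>. C * (?b \<omega> + exp (beta * a) * (exp (beta * (X (?t + h) \<omega> - X ?t \<omega>)) * ?b \<omega>)))"
    by (intro integrable_mult_right Bochner_Integration.integrable_add i0 i1)
  then show ?thesis
  proof (rule Bochner_Integration.integrable_bound)
    show "?f \<in> borel_measurable (P x i)" by measurable
    show "AE \<omega> in P x i. norm (?f \<omega>) \<le> norm (C * (?b \<omega> + exp (beta * a) * (exp (beta * (X (?t + h) \<omega> - X ?t \<omega>)) * ?b \<omega>)))"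
    proof (rule AE_I2)
      fix \<omega>
      show "norm (?f \<omega>) \<le> norm (C * (?b \<omega> + exp (beta * a) * (exp (beta * (X (?t + h) \<omega> - X ?t \<omega>)) * ?b \<omega>)))"
      proof (cases "grid_below a n k \<omega> \<and> J ?t \<omega> = Some l \<and> J (?t + h) \<omega> = Some m")
        case True
        have e: "exp (- \<alpha> * grid_R X n k \<omega>) \<le> 1" using alpha_nonneg grid_R_nonneg[of X n k \<omega>] by simp
        have z: "\<bar>Zext m j (grid_Y X n k \<omega> + grid_inc n k \<omega>)\<bar> \<le> C * (1 + exp (beta * a) * exp (beta * grid_inc n k \<omega>))"
          using True by (intro Zext_below_bound[OF C(2) C(1)] grid_Y_below) auto
        have "norm (?f \<omega>) = exp (- \<alpha> * grid_R X n k \<omega>) * \<bar>Zext m j (grid_Y X n k \<omega> + grid_inc n k \<omega>)\<bar>"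
          using True by (simp add: h_def abs_mult)
        also have "\<dots> \<le> 1 * (C * (1 + exp (beta * a) * exp (beta * grid_inc n k \<omega>)))"
          by (intro mult_mono e z) auto
        finally show ?thesis using True C(1) by (simp add: grid_inc_def h_def)
      next
        case False then show ?thesis by (auto simp: h_def)
      qed
    qed
  qed
qed

text \<open>Conditioning on the grid history: not having been stopped, the regulator and the
  reflected value belong to the past, and averaging over the next increment produces
  \<open>next_mean\<close>.\<close>

lemma markov_step:
  "(\<integral>\<omega>. of_bool (grid_below a n k \<omega>) * exp (- \<alpha> * grid_R X n k \<omega>) * Zext m j (grid_Y X n k \<omega> + grid_inc n k \<omega>)
     * of_bool (J (real k / 2 ^ n) \<omega> = Some l \<and> J (real k / 2 ^ n + 1 / 2 ^ n) \<omega> = Some m) \<partial>P x i)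
   = (\<integral>\<omega>. of_bool (grid_below a n k \<omega>) * exp (- \<alpha> * grid_R X n k \<omega>) * next_mean n l m j (grid_Y X n k \<omega>)
     * of_bool (J (real k / 2 ^ n) \<omega> = Some l) \<partial>P x i)"
proof -
  define \<psi> :: "'w \<Rightarrow> real \<Rightarrow> real" where
    "\<psi> \<omega> y = of_bool (grid_below a n k \<omega>) * exp (- \<alpha> * grid_R X n k \<omega>) * Zext m j (grid_Y X n k \<omega> + y)" for \<omega> y
  have gY: "(\<lambda>z. grid_Y X n k (fst z)) \<in> borel_measurable (grid_algebra n k \<Otimes>\<^sub>M borel)"
    by (rule measurable_compose[OF measurable_fst grid_algebra_grid_Y]) simp
  have gR: "(\<lambda>z. grid_R X n k (fst z)) \<in> borel_measurable (grid_algebra n k \<Otimes>\<^sub>M borel)"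
    by (rule measurable_compose[OF measurable_fst grid_algebra_grid_R]) simp
  have gb: "(\<lambda>z. of_bool (grid_below a n k (fst z)) :: real) \<in> borel_measurable (grid_algebra n k \<Otimes>\<^sub>M borel)"
    by (rule measurable_compose[OF measurable_fst measurable_of_bool[OF grid_algebra_grid_below]])
  have gZ: "(\<lambda>z. Zext m j (grid_Y X n k (fst z) + snd z)) \<in> borel_measurable (grid_algebra n k \<Otimes>\<^sub>M borel)"
    by (rule measurable_compose[OF _ measurable_Zext]) (intro borel_measurable_add gY measurable_snd)
  have gE: "(\<lambda>z. exp (- \<alpha> * grid_R X n k (fst z))) \<in> borel_measurable (grid_algebra n k \<Otimes>\<^sub>M borel)"
    by (rule measurable_compose[OF gR]) measurable
  have \<psi>m: "case_prod \<psi> \<in> borel_measurable (grid_algebra n k \<Otimes>\<^sub>M borel)"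
    unfolding \<psi>_def case_prod_beta' by (intro borel_measurable_times gb gE gZ)
  have "(\<integral>\<omega>. \<psi> \<omega> (X (real k / 2 ^ n + 1 / 2 ^ n) \<omega> - X (real k / 2 ^ n) \<omega>)
        * of_bool (J (real k / 2 ^ n) \<omega> = Some l \<and> J (real k / 2 ^ n + 1 / 2 ^ n) \<omega> = Some m) \<partial>P x i)
    = (\<integral>\<omega>. (\<integral>\<omega>'. \<psi> \<omega> (X (1 / 2 ^ n) \<omega>') * of_bool (J (1 / 2 ^ n) \<omega>' = Some m) \<partial>P 0 l) * of_bool (J (real k / 2 ^ n) \<omega> = Some l) \<partial>P x i)"
  proof (rule markov_integral_1[where u = "\<lambda>l. real l / 2 ^ n" and m = "Suc k"])
    show "case_prod \<psi> \<in> borel_measurable (past_algebra (\<lambda>l. real l / 2 ^ n) (Suc k) \<Otimes>\<^sub>M borel)"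
      using \<psi>m by (simp only: grid_algebra_def)
    show "integrable (P x i) (\<lambda>\<omega>. \<psi> \<omega> (X (real k / 2 ^ n + 1 / 2 ^ n) \<omega> - X (real k / 2 ^ n) \<omega>)
        * of_bool (J (real k / 2 ^ n) \<omega> = Some l \<and> J (real k / 2 ^ n + 1 / 2 ^ n) \<omega> = Some m))"
      using integrable_step[where a = a and n = n and k = k and m = m and j = j and l = l and x = x and i = i]
      unfolding \<psi>_def grid_inc_def .
  qed (auto intro!: divide_right_mono)
  then show ?thesis
    unfolding \<psi>_def grid_inc_def[symmetric] next_mean_def
    by (simp only: mult.assoc Bochner_Integration.integral_mult_right_zero)
qed

lemma integrable_stopped_step:
  shows "integrable (P x i) (\<lambda>\<omega>. of_bool (grid_below a n k \<omega>) * grid_value (Zcase j) n (Suc k) \<omega>)" (is ?I1)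
    and "(\<integral>\<omega>. of_bool (grid_below a n k \<omega>) * grid_value (Zcase j) n (Suc k) \<omega> \<partial>P x i)
      = (\<Sum>l\<in>UNIV. \<Sum>m\<in>UNIV. \<integral>\<omega>. of_bool (grid_below a n k \<omega>) * exp (- \<alpha> * grid_R X n k \<omega>) * next_mean n l m j (grid_Y X n k \<omega>)
     * of_bool (J (real k / 2 ^ n) \<omega> = Some l) \<partial>P x i)" (is ?E1)
proof -
  let ?f = "\<lambda>l m \<omega>. of_bool (grid_below a n k \<omega>) * exp (- \<alpha> * grid_R X n k \<omega>) * Zext m j (grid_Y X n k \<omega> + grid_inc n k \<omega>)
     * of_bool (J (real k / 2 ^ n) \<omega> = Some l \<and> J (real k / 2 ^ n + 1 / 2 ^ n) \<omega> = Some m)"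
  have eq: "of_bool (grid_below a n k \<omega>) * grid_value (Zcase j) n (Suc k) \<omega> = (\<Sum>l\<in>UNIV. \<Sum>m\<in>UNIV. ?f l m \<omega>)" if "\<omega> \<in> space (P x i)" for \<omega>
    using that by (simp only: space_P grid_value_Suc_sum sum_distrib_left mult.assoc)
  have i: "integrable (P x i) (\<lambda>\<omega>. \<Sum>l\<in>UNIV. \<Sum>m\<in>UNIV. ?f l m \<omega>)"
    by (intro Bochner_Integration.integrable_sum integrable_step)
  show ?I1 using i by (subst Bochner_Integration.integrable_cong[OF refl eq]) auto
  have "(\<integral>\<omega>. of_bool (grid_below a n k \<omega>) * grid_value (Zcase j) n (Suc k) \<omega> \<partial>P x i) = (\<integral>\<omega>. (\<Sum>l\<in>UNIV. \<Sum>m\<in>UNIV. ?f l m \<omega>) \<partial>P x i)"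
    by (rule Bochner_Integration.integral_cong[OF refl eq])
  also have "\<dots> = (\<Sum>l\<in>UNIV. \<Sum>m\<in>UNIV. \<integral>\<omega>. ?f l m \<omega> \<partial>P x i)"
    by (subst Bochner_Integration.integral_sum, intro Bochner_Integration.integrable_sum integrable_step, intro sum.cong refl Bochner_Integration.integral_sum integrable_step)
  finally show ?E1 by (simp only: markov_step)
qed

text \<open>Summed over the arrival states, \<open>next_mean\<close> differs from
  \<open>Zext\<close> by \<open>defect\<close>. The factor for discount and non-stopping lies
  between 0 and 1, so the defects are bounded by low times, and these by the time at the
  minimum.\<close>

lemma stopped_step_bound:
  "ennreal \<bar>(\<integral>\<omega>. of_bool (grid_below a n k \<omega>) * grid_value (Zcase j) n (Suc k) \<omega> \<partial>P x i)
      - (\<integral>\<omega>. of_bool (grid_below a n k \<omega>) * grid_value (Zcase j) n k \<omega> \<partial>P x i)\<bar>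
    \<le> ennreal (entry_sum (F \<alpha>)) * (\<integral>\<^sup>+s. min_prob x i n s * indicator {real k / 2 ^ n..<real (Suc k) / 2 ^ n} s \<partial>lborel)"
proof -
  let ?t = "real k / 2 ^ n"
  let ?c = "\<lambda>\<omega>. of_bool (grid_below a n k \<omega>) * exp (- \<alpha> * grid_R X n k \<omega>)"
  let ?Y = "grid_Y X n k"
  obtain D where D: "\<And>l m y. y \<le> a \<Longrightarrow> \<bar>next_mean n l m j y\<bar> \<le> D" using next_mean_bound by meson
  obtain C where C: "C \<ge> 0" "\<And>i j y. \<bar>Zext i j y\<bar> \<le> C * (1 + exp (beta * y))" using Zext_bound by blast
  have c: "\<bar>?c \<omega>\<bar> \<le> of_bool (grid_below a n k \<omega>)" for \<omega>
    using alpha_nonneg grid_R_nonneg[of X n k \<omega>] by auto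
  have iN: "integrable (P x i) (\<lambda>\<omega>. ?c \<omega> * next_mean n l m j (?Y \<omega>) * of_bool (J ?t \<omega> = Some l))" for l m
  proof (rule P.integrable_of_bool_bounded[where C = "\<bar>D\<bar>"])
    fix \<omega>
    show "\<bar>?c \<omega> * next_mean n l m j (?Y \<omega>) * of_bool (J ?t \<omega> = Some l)\<bar> \<le> \<bar>D\<bar>"
    proof (cases "grid_below a n k \<omega>")
      case True
      have "\<bar>?c \<omega>\<bar> * \<bar>next_mean n l m j (?Y \<omega>)\<bar> \<le> 1 * \<bar>D\<bar>"
        using c[of \<omega>] True D[OF grid_Y_below[OF True], of l m] by (intro mult_mono) auto
      then show ?thesis by (simp add: abs_mult)
    qed simp
  qed measurable
  have iZ: "integrable (P x i) (\<lambda>\<omega>. ?c \<omega> * Zext l j (?Y \<omega>) * of_bool (J ?t \<omega> = Some l))" for l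
  proof (rule P.integrable_of_bool_bounded[where C = "C * (1 + exp (beta * a))"])
    fix \<omega>
    show "\<bar>?c \<omega> * Zext l j (?Y \<omega>) * of_bool (J ?t \<omega> = Some l)\<bar> \<le> C * (1 + exp (beta * a))"
    proof (cases "grid_below a n k \<omega>")
      case True
      have "\<bar>?c \<omega>\<bar> * \<bar>Zext l j (?Y \<omega>)\<bar> \<le> 1 * (C * (1 + exp (beta * a)))"
        using c[of \<omega>] True Zext_below_bound[OF C(2) C(1) grid_Y_below[OF True], of l j 0] by (intro mult_mono) auto
      then show ?thesis using C(1) by (simp add: abs_mult)
    qed (use C(1) in simp)
  qed measurable
  have eq0: "of_bool (grid_below a n k \<omega>) * grid_value (Zcase j) n k \<omega> = (\<Sum>l\<in>UNIV. ?c \<omega> * Zext l j (?Y \<omega>) * of_bool (J ?t \<omega> = Some l))" for \<omega>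
    by (simp only: grid_value_def Zcase_eq_sum sum_distrib_left mult.assoc)
  have E0: "(\<integral>\<omega>. of_bool (grid_below a n k \<omega>) * grid_value (Zcase j) n k \<omega> \<partial>P x i) = (\<Sum>l\<in>UNIV. \<integral>\<omega>. ?c \<omega> * Zext l j (?Y \<omega>) * of_bool (J ?t \<omega> = Some l) \<partial>P x i)"
    unfolding eq0 by (intro Bochner_Integration.integral_sum iZ)
  have d: "(\<Sum>m\<in>UNIV. ?c \<omega> * next_mean n l m j (?Y \<omega>) * of_bool (J ?t \<omega> = Some l)) - ?c \<omega> * Zext l j (?Y \<omega>) * of_bool (J ?t \<omega> = Some l)
     = ?c \<omega> * defect (1 / 2 ^ n) l j (?Y \<omega>) * of_bool (J ?t \<omega> = Some l)" for l \<omega>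
    using sum_next_mean[of n l j "?Y \<omega>"] unfolding sum_distrib_right[symmetric] sum_distrib_left[symmetric]
    by (simp add: algebra_simps)
  have iM: "integrable (P x i) (\<lambda>\<omega>. \<Sum>m\<in>UNIV. ?c \<omega> * next_mean n l m j (?Y \<omega>) * of_bool (J ?t \<omega> = Some l))" for l
    by (intro Bochner_Integration.integrable_sum iN)
  have iD: "integrable (P x i) (\<lambda>\<omega>. ?c \<omega> * defect (1 / 2 ^ n) l j (?Y \<omega>) * of_bool (J ?t \<omega> = Some l))" for l
    unfolding d[symmetric] by (intro Bochner_Integration.integrable_diff iM iZ)
  have E1: "(\<Sum>m\<in>UNIV. \<integral>\<omega>. ?c \<omega> * next_mean n l m j (?Y \<omega>) * of_bool (J ?t \<omega> = Some l) \<partial>P x i) - (\<integral>\<omega>. ?c \<omega> * Zext l j (?Y \<omega>) * of_bool (J ?t \<omega> = Some l) \<partial>P x i)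
     = (\<integral>\<omega>. ?c \<omega> * defect (1 / 2 ^ n) l j (?Y \<omega>) * of_bool (J ?t \<omega> = Some l) \<partial>P x i)" for l
    unfolding d[symmetric] Bochner_Integration.integral_diff[OF iM iZ] Bochner_Integration.integral_sum[OF iN] ..
  have sub: "(\<integral>\<omega>. of_bool (grid_below a n k \<omega>) * grid_value (Zcase j) n (Suc k) \<omega> \<partial>P x i)
      - (\<integral>\<omega>. of_bool (grid_below a n k \<omega>) * grid_value (Zcase j) n k \<omega> \<partial>P x i)
     = (\<Sum>l\<in>UNIV. \<integral>\<omega>. ?c \<omega> * defect (1 / 2 ^ n) l j (?Y \<omega>) * of_bool (J ?t \<omega> = Some l) \<partial>P x i)"
    unfolding integrable_stopped_step(2) E0 sum_subtractf[symmetric] E1 ..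
  have [measurable]: "low_time (1 / 2 ^ n) l \<in> borel_measurable borel" for l
    unfolding low_time_eq[abs_def] low_prob_def by measurable
  have one: "ennreal \<bar>\<integral>\<omega>. ?c \<omega> * defect (1 / 2 ^ n) l j (?Y \<omega>) * of_bool (J ?t \<omega> = Some l) \<partial>P x i\<bar>
     \<le> ennreal (entry_sum (F \<alpha>)) * (\<integral>\<^sup>+\<omega>. low_time (1 / 2 ^ n) l (?Y \<omega>) * of_bool (J ?t \<omega> = Some l) \<partial>P x i)" for l
  proof -
    have "ennreal \<bar>\<integral>\<omega>. ?c \<omega> * defect (1 / 2 ^ n) l j (?Y \<omega>) * of_bool (J ?t \<omega> = Some l) \<partial>P x i\<bar>
       \<le> (\<integral>\<^sup>+\<omega>. ennreal (norm (?c \<omega> * defect (1 / 2 ^ n) l j (?Y \<omega>) * of_bool (J ?t \<omega> = Some l))) \<partial>P x i)"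
      using integral_norm_bound_ennreal[OF iD] by (simp only: real_norm_def)
    also have "\<dots> \<le> (\<integral>\<^sup>+\<omega>. ennreal (entry_sum (F \<alpha>)) * (low_time (1 / 2 ^ n) l (?Y \<omega>) * of_bool (J ?t \<omega> = Some l)) \<partial>P x i)"
    proof (rule nn_integral_mono)
      fix \<omega>
      have "\<bar>?c \<omega>\<bar> \<le> 1" using c[of \<omega>] by (auto split: if_splits simp: of_bool_def)
      then have "\<bar>?c \<omega>\<bar> * \<bar>defect (1 / 2 ^ n) l j (?Y \<omega>)\<bar> \<le> 1 * \<bar>defect (1 / 2 ^ n) l j (?Y \<omega>)\<bar>" by (intro mult_right_mono) auto
      then have A: "\<bar>?c \<omega>\<bar> * \<bar>defect (1 / 2 ^ n) l j (?Y \<omega>)\<bar> \<le> \<bar>defect (1 / 2 ^ n) l j (?Y \<omega>)\<bar>" by simp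
      have B: "ennreal \<bar>defect (1 / 2 ^ n) l j (?Y \<omega>)\<bar> \<le> ennreal (entry_sum (F \<alpha>)) * low_time (1 / 2 ^ n) l (?Y \<omega>)"
        by (rule defect_le_low_time) simp
      have "ennreal (\<bar>?c \<omega>\<bar> * \<bar>defect (1 / 2 ^ n) l j (?Y \<omega>)\<bar>) \<le> ennreal (entry_sum (F \<alpha>)) * low_time (1 / 2 ^ n) l (?Y \<omega>)"
        by (rule order_trans[OF ennreal_leI[OF A] B])
      then show "ennreal (norm (?c \<omega> * defect (1 / 2 ^ n) l j (?Y \<omega>) * of_bool (J ?t \<omega> = Some l)))
        \<le> ennreal (entry_sum (F \<alpha>)) * (low_time (1 / 2 ^ n) l (?Y \<omega>) * of_bool (J ?t \<omega> = Some l))"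
        by (cases "J ?t \<omega> = Some l") (simp_all add: abs_mult)
    qed
    also have "\<dots> = ennreal (entry_sum (F \<alpha>)) * (\<integral>\<^sup>+\<omega>. low_time (1 / 2 ^ n) l (?Y \<omega>) * of_bool (J ?t \<omega> = Some l) \<partial>P x i)"
      by (rule nn_integral_cmult) measurable
    finally show ?thesis .
  qed
  have "ennreal \<bar>\<Sum>l\<in>UNIV. \<integral>\<omega>. ?c \<omega> * defect (1 / 2 ^ n) l j (?Y \<omega>) * of_bool (J ?t \<omega> = Some l) \<partial>P x i\<bar>
     \<le> (\<Sum>l\<in>UNIV. ennreal \<bar>\<integral>\<omega>. ?c \<omega> * defect (1 / 2 ^ n) l j (?Y \<omega>) * of_bool (J ?t \<omega> = Some l) \<partial>P x i\<bar>)"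
    unfolding sum_ennreal[OF abs_ge_zero] by (rule ennreal_leI) (rule sum_abs)
  also have "\<dots> \<le> (\<Sum>l\<in>UNIV. ennreal (entry_sum (F \<alpha>)) * (\<integral>\<^sup>+\<omega>. low_time (1 / 2 ^ n) l (?Y \<omega>) * of_bool (J ?t \<omega> = Some l) \<partial>P x i))"
    by (intro sum_mono one)
  also have "\<dots> \<le> ennreal (entry_sum (F \<alpha>)) * (\<integral>\<^sup>+s. min_prob x i n s * indicator {real k / 2 ^ n..<real (Suc k) / 2 ^ n} s \<partial>lborel)"
    unfolding sum_distrib_left[symmetric] by (rule mult_left_mono[OF low_time_step]) simp
  finally show ?thesis unfolding sub .
qed

end

section \<open>Refining the grid\<close>

text \<open>Bounded second moments give uniform integrability: \<open>min \<bar>d\<bar> L\<close> is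
  handled by dominated convergence, and beyond \<open>L\<close> one has
  \<open>\<bar>d\<bar> \<le> d\<^sup>2 / L\<close>.\<close>

lemma (in prob_space) tendsto_expectation_of_square_bound:
  fixes d :: "nat \<Rightarrow> 'a \<Rightarrow> real"
  assumes [measurable]: "\<And>n. d n \<in> borel_measurable M"
    and lim: "AE \<omega> in M. (\<lambda>n. d n \<omega>) \<longlonglongrightarrow> 0"
    and sq: "\<And>n. integrable M (\<lambda>\<omega>. (d n \<omega>)\<^sup>2)" "\<And>n. expectation (\<lambda>\<omega>. (d n \<omega>)\<^sup>2) \<le> B"
  shows "(\<lambda>n. expectation (d n)) \<longlonglongrightarrow> 0"
proof (rule LIMSEQ_I)
  fix r :: real assume r: "r > 0"
  have "0 \<le> expectation (\<lambda>\<omega>. (d 0 \<omega>)\<^sup>2)" by simp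
  then have B: "B \<ge> 0" using sq(2)[of 0] by linarith
  \<comment> \<open>Large enough that the tail contributes less than \<open>r / 2\<close>; the
    summand 1 keeps it positive when \<open>B = 0\<close>.\<close>
  define L where "L = 2 * B / r + 1"
  have L: "L > 0" "B / L < r / 2" using B r by (auto simp: L_def field_simps add_pos_nonneg)
  have "(\<lambda>n. expectation (\<lambda>\<omega>. min \<bar>d n \<omega>\<bar> L)) \<longlonglongrightarrow> expectation (\<lambda>\<omega>. 0)"
  proof (rule integral_dominated_convergence[where w = "\<lambda>_. L"])
    show "AE \<omega> in M. (\<lambda>n. min \<bar>d n \<omega>\<bar> L) \<longlonglongrightarrow> 0"
      using lim
    proof eventually_elim
      case (elim \<omega>)
      have "(\<lambda>n. min \<bar>d n \<omega>\<bar> L) \<longlonglongrightarrow> min \<bar>0\<bar> L" by (intro tendsto_intros elim)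
      then show ?case using L by simp
    qed
  qed (use L in auto)
  then have "eventually (\<lambda>n. expectation (\<lambda>\<omega>. min \<bar>d n \<omega>\<bar> L) < r / 2) sequentially"
    using r by (intro order_tendstoD(2)) auto
  then obtain N where N: "\<And>n. n \<ge> N \<Longrightarrow> expectation (\<lambda>\<omega>. min \<bar>d n \<omega>\<bar> L) < r / 2"
    by (auto simp: eventually_sequentially)
  have "norm (expectation (d n) - 0) < r" if "n \<ge> N" for n
  proof -
    have i1: "integrable M (\<lambda>\<omega>. min \<bar>d n \<omega>\<bar> L)"
      by (rule integrable_const_bound[where B = L]) (use L in auto)
    have i2: "integrable M (\<lambda>\<omega>. (d n \<omega>)\<^sup>2 / L)" using sq(1)[of n] by simp
    have pw: "\<bar>d n \<omega>\<bar> \<le> min \<bar>d n \<omega>\<bar> L + (d n \<omega>)\<^sup>2 / L" for \<omega>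
    proof (cases "\<bar>d n \<omega>\<bar> \<le> L")
      case True then show ?thesis using L by (simp add: min_def)
    next
      case False
      then have "L * \<bar>d n \<omega>\<bar> \<le> \<bar>d n \<omega>\<bar> * \<bar>d n \<omega>\<bar>" by (intro mult_right_mono) auto
      then have "\<bar>d n \<omega>\<bar> \<le> (d n \<omega>)\<^sup>2 / L" using L by (simp add: field_simps power2_eq_square)
      then show ?thesis using L False by (simp add: min_def)
    qed
    have "\<bar>expectation (d n)\<bar> \<le> expectation (\<lambda>\<omega>. \<bar>d n \<omega>\<bar>)" by (rule integral_abs_bound)
    also have "\<dots> \<le> expectation (\<lambda>\<omega>. min \<bar>d n \<omega>\<bar> L + (d n \<omega>)\<^sup>2 / L)"
      by (rule integral_mono') (use i1 i2 pw L in auto)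
    also have "\<dots> = expectation (\<lambda>\<omega>. min \<bar>d n \<omega>\<bar> L) + expectation (\<lambda>\<omega>. (d n \<omega>)\<^sup>2) / L"
      using i1 i2 by simp
    also have "\<dots> < r"
    proof -
      have "expectation (\<lambda>\<omega>. (d n \<omega>)\<^sup>2) / L \<le> B / L" using sq(2)[of n] L by (intro divide_right_mono) auto
      then show ?thesis using N[OF that] L(2) by linarith
    qed
    finally show ?thesis by simp
  qed
  then show "\<exists>N. \<forall>n\<ge>N. norm (expectation (d n) - 0) < r" by blast
qed

context spectrally_negative_MAP_scale
begin

section \<open>Second moments of stopped values, uniformly in the mesh\<close>

text \<open>The double sum only encodes that the chain is alive at both ends of the step; it is
  spelled out by pairs of states so that \<open>increment_moment\<close> applies to each
  summand.\<close>

definition grid_fluct :: "nat \<Rightarrow> nat \<Rightarrow> 'w \<Rightarrow> real" where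
  "grid_fluct n k \<omega> = (\<Sum>l\<in>UNIV. \<Sum>m\<in>UNIV. (exp (beta * grid_inc n k \<omega>) - 1)\<^sup>2
     * of_bool (J (real k / 2 ^ n) \<omega> = Some l \<and> J (real k / 2 ^ n + 1 / 2 ^ n) \<omega> = Some m))"

lemma grid_fluct_nonneg: "0 \<le> grid_fluct n k \<omega>"
  unfolding grid_fluct_def by (intro sum_nonneg) auto

lemma grid_fluct_alive:
  assumes "\<omega> \<in> space \<Omega>" "J (real k / 2 ^ n + 1 / 2 ^ n) \<omega> \<noteq> None"
  shows "grid_fluct n k \<omega> = (exp (beta * grid_inc n k \<omega>) - 1)\<^sup>2"
proof -
  have "J (real k / 2 ^ n) \<omega> \<noteq> None" by (rule J_alive[OF assms]) auto
  then show ?thesis using assms(2) unfolding grid_fluct_def sum_of_bool_Some2 by (auto split: option.split)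
qed

lemma grid_fluct_moment:
  obtains K where "K \<ge> 0"
    "\<And>x i n k. integrable (P x i) (grid_fluct n k)"
    "\<And>x i n k. (\<integral>\<omega>. grid_fluct n k \<omega> \<partial>P x i) \<le> K / 2 ^ n"
proof -
  define V where "V h i j = mat_exp (h *\<^sub>R F (2 * beta)) $ i $ j - 2 * mat_exp (h *\<^sub>R F beta) $ i $ j + mat_exp (h *\<^sub>R F 0) $ i $ j" for h :: real and i j
  have "\<exists>C\<ge>0. \<forall>h i j. 0 \<le> h \<longrightarrow> h \<le> 1 \<longrightarrow>
     has_bochner_integral (P 0 i) (\<lambda>\<omega>. (exp (beta * X h \<omega>) - 1)\<^sup>2 * of_bool (J h \<omega> = Some j)) (V h i j) \<and> V h i j \<le> C * h"
    unfolding V_def by (rule exp_increment_variance)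
  then obtain C where C: "C \<ge> 0" and V: "\<And>h i j. 0 \<le> h \<Longrightarrow> h \<le> 1 \<Longrightarrow>
     has_bochner_integral (P 0 i) (\<lambda>\<omega>. (exp (beta * X h \<omega>) - 1)\<^sup>2 * of_bool (J h \<omega> = Some j)) (V h i j) \<and> V h i j \<le> C * h"
    by blast
  define K where "K = real CARD('n) * (real CARD('n) * C)"
  have main: "integrable (P x i) (grid_fluct n k) \<and> (\<integral>\<omega>. grid_fluct n k \<omega> \<partial>P x i) \<le> K / 2 ^ n" for x i n k
  proof -
    define h :: real where "h = 1 / 2 ^ n"
    have h: "0 \<le> h" "h \<le> 1" by (auto simp: h_def)
    define p where "p l = measure (P x i) {\<omega>\<in>space \<Omega>. J (real k / 2 ^ n) \<omega> = Some l}" for l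
    have p: "0 \<le> p l" "p l \<le> 1" for l by (auto simp: p_def)
    have one: "has_bochner_integral (P x i) (\<lambda>\<omega>. (exp (beta * grid_inc n k \<omega>) - 1)\<^sup>2
     * of_bool (J (real k / 2 ^ n) \<omega> = Some l \<and> J (real k / 2 ^ n + 1 / 2 ^ n) \<omega> = Some m)) (p l * V h l m)" for l m
      using V[OF h, of l m] h unfolding grid_inc_def p_def h_def
      by (intro increment_moment[where f = "\<lambda>y. (exp (beta * y) - 1)\<^sup>2"]) auto
    have le: "p l * V h l m \<le> C * h" for l m
    proof -
      have "p l * V h l m \<le> p l * (C * h)" using V[OF h, of l m] p by (intro mult_left_mono) auto
      also have "\<dots> \<le> 1 * (C * h)" using p C h by (intro mult_right_mono) auto
      finally show ?thesis by simp
    qed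
    have hb: "has_bochner_integral (P x i) (grid_fluct n k) (\<Sum>l\<in>UNIV. \<Sum>m\<in>UNIV. p l * V h l m)"
      unfolding grid_fluct_def[abs_def] by (intro has_bochner_integral_sum one)
    have "(\<Sum>l\<in>UNIV. \<Sum>m\<in>UNIV. p l * V h l m) \<le> (\<Sum>l\<in>(UNIV :: 'n set). \<Sum>m\<in>(UNIV :: 'n set). C * h)"
      by (intro sum_mono le)
    also have "\<dots> = K / 2 ^ n" by (simp add: K_def h_def)
    finally show ?thesis using hb by (simp add: has_bochner_integral_iff)
  qed
  have "K \<ge> 0" using C by (simp add: K_def)
  then show thesis using main that by blast
qed

text \<open>Until stopping the reflected value is at most \<open>a\<close>, where
  \<open>Zext\<close> is bounded; only the stopping step can leave this range, by a single
  increment. As its index is random, the fluctuations of all steps are added, which still has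
  bounded expectation.\<close>

lemma stopped_square_bound:
  obtains K where "K \<ge> 0"
    "\<And>\<omega> j n k. \<omega> \<in> space \<Omega> \<Longrightarrow> 0 \<le> X 0 \<omega> \<Longrightarrow> X 0 \<omega> \<le> a \<Longrightarrow>
       (stopped_value (Zcase j) a n k \<omega>)\<^sup>2 \<le> K * (1 + (\<Sum>r<k. grid_fluct n r \<omega>))"
proof -
  obtain C where C: "C \<ge> 0" "\<And>i j y. \<bar>Zext i j y\<bar> \<le> C * (1 + exp (beta * y))" using Zext_bound by blast
  define e where "e = exp (beta * a)"
  have e: "e > 0" by (simp add: e_def)
  define D where "D = C * (2 + e)"
  have D: "D \<ge> 0" using C e by (simp add: D_def)
  have Zc: "\<bar>Zcase j v y\<bar> \<le> D" if "y \<le> a" for j v y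
  proof -
    have "\<bar>Zext l j y\<bar> \<le> D" for l
    proof -
      have "C * (1 + e * 1) \<le> D" unfolding D_def using C e by (intro mult_left_mono) auto
      then show ?thesis using Zext_below_bound[OF C(2) C(1) that, of l j 0] by (simp add: e_def)
    qed
    then show ?thesis using D by (cases v) (auto simp: Zcase_def)
  qed
  have main: "(stopped_value (Zcase j) a n k \<omega>)\<^sup>2 \<le> 2 * D\<^sup>2 * (1 + (\<Sum>r<k. grid_fluct n r \<omega>))"
    if \<omega>: "\<omega> \<in> space \<Omega>" "0 \<le> X 0 \<omega>" "X 0 \<omega> \<le> a" for \<omega> j n k
  proof (induction k)
    case 0
    have R0: "grid_R X n 0 \<omega> = 0" using \<omega> by simp
    have "\<bar>stopped_value (Zcase j) a n 0 \<omega>\<bar> \<le> D"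
      unfolding stopped_value_0 grid_value_def R0 using Zc[of "grid_Y X n 0 \<omega>"] \<omega> by (simp add: grid_Y_0)
    then have "\<bar>stopped_value (Zcase j) a n 0 \<omega>\<bar>\<^sup>2 \<le> D\<^sup>2" by (rule power_mono) simp
    then have "(stopped_value (Zcase j) a n 0 \<omega>)\<^sup>2 \<le> 2 * D\<^sup>2" using zero_le_power2[of D] unfolding power2_abs by linarith
    then show ?case by simp
  next
    case (Suc k)
    have s0: "0 \<le> (\<Sum>r<k. grid_fluct n r \<omega>)" by (intro sum_nonneg grid_fluct_nonneg)
    show ?case
    proof (cases "grid_below a n k \<omega>")
      case False
      then have "(stopped_value (Zcase j) a n (Suc k) \<omega>)\<^sup>2 \<le> 2 * D\<^sup>2 * (1 + (\<Sum>r<k. grid_fluct n r \<omega>))"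
        using Suc by (simp add: stopped_value_Suc)
      also have "\<dots> \<le> 2 * D\<^sup>2 * (1 + (\<Sum>r<Suc k. grid_fluct n r \<omega>))"
        using grid_fluct_nonneg[of n k \<omega>] by (intro mult_left_mono) auto
      finally show ?thesis .
    next
      case True
      then have v: "stopped_value (Zcase j) a n (Suc k) \<omega> = grid_value (Zcase j) n (Suc k) \<omega>" by (simp add: stopped_value_Suc)
      show ?thesis
      proof (cases "J (real k / 2 ^ n + 1 / 2 ^ n) \<omega>")
        case None
        have "grid_value (Zcase j) n (Suc k) \<omega> = 0" unfolding grid_value_Suc_eq None by (simp add: Zcase_def)
        then have "stopped_value (Zcase j) a n (Suc k) \<omega> = 0" using v by simp
        moreover have "0 \<le> (\<Sum>r<Suc k. grid_fluct n r \<omega>)" by (intro sum_nonneg grid_fluct_nonneg)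
        ultimately show ?thesis by simp
      next
        case (Some l)
        define u where "u = exp (beta * grid_inc n k \<omega>) - 1"
        have fl: "grid_fluct n k \<omega> = u\<^sup>2" unfolding u_def using Some by (intro grid_fluct_alive \<omega>) simp
        have ee: "exp (- \<alpha> * grid_R X n k \<omega>) \<le> 1" using alpha_nonneg grid_R_nonneg[of X n k \<omega>] by simp
        have "\<bar>Zext l j (grid_Y X n k \<omega> + grid_inc n k \<omega>)\<bar> \<le> C * (1 + e * exp (beta * grid_inc n k \<omega>))"
          unfolding e_def by (rule Zext_below_bound[OF C(2) C(1) grid_Y_below[OF True]])
        also have "\<dots> \<le> C * ((2 + e) * (1 + \<bar>u\<bar>))"
        proof (rule mult_left_mono[OF _ C(1)])
          have "e * (u + 1) \<le> e * (1 + \<bar>u\<bar>)" using e by (intro mult_left_mono) auto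
          moreover have "exp (beta * grid_inc n k \<omega>) = u + 1" by (simp add: u_def)
          ultimately show "1 + e * exp (beta * grid_inc n k \<omega>) \<le> (2 + e) * (1 + \<bar>u\<bar>)"
            by (simp add: ring_distribs)
        qed
        finally have z: "\<bar>Zext l j (grid_Y X n k \<omega> + grid_inc n k \<omega>)\<bar> \<le> D * (1 + \<bar>u\<bar>)" by (simp add: D_def mult.assoc)
        have "\<bar>grid_value (Zcase j) n (Suc k) \<omega>\<bar> = exp (- \<alpha> * grid_R X n k \<omega>) * \<bar>Zext l j (grid_Y X n k \<omega> + grid_inc n k \<omega>)\<bar>"
          unfolding grid_value_Suc_eq Some by (simp add: Zcase_def abs_mult)
        also have "\<dots> \<le> 1 * (D * (1 + \<bar>u\<bar>))" by (intro mult_mono ee z) auto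
        finally have "\<bar>grid_value (Zcase j) n (Suc k) \<omega>\<bar>\<^sup>2 \<le> (D * (1 + \<bar>u\<bar>))\<^sup>2" by (intro power_mono) auto
        also have "\<dots> = D\<^sup>2 * (1 + \<bar>u\<bar>)\<^sup>2" by (rule power_mult_distrib)
        \<comment> \<open>The elementary \<open>(1 + v)\<^sup>2 \<le> 2 * (1 + v\<^sup>2)\<close>
          makes the bound linear in the fluctuation.\<close>
        also have "\<dots> \<le> D\<^sup>2 * (2 * (1 + u\<^sup>2))"
        proof (rule mult_left_mono)
          have "0 \<le> (1 - \<bar>u\<bar>)\<^sup>2" by simp
          then show "(1 + \<bar>u\<bar>)\<^sup>2 \<le> 2 * (1 + u\<^sup>2)" by (simp add: power2_eq_square algebra_simps)
        qed simp
        also have "\<dots> \<le> 2 * D\<^sup>2 * (1 + (\<Sum>r<Suc k. grid_fluct n r \<omega>))"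
        proof -
          have "D\<^sup>2 * (1 + u\<^sup>2) \<le> D\<^sup>2 * (1 + (\<Sum>r<Suc k. grid_fluct n r \<omega>))"
            using s0 fl by (intro mult_left_mono) auto
          then show ?thesis by (simp only: mult.assoc mult.left_commute[of _ 2])
        qed
        finally show ?thesis using v by simp
      qed
    qed
  qed
  show thesis by (rule that[of "2 * D\<^sup>2"]) (use main in auto)
qed

lemma stopped_moment:
  obtains K where "K \<ge> 0"
    "\<And>x i j n k. 0 \<le> x \<Longrightarrow> x \<le> a \<Longrightarrow> integrable (P x i) (\<lambda>\<omega>. (stopped_value (Zcase j) a n k \<omega>)\<^sup>2)"
    "\<And>x i j n m. 0 \<le> x \<Longrightarrow> x \<le> a \<Longrightarrow> (\<integral>\<omega>. (stopped_value (Zcase j) a n (m * 2 ^ n) \<omega>)\<^sup>2 \<partial>P x i) \<le> K * (1 + real m)"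
proof -
  obtain K1 where K1: "K1 \<ge> 0" "\<And>\<omega> j n k. \<omega> \<in> space \<Omega> \<Longrightarrow> 0 \<le> X 0 \<omega> \<Longrightarrow> X 0 \<omega> \<le> a \<Longrightarrow>
       (stopped_value (Zcase j) a n k \<omega>)\<^sup>2 \<le> K1 * (1 + (\<Sum>r<k. grid_fluct n r \<omega>))"
  proof (rule stopped_square_bound[where a = a])
    fix K assume "K \<ge> 0" "\<And>\<omega> j n k. \<omega> \<in> space \<Omega> \<Longrightarrow> 0 \<le> X 0 \<omega> \<Longrightarrow> X 0 \<omega> \<le> a \<Longrightarrow>
       (stopped_value (Zcase j) a n k \<omega>)\<^sup>2 \<le> K * (1 + (\<Sum>r<k. grid_fluct n r \<omega>))"
    then show thesis by (rule that)
  qed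
  obtain K2 where K2: "K2 \<ge> 0" "\<And>x i n k. integrable (P x i) (grid_fluct n k)"
    "\<And>x i n k. (\<integral>\<omega>. grid_fluct n k \<omega> \<partial>P x i) \<le> K2 / 2 ^ n"
  proof (rule grid_fluct_moment)
    fix K assume "K \<ge> 0" "\<And>x i n k. integrable (P x i) (grid_fluct n k)"
      "\<And>x i n k. (\<integral>\<omega>. grid_fluct n k \<omega> \<partial>P x i) \<le> K / 2 ^ n"
    then show thesis by (rule that)
  qed
  have i1: "integrable (P x i) (\<lambda>\<omega>. K1 * (1 + (\<Sum>r<k. grid_fluct n r \<omega>)))" for x i n k
    by (intro integrable_mult_right Bochner_Integration.integrable_add Bochner_Integration.integrable_sum K2) auto
  have ae: "AE \<omega> in P x i. (stopped_value (Zcase j) a n k \<omega>)\<^sup>2 \<le> K1 * (1 + (\<Sum>r<k. grid_fluct n r \<omega>))"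
    if "0 \<le> x" "x \<le> a" for x i j n k
    using AE_X0[where x = x and i = i] AE_space
  proof eventually_elim
    case (elim \<omega>)
    then have "\<omega> \<in> space \<Omega>" "0 \<le> X 0 \<omega>" "X 0 \<omega> \<le> a" using that by auto
    then show ?case by (rule K1(2))
  qed
  have i2: "integrable (P x i) (\<lambda>\<omega>. (stopped_value (Zcase j) a n k \<omega>)\<^sup>2)" if "0 \<le> x" "x \<le> a" for x i j n k
  proof (rule Bochner_Integration.integrable_bound[OF i1])
    show "AE \<omega> in P x i. norm ((stopped_value (Zcase j) a n k \<omega>)\<^sup>2) \<le> norm (K1 * (1 + (\<Sum>r<k. grid_fluct n r \<omega>)))"
    proof (rule AE_mp[OF ae[OF that] AE_I2[OF impI]])
      fix \<omega> assume "(stopped_value (Zcase j) a n k \<omega>)\<^sup>2 \<le> K1 * (1 + (\<Sum>r<k. grid_fluct n r \<omega>))"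
      then show "norm ((stopped_value (Zcase j) a n k \<omega>)\<^sup>2) \<le> norm (K1 * (1 + (\<Sum>r<k. grid_fluct n r \<omega>)))"
        using zero_le_power2[of "stopped_value (Zcase j) a n k \<omega>"] unfolding real_norm_def by linarith
    qed
  qed measurable
  have b: "(\<integral>\<omega>. (stopped_value (Zcase j) a n (m * 2 ^ n) \<omega>)\<^sup>2 \<partial>P x i) \<le> K1 * (1 + K2) * (1 + real m)"
    if x: "0 \<le> x" "x \<le> a" for x i j n m
  proof -
    have "(\<integral>\<omega>. (stopped_value (Zcase j) a n (m * 2 ^ n) \<omega>)\<^sup>2 \<partial>P x i) \<le> (\<integral>\<omega>. K1 * (1 + (\<Sum>r<m * 2 ^ n. grid_fluct n r \<omega>)) \<partial>P x i)"
      by (intro integral_mono_AE i1 i2 x ae)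
    also have "\<dots> = K1 * (1 + (\<Sum>r<m * 2 ^ n. \<integral>\<omega>. grid_fluct n r \<omega> \<partial>P x i))"
      using K2(2) P.prob_space[of x i] by simp
    also have "\<dots> \<le> K1 * (1 + (\<Sum>r<m * 2 ^ n. K2 / 2 ^ n))"
      by (intro mult_left_mono add_left_mono sum_mono K2 K1)
    \<comment> \<open>The number of steps cancels against the order of a single fluctuation: the
      bound no longer depends on the mesh.\<close>
    also have "(\<Sum>r<m * 2 ^ n. K2 / 2 ^ n) = real m * K2" by simp
    also have "K1 * (1 + real m * K2) \<le> K1 * ((1 + K2) * (1 + real m))"
      using K1(1) K2(1) by (intro mult_left_mono) (auto simp: algebra_simps)
    finally show ?thesis by (simp add: mult.assoc)
  qed
  show thesis by (rule that[of "K1 * (1 + K2)"]) (use K1 K2 i2 b in auto)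
qed

lemma integrable_stopped:
  assumes "0 \<le> x" "x \<le> a"
  shows "integrable (P x i) (stopped_value (Zcase j) a n k)"
proof -
  have "integrable (P x i) (\<lambda>\<omega>. (stopped_value (Zcase j) a n k \<omega>)\<^sup>2)"
  proof (rule stopped_moment[where a = a])
    fix K assume "\<And>x i j n k. 0 \<le> x \<Longrightarrow> x \<le> a \<Longrightarrow> integrable (P x i) (\<lambda>\<omega>. (stopped_value (Zcase j) a n k \<omega>)\<^sup>2)"
    from this[OF assms] show ?thesis .
  qed
  then show ?thesis
    by (rule P.square_integrable_imp_integrable[rotated]) measurable
qed

lemma stopped_start:
  assumes "0 \<le> x" "x \<le> a"
  shows "(\<integral>\<omega>. stopped_value (Zcase j) a n 0 \<omega> \<partial>P x i) = Zext i j x"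
proof -
  have "(\<integral>\<omega>. stopped_value (Zcase j) a n 0 \<omega> \<partial>P x i) = (\<integral>\<omega>. Zext i j x \<partial>P x i)"
  proof (rule integral_cong_AE)
    show "AE \<omega> in P x i. stopped_value (Zcase j) a n 0 \<omega> = Zext i j x"
      using AE_X0[where x = x and i = i] AE_J0[where x = x and i = i]
    proof eventually_elim
      case (elim \<omega>)
      have "grid_R X n 0 \<omega> = 0" "grid_Y X n 0 \<omega> = x" using elim assms by (simp_all add: grid_Y_0)
      then show ?case using elim by (simp add: stopped_value_0 grid_value_def Zcase_def)
    qed
  qed measurable
  then show ?thesis using P.prob_space[of x i] by simp
qed

text \<open>Optional stopping by telescoping. The errors of the individual steps live on disjoint
  time intervals and add up to one integral.\<close>

lemma stopped_error:
  assumes x: "0 \<le> x" "x \<le> a"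
  shows "ennreal \<bar>(\<integral>\<omega>. stopped_value (Zcase j) a n k \<omega> \<partial>P x i) - Zext i j x\<bar>
    \<le> ennreal (entry_sum (F \<alpha>)) * (\<integral>\<^sup>+s. min_prob x i n s * indicator {0..<real k / 2 ^ n} s \<partial>lborel)"
proof (induction k)
  case 0 show ?case using stopped_start[OF x] by simp
next
  case (Suc k)
  let ?S = "\<lambda>k. \<integral>\<omega>. stopped_value (Zcase j) a n k \<omega> \<partial>P x i"
  let ?b = "\<lambda>\<omega>. of_bool (grid_below a n k \<omega>) :: real"
  let ?M = "\<lambda>A. \<integral>\<^sup>+s. min_prob x i n s * indicator A s \<partial>lborel"
  have i2: "integrable (P x i) (\<lambda>\<omega>. ?b \<omega> * grid_value (Zcase j) n k \<omega>)"
  proof (rule Bochner_Integration.integrable_bound[OF integrable_stopped[OF x]])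
    show "AE \<omega> in P x i. norm (?b \<omega> * grid_value (Zcase j) n k \<omega>) \<le> norm (stopped_value (Zcase j) a n k \<omega>)"
      by (rule AE_I2) (auto simp: stopped_value_below)
  qed measurable
  have "?S (Suc k) - ?S k = (\<integral>\<omega>. stopped_value (Zcase j) a n (Suc k) \<omega> - stopped_value (Zcase j) a n k \<omega> \<partial>P x i)"
    by (rule Bochner_Integration.integral_diff[symmetric]) (intro integrable_stopped x)+
  also have "\<dots> = (\<integral>\<omega>. ?b \<omega> * grid_value (Zcase j) n (Suc k) \<omega> - ?b \<omega> * grid_value (Zcase j) n k \<omega> \<partial>P x i)"
    by (simp only: stopped_value_Suc_diff)
  also have "\<dots> = (\<integral>\<omega>. ?b \<omega> * grid_value (Zcase j) n (Suc k) \<omega> \<partial>P x i) - (\<integral>\<omega>. ?b \<omega> * grid_value (Zcase j) n k \<omega> \<partial>P x i)"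
    by (rule Bochner_Integration.integral_diff[OF integrable_stopped_step(1) i2])
  finally have d: "ennreal \<bar>?S (Suc k) - ?S k\<bar> \<le> ennreal (entry_sum (F \<alpha>)) * ?M {real k / 2 ^ n..<real (Suc k) / 2 ^ n}"
    using stopped_step_bound[where a = a and n = n and k = k and j = j and x = x and i = i] by simp
  have "ennreal \<bar>?S (Suc k) - Zext i j x\<bar> \<le> ennreal (\<bar>?S k - Zext i j x\<bar> + \<bar>?S (Suc k) - ?S k\<bar>)"
    by (rule ennreal_leI) linarith
  also have "\<dots> = ennreal \<bar>?S k - Zext i j x\<bar> + ennreal \<bar>?S (Suc k) - ?S k\<bar>" by (rule ennreal_plus) auto
  also have "\<dots> \<le> ennreal (entry_sum (F \<alpha>)) * ?M {0..<real k / 2 ^ n} + ennreal (entry_sum (F \<alpha>)) * ?M {real k / 2 ^ n..<real (Suc k) / 2 ^ n}"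
    by (intro add_mono Suc.IH d)
  also have "\<dots> = ennreal (entry_sum (F \<alpha>)) * (?M {0..<real k / 2 ^ n} + ?M {real k / 2 ^ n..<real (Suc k) / 2 ^ n})"
    by (rule distrib_left[symmetric])
  also have "?M {0..<real k / 2 ^ n} + ?M {real k / 2 ^ n..<real (Suc k) / 2 ^ n}
     = (\<integral>\<^sup>+s. min_prob x i n s * indicator {0..<real k / 2 ^ n} s + min_prob x i n s * indicator {real k / 2 ^ n..<real (Suc k) / 2 ^ n} s \<partial>lborel)"
    by (rule nn_integral_add[symmetric]) measurable
  also have "\<dots> = ?M {0..<real (Suc k) / 2 ^ n}"
  proof (rule nn_integral_cong)
    fix s :: real
    have "real k / 2 ^ n \<le> real (Suc k) / 2 ^ n" by (auto intro: divide_right_mono)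
    moreover have "real k / 2 ^ n \<le> s \<Longrightarrow> 0 \<le> s" using order_trans[of 0 "real k / 2 ^ n" s] by simp
    ultimately show "min_prob x i n s * indicator {0..<real k / 2 ^ n} s + min_prob x i n s * indicator {real k / 2 ^ n..<real (Suc k) / 2 ^ n} s
      = min_prob x i n s * indicator {0..<real (Suc k) / 2 ^ n} s"
      by (auto simp del: of_nat_Suc split: split_indicator)
  qed
  finally show ?case .
qed

lemma stopped_tendsto:
  assumes x: "0 \<le> x" "x \<le> a"
  shows "(\<lambda>n. \<integral>\<omega>. stopped_value (Zcase j) a n (m * 2 ^ n) \<omega> \<partial>P x i) \<longlonglongrightarrow> Zext i j x"
proof -
  let ?S = "\<lambda>n. \<integral>\<omega>. stopped_value (Zcase j) a n (m * 2 ^ n) \<omega> \<partial>P x i"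
  let ?B = "\<lambda>n. ennreal (entry_sum (F \<alpha>)) * (\<integral>\<^sup>+s. min_prob x i n s * indicator {0..<real m} s \<partial>lborel)"
  have le: "ennreal \<bar>?S n - Zext i j x\<bar> \<le> ?B n" for n
    using stopped_error[OF x, where k = "m * 2 ^ n" and n = n] by simp
  have "?B \<longlonglongrightarrow> ennreal (entry_sum (F \<alpha>)) * 0"
    by (intro ennreal_tendsto_cmult min_prob_integral_tendsto_0) simp
  then have "?B \<longlonglongrightarrow> 0" by simp
  then have "(\<lambda>n. ennreal \<bar>?S n - Zext i j x\<bar>) \<longlonglongrightarrow> 0"
    by (rule tendsto_sandwich[OF _ _ tendsto_const, rotated 2]) (use le in auto)
  then have "(\<lambda>n. \<bar>?S n - Zext i j x\<bar>) \<longlonglongrightarrow> 0"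
    by (simp add: ennreal_0[symmetric] tendsto_ennreal_iff del: ennreal_0)
  then show ?thesis by (simp add: LIM_zero_cancel tendsto_rabs_zero_iff)
qed

section \<open>Passage to the limit and identification of the exit value\<close>

text \<open>Without exceedance \<open>passage_time\<close> is the infimum of the empty set and
  meaningless, so the value is set to 0; death before passage is handled by requiring
  \<open>\<phi> None = 0\<close>.\<close>

definition exit_value :: "('n option \<Rightarrow> real) \<Rightarrow> real \<Rightarrow> 'w \<Rightarrow> real" where
  "exit_value \<phi> a \<omega> = (if exceed_set X a \<omega> = {} then 0
     else exp (- \<alpha> * refl_R X (passage_time X a \<omega>) \<omega>) * \<phi> (J (passage_time X a \<omega>) \<omega>))"

lemma stopped_value_const_tendsto:
  assumes \<omega>: "\<omega> \<in> space \<Omega>" "grid_exceeds a m \<omega>"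
  shows "(\<lambda>n. stopped_value (\<lambda>v _. \<phi> v) a n (m * 2 ^ n) \<omega>) \<longlonglongrightarrow> exit_value \<phi> a \<omega>"
proof -
  let ?T = "passage_time X a \<omega>" and ?K = "\<lambda>n. grid_stop X a n (m * 2 ^ n) \<omega>"
  have ev: "eventually (\<lambda>n. stopped_value (\<lambda>v _. \<phi> v) a n (m * 2 ^ n) \<omega> = exp (- \<alpha> * grid_R X n (?K n) \<omega>) * \<phi> (J ?T \<omega>)) sequentially"
    using passage_limit(5)[OF \<omega>] by eventually_elim (simp add: stopped_value_def grid_value_def)
  have "(\<lambda>n. exp (- \<alpha> * grid_R X n (?K n) \<omega>) * \<phi> (J ?T \<omega>)) \<longlonglongrightarrow> exp (- \<alpha> * refl_R X ?T \<omega>) * \<phi> (J ?T \<omega>)"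
    by (intro tendsto_intros passage_limit(6)[OF \<omega>])
  then show ?thesis
    using passage_limit(1)[OF \<omega>] by (simp add: exit_value_def tendsto_cong[OF ev])
qed

text \<open>Here the absence of an overshoot enters: the reflected value tends to \<open>a\<close>,
  and \<open>Zext\<close> is continuous.\<close>

lemma stopped_value_Zcase_tendsto:
  assumes \<omega>: "\<omega> \<in> space \<Omega>" "grid_exceeds a m \<omega>" and X0: "0 \<le> X 0 \<omega>" "X 0 \<omega> \<le> a"
  shows "(\<lambda>n. stopped_value (Zcase j) a n (m * 2 ^ n) \<omega>) \<longlonglongrightarrow> exit_value (\<lambda>v. Zcase j v a) a \<omega>"
proof -
  let ?T = "passage_time X a \<omega>" and ?K = "\<lambda>n. grid_stop X a n (m * 2 ^ n) \<omega>"
  have ev: "eventually (\<lambda>n. stopped_value (Zcase j) a n (m * 2 ^ n) \<omega> = exp (- \<alpha> * grid_R X n (?K n) \<omega>) * Zcase j (J ?T \<omega>) (grid_Y X n (?K n) \<omega>)) sequentially"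
    using passage_limit(5)[OF \<omega>] by eventually_elim (simp add: stopped_value_def grid_value_def)
  have c: "isCont (Zcase j (J ?T \<omega>)) a"
    by (cases "J ?T \<omega>") (simp_all add: Zcase_def[abs_def] isCont_Zext)
  have "(\<lambda>n. exp (- \<alpha> * grid_R X n (?K n) \<omega>) * Zcase j (J ?T \<omega>) (grid_Y X n (?K n) \<omega>))
     \<longlonglongrightarrow> exp (- \<alpha> * refl_R X ?T \<omega>) * Zcase j (J ?T \<omega>) a"
    by (intro tendsto_mult isCont_tendsto_compose[OF c] passage_limit(7)[OF \<omega> X0] tendsto_intros passage_limit(6)[OF \<omega>])
  then show ?thesis
    using passage_limit(1)[OF \<omega>] by (simp add: exit_value_def tendsto_cong[OF ev])
qed

lemma exit_value_truncation_tendsto: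
  assumes \<omega>: "\<omega> \<in> space \<Omega>" and \<phi>: "\<phi> None = 0"
  shows "(\<lambda>m. of_bool (grid_exceeds a m \<omega>) * exit_value \<phi> a \<omega>) \<longlonglongrightarrow> exit_value \<phi> a \<omega>"
proof (cases "exceed_set X a \<omega> \<noteq> {} \<and> J (passage_time X a \<omega>) \<omega> \<noteq> None")
  case True
  have "eventually (\<lambda>m. passage_time X a \<omega> < real m) sequentially"
    using filterlim_real_sequentially by (rule filterlim_at_top_dense[THEN iffD1, rule_format])
  then have "eventually (\<lambda>m. of_bool (grid_exceeds a m \<omega>) * exit_value \<phi> a \<omega> = exit_value \<phi> a \<omega>) sequentially"
  proof eventually_elim
    case (elim m)
    then have "grid_exceeds a m \<omega>" using True by (intro grid_exceeds_of_passage \<omega>) auto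
    then show ?case by simp
  qed
  then show ?thesis by (rule tendsto_eventually)
next
  case False
  then have "exit_value \<phi> a \<omega> = 0" using \<phi> by (auto simp: exit_value_def)
  then show ?thesis by simp
qed

text \<open>The functional is defined through infima over uncountably many times; it is an iterated
  limit, in the mesh and then in the horizon, of functionals of finitely many coordinates.\<close>

lemma measurable_exit_value:
  assumes "\<phi> None = 0"
  shows "exit_value \<phi> a \<in> borel_measurable \<Omega>"
proof (rule borel_measurable_LIMSEQ_real)
  fix \<omega> assume "\<omega> \<in> space \<Omega>"
  then show "(\<lambda>m. of_bool (grid_exceeds a m \<omega>) * exit_value \<phi> a \<omega>) \<longlonglongrightarrow> exit_value \<phi> a \<omega>"
    using assms by (rule exit_value_truncation_tendsto)
next
  fix m
  have [measurable]: "stopped_value (\<lambda>v _. \<phi> v) a n k \<in> borel_measurable \<Omega>" for n k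
    by (rule measurable_stopped_value) simp
  show "(\<lambda>\<omega>. of_bool (grid_exceeds a m \<omega>) * exit_value \<phi> a \<omega>) \<in> borel_measurable \<Omega>"
  proof (rule borel_measurable_LIMSEQ_real)
    fix \<omega> assume "\<omega> \<in> space \<Omega>"
    then show "(\<lambda>n. of_bool (grid_exceeds a m \<omega>) * stopped_value (\<lambda>v _. \<phi> v) a n (m * 2 ^ n) \<omega>) \<longlonglongrightarrow> of_bool (grid_exceeds a m \<omega>) * exit_value \<phi> a \<omega>"
      by (cases "grid_exceeds a m \<omega>") (auto intro: stopped_value_const_tendsto)
  qed measurable
qed

lemma exit_value_bound:
  assumes "\<phi> None = 0"
  shows "\<bar>exit_value \<phi> a \<omega>\<bar> \<le> (\<Sum>l\<in>UNIV. \<bar>\<phi> (Some l)\<bar>)"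
proof -
  have p: "\<bar>\<phi> v\<bar> \<le> (\<Sum>l\<in>UNIV. \<bar>\<phi> (Some l)\<bar>)" for v
  proof (cases v)
    case None then show ?thesis using assms by (simp add: sum_nonneg)
  next
    case (Some l)
    have "\<bar>\<phi> (Some l)\<bar> \<le> (\<Sum>l\<in>UNIV. \<bar>\<phi> (Some l)\<bar>)" by (rule member_le_sum) auto
    then show ?thesis using Some by simp
  qed
  let ?T = "passage_time X a \<omega>"
  have "exp (- \<alpha> * refl_R X ?T \<omega>) \<le> 1" using alpha_nonneg refl_R_nonneg[of ?T \<omega>] by simp
  then have "exp (- \<alpha> * refl_R X ?T \<omega>) * \<bar>\<phi> (J ?T \<omega>)\<bar> \<le> 1 * (\<Sum>l\<in>UNIV. \<bar>\<phi> (Some l)\<bar>)"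
    by (intro mult_mono p) auto
  then show ?thesis by (auto simp: exit_value_def abs_mult sum_nonneg)
qed

text \<open>If the grid stops at the horizon the chain is dead by assumption; if it stops earlier,
  it must be dead there, since an exceedance while alive would be counted by
  \<open>grid_exceeds\<close>.\<close>

lemma stopped_value_dead:
  assumes "\<not> grid_exceeds a m \<omega>" "J (real m) \<omega> = None"
  shows "stopped_value (Zcase j) a n (m * 2 ^ n) \<omega> = 0"
proof -
  let ?K = "grid_stop X a n (m * 2 ^ n) \<omega>"
  have "J (real ?K / 2 ^ n) \<omega> = None"
  proof (cases rule: grid_stop_cases[where X = X and a = a and n = n and N = "m * 2 ^ n" and \<omega> = \<omega>])
    case 1 then show ?thesis using assms(2) by simp
  next
    case 2 then show ?thesis using assms(1) by (auto simp: grid_exceeds_def)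
  qed
  then show ?thesis by (simp add: stopped_value_def grid_value_def Zcase_def)
qed

text \<open>On paths with passage before \<open>m\<close> the stopped values converge to the exit
  value in mean. The remaining paths contribute only if still alive, and are estimated by Young's
  inequality with a free weight \<open>\<theta>\<close>, which separates the second moment from the
  probability of the event.\<close>

lemma exit_error:
  obtains K where "K \<ge> 0"
    "\<And>x i j m \<theta>. 0 \<le> x \<Longrightarrow> x \<le> a \<Longrightarrow> \<theta> > 0 \<Longrightarrow>
      \<bar>Zext i j x - (\<integral>\<omega>. of_bool (grid_exceeds a m \<omega>) * exit_value (\<lambda>v. Zcase j v a) a \<omega> \<partial>P x i)\<bar>
      \<le> (\<theta> * (K * (1 + real m)) + measure (P x i) {\<omega>\<in>space \<Omega>. J (real m) \<omega> \<noteq> None \<and> \<not> grid_exceeds a m \<omega>} / \<theta>) / 2"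
proof (rule stopped_moment[where a = a])
  fix K assume K: "K \<ge> 0"
    "\<And>x i j n k. 0 \<le> x \<Longrightarrow> x \<le> a \<Longrightarrow> integrable (P x i) (\<lambda>\<omega>. (stopped_value (Zcase j) a n k \<omega>)\<^sup>2)"
    "\<And>x i j n m. 0 \<le> x \<Longrightarrow> x \<le> a \<Longrightarrow> (\<integral>\<omega>. (stopped_value (Zcase j) a n (m * 2 ^ n) \<omega>)\<^sup>2 \<partial>P x i) \<le> K * (1 + real m)"
  have main: "\<bar>Zext i j x - (\<integral>\<omega>. of_bool (grid_exceeds a m \<omega>) * exit_value (\<lambda>v. Zcase j v a) a \<omega> \<partial>P x i)\<bar>
      \<le> (\<theta> * (K * (1 + real m)) + measure (P x i) {\<omega>\<in>space \<Omega>. J (real m) \<omega> \<noteq> None \<and> \<not> grid_exceeds a m \<omega>} / \<theta>) / 2"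
    if x: "0 \<le> x" "x \<le> a" and \<theta>: "\<theta> > 0" for x i j m \<theta>
  proof -
    define S where "S = exit_value (\<lambda>v. Zcase j v a) a"
    define A :: "'w \<Rightarrow> real" where "A \<omega> = of_bool (grid_exceeds a m \<omega>)" for \<omega>
    define b :: "'w \<Rightarrow> real" where "b \<omega> = of_bool (J (real m) \<omega> \<noteq> None \<and> \<not> grid_exceeds a m \<omega>)" for \<omega>
    define g where "g n = stopped_value (Zcase j) a n (m * 2 ^ n)" for n
    define p where "p = measure (P x i) {\<omega>\<in>space \<Omega>. J (real m) \<omega> \<noteq> None \<and> \<not> grid_exceeds a m \<omega>}"
    define M where "M = (\<Sum>l\<in>UNIV. \<bar>Zcase j (Some l) a\<bar>)"
    have [measurable]: "S \<in> borel_measurable \<Omega>"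
      unfolding S_def by (rule measurable_exit_value) (simp add: Zcase_def)
    have [measurable]: "A \<in> borel_measurable \<Omega>" "b \<in> borel_measurable \<Omega>" "g n \<in> borel_measurable \<Omega>" for n
      unfolding A_def[abs_def] b_def[abs_def] g_def by measurable
    have S: "\<bar>S \<omega>\<bar> \<le> M" for \<omega>
      unfolding S_def M_def by (rule exit_value_bound) (simp add: Zcase_def)
    have A01: "A \<omega> = 0 \<or> A \<omega> = 1" for \<omega> by (simp add: A_def)
    have ig: "integrable (P x i) (g n)" for n unfolding g_def by (rule integrable_stopped[OF x])
    have ig2: "integrable (P x i) (\<lambda>\<omega>. (g n \<omega>)\<^sup>2)" for n unfolding g_def by (rule K(2)[OF x])
    have eg2: "(\<integral>\<omega>. (g n \<omega>)\<^sup>2 \<partial>P x i) \<le> K * (1 + real m)" for n unfolding g_def by (rule K(3)[OF x])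
    have iAS: "integrable (P x i) (\<lambda>\<omega>. A \<omega> * S \<omega>)"
    proof (rule P.integrable_of_bool_bounded[where C = M])
      fix \<omega> show "\<bar>A \<omega> * S \<omega>\<bar> \<le> M" using A01[of \<omega>] S[of \<omega>] by auto
    qed measurable
    have iAg: "integrable (P x i) (\<lambda>\<omega>. A \<omega> * g n \<omega>)" for n
    proof (rule Bochner_Integration.integrable_bound[OF ig[of n] _ AE_I2])
      fix \<omega> show "norm (A \<omega> * g n \<omega>) \<le> norm (g n \<omega>)" using A01[of \<omega>] by auto
    qed measurable
    have iBg: "integrable (P x i) (\<lambda>\<omega>. (1 - A \<omega>) * g n \<omega>)" for n
    proof (rule Bochner_Integration.integrable_bound[OF ig[of n] _ AE_I2])
      fix \<omega> show "norm ((1 - A \<omega>) * g n \<omega>) \<le> norm (g n \<omega>)" using A01[of \<omega>] by auto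
    qed measurable
    define d where "d n \<omega> = A \<omega> * g n \<omega> - A \<omega> * S \<omega>" for n \<omega>
    have [measurable]: "d n \<in> borel_measurable \<Omega>" for n unfolding d_def[abs_def] by measurable
    have dint: "integrable (P x i) (d n)" for n
      unfolding d_def by (intro Bochner_Integration.integrable_diff iAg iAS)
    have dlim: "(\<lambda>n. \<integral>\<omega>. d n \<omega> \<partial>P x i) \<longlonglongrightarrow> 0"
    proof (rule P.tendsto_expectation_of_square_bound)
      show "AE \<omega> in P x i. (\<lambda>n. d n \<omega>) \<longlonglongrightarrow> 0"
        using AE_X0[where x = x and i = i] AE_space
      proof eventually_elim
        case (elim \<omega>)
        then have \<omega>: "\<omega> \<in> space \<Omega>" "0 \<le> X 0 \<omega>" "X 0 \<omega> \<le> a" using x by auto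
        show ?case
        proof (cases "grid_exceeds a m \<omega>")
          case True
          have "(\<lambda>n. g n \<omega>) \<longlonglongrightarrow> S \<omega>" unfolding g_def S_def by (rule stopped_value_Zcase_tendsto[OF \<omega>(1) True \<omega>(2,3)])
          then have "(\<lambda>n. A \<omega> * g n \<omega> - A \<omega> * S \<omega>) \<longlonglongrightarrow> A \<omega> * S \<omega> - A \<omega> * S \<omega>" by (intro tendsto_intros)
          then show ?thesis by (simp add: d_def)
        next
          case False then show ?thesis by (simp add: d_def A_def)
        qed
      qed
      have dsq: "(d n \<omega>)\<^sup>2 \<le> 2 * (g n \<omega>)\<^sup>2 + 2 * M\<^sup>2" for n \<omega>
      proof (cases "A \<omega> = 0")
        case True then show ?thesis by (simp add: d_def)
      next
        case False
        then have dg: "d n \<omega> = g n \<omega> - S \<omega>" using A01[of \<omega>] by (auto simp: d_def)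
        have "(d n \<omega>)\<^sup>2 = 2 * (g n \<omega>)\<^sup>2 + 2 * (S \<omega>)\<^sup>2 - (g n \<omega> + S \<omega>)\<^sup>2"
          unfolding dg by (simp add: power2_eq_square algebra_simps)
        moreover have "0 \<le> (g n \<omega> + S \<omega>)\<^sup>2" by simp
        moreover have "\<bar>S \<omega>\<bar>\<^sup>2 \<le> M\<^sup>2" by (rule power_mono[OF S]) simp
        ultimately show ?thesis unfolding power2_abs by linarith
      qed
      have ib: "integrable (P x i) (\<lambda>\<omega>. 2 * (g n \<omega>)\<^sup>2 + 2 * M\<^sup>2)" for n
        by (intro Bochner_Integration.integrable_add integrable_mult_right ig2 P.integrable_const)
      show i2: "integrable (P x i) (\<lambda>\<omega>. (d n \<omega>)\<^sup>2)" for n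
      proof (rule Bochner_Integration.integrable_bound[OF ib[of n] _ AE_I2])
        fix \<omega> show "norm ((d n \<omega>)\<^sup>2) \<le> norm (2 * (g n \<omega>)\<^sup>2 + 2 * M\<^sup>2)" using dsq[of n \<omega>] by simp
      qed measurable
      show "(\<integral>\<omega>. (d n \<omega>)\<^sup>2 \<partial>P x i) \<le> 2 * (K * (1 + real m)) + 2 * M\<^sup>2" for n
      proof -
        have "(\<integral>\<omega>. (d n \<omega>)\<^sup>2 \<partial>P x i) \<le> (\<integral>\<omega>. 2 * (g n \<omega>)\<^sup>2 + 2 * M\<^sup>2 \<partial>P x i)"
          by (intro integral_mono i2 ib dsq)
        also have "\<dots> = 2 * (\<integral>\<omega>. (g n \<omega>)\<^sup>2 \<partial>P x i) + 2 * M\<^sup>2"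
          using ig2[of n] P.prob_space[of x i] by simp
        finally show ?thesis using eg2[of n] by linarith
      qed
    qed measurable
    have split: "(\<integral>\<omega>. g n \<omega> \<partial>P x i) = (\<integral>\<omega>. A \<omega> * S \<omega> \<partial>P x i) + (\<integral>\<omega>. d n \<omega> \<partial>P x i) + (\<integral>\<omega>. (1 - A \<omega>) * g n \<omega> \<partial>P x i)" for n
    proof -
      have "(\<integral>\<omega>. g n \<omega> \<partial>P x i) = (\<integral>\<omega>. (A \<omega> * S \<omega> + d n \<omega>) + (1 - A \<omega>) * g n \<omega> \<partial>P x i)"
        by (intro Bochner_Integration.integral_cong) (auto simp: d_def algebra_simps)
      also have "\<dots> = (\<integral>\<omega>. A \<omega> * S \<omega> + d n \<omega> \<partial>P x i) + (\<integral>\<omega>. (1 - A \<omega>) * g n \<omega> \<partial>P x i)"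
        by (rule Bochner_Integration.integral_add[OF Bochner_Integration.integrable_add[OF iAS dint] iBg])
      also have "(\<integral>\<omega>. A \<omega> * S \<omega> + d n \<omega> \<partial>P x i) = (\<integral>\<omega>. A \<omega> * S \<omega> \<partial>P x i) + (\<integral>\<omega>. d n \<omega> \<partial>P x i)"
        by (rule Bochner_Integration.integral_add[OF iAS dint])
      finally show ?thesis .
    qed
    have off: "\<bar>\<integral>\<omega>. (1 - A \<omega>) * g n \<omega> \<partial>P x i\<bar> \<le> (\<theta> * (K * (1 + real m)) + p / \<theta>) / 2" for n
    proof -
      have ib: "integrable (P x i) b"
        by (rule P.integrable_of_bool_bounded[where C = 1]) (auto simp: b_def)
      have Eb: "(\<integral>\<omega>. b \<omega> \<partial>P x i) = p" unfolding b_def p_def by (subst integral_of_bool) simp_all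
      have ir: "integrable (P x i) (\<lambda>\<omega>. (\<theta> * (g n \<omega>)\<^sup>2 + b \<omega> / \<theta>) / 2)"
        using ig2[of n] ib by simp
      \<comment> \<open>Young's inequality, from the nonnegativity of
        \<open>\<theta> * (\<bar>g\<bar> - 1 / \<theta>)\<^sup>2\<close>; where \<open>b\<close> is
        0, the left-hand side vanishes.\<close>
      have pw: "\<bar>(1 - A \<omega>) * g n \<omega>\<bar> \<le> (\<theta> * (g n \<omega>)\<^sup>2 + b \<omega> / \<theta>) / 2" for \<omega>
      proof (cases "b \<omega> = 0")
        case True
        then have e: "(1 - A \<omega>) * g n \<omega> = 0"
          using stopped_value_dead[where a = a and m = m and \<omega> = \<omega> and j = j and n = n] by (auto simp: b_def A_def g_def)
        show ?thesis unfolding e True using \<theta> by simp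
      next
        case False
        then have 1: "b \<omega> = 1" "A \<omega> = 0" by (auto simp: b_def A_def)
        have "0 \<le> \<theta> * (\<bar>g n \<omega>\<bar> - 1 / \<theta>)\<^sup>2" using \<theta> by simp
        also have "\<dots> = \<theta> * (g n \<omega>)\<^sup>2 - 2 * \<bar>g n \<omega>\<bar> + 1 / \<theta>"
          using \<theta> by (simp add: power2_diff field_simps power2_eq_square)
        finally show ?thesis using 1 by simp
      qed
      have "\<bar>\<integral>\<omega>. (1 - A \<omega>) * g n \<omega> \<partial>P x i\<bar> \<le> (\<integral>\<omega>. \<bar>(1 - A \<omega>) * g n \<omega>\<bar> \<partial>P x i)" by (rule integral_abs_bound)
      also have "\<dots> \<le> (\<integral>\<omega>. (\<theta> * (g n \<omega>)\<^sup>2 + b \<omega> / \<theta>) / 2 \<partial>P x i)"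
        by (intro integral_mono ir pw) (use iBg[of n] in simp)
      also have "\<dots> = (\<theta> * (\<integral>\<omega>. (g n \<omega>)\<^sup>2 \<partial>P x i) + p / \<theta>) / 2"
        using ig2[of n] ib by (simp add: Eb)
      also have "\<dots> \<le> (\<theta> * (K * (1 + real m)) + p / \<theta>) / 2"
        using mult_left_mono[OF eg2[of n], of \<theta>] \<theta> by simp
      finally show ?thesis .
    qed
    have "(\<lambda>n. \<bar>(\<integral>\<omega>. g n \<omega> \<partial>P x i) - (\<integral>\<omega>. A \<omega> * S \<omega> \<partial>P x i) - (\<integral>\<omega>. d n \<omega> \<partial>P x i)\<bar>) \<longlonglongrightarrow> \<bar>Zext i j x - (\<integral>\<omega>. A \<omega> * S \<omega> \<partial>P x i) - 0\<bar>"
      unfolding g_def by (intro tendsto_intros stopped_tendsto[OF x] dlim)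
    then have "\<bar>Zext i j x - (\<integral>\<omega>. A \<omega> * S \<omega> \<partial>P x i) - 0\<bar> \<le> (\<theta> * (K * (1 + real m)) + p / \<theta>) / 2"
      by (rule LIMSEQ_le_const2) (use off split in auto)
    then show ?thesis by (simp add: A_def S_def p_def)
  qed
  show thesis by (rule that[OF K(1)]) (rule main)
qed

lemma refl_exit_entry_eq:
  "refl_exit_entry P X J \<alpha> a x i l = (\<integral>\<omega>. exit_value (\<lambda>v. of_bool (v = Some l)) a \<omega> \<partial>P x i)"
  unfolding refl_exit_entry_def exit_value_def
  by (intro Bochner_Integration.integral_cong) (auto simp: indicator_def)

lemma exit_value_Zcase:
  "exit_value (\<lambda>v. Zcase j v a) a \<omega> = (\<Sum>l\<in>UNIV. exit_value (\<lambda>v. of_bool (v = Some l)) a \<omega> * Zext l j a)"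
proof (cases "exceed_set X a \<omega> = {}")
  case False
  then show ?thesis by (simp only: exit_value_def Zcase_eq_sum if_False sum_distrib_left mult_ac)
qed (simp add: exit_value_def)

text \<open>At horizon \<open>k * T + 1\<close> the weight \<open>\<theta> = q ^ k\<close> is used.
  The second-moment term is then of order \<open>k * q ^ k\<close>, and the probability, at most
  \<open>q ^ k * q ^ k\<close>, leaves \<open>q ^ k\<close> after division.\<close>

lemma refl_exit_identity:
  assumes x: "0 \<le> x" "x \<le> a"
  shows "Zext i j x = (\<Sum>l\<in>UNIV. refl_exit_entry P X J \<alpha> a x i l * Zext l j a)"
proof -
  define S where "S = exit_value (\<lambda>v. Zcase j v a) a"
  have a: "0 \<le> a" using x by simp
  have [measurable]: "S \<in> borel_measurable \<Omega>"
    unfolding S_def by (rule measurable_exit_value) (simp add: Zcase_def)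
  have S: "\<bar>S \<omega>\<bar> \<le> (\<Sum>l\<in>UNIV. \<bar>Zcase j (Some l) a\<bar>)" for \<omega>
    unfolding S_def by (rule exit_value_bound) (simp add: Zcase_def)
  have "Zext i j x = (\<integral>\<omega>. S \<omega> \<partial>P x i)"
  proof (rule no_passage_prob[OF a])
    fix T c assume T: "T > 0" and c: "c > 0" "c \<le> 1"
      and np: "\<And>x i j. measure (P x i) {\<omega>\<in>space \<Omega>. J (real (j * T + 1)) \<omega> \<noteq> None \<and> \<not> grid_exceeds a (j * T + 1) \<omega>} \<le> (1 - c) ^ j"
    show ?thesis
    proof (rule exit_error[where a = a])
      fix K assume K: "K \<ge> 0" and err: "\<And>x i j m \<theta>. 0 \<le> x \<Longrightarrow> x \<le> a \<Longrightarrow> \<theta> > 0 \<Longrightarrow>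
        \<bar>Zext i j x - (\<integral>\<omega>. of_bool (grid_exceeds a m \<omega>) * exit_value (\<lambda>v. Zcase j v a) a \<omega> \<partial>P x i)\<bar>
        \<le> (\<theta> * (K * (1 + real m)) + measure (P x i) {\<omega>\<in>space \<Omega>. J (real m) \<omega> \<noteq> None \<and> \<not> grid_exceeds a m \<omega>} / \<theta>) / 2"
      \<comment> \<open>A convenient upper bound for the square root of \<open>1 - c\<close>, as
        \<open>q * q = 1 - c + c\<^sup>2 / 4\<close>. It is positive even for \<open>c = 1\<close>,
        so division by \<open>q ^ k\<close> is legitimate.\<close>
      define q where "q = 1 - c / 2"
      have q: "0 < q" "q < 1" "1 - c \<le> q * q" using c by (auto simp: q_def algebra_simps)
      define E where "E k = (\<integral>\<omega>. of_bool (grid_exceeds a (k * T + 1) \<omega>) * S \<omega> \<partial>P x i)" for k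
      have bound: "\<bar>Zext i j x - E k\<bar> \<le> (2 * K + 1) * q ^ k + K * real T * (real k * q ^ k)" for k
      proof -
        have "measure (P x i) {\<omega>\<in>space \<Omega>. J (real (k * T + 1)) \<omega> \<noteq> None \<and> \<not> grid_exceeds a (k * T + 1) \<omega>} \<le> (1 - c) ^ k"
          by (rule np)
        also have "\<dots> \<le> (q * q) ^ k" using q c by (intro power_mono) auto
        also have "\<dots> = q ^ k * q ^ k" by (rule power_mult_distrib)
        finally have m: "measure (P x i) {\<omega>\<in>space \<Omega>. J (real (k * T + 1)) \<omega> \<noteq> None \<and> \<not> grid_exceeds a (k * T + 1) \<omega>} / q ^ k \<le> q ^ k"
          using q by (simp add: divide_le_eq)
        have "\<bar>Zext i j x - E k\<bar> \<le> (q ^ k * (K * (1 + real (k * T + 1))) + measure (P x i) {\<omega>\<in>space \<Omega>. J (real (k * T + 1)) \<omega> \<noteq> None \<and> \<not> grid_exceeds a (k * T + 1) \<omega>} / q ^ k) / 2"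
          unfolding E_def S_def by (rule err[OF x]) (use q in simp)
        also have "\<dots> \<le> (q ^ k * (K * (1 + real (k * T + 1))) + q ^ k) / 2"
          by (intro divide_right_mono add_left_mono m) simp
        also have "\<dots> \<le> q ^ k * (K * (1 + real (k * T + 1))) + q ^ k"
          using q K by simp
        also have "\<dots> = (2 * K + 1) * q ^ k + K * real T * (real k * q ^ k)" by (simp add: algebra_simps)
        finally show ?thesis .
      qed
      have "(\<lambda>k. (2 * K + 1) * q ^ k + K * real T * (real k * q ^ k)) \<longlonglongrightarrow> (2 * K + 1) * 0 + K * real T * 0"
        using q by (intro tendsto_intros LIMSEQ_realpow_zero powser_times_n_limit_0) auto
      then have "(\<lambda>k. (2 * K + 1) * q ^ k + K * real T * (real k * q ^ k)) \<longlonglongrightarrow> 0" by simp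
      then have "(\<lambda>k. \<bar>Zext i j x - E k\<bar>) \<longlonglongrightarrow> 0"
        by (rule tendsto_sandwich[OF _ _ tendsto_const, rotated 2]) (use bound in auto)
      then have lim1: "E \<longlonglongrightarrow> Zext i j x"
        by (simp add: tendsto_rabs_zero_iff LIM_zero_iff tendsto_minus_cancel_left[symmetric] abs_minus_commute)
      have "E \<longlonglongrightarrow> (\<integral>\<omega>. S \<omega> \<partial>P x i)"
        unfolding E_def
      proof (rule integral_dominated_convergence[where w = "\<lambda>_. \<Sum>l\<in>UNIV. \<bar>Zcase j (Some l) a\<bar>"])
        show "AE \<omega> in P x i. (\<lambda>k. of_bool (grid_exceeds a (k * T + 1) \<omega>) * S \<omega>) \<longlonglongrightarrow> S \<omega>"
        proof (rule AE_I2)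
          fix \<omega> assume "\<omega> \<in> space (P x i)"
          then have "(\<lambda>m. of_bool (grid_exceeds a m \<omega>) * S \<omega>) \<longlonglongrightarrow> S \<omega>"
            unfolding S_def by (intro exit_value_truncation_tendsto) (simp_all add: Zcase_def)
          \<comment> \<open>The horizons form a subsequence of the natural numbers because
            \<open>T > 0\<close>, so the convergence of the truncations carries over.\<close>
          moreover have "strict_mono (\<lambda>k. k * T + 1)" using T by (auto simp: strict_mono_def)
          ultimately show "(\<lambda>k. of_bool (grid_exceeds a (k * T + 1) \<omega>) * S \<omega>) \<longlonglongrightarrow> S \<omega>"
            by (auto dest: LIMSEQ_subseq_LIMSEQ simp: comp_def)
        qed
        show "AE \<omega> in P x i. norm (of_bool (grid_exceeds a (k * T + 1) \<omega>) * S \<omega>) \<le> (\<Sum>l\<in>UNIV. \<bar>Zcase j (Some l) a\<bar>)" for k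
          by (rule AE_I2) (use S in \<open>auto simp: sum_nonneg\<close>)
      qed auto
      from LIMSEQ_unique[OF lim1 this] show ?thesis .
    qed
  qed
  also have "\<dots> = (\<integral>\<omega>. (\<Sum>l\<in>UNIV. exit_value (\<lambda>v. of_bool (v = Some l)) a \<omega> * Zext l j a) \<partial>P x i)"
    by (simp only: S_def exit_value_Zcase)
  also have "\<dots> = (\<Sum>l\<in>UNIV. refl_exit_entry P X J \<alpha> a x i l * Zext l j a)"
  proof -
    have "integrable (P x i) (exit_value (\<lambda>v. of_bool (v = Some l)) a)" for l
    proof (rule P.integrable_of_bool_bounded)
      show "exit_value (\<lambda>v. of_bool (v = Some l)) a \<in> borel_measurable (P x i)"
        using measurable_exit_value[of "\<lambda>v. of_bool (v = Some l)" a] by simp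
      show "\<bar>exit_value (\<lambda>v. of_bool (v = Some l)) a \<omega>\<bar> \<le> (\<Sum>m\<in>UNIV. \<bar>of_bool (Some m = Some l)\<bar>)" for \<omega>
        by (rule exit_value_bound) simp
    qed
    then show ?thesis by (simp add: refl_exit_entry_eq)
  qed
  finally show ?thesis .
qed

end

theorem theorem2:
  fixes \<Omega> :: "'w measure" and P :: "real \<Rightarrow> 'n::finite \<Rightarrow> 'w measure"
    and X :: "real \<Rightarrow> 'w \<Rightarrow> real" and J :: "real \<Rightarrow> 'w \<Rightarrow> 'n option"
    and F W :: "real \<Rightarrow> real^'n^'n"
  assumes "sn_MAP \<Omega> P X J"
    and "matrix_exponent \<Omega> P X J F"
    and "scale_matrix F W"
    and "0 \<le> \<alpha>" and "0 < a"
  shows "invertible (Zmat F W \<alpha> a) \<and>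
    (\<forall>x\<in>{0..a}. \<forall>i j. refl_exit_entry P X J \<alpha> a x i j
        = (Zmat F W \<alpha> x ** matrix_inv (Zmat F W \<alpha> a)) $ i $ j)"
proof -
  interpret spectrally_negative_MAP_scale \<Omega> P X J F W \<alpha>
    by unfold_locales (use assms in auto)
  define G where "G x = (\<chi> i j. refl_exit_entry P X J \<alpha> a x i j)" for x
  have G: "G x ** Zmat F W \<alpha> a = Zmat F W \<alpha> x" if "x \<in> {0..a}" for x
  proof -
    have "(G x ** Zmat F W \<alpha> a) $ i $ j = Zmat F W \<alpha> x $ i $ j" for i j
      using refl_exit_identity[of x a i j] that
      by (simp add: G_def matrix_matrix_mult_def Zext_eq_Zmat)
    then show ?thesis by (simp add: vec_eq_iff)
  qed
  have "Zmat F W \<alpha> 0 = mat 1" by (simp add: Zmat_def)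
  then have "G 0 ** Zmat F W \<alpha> a = mat 1" using G[of 0] \<open>0 < a\<close> by simp
  \<comment> \<open>For square matrices a left inverse is enough.\<close>
  then have inv: "invertible (Zmat F W \<alpha> a)" unfolding invertible_left_inverse by blast
  have "G x = Zmat F W \<alpha> x ** matrix_inv (Zmat F W \<alpha> a)" if "x \<in> {0..a}" for x
  proof -
    have "G x = G x ** (Zmat F W \<alpha> a ** matrix_inv (Zmat F W \<alpha> a))" by (simp add: matrix_inv_right[OF inv])
    then show ?thesis by (simp add: matrix_mul_assoc G[OF that])
  qed
  then have "refl_exit_entry P X J \<alpha> a x i j = (Zmat F W \<alpha> x ** matrix_inv (Zmat F W \<alpha> a)) $ i $ j" if "x \<in> {0..a}" for x i j
    using that by (simp add: G_def vec_eq_iff)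
  then show ?thesis using inv by blast
qed

end
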